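(* Suppose that $\Gamma$ is a sofic (respectively $\mathbb{K}$-linear sofic, for a field $\mathbb{K}$; hyperlinear; weakly sofic) group and that $\Gamma\curvearrowright_{\alpha}X$ is a sofic action on the set $X$. If $R$ is a commutative unital ring with the property that $\operatorname{Aut}_R(R[Z])$ is a sofic (respectively $\mathbb{K}$-linear sofic; hyperlinear; weakly sofic) group for every finite set $Z$, then $\mathcal{GL}(\Gamma,X,R)$ is a sofic (respectively $\mathbb{K}$-linear sofic; hyperlinear; weakly sofic) group. In particular this holds if $R$ is an integral domain.
   Context: Linear enrichment. For a commutative unital ring $R$ and a set $X$, $R[X]$ is the free $R$-module with basis $X$ and $\operatorname{Aut}_R(R[X])$ its group of $R$-module automorphisms. $GL_f(X,R)\leq\operatorname{Aut}_R(R[X])$ is the subgroup of those $A$ for which there is a finite $Z_A\subseteq X$ such that $A$ preserves $R[Z_A]$ and fixes every basis vector $x\in X\setminus Z_A$. An action $\Gamma\curvearrowright_\alpha X$ induces an action (also denoted $\alpha$) on $R[X]$ by permuting basis elements, and $\hat\alpha(g):A\mapsto\alpha(g)A\alpha(g)^{-1}$ on $GL_f(X,R)$. Set $\mathcal{GL}(\Gamma,X,R)=GL_f(X,R)\rtimes_{\hat\alpha}\Gamma$. Metric approximation. For a group $\Gamma$, a group $G$ with bounded bi-invariant metric $d$, a function $\varphi:\Gamma\to G$, finite $F\subseteq\Gamma$ and $\epsilon,c>0$: $\varphi$ is $(F,\epsilon)$-multiplicative if $d(\varphi(gh),\varphi(g)\varphi(h))<\epsilon$ for all $g,h\in F$ with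 $gh\in F$; $(F,c)$-separating if $d(\varphi(g),e_G)>c$ for all $e\neq g\in F$; unital if $\varphi(e_\Gamma)=e_G$. Given a family $\mathcal{G}$ of groups with bi-invariant metrics of uniformly bounded diameter, $\Gamma$ is $\mathcal{G}$-approximable if there is $c>0$ such that for all finite $F\subseteq\Gamma$ and $\epsilon>0$ there is a unital, $(F,\epsilon)$-multiplicative, $(F,c)$-separating function from $\Gamma$ to some member of $\mathcal{G}$. Then $\Gamma$ is: sofic if $\mathcal{G}=\{(\operatorname{Sym}(n),d_n):n\in\mathbb{N}\}$ with $d_n$ the normalized Hamming metric; $\mathbb{K}$-linear sofic if $\mathcal{G}=\{GL_n(\mathbb{K}):n\in\mathbb{N}\}$ with metric $\frac1n\operatorname{rk}(M-N)$; hyperlinear if $\mathcal{G}=\{U(n):n\in\mathbb{N}\}$ (unitary groups) with metric $\sqrt{\frac1n\operatorname{Tr}((A-B)(A-B)^* )}$; weakly sofic if $\mathcal{G}$ is the family of all finite groups equipped with bi-invariant metrics of diameter one. The normalized Hamming metric on $\operatorname{Sym}(A)$, $A$ finite, is $d_A(\sigma,\tau)=1-\frac{1}{|A|}|\{a\in A:\sigma(a)=\tau(a)\}|$. Sofic actions on sets. Given $\Gamma\curvearrowright_\alpha X$, finite $F\subseteq\Gamma$, $E\subseteq X$, and $\epsilon>0$, a function $\varphi:\Gamma\to\operatorname{Sym}(A)$ ($A$ finite) is an $(F,E,\epsilon)$-orbit approximation of $\alpha$ if there exist a finite set $B$, $S\subseteq A$ with $|S|>(1-\epsilon)|A|$,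 and injective functions $(\pi_s:E\hookrightarrow B)_{s\in S}$ such that for all $g\in F$, $x\in E$, $s\in S$, if $\varphi(g)\cdot s\in S$ and $\alpha(g)^{-1}\cdot x\in E$ then $\pi_{\varphi(g)\cdot s}(x)=\pi_s(\alpha(g)^{-1}\cdot x)$. The action $\alpha$ is sofic if for all such $F,E,\epsilon$ there exist a finite set $A$ and a unital $(F,\epsilon)$-multiplicative (with respect to $d_A$) $(F,E,\epsilon)$-orbit approximation $\varphi:\Gamma\to\operatorname{Sym}(A)$ of $\alpha$. *)

theory Defs
  imports
    "HOL-Analysis.Abstract_Metric_Spaces"
    "HOL-Algebra.Group_Action"
    "Jordan_Normal_Form.DL_Rank"
    "Jordan_Normal_Form.Schur_Decomposition"
begin

section \<open>Linear enrichments\<close>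

text \<open>\<open>R[X]\<close> is modelled by finitely supported functions that vanish outside \<open>X\<close>, so that
  \<open>R[Z]\<close> is literally a subset of \<open>R[X]\<close> for \<open>Z \<subseteq> X\<close>. The fields \<open>mult\<close> and \<open>one\<close> of the
  module record have no meaning for a module.\<close>

definition free_module :: "('r, 'm) ring_scheme \<Rightarrow> 'x set \<Rightarrow> ('r, 'x \<Rightarrow> 'r) module" where
  "free_module R X =
    \<lparr>carrier = {f. (\<forall>x\<in>X. f x \<in> carrier R) \<and> (\<forall>x. x \<notin> X \<longrightarrow> f x = \<zero>\<^bsub>R\<^esub>)
                  \<and> finite {x\<in>X. f x \<noteq> \<zero>\<^bsub>R\<^esub>}},
     monoid.mult = undefined,
     monoid.one = undefined,
     ring.zero = (\<lambda>x. \<zero>\<^bsub>R\<^esub>),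
     ring.add = (\<lambda>f g x. f x \<oplus>\<^bsub>R\<^esub> g x),
     module.smult = (\<lambda>r f x. r \<otimes>\<^bsub>R\<^esub> f x)\<rparr>"

definition basis_vec :: "('r, 'm) ring_scheme \<Rightarrow> 'x \<Rightarrow> 'x \<Rightarrow> 'r" where
  "basis_vec R x = (\<lambda>y. if y = x then \<one>\<^bsub>R\<^esub> else \<zero>\<^bsub>R\<^esub>)"

definition module_Aut ::
    "('r, 'm) ring_scheme \<Rightarrow> ('r, 'v, 'n) module_scheme \<Rightarrow> ('v \<Rightarrow> 'v) monoid" where
  "module_Aut R M = (BijGroup (carrier M))
    \<lparr>carrier := {A \<in> Bij (carrier M).
        (\<forall>u\<in>carrier M. \<forall>v\<in>carrier M. A (u \<oplus>\<^bsub>M\<^esub> v) = A u \<oplus>\<^bsub>M\<^esub> A v) \<and>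
        (\<forall>r\<in>carrier R. \<forall>v\<in>carrier M. A (r \<odot>\<^bsub>M\<^esub> v) = r \<odot>\<^bsub>M\<^esub> A v)}\<rparr>"

text \<open>For an automorphism fixing all basis vectors outside \<open>Z\<close>, mapping \<open>R[Z]\<close> onto itself is the
  same as mapping it into itself.\<close>

definition GL_f :: "'x set \<Rightarrow> ('r, 'm) ring_scheme \<Rightarrow> (('x \<Rightarrow> 'r) \<Rightarrow> ('x \<Rightarrow> 'r)) monoid" where
  "GL_f X R = (module_Aut R (free_module R X))
    \<lparr>carrier := {A \<in> carrier (module_Aut R (free_module R X)).
        \<exists>Z. finite Z \<and> Z \<subseteq> X \<and>
          A ` carrier (free_module R Z) = carrier (free_module R Z) \<and>
          (\<forall>x\<in>X - Z. A (basis_vec R x) = basis_vec R x)}\<rparr>"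

text \<open>The action on \<open>R[X]\<close> permuting the basis: \<open>basis_vec R x\<close> is sent to
  \<open>basis_vec R (\<alpha> g x)\<close>, i.e. \<open>f\<close> is sent to \<open>f \<circ> \<alpha>(g)\<inverse>\<close>. The case distinction is needed since
  \<open>\<alpha> g\<close> is \<open>undefined\<close> outside \<open>X\<close>.\<close>

definition lin_action ::
    "('g, 'a) monoid_scheme \<Rightarrow> 'x set \<Rightarrow> ('g \<Rightarrow> 'x \<Rightarrow> 'x) \<Rightarrow> ('r, 'm) ring_scheme \<Rightarrow>
      'g \<Rightarrow> ('x \<Rightarrow> 'r) \<Rightarrow> ('x \<Rightarrow> 'r)" where
  "lin_action \<Gamma> X \<alpha> R g =
    (\<lambda>f \<in> carrier (free_module R X). \<lambda>x. if x \<in> X then f (\<alpha> (inv\<^bsub>\<Gamma>\<^esub> g) x) else \<zero>\<^bsub>R\<^esub>)"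

definition conj_action ::
    "('g, 'a) monoid_scheme \<Rightarrow> 'x set \<Rightarrow> ('g \<Rightarrow> 'x \<Rightarrow> 'x) \<Rightarrow> ('r, 'm) ring_scheme \<Rightarrow>
      'g \<Rightarrow> (('x \<Rightarrow> 'r) \<Rightarrow> ('x \<Rightarrow> 'r)) \<Rightarrow> (('x \<Rightarrow> 'r) \<Rightarrow> ('x \<Rightarrow> 'r))" where
  "conj_action \<Gamma> X \<alpha> R g A =
    (let H = module_Aut R (free_module R X); U = lin_action \<Gamma> X \<alpha> R g
     in U \<otimes>\<^bsub>H\<^esub> A \<otimes>\<^bsub>H\<^esub> inv\<^bsub>H\<^esub> U)"

definition semidirect ::
    "('n, 'a) monoid_scheme \<Rightarrow> ('g, 'b) monoid_scheme \<Rightarrow> ('g \<Rightarrow> 'n \<Rightarrow> 'n) \<Rightarrow> ('n \<times> 'g) monoid" where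
  "semidirect N \<Gamma> \<theta> =
    \<lparr>carrier = carrier N \<times> carrier \<Gamma>,
     monoid.mult = (\<lambda>(a, g) (b, h). (a \<otimes>\<^bsub>N\<^esub> \<theta> g b, g \<otimes>\<^bsub>\<Gamma>\<^esub> h)),
     monoid.one = (\<one>\<^bsub>N\<^esub>, \<one>\<^bsub>\<Gamma>\<^esub>)\<rparr>"

definition linear_enrichment ::
    "('g, 'a) monoid_scheme \<Rightarrow> 'x set \<Rightarrow> ('g \<Rightarrow> 'x \<Rightarrow> 'x) \<Rightarrow> ('r, 'm) ring_scheme \<Rightarrow>
      ((('x \<Rightarrow> 'r) \<Rightarrow> ('x \<Rightarrow> 'r)) \<times> 'g) monoid" where
  "linear_enrichment \<Gamma> X \<alpha> R = semidirect (GL_f X R) \<Gamma> (conj_action \<Gamma> X \<alpha> R)"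


section \<open>Metric approximation\<close>

definition unital ::
    "('g, 'a) monoid_scheme \<Rightarrow> ('h, 'b) monoid_scheme \<Rightarrow> ('g \<Rightarrow> 'h) \<Rightarrow> bool" where
  "unital \<Gamma> G \<phi> \<longleftrightarrow> \<phi> \<one>\<^bsub>\<Gamma>\<^esub> = \<one>\<^bsub>G\<^esub>"

definition multiplicative ::
    "('g, 'a) monoid_scheme \<Rightarrow> ('h, 'b) monoid_scheme \<Rightarrow> ('h \<Rightarrow> 'h \<Rightarrow> real) \<Rightarrow>
      'g set \<Rightarrow> real \<Rightarrow> ('g \<Rightarrow> 'h) \<Rightarrow> bool" where
  "multiplicative \<Gamma> G d F \<epsilon> \<phi> \<longleftrightarrow>
    (\<forall>g\<in>F. \<forall>h\<in>F. g \<otimes>\<^bsub>\<Gamma>\<^esub> h \<in> F \<longrightarrow> d (\<phi> (g \<otimes>\<^bsub>\<Gamma>\<^esub> h)) (\<phi> g \<otimes>\<^bsub>G\<^esub> \<phi> h) < \<epsilon>)"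

definition separating ::
    "('g, 'a) monoid_scheme \<Rightarrow> ('h, 'b) monoid_scheme \<Rightarrow> ('h \<Rightarrow> 'h \<Rightarrow> real) \<Rightarrow>
      'g set \<Rightarrow> real \<Rightarrow> ('g \<Rightarrow> 'h) \<Rightarrow> bool" where
  "separating \<Gamma> G d F c \<phi> \<longleftrightarrow> (\<forall>g\<in>F. g \<noteq> \<one>\<^bsub>\<Gamma>\<^esub> \<longrightarrow> d (\<phi> g) \<one>\<^bsub>G\<^esub> > c)"

definition approximable ::
    "('h monoid \<times> ('h \<Rightarrow> 'h \<Rightarrow> real)) set \<Rightarrow> ('g, 'a) monoid_scheme \<Rightarrow> bool" where
  "approximable \<G> \<Gamma> \<longleftrightarrow> group \<Gamma> \<and>
    (\<exists>c>0. \<forall>F \<epsilon>. finite F \<and> F \<subseteq> carrier \<Gamma> \<and> \<epsilon> > 0 \<longrightarrow>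
      (\<exists>(G, d)\<in>\<G>. \<exists>\<phi> \<in> carrier \<Gamma> \<rightarrow> carrier G.
        unital \<Gamma> G \<phi> \<and> multiplicative \<Gamma> G d F \<epsilon> \<phi> \<and> separating \<Gamma> G d F c \<phi>))"

text \<open>In the families below \<open>n\<close> is positive, as the normalizations by \<open>1/n\<close> require.\<close>

definition hamming_dist :: "'a set \<Rightarrow> ('a \<Rightarrow> 'a) \<Rightarrow> ('a \<Rightarrow> 'a) \<Rightarrow> real" where
  "hamming_dist A \<sigma> \<tau> = 1 - real (card {a\<in>A. \<sigma> a = \<tau> a}) / real (card A)"

definition sofic_group :: "('g, 'a) monoid_scheme \<Rightarrow> bool" where
  "sofic_group = approximable {(BijGroup {..<n}, hamming_dist {..<n}) | n::nat. n > 0}"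

definition rank_dist :: "nat \<Rightarrow> 'k::field mat \<Rightarrow> 'k mat \<Rightarrow> real" where
  "rank_dist n M N = real (vec_space.rank n (M - N)) / real n"

definition linear_sofic_group :: "'k::field itself \<Rightarrow> ('g, 'a) monoid_scheme \<Rightarrow> bool" where
  "linear_sofic_group K =
    approximable {(units_of (ring_mat TYPE('k) n ()), rank_dist n) | n::nat. n > 0}"

definition unitary_group :: "nat \<Rightarrow> complex mat monoid" where
  "unitary_group n =
    \<lparr>carrier = {A \<in> carrier_mat n n. A * mat_adjoint A = 1\<^sub>m n \<and> mat_adjoint A * A = 1\<^sub>m n},
     monoid.mult = (*),
     monoid.one = 1\<^sub>m n\<rparr>"

definition mat_trace :: "'k::comm_monoid_add mat \<Rightarrow> 'k" where
  "mat_trace A = (\<Sum>i<dim_row A. A $$ (i, i))"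

text \<open>The trace in the next definition is a nonnegative real number; \<open>Re\<close> is only a type conversion.\<close>

definition hs_dist :: "nat \<Rightarrow> complex mat \<Rightarrow> complex mat \<Rightarrow> real" where
  "hs_dist n A B = sqrt (Re (mat_trace ((A - B) * mat_adjoint (A - B))) / real n)"

definition hyperlinear_group :: "('g, 'a) monoid_scheme \<Rightarrow> bool" where
  "hyperlinear_group = approximable {(unitary_group n, hs_dist n) | n::nat. n > 0}"

definition bi_invariant :: "('h, 'b) monoid_scheme \<Rightarrow> ('h \<Rightarrow> 'h \<Rightarrow> real) \<Rightarrow> bool" where
  "bi_invariant G d \<longleftrightarrow>
    (\<forall>x\<in>carrier G. \<forall>y\<in>carrier G. \<forall>z\<in>carrier G.
      d (z \<otimes>\<^bsub>G\<^esub> x) (z \<otimes>\<^bsub>G\<^esub> y) = d x y \<and> d (x \<otimes>\<^bsub>G\<^esub> z) (y \<otimes>\<^bsub>G\<^esub> z) = d x y)"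

text \<open>Every finite group is isomorphic to one whose carrier consists of natural numbers.\<close>

definition weakly_sofic_group :: "('g, 'a) monoid_scheme \<Rightarrow> bool" where
  "weakly_sofic_group =
    approximable {(G :: nat monoid, d). group G \<and> finite (carrier G) \<and>
      Metric_space (carrier G) d \<and> bi_invariant G d \<and>
      (SUP (x, y) \<in> carrier G \<times> carrier G. d x y) = 1}"


section \<open>Sofic actions\<close>

text \<open>\<open>B\<close> (and \<open>A\<close> in the definition of sofic actions below) is an arbitrary finite set; up to
  bijection it consists of natural numbers.\<close>

definition orbit_approximation ::
    "('g, 'a) monoid_scheme \<Rightarrow> ('g \<Rightarrow> 'x \<Rightarrow> 'x) \<Rightarrow> 'g set \<Rightarrow> 'x set \<Rightarrow> real \<Rightarrow>
      'p set \<Rightarrow> ('g \<Rightarrow> 'p \<Rightarrow> 'p) \<Rightarrow> bool" where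
  "orbit_approximation \<Gamma> \<alpha> F E \<epsilon> A \<phi> \<longleftrightarrow>
    (\<exists>(B :: nat set) S \<pi>. finite B \<and> S \<subseteq> A \<and> real (card S) > (1 - \<epsilon>) * real (card A) \<and>
      (\<forall>s\<in>S. inj_on (\<pi> s) E \<and> \<pi> s ` E \<subseteq> B) \<and>
      (\<forall>g\<in>F. \<forall>x\<in>E. \<forall>s\<in>S. \<phi> g s \<in> S \<and> \<alpha> (inv\<^bsub>\<Gamma>\<^esub> g) x \<in> E \<longrightarrow>
        \<pi> (\<phi> g s) x = \<pi> s (\<alpha> (inv\<^bsub>\<Gamma>\<^esub> g) x)))"

definition sofic_action ::
    "('g, 'a) monoid_scheme \<Rightarrow> 'x set \<Rightarrow> ('g \<Rightarrow> 'x \<Rightarrow> 'x) \<Rightarrow> bool" where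
  "sofic_action \<Gamma> X \<alpha> \<longleftrightarrow> group_action \<Gamma> X \<alpha> \<and>
    (\<forall>F E \<epsilon>. finite F \<and> F \<subseteq> carrier \<Gamma> \<and> finite E \<and> E \<subseteq> X \<and> \<epsilon> > 0 \<longrightarrow>
      (\<exists>(A :: nat set) \<phi>. finite A \<and> \<phi> \<in> carrier \<Gamma> \<rightarrow> carrier (BijGroup A) \<and>
        unital \<Gamma> (BijGroup A) \<phi> \<and>
        multiplicative \<Gamma> (BijGroup A) (hamming_dist A) F \<epsilon> \<phi> \<and>
        orbit_approximation \<Gamma> \<alpha> F E \<epsilon> A \<phi>))"

end

theory Submission
  imports Defs "HOL-Algebra.Divisibility" "HOL-Algebra.Subrings" "HOL-Number_Theory.Residues"
begin

text \<open>Let \<open>\<phi> : \<Gamma> \<rightarrow> Sym(A)\<close> be a sofic approximation of the action with injections \<open>\<pi>\<^sub>t : E \<rightarrow> B\<close> for most \<open>t \<in> A\<close>.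
  An automorphism \<open>a\<close> supported in \<open>E\<close> is transported along \<open>\<pi>\<^sub>t\<close> to an automorphism of \<open>R[B]\<close>, which is
  then approximated in a metric group \<open>G\<close>. These elements of \<open>G\<close>, indexed by \<open>t\<close>, together with the
  permutation \<open>\<phi>(g)\<close> define an element of the wreath product of \<open>G\<close> and \<open>Sym(A)\<close>, and orbit approximation makes
  this map almost multiplicative in \<open>(a, g)\<close>. A further summand, an approximation of \<open>\<Gamma>\<close>, separates
  the elements with \<open>g \<noteq> 1\<close>.

  For the separation of \<open>a\<close> the constant for \<open>Aut(R[B])\<close> must not depend on \<open>B\<close>. Replacing a matrix (or
  permutation) \<open>x\<close> by \<open>x \<otimes> (x \<oplus> 1)\<close> increases small distances to the identity by a constant factor, so
  repetition leads to a universal constant; for weakly sofic groups one replaces the metric \<open>d\<close> by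
  \<open>min 1 (d / c)\<close>.

  Over an integral domain, finitely many elements lie in a subring all of whose nonzero elements are
  mapped to units by homomorphisms to finite rings. So \<open>Aut(R[Z])\<close> is locally embeddable into finite
  groups, and finite groups embed into groups of each of the four families.\<close>

section \<open>Finitely generated integral domains\<close>

text \<open>Two points shape the proof. The set \<open>B\<close> is known only after the precision
  for the sofic action is fixed, so \<open>Aut B\<close> varies with the precision, and a constant
  attached to each single \<open>Aut B\<close> says nothing in the limit. For one finite
  \<open>F\<close> the constant can still be raised: the number of repetitions depends on
  \<open>F\<close> and its constant but not on the precision, so each repetition may spend some
  multiplicativity. The plain square \<open>x \<otimes> x\<close> would not do for matrices, since
  it sends \<open>- 1\<close> to \<open>1\<close>; in \<open>x \<otimes> (x \<oplus> 1)\<close> the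
  extra summand keeps such elements away from \<open>1\<close>. Its gain for small distances is
  close to 3/2, in the Hilbert-Schmidt metric to the square root of 3/2; the factor 11/10 lies
  safely below both. Over a domain, the property carried from one generator to the next speaks of
  units and not of nonzero images: once a leading coefficient has become a unit, division with
  remainder makes the quotient of \<open>k[X]\<close> finite, although neither \<open>k\<close> nor
  the quotient has to be a field.\<close>

lemma exists_nat_copy_of_finite_cring:
  assumes "cring k" "finite (carrier k)"
  obtains k' :: "nat ring" and e where "cring k'" "finite (carrier k')" "e \<in> ring_iso k k'"
proof -
  obtain e where e: "inj_on e (carrier k)" "e ` carrier k = {..<card (carrier k)}"
    using ex_bij_betw_finite_nat[OF assms(2)] by (auto simp: bij_betw_def atLeast0LessThan)
  interpret k: cring k by fact
  define i where "i = inv_into (carrier k) e"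
  define k' :: "nat ring" where "k' = \<lparr>carrier = e ` carrier k, monoid.mult = (\<lambda>x y. e (i x \<otimes>\<^bsub>k\<^esub> i y)),
     monoid.one = e \<one>\<^bsub>k\<^esub>, ring.zero = e \<zero>\<^bsub>k\<^esub>, ring.add = (\<lambda>x y. e (i x \<oplus>\<^bsub>k\<^esub> i y))\<rparr>"
  have i: "i (e x) = x" if "x \<in> carrier k" for x using e that by (simp add: i_def)
  have iso: "e \<in> ring_iso k k'"
    using e(1) unfolding ring_iso_def Ring.ring_hom_def by (auto simp: k'_def i bij_betw_def)
  then have "cring k'"
    using k.ring_iso_imp_img_cring[OF iso] by (simp add: k'_def)
  moreover have "finite (carrier k')" using assms by (simp add: k'_def)
  ultimately show ?thesis using iso that by blast
qed

text \<open>Speaks of one coefficient because the degree of a product may drop: the finite rings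
  \<open>k\<close> used below can have zero divisors.\<close>

lemma (in UP_cring) coeff_mult_top:
  assumes "p \<in> carrier P" "q \<in> carrier P"
  shows "coeff P (p \<otimes>\<^bsub>P\<^esub> q) (deg R p + deg R q) = lcoeff p \<otimes> lcoeff q"
proof -
  have "coeff P p i \<otimes> coeff P q (deg R p + deg R q - i) = (if deg R p = i then lcoeff p \<otimes> lcoeff q else \<zero>)"
    if "i \<le> deg R p + deg R q" for i
  proof (cases "i < deg R p")
    case True
    then have "deg R q < deg R p + deg R q - i" by linarith
    then show ?thesis using True assms by (simp add: deg_aboveD)
  next
    case False then show ?thesis using assms
      by (cases "i = deg R p") (auto simp: deg_aboveD)
  qed
  then have "coeff P (p \<otimes>\<^bsub>P\<^esub> q) (deg R p + deg R q) = (\<Oplus>i\<in>{..deg R p + deg R q}. if deg R p = i then lcoeff p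
    \<otimes> lcoeff q else \<zero>)"
    using assms by (subst coeff_mult) (auto intro!: R.finsum_cong' simp: Pi_def)
  also have "\<dots> = lcoeff p \<otimes> lcoeff q" using R.finsum_singleton[of "deg R p" "{..deg R p + deg R q}"
    "\<lambda>_. lcoeff p \<otimes> lcoeff q"] assms
    by simp
  finally show ?thesis .
qed

lemma (in UP_cring) finite_bounded_degree:
  assumes "finite (carrier R)"
  shows "finite {p \<in> carrier P. deg R p < n}"
proof -
  let ?D = "{p \<in> carrier P. deg R p < n}"
  have "inj_on (\<lambda>p. restrict (coeff P p) {..<n}) ?D"
  proof (rule inj_onI, rule up_eqI)
    fix p q i assume pq: "p \<in> ?D" "q \<in> ?D" and eq: "restrict (coeff P p) {..<n} = restrict (coeff P q) {..<n}"
    have "coeff P p i = coeff P q i" if "i < n" using fun_cong[OF eq, of i] that by simp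
    then show "coeff P p i = coeff P q i" using pq
      by (cases "i < n") (simp_all add: deg_aboveD)
  qed auto
  moreover have "(\<lambda>p. restrict (coeff P p) {..<n}) ` ?D \<subseteq> {..<n} \<rightarrow>\<^sub>E carrier R"
    by (intro image_subsetI PiE_I) simp_all
  moreover have "finite ({..<n} \<rightarrow>\<^sub>E carrier R)" using assms by (simp add: finite_PiE)
  ultimately show ?thesis using inj_on_finite by blast
qed

text \<open>As the leading coefficient of \<open>q\<close> is a unit, division by \<open>q\<close>
  leaves remainders of degree below \<open>deg R q\<close>, and a finite ring admits only finitely
  many of them. A product of \<open>q\<close> with a nonzero \<open>s\<close> has a nonzero
  coefficient in the positive degree \<open>deg R s + deg R q\<close>, so it is not
  \<open>1\<close>.\<close>

lemma (in UP_cring) quotient_by_unit_lcoeff: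
  assumes fin: "finite (carrier R)" and one: "\<one> \<noteq> \<zero>"
    and q: "q \<in> carrier P" "lcoeff q \<in> Units R" "deg R q \<noteq> 0"
  shows "ideal (PIdl\<^bsub>P\<^esub> q) P" "finite (carrier (P Quot (PIdl\<^bsub>P\<^esub> q)))"
    "\<one>\<^bsub>P Quot (PIdl\<^bsub>P\<^esub> q)\<^esub> \<noteq> \<zero>\<^bsub>P Quot (PIdl\<^bsub>P\<^esub> q)\<^esub>"
proof -
  interpret P: cring P by (rule UP_cring)
  let ?I = "PIdl\<^bsub>P\<^esub> q"
  show id: "ideal ?I P" using P.cgenideal_ideal q by blast
  then interpret I: ideal ?I P .
  have q0: "q \<noteq> \<zero>\<^bsub>P\<^esub>" using q by auto
  have mem: "q \<otimes>\<^bsub>P\<^esub> s \<in> ?I" if "s \<in> carrier P" for s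
    unfolding cgenideal_def using that q P.m_comm[OF q(1) that] by blast
  have "carrier (P Quot ?I) \<subseteq> (+>\<^bsub>P\<^esub>) ?I ` ({\<zero>\<^bsub>P\<^esub>} \<union> {p \<in> carrier P. deg R p < deg R q})"
  proof
    fix x assume "x \<in> carrier (P Quot ?I)"
    then obtain f where f: "f \<in> carrier P" "x = ?I +>\<^bsub>P\<^esub> f"
      by (auto simp: FactRing_def A_RCOSETS_def')
    obtain s r and k :: nat where "s \<in> carrier P \<and> r \<in> carrier P \<and>
        (lcoeff q)[^]k \<odot>\<^bsub>P\<^esub> f = q \<otimes>\<^bsub>P\<^esub> s \<oplus>\<^bsub>P\<^esub> r \<and> (r = \<zero>\<^bsub>P\<^esub> \<or> deg R r < deg R q)"
      using long_div_theorem[OF q(1) f(1) q0] by (elim exE) (rule that)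
    then have sr: "s \<in> carrier P" "r \<in> carrier P"
        "(lcoeff q)[^]k \<odot>\<^bsub>P\<^esub> f = q \<otimes>\<^bsub>P\<^esub> s \<oplus>\<^bsub>P\<^esub> r" "r = \<zero>\<^bsub>P\<^esub> \<or> deg R r < deg R q"
      by simp_all
    \<comment> \<open>The division theorem first multiplies \<open>f\<close> by a power of the
      leading coefficient; \<open>c\<close> undoes this.\<close>
    define c where "c = inv ((lcoeff q)[^]k)"
    have u: "(lcoeff q)[^]k \<in> Units R" using q(2) by (rule R.Units_pow_closed)
    have c: "c \<in> carrier R" "c \<otimes> (lcoeff q)[^]k = \<one>" using u by (auto simp: c_def R.Units_l_inv)
    have "f = c \<odot>\<^bsub>P\<^esub> ((lcoeff q)[^]k \<odot>\<^bsub>P\<^esub> f)" using c f u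
      by (subst UP_smult_assoc1[symmetric]) auto
    also have "\<dots> = q \<otimes>\<^bsub>P\<^esub> (c \<odot>\<^bsub>P\<^esub> s) \<oplus>\<^bsub>P\<^esub> c \<odot>\<^bsub>P\<^esub> r"
    proof -
      have "c \<odot>\<^bsub>P\<^esub> (q \<otimes>\<^bsub>P\<^esub> s) = q \<otimes>\<^bsub>P\<^esub> (c \<odot>\<^bsub>P\<^esub> s)"
        using c sr q P.m_comm by (metis UP_smult_assoc2 UP_smult_closed)
      then show ?thesis using sr c q by (simp add: UP_smult_r_distr)
    qed
    finally have f': "f = q \<otimes>\<^bsub>P\<^esub> (c \<odot>\<^bsub>P\<^esub> s) \<oplus>\<^bsub>P\<^esub> c \<odot>\<^bsub>P\<^esub> r" .
    have "f \<in> ?I +>\<^bsub>P\<^esub> (c \<odot>\<^bsub>P\<^esub> r)"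
      unfolding a_r_coset_def' using f' mem[of "c \<odot>\<^bsub>P\<^esub> s"] c sr by auto
    then have "x = ?I +>\<^bsub>P\<^esub> (c \<odot>\<^bsub>P\<^esub> r)" using f c sr I.a_repr_independence' by auto
    moreover have "c \<odot>\<^bsub>P\<^esub> \<zero>\<^bsub>P\<^esub> = \<zero>\<^bsub>P\<^esub>" by (rule up_eqI) (use c in auto)
    then have "c \<odot>\<^bsub>P\<^esub> r = \<zero>\<^bsub>P\<^esub> \<or> deg R (c \<odot>\<^bsub>P\<^esub> r) < deg R q"
      using sr(4) deg_smult_decr[OF c(1) sr(2)] by auto
    ultimately show "x \<in> (+>\<^bsub>P\<^esub>) ?I ` ({\<zero>\<^bsub>P\<^esub>} \<union> {p \<in> carrier P. deg R p < deg R q})"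
      using c sr by auto
  qed
  then show "finite (carrier (P Quot ?I))"
    by (rule finite_subset) (simp add: finite_bounded_degree[OF fin])
  have "\<one>\<^bsub>P\<^esub> \<notin> ?I"
  proof
    assume "\<one>\<^bsub>P\<^esub> \<in> ?I"
    then obtain s where s: "s \<in> carrier P" "\<one>\<^bsub>P\<^esub> = s \<otimes>\<^bsub>P\<^esub> q" unfolding cgenideal_def by blast
    have "s \<noteq> \<zero>\<^bsub>P\<^esub>"
    proof
      assume "s = \<zero>\<^bsub>P\<^esub>"
      then have "coeff P \<one>\<^bsub>P\<^esub> 0 = coeff P \<zero>\<^bsub>P\<^esub> 0" using s q by simp
      then show False using one by simp
    qed
    then have "lcoeff s \<noteq> \<zero>" using s by (simp add: lcoeff_nonzero2)
    moreover have "lcoeff s \<otimes> lcoeff q = coeff P \<one>\<^bsub>P\<^esub> (deg R s + deg R q)"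
      using coeff_mult_top[OF s(1) q(1)] s(2) by simp
    then have "lcoeff s \<otimes> lcoeff q = \<zero>" using q(3) by simp
    then have "lcoeff s \<otimes> lcoeff q \<otimes> inv (lcoeff q) = \<zero>" using q by simp
    then have "lcoeff s = \<zero>" using q s by (simp add: R.m_assoc R.Units_r_inv R.Units_closed)
    ultimately show False by simp
  qed
  then show "\<one>\<^bsub>P Quot ?I\<^esub> \<noteq> \<zero>\<^bsub>P Quot ?I\<^esub>"
    using I.a_rcos_self[of "\<one>\<^bsub>P\<^esub>"] by (auto simp: FactRing_def)
qed

lemma UP_map_ring_hom:
  fixes f h
  assumes "cring A" "cring k" "f \<in> Ring.ring_hom A k"
  assumes h_def: "\<And>p i. h p i = f (coeff (UP A) p i)"
  shows "h \<in> Ring.ring_hom (UP A) (UP k)"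
    "\<And>p i. p \<in> carrier (UP A) \<Longrightarrow> coeff (UP k) (h p) i = f (coeff (UP A) p i)"
proof -
  interpret f: ring_hom_cring A k f using assms by (simp add: ring_hom_cring_axioms_def ring_hom_cring_def)
  interpret A: UP_cring A "UP A" by (auto intro: UP_cring.intro assms)
  interpret k: UP_cring k "UP k" by (auto intro: UP_cring.intro assms)
  have hin: "h p \<in> carrier (UP k)" if p: "p \<in> carrier (UP A)" for p
  proof -
    have "bound \<zero>\<^bsub>k\<^esub> (deg A p) (h p)" using p by (auto simp: bound_def h_def A.deg_aboveD)
    moreover have "h p n \<in> carrier k" for n using p by (auto simp: h_def)
    ultimately show ?thesis by (auto simp: UP_def)
  qed
  show c: "\<And>p i. p \<in> carrier (UP A) \<Longrightarrow> coeff (UP k) (h p) i = f (coeff (UP A) p i)"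
    using hin by (auto simp: UP_def) (auto simp: h_def UP_def)
  show "h \<in> Ring.ring_hom (UP A) (UP k)"
  proof (rule ring_hom_memI)
    fix p q assume p: "p \<in> carrier (UP A)" and q: "q \<in> carrier (UP A)"
    show "h (p \<otimes>\<^bsub>UP A\<^esub> q) = h p \<otimes>\<^bsub>UP k\<^esub> h q"
    proof (rule k.up_eqI)
      fix n
      have "f (\<Oplus>\<^bsub>A\<^esub>i\<in>{..n}. coeff (UP A) p i \<otimes>\<^bsub>A\<^esub> coeff (UP A) q (n - i)) =
        (\<Oplus>\<^bsub>k\<^esub>i\<in>{..n}. f (coeff (UP A) p i) \<otimes>\<^bsub>k\<^esub> f (coeff (UP A) q (n - i)))"
        using p q by (subst f.hom_finsum) (auto simp: o_def)
      then show "coeff (UP k) (h (p \<otimes>\<^bsub>UP A\<^esub> q)) n = coeff (UP k) (h p \<otimes>\<^bsub>UP k\<^esub> h q) n"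
        using p q hin by (simp add: c)
    qed (use p q hin in auto)
    show "h (p \<oplus>\<^bsub>UP A\<^esub> q) = h p \<oplus>\<^bsub>UP k\<^esub> h q"
      by (rule k.up_eqI) (use p q hin in \<open>auto simp: c\<close>)
  next
    show "h \<one>\<^bsub>UP A\<^esub> = \<one>\<^bsub>UP k\<^esub>" by (rule k.up_eqI) (use hin in \<open>auto simp: c\<close>)
  qed (use hin in auto)
qed

text \<open>The homomorphism theorem for the image of \<open>E\<close> in place of a quotient of
  \<open>P\<close>: \<open>g\<close> picks preimages under \<open>E\<close>, and \<open>ker\<close>
  makes its values independent of the choice.\<close>

lemma ring_hom_factor:
  assumes "ring P" "ring Q" "ring S" and E: "E \<in> Ring.ring_hom P S" and H: "H \<in> Ring.ring_hom P Q"
    and ker: "\<And>p. p \<in> carrier P \<Longrightarrow> E p = \<zero>\<^bsub>S\<^esub> \<Longrightarrow> H p = \<zero>\<^bsub>Q\<^esub>"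
  obtains g where "g \<in> Ring.ring_hom (S\<lparr>carrier := E ` carrier P\<rparr>) Q" "\<And>p. p \<in> carrier P \<Longrightarrow> g (E p) = H p"
proof -
  interpret E: ring_hom_ring P S E using assms by (simp add: ring_hom_ring_def ring_hom_ring_axioms_def)
  interpret H: ring_hom_ring P Q H using assms by (simp add: ring_hom_ring_def ring_hom_ring_axioms_def)
  define g where "g y = H (SOME p. p \<in> carrier P \<and> E p = y)" for y
  have g: "g (E p) = H p" if p: "p \<in> carrier P" for p
  proof -
    define p' where "p' = (SOME p'. p' \<in> carrier P \<and> E p' = E p)"
    have p': "p' \<in> carrier P" "E p' = E p"
      using someI[of "\<lambda>p'. p' \<in> carrier P \<and> E p' = E p" p] p by (auto simp: p'_def)
    then have "E (p' \<ominus>\<^bsub>P\<^esub> p) = \<zero>\<^bsub>S\<^esub>" using p by (simp add: a_minus_def E.S.r_neg)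
    then have "H (p' \<ominus>\<^bsub>P\<^esub> p) = \<zero>\<^bsub>Q\<^esub>" using ker p p' by simp
    then have "H p' \<oplus>\<^bsub>Q\<^esub> (\<ominus>\<^bsub>Q\<^esub> H p) = \<zero>\<^bsub>Q\<^esub>" using p p' by (simp add: a_minus_def)
    then have "H p' = H p" using p p' by (metis H.S.minus_equality H.S.minus_minus H.hom_closed
      H.S.a_inv_closed)
    then show ?thesis by (simp add: g_def p'_def)
  qed
  have "g \<in> Ring.ring_hom (S\<lparr>carrier := E ` carrier P\<rparr>) Q"
  proof (rule ring_hom_memI)
    fix x y assume "x \<in> carrier (S\<lparr>carrier := E ` carrier P\<rparr>)" "y \<in> carrier (S\<lparr>carrier := E ` carrier P\<rparr>)"
    then obtain p q where pq: "p \<in> carrier P" "q \<in> carrier P" "x = E p" "y = E q" by auto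
    have "g (E (p \<otimes>\<^bsub>P\<^esub> q)) = g (E p) \<otimes>\<^bsub>Q\<^esub> g (E q)" using pq by (simp only: g E.R.m_closed H.hom_mult)
    then show "g (x \<otimes>\<^bsub>S\<lparr>carrier := E ` carrier P\<rparr>\<^esub> y) = g x \<otimes>\<^bsub>Q\<^esub> g y" using pq by simp
    have "g (E (p \<oplus>\<^bsub>P\<^esub> q)) = g (E p) \<oplus>\<^bsub>Q\<^esub> g (E q)" using pq by (simp only: g E.R.a_closed H.hom_add)
    then show "g (x \<oplus>\<^bsub>S\<lparr>carrier := E ` carrier P\<rparr>\<^esub> y) = g x \<oplus>\<^bsub>Q\<^esub> g y" using pq by simp
  next
    have "g (E \<one>\<^bsub>P\<^esub>) = \<one>\<^bsub>Q\<^esub>" by (simp only: g E.R.one_closed H.hom_one)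
    then show "g \<one>\<^bsub>S\<lparr>carrier := E ` carrier P\<rparr>\<^esub> = \<one>\<^bsub>Q\<^esub>" by simp
  qed (auto simp: g)
  with g that show ?thesis by blast
qed

section \<open>Elements that become invertible in a finite ring\<close>

lemma ring_hom_Units:
  assumes "monoid A" "monoid B" "f \<in> Ring.ring_hom A B" "u \<in> Units A" shows "f u \<in> Units B"
proof -
  interpret A: monoid A by fact
  interpret B: monoid B by fact
  have v: "u \<in> carrier A" "inv\<^bsub>A\<^esub> u \<in> carrier A" using assms by auto
  have w: "f u \<in> carrier B" "f (inv\<^bsub>A\<^esub> u) \<in> carrier B" using assms v by (auto simp: Ring.ring_hom_def)
  have "f u \<otimes>\<^bsub>B\<^esub> f (inv\<^bsub>A\<^esub> u) = f (u \<otimes>\<^bsub>A\<^esub> inv\<^bsub>A\<^esub> u)"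
    "f (inv\<^bsub>A\<^esub> u) \<otimes>\<^bsub>B\<^esub> f u = f (inv\<^bsub>A\<^esub> u \<otimes>\<^bsub>A\<^esub> u)"
    using ring_hom_mult[OF assms(3)] v by auto
  then show ?thesis
    using assms w ring_hom_one[OF assms(3)] unfolding Units_def[of B]
    by (auto simp: A.Units_l_inv A.Units_r_inv intro!: bexI[of _ "f (inv\<^bsub>A\<^esub> u)"])
qed

text \<open>The property carried through the induction over generators. The zero ring is excluded
  because all its elements are units. Rings on the naturals represent all finite rings, as
  \<open>unit_to_finiteI\<close> shows; a definition cannot quantify over types.\<close>

definition unit_to_finite :: "('r, 'm) ring_scheme \<Rightarrow> 'r \<Rightarrow> bool" where
  "unit_to_finite A a \<longleftrightarrow> (\<exists>(k :: nat ring) f. cring k \<and> finite (carrier k) \<and> \<one>\<^bsub>k\<^esub> \<noteq> \<zero>\<^bsub>k\<^esub> \<and>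
     f \<in> Ring.ring_hom A k \<and> f a \<in> Units k)"

lemma unit_to_finiteI:
  assumes k: "cring k" "finite (carrier k)" "\<one>\<^bsub>k\<^esub> \<noteq> \<zero>\<^bsub>k\<^esub>" and f: "f \<in> Ring.ring_hom A k" "f a \<in> Units k"
  shows "unit_to_finite A a"
proof -
  obtain k' :: "nat ring" and e where k': "cring k'" "finite (carrier k')" and e: "e \<in> ring_iso k k'"
    using exists_nat_copy_of_finite_cring[OF k(1,2)] .
  interpret k: cring k by fact
  interpret k': cring k' by fact
  have eh: "e \<in> Ring.ring_hom k k'" and inj: "inj_on e (carrier k)" using e
    by (auto simp: ring_iso_def bij_betw_def)
  have "\<one>\<^bsub>k'\<^esub> \<noteq> \<zero>\<^bsub>k'\<^esub>"
    using ring_hom_one[OF eh] ring_hom_zero[OF eh k.ring_axioms k'.ring_axioms] k(3) inj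
    by (metis inj_onD k.one_closed k.zero_closed)
  moreover have "e \<circ> f \<in> Ring.ring_hom A k'" using ring_hom_trans[OF f(1) eh] .
  moreover have "(e \<circ> f) a \<in> Units k'"
    using ring_hom_Units[OF k.monoid_axioms k'.monoid_axioms eh f(2)] by simp
  ultimately show ?thesis unfolding unit_to_finite_def using k' by blast
qed

lemma unit_to_finite_image:
  fixes A :: "('r, 'm) ring_scheme" and k :: "'k ring" and h :: "(nat \<Rightarrow> 'r) \<Rightarrow> nat \<Rightarrow> 'k"
  assumes "cring A" "cring S" and E: "E \<in> Ring.ring_hom (UP A) S"
    and k: "cring k" "finite (carrier k)" "\<one>\<^bsub>k\<^esub> \<noteq> \<zero>\<^bsub>k\<^esub>" and h: "h \<in> Ring.ring_hom (UP A) (UP k)"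
    and q: "q \<in> carrier (UP k)" "coeff (UP k) q (deg k q) \<in> Units k" "deg k q \<noteq> 0"
    and ker: "\<And>p. p \<in> carrier (UP A) \<Longrightarrow> E p = \<zero>\<^bsub>S\<^esub> \<Longrightarrow> h p \<in> PIdl\<^bsub>UP k\<^esub> q"
    and b: "b \<in> carrier (UP A)" "v \<in> carrier (UP k)" "u \<in> Units (UP k)" "h b \<otimes>\<^bsub>UP k\<^esub> v \<ominus>\<^bsub>UP k\<^esub> u \<in> PIdl\<^bsub>UP k\<^esub>
      q"
  shows "unit_to_finite (S\<lparr>carrier := E ` carrier (UP A)\<rparr>) (E b)"
proof -
  interpret A: UP_cring A "UP A" using assms by (auto intro: UP_cring.intro)
  interpret k: UP_cring k "UP k" using assms by (auto intro: UP_cring.intro)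
  interpret S: cring S by fact
  let ?I = "PIdl\<^bsub>UP k\<^esub> q"
  let ?Q = "UP k Quot ?I"
  note quot = k.quotient_by_unit_lcoeff[OF k(2,3) q]
  interpret I: ideal ?I "UP k" by (rule quot)
  interpret Q: cring ?Q by (rule I.quotient_is_cring[OF k.UP_cring])
  let ?pi = "(+>\<^bsub>UP k\<^esub>) ?I"
  have pi: "?pi \<in> Ring.ring_hom (UP k) ?Q" by (rule I.rcos_ring_hom)
  have pi0: "?pi y = \<zero>\<^bsub>?Q\<^esub>" if "y \<in> ?I" for y
    using I.a_rcos_const[OF that] by (simp add: FactRing_def)
  have hp: "h p \<in> carrier (UP k)" if "p \<in> carrier (UP A)" for p using h that by (auto simp: Ring.ring_hom_def)
  obtain g where g: "g \<in> Ring.ring_hom (S\<lparr>carrier := E ` carrier (UP A)\<rparr>) ?Q"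
      "\<And>p. p \<in> carrier (UP A) \<Longrightarrow> g (E p) = (?pi \<circ> h) p"
  proof (rule ring_hom_factor[OF A.P.ring_axioms Q.ring_axioms S.ring_axioms E ring_hom_trans[OF h pi]])
    fix p assume "p \<in> carrier (UP A)" "E p = \<zero>\<^bsub>S\<^esub>"
    then show "(?pi \<circ> h) p = \<zero>\<^bsub>?Q\<^esub>" using ker pi0 by (simp del: I.a_rcos_const)
  qed (use that in blast)
  have "g (E b) \<in> Units ?Q"
  proof -
    have uc: "u \<in> carrier (UP k)" using b(3) by auto
    have "?pi u \<in> Units ?Q" using ring_hom_Units[OF k.P.monoid_axioms Q.monoid_axioms pi b(3)] .
    moreover have "?pi (h b \<otimes>\<^bsub>UP k\<^esub> v) = ?pi u"
    proof -
      let ?w = "h b \<otimes>\<^bsub>UP k\<^esub> v"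
      have wc: "?w \<in> carrier (UP k)" using hp b by simp
      have "?w = (?w \<ominus>\<^bsub>UP k\<^esub> u) \<oplus>\<^bsub>UP k\<^esub> u" using wc uc by (simp add: a_minus_def k.P.a_assoc k.P.l_neg)
      then have "?w \<in> ?I +>\<^bsub>UP k\<^esub> u" unfolding a_r_coset_def' using b(4) by auto
      then show ?thesis using I.a_repr_independence' uc by metis
    qed
    ultimately have "?pi (h b) \<otimes>\<^bsub>?Q\<^esub> ?pi v \<in> Units ?Q"
      using ring_hom_mult[OF pi hp[OF b(1)] b(2)] by simp
    moreover have "?pi (h b) \<in> carrier ?Q" "?pi v \<in> carrier ?Q" using ring_hom_closed[OF pi] hp b by auto
    ultimately have "?pi (h b) \<in> Units ?Q" using Q.unit_factor by blast
    then show ?thesis using g(2)[OF b(1)] by simp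
  qed
  then show ?thesis using unit_to_finiteI[OF Q.cring_axioms quot(2,3) g(1)] by blast
qed

section \<open>Adjoining one element to a subring of a domain\<close>

context UP_domain begin

text \<open>The scalar is written as a constant polynomial so that ring homomorphisms can be applied
  to the equation.\<close>

lemma pseudo_division:
  assumes "p \<in> carrier P" "p \<noteq> \<zero>\<^bsub>P\<^esub>" "g \<in> carrier P"
  obtains n s r where "s \<in> carrier P" "r \<in> carrier P"
    "monom P (lcoeff p [^] (n::nat)) 0 \<otimes>\<^bsub>P\<^esub> g = p \<otimes>\<^bsub>P\<^esub> s \<oplus>\<^bsub>P\<^esub> r" "r = \<zero>\<^bsub>P\<^esub> \<or> deg R r < deg R p"
proof -
  obtain s r n where "s \<in> carrier P \<and> r \<in> carrier P \<and>
      (lcoeff p)[^](n::nat) \<odot>\<^bsub>P\<^esub> g = p \<otimes>\<^bsub>P\<^esub> s \<oplus>\<^bsub>P\<^esub> r \<and> (r = \<zero>\<^bsub>P\<^esub> \<or> deg R r < deg R p)"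
    using long_div_theorem[OF assms(1,3,2)] by (elim exE) (rule that)
  moreover have "monom P ((lcoeff p)[^]n) 0 \<otimes>\<^bsub>P\<^esub> g = (lcoeff p)[^]n \<odot>\<^bsub>P\<^esub> g"
    using assms by (simp add: monom_mult_is_smult)
  ultimately show ?thesis using that by metis
qed

lemma lcoeff_pow_nonzero:
  assumes "p \<in> carrier P" "p \<noteq> \<zero>\<^bsub>P\<^esub>"
  shows "lcoeff p [^] (n::nat) \<noteq> \<zero>"
  using assms by (induction n) (auto simp: R.integral_iff lcoeff_nonzero2 R.one_not_zero)

text \<open>Elimination without a field of fractions. Take \<open>w\<close> of least degree among
  the polynomials whose image is a nonzero multiple of \<open>E b\<close>. Reducing \<open>w\<close>
  modulo \<open>p\<close> shows that its degree is below that of \<open>p\<close>. Dividing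
  \<open>p\<close> by \<open>w\<close> leaves no remainder, since a nonzero one would be a smaller
  choice of \<open>w\<close>. So, up to a nonzero constant, \<open>p\<close> is \<open>w\<close>
  times \<open>q\<close>, and \<open>E q\<close> vanishes because \<open>S\<close> is a domain. By
  minimality of \<open>p\<close> the degree of \<open>q\<close> is at least that of
  \<open>p\<close>, which leaves degree zero for \<open>w\<close>.\<close>

lemma constant_combination:
  assumes S: "domain S" and E: "E \<in> Ring.ring_hom P S"
    and inj: "\<And>a. a \<in> carrier R \<Longrightarrow> a \<noteq> \<zero> \<Longrightarrow> E (monom P a 0) \<noteq> \<zero>\<^bsub>S\<^esub>"
    and p: "p \<in> carrier P" "p \<noteq> \<zero>\<^bsub>P\<^esub>" "E p = \<zero>\<^bsub>S\<^esub>"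
    and minp: "\<And>g. g \<in> carrier P \<Longrightarrow> E g = \<zero>\<^bsub>S\<^esub> \<Longrightarrow> deg R g < deg R p \<Longrightarrow> g = \<zero>\<^bsub>P\<^esub>"
    and b: "b \<in> carrier P" "E b \<noteq> \<zero>\<^bsub>S\<^esub>"
  obtains a s where "a \<in> carrier R" "a \<noteq> \<zero>" "s \<in> carrier P" "E (b \<otimes>\<^bsub>P\<^esub> s) = E (monom P a 0)"
proof -
  interpret S: domain S by fact
  interpret E: ring_hom_cring P S E using E by (simp add: ring_hom_cring_def ring_hom_cring_axioms_def
    P.is_cring S.is_cring)
  define J where "J w \<longleftrightarrow> w \<in> carrier P \<and> E w \<noteq> \<zero>\<^bsub>S\<^esub> \<and> (\<exists>s\<in>carrier P. E w = E b \<otimes>\<^bsub>S\<^esub> E s)" for w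
  have "J b" using b by (auto simp: J_def intro!: bexI[of _ "\<one>\<^bsub>P\<^esub>"])
  then obtain w where w: "J w" and minw: "\<And>v. J v \<Longrightarrow> deg R w \<le> deg R v"
    using ex_has_least_nat[of J b "deg R"] by blast
  obtain t where wt: "w \<in> carrier P" "E w \<noteq> \<zero>\<^bsub>S\<^esub>" "t \<in> carrier P" "E w = E b \<otimes>\<^bsub>S\<^esub> E t" using w
    by (auto simp: J_def)
  have w0: "w \<noteq> \<zero>\<^bsub>P\<^esub>" using wt by auto
  have Ec: "E (monom P (lcoeff u [^] (n::nat)) 0) \<noteq> \<zero>\<^bsub>S\<^esub>" if "u \<in> carrier P" "u \<noteq> \<zero>\<^bsub>P\<^esub>" for u n
    using inj[of "lcoeff u [^] n"] lcoeff_pow_nonzero[OF that] that by simp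
  have degw: "deg R w < deg R p"
  proof -
    obtain n s r where d: "s \<in> carrier P" "r \<in> carrier P"
      "monom P (lcoeff p [^] (n::nat)) 0 \<otimes>\<^bsub>P\<^esub> w = p \<otimes>\<^bsub>P\<^esub> s \<oplus>\<^bsub>P\<^esub> r" "r = \<zero>\<^bsub>P\<^esub> \<or> deg R r < deg R p"
      using pseudo_division[OF p(1,2) wt(1)] .
    let ?c = "monom P (lcoeff p [^] n) 0"
    have c: "?c \<in> carrier P" using p by simp
    have "E ?c \<otimes>\<^bsub>S\<^esub> E w = E (?c \<otimes>\<^bsub>P\<^esub> w)" using c wt(1) by simp
    also have "\<dots> = E p \<otimes>\<^bsub>S\<^esub> E s \<oplus>\<^bsub>S\<^esub> E r" unfolding d(3) using p(1) d(1,2) by simp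
    finally have "E ?c \<otimes>\<^bsub>S\<^esub> E w = E p \<otimes>\<^bsub>S\<^esub> E s \<oplus>\<^bsub>S\<^esub> E r" .
    then have Er: "E r = E ?c \<otimes>\<^bsub>S\<^esub> E w" using p d by simp
    then have nz: "E r \<noteq> \<zero>\<^bsub>S\<^esub>" using Ec[OF p(1,2), of n] wt(1,2) c
      by (simp only: S.integral_iff E.hom_closed) simp
    have "E r = E b \<otimes>\<^bsub>S\<^esub> E (?c \<otimes>\<^bsub>P\<^esub> t)" unfolding Er wt(4) using wt(3) c b by (simp add: S.m_lcomm)
    moreover have "?c \<otimes>\<^bsub>P\<^esub> t \<in> carrier P" using c wt(3) by simp
    ultimately have "J r" unfolding J_def using nz d(2) by blast
    then show ?thesis using minw d(4) nz by fastforce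
  qed
  obtain n q r where d: "q \<in> carrier P" "r \<in> carrier P"
      "monom P (lcoeff w [^] (n::nat)) 0 \<otimes>\<^bsub>P\<^esub> p = w \<otimes>\<^bsub>P\<^esub> q \<oplus>\<^bsub>P\<^esub> r" "r = \<zero>\<^bsub>P\<^esub> \<or> deg R r < deg R w"
    using pseudo_division[OF wt(1) w0 p(1)] .
  let ?c = "monom P (lcoeff w [^] n) 0"
  have c: "?c \<in> carrier P" using wt by simp
  have "E ?c \<otimes>\<^bsub>S\<^esub> E p = E (?c \<otimes>\<^bsub>P\<^esub> p)" using c p(1) by simp
  also have "\<dots> = E w \<otimes>\<^bsub>S\<^esub> E q \<oplus>\<^bsub>S\<^esub> E r" unfolding d(3) using wt(1) d(1,2) by simp
  finally have "E ?c \<otimes>\<^bsub>S\<^esub> E p = E w \<otimes>\<^bsub>S\<^esub> E q \<oplus>\<^bsub>S\<^esub> E r" .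
  then have s0: "E w \<otimes>\<^bsub>S\<^esub> E q \<oplus>\<^bsub>S\<^esub> E r = \<zero>\<^bsub>S\<^esub>" using p c by simp
  have "r = \<zero>\<^bsub>P\<^esub>"
  proof (rule ccontr)
    assume r0: "r \<noteq> \<zero>\<^bsub>P\<^esub>"
    then have dr: "deg R r < deg R w" using d by simp
    \<comment> \<open>The degree of \<open>r\<close> is also below that of \<open>p\<close>, so
      \<open>minp\<close> keeps its image nonzero; this makes \<open>r\<close> a competitor of
      \<open>w\<close>.\<close>
    have "E r \<noteq> \<zero>\<^bsub>S\<^esub>" using minp[OF d(2)] r0 dr degw by auto
    moreover have "E r = \<ominus>\<^bsub>S\<^esub> (E w \<otimes>\<^bsub>S\<^esub> E q)" using s0 wt d
      by (metis E.hom_closed S.a_comm S.m_closed S.minus_equality)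
    then have "E r = E b \<otimes>\<^bsub>S\<^esub> E (\<ominus>\<^bsub>P\<^esub> (t \<otimes>\<^bsub>P\<^esub> q))" unfolding wt(4) using wt(3) d(1) b(1)
      by (simp add: S.m_assoc S.r_minus)
    moreover have "\<ominus>\<^bsub>P\<^esub> (t \<otimes>\<^bsub>P\<^esub> q) \<in> carrier P" using d(1) wt(3) by simp
    ultimately have "J r" unfolding J_def using d(2) by blast
    then show False using minw dr by fastforce
  qed
  then have pq: "?c \<otimes>\<^bsub>P\<^esub> p = w \<otimes>\<^bsub>P\<^esub> q" using d(1,3) wt(1) by simp
  have "E w \<otimes>\<^bsub>S\<^esub> E q = \<zero>\<^bsub>S\<^esub>" using s0 unfolding \<open>r = \<zero>\<^bsub>P\<^esub>\<close> using wt(1) d(1)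
    by (simp only: E.hom_zero S.r_zero S.m_closed E.hom_closed)
  then have Eq: "E q = \<zero>\<^bsub>S\<^esub>" using wt d S.integral by fastforce
  have c0: "?c \<noteq> \<zero>\<^bsub>P\<^esub>" using Ec[OF wt(1) w0, of n] by auto
  have "?c \<otimes>\<^bsub>P\<^esub> p \<noteq> \<zero>\<^bsub>P\<^esub>" using c0 p c by (simp add: domain.integral_iff[OF UP_domain])
  then have q0: "q \<noteq> \<zero>\<^bsub>P\<^esub>" using pq wt by auto
  have "deg R p \<le> deg R q" using minp[OF d(1) Eq] q0 by (meson not_le)
  moreover have "deg R ?c + deg R p = deg R w + deg R q"
    using arg_cong[OF pq, of "deg R"] deg_mult[OF c0 p(2) c p(1)] deg_mult[OF w0 q0 wt(1) d(1)] by simp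
  moreover have "deg R ?c = 0" using wt by simp
  ultimately have "deg R w = 0" by linarith
  then have "w = monom P (coeff P w 0) 0" using deg_zero_impl_monom wt by simp
  moreover have "coeff P w 0 \<noteq> \<zero>" using calculation w0 by (metis monom_zero)
  ultimately show ?thesis using that[of "coeff P w 0" t] wt b by simp
qed

end

text \<open>If \<open>x\<close> is transcendental over \<open>D\<close>, invert the leading coefficient of the polynomial \<open>b\<close> and pass to
  \<open>k[X]/(X b - 1)\<close>. If \<open>p\<close> is a polynomial over \<open>D\<close> of least degree vanishing at \<open>x\<close>, some multiple of
  \<open>b(x)\<close> is a nonzero constant \<open>a0\<close>; invert \<open>a0\<close> and the leading coefficient of \<open>p\<close> and pass to
  \<open>k[X]/(p)\<close>.\<close>

lemma (in domain) unit_to_finite_adjoin: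
  assumes D: "subring D R" and sep: "\<And>a. a \<in> D \<Longrightarrow> a \<noteq> \<zero> \<Longrightarrow> unit_to_finite (R\<lparr>carrier := D\<rparr>) a"
    and x: "x \<in> carrier R"
  obtains D' where "subring D' R" "D \<subseteq> D'" "x \<in> D'" "\<And>a. a \<in> D' \<Longrightarrow> a \<noteq> \<zero> \<Longrightarrow> unit_to_finite (R\<lparr>carrier := D'\<rparr>) a"
proof -
  define A where "A = R\<lparr>carrier := D\<rparr>"
  have DR: "D \<subseteq> carrier R" using subringE(1)[OF D] .
  interpret A: domain A unfolding A_def by (rule subring_is_domain[OF D])
  interpret U: UP_domain A "UP A" by unfold_locales
  have idh: "id \<in> Ring.ring_hom A R" using DR by (auto simp: A_def Ring.ring_hom_def)
  interpret pre: UP_pre_univ_prop A R id "UP A"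
    using idh A.is_cring is_cring by (auto intro!: UP_pre_univ_propI)
  define E where "E = eval A R id x"
  have E: "E \<in> Ring.ring_hom (UP A) R" unfolding E_def by (rule pre.eval_ring_hom[OF x])
  interpret E: ring_hom_cring "UP A" R E using E
    by (simp add: ring_hom_cring_def ring_hom_cring_axioms_def U.P.is_cring is_cring)
  have Econst: "E (monom (UP A) a 0) = a" if "a \<in> D" for a
    using pre.eval_const[OF x, of a] that by (simp add: E_def A_def)
  have EX: "E (monom (UP A) \<one>\<^bsub>A\<^esub> 1) = x" using pre.eval_monom1[OF x] by (simp add: E_def)
  define D' where "D' = E ` carrier (UP A)"
  have "subring D' R" unfolding D'_def
    by (rule ring_hom_ring.img_is_subring[OF _ U.P.carrier_is_subring])
      (simp add: ring_hom_ring_def ring_hom_ring_axioms_def U.P.ring_axioms ring_axioms E)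
  moreover have "D \<subseteq> D'"
  proof
    fix a assume "a \<in> D"
    then have "monom (UP A) a 0 \<in> carrier (UP A)" by (auto simp: A_def[symmetric] intro!: U.monom_closed)
      (simp add: A_def)
    then show "a \<in> D'" using Econst[OF \<open>a \<in> D\<close>] unfolding D'_def by force
  qed
  moreover have "x \<in> D'" using EX U.monom_closed[of "\<one>\<^bsub>A\<^esub>" 1] unfolding D'_def by force
  moreover have "unit_to_finite (R\<lparr>carrier := D'\<rparr>) a" if a: "a \<in> D'" "a \<noteq> \<zero>" for a
  proof -
    obtain b where b: "b \<in> carrier (UP A)" "a = E b" using a by (auto simp: D'_def)
    then have Eb: "E b \<noteq> \<zero>" and b0: "b \<noteq> \<zero>\<^bsub>UP A\<^esub>" using a by auto
    have sepA: "\<exists>(k :: nat ring) f. cring k \<and> finite (carrier k) \<and> \<one>\<^bsub>k\<^esub> \<noteq> \<zero>\<^bsub>k\<^esub> \<and> f \<in> Ring.ring_hom A k \<and>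
      f c \<in> Units k"
      if "c \<in> carrier A" "c \<noteq> \<zero>" for c using sep[of c] that unfolding unit_to_finite_def A_def by simp
    show ?thesis
    proof (cases "\<forall>p\<in>carrier (UP A). E p = \<zero> \<longrightarrow> p = \<zero>\<^bsub>UP A\<^esub>")
      case True
      let ?c = "coeff (UP A) b (deg A b)"
      have c: "?c \<in> carrier A" using b by simp
      have c0: "?c \<noteq> \<zero>" using U.lcoeff_nonzero2[OF b(1) b0] by (simp add: A_def)
      obtain k :: "nat ring" and f where k: "cring k" "finite (carrier k)" "\<one>\<^bsub>k\<^esub> \<noteq> \<zero>\<^bsub>k\<^esub>"
        and f: "f \<in> Ring.ring_hom A k" "f ?c \<in> Units k" using sepA[OF c c0] by blast
      define h where "h p i = f (coeff (UP A) p i)" for p i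
      note h = UP_map_ring_hom[OF A.is_cring k(1) f(1), of h, OF h_def]
      interpret k: UP_cring k "UP k" using k by (auto intro: UP_cring.intro)
      have hb: "h b \<in> carrier (UP k)" using h b by (auto simp: Ring.ring_hom_def)
      let ?X = "monom (UP k) \<one>\<^bsub>k\<^esub> 1"
      have X: "?X \<in> carrier (UP k)" by simp
      define q where "q = ?X \<otimes>\<^bsub>UP k\<^esub> h b \<ominus>\<^bsub>UP k\<^esub> \<one>\<^bsub>UP k\<^esub>"
      have q: "q \<in> carrier (UP k)" using hb X by (simp add: q_def)
      have top: "coeff (UP k) q (deg A b + 1) = f ?c"
        using k.coeff_monom_mult[OF k.R.one_closed hb, of 1 "deg A b"] hb f h(2)[OF b(1)]
          ring_hom_closed[OF f(1) c]
        by (simp add: q_def a_minus_def)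
      have "deg k (h b) \<le> deg A b"
        by (rule k.deg_aboveI) (use hb h(2)[OF b(1)] b f in
          \<open>auto simp: U.deg_aboveD ring_hom_zero[OF f(1) A.ring_axioms k.R.ring_axioms]\<close>)
      moreover have "deg k ?X \<le> 1" using k.deg_monom_le[of "\<one>\<^bsub>k\<^esub>" 1] by simp
      ultimately have "deg k (?X \<otimes>\<^bsub>UP k\<^esub> h b) \<le> deg A b + 1" using k.deg_mult_ring[OF X hb] by linarith
      then have "coeff (UP k) q m = \<zero>\<^bsub>k\<^esub>" if "m > deg A b + 1" for m
        using that hb X by (simp add: q_def a_minus_def k.deg_aboveD)
      moreover have fc0: "f ?c \<noteq> \<zero>\<^bsub>k\<^esub>"
        using f(2) k(3) by (metis k.R.Units_r_inv k.R.Units_inv_closed k.R.l_null)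
      \<comment> \<open>The factor \<open>X\<close> makes the degree positive even for constant
        \<open>b\<close>, as the quotient lemma demands.\<close>
      ultimately have dq: "deg k q = deg A b + 1"
        using q top by (intro antisym k.deg_aboveI k.deg_belowI) auto
      show ?thesis unfolding b(2) D'_def
      proof (rule unit_to_finite_image[OF A.is_cring is_cring E k h(1) q _ _ _ b(1) X k.P.Units_one_closed])
        show "h b \<otimes>\<^bsub>UP k\<^esub> ?X \<ominus>\<^bsub>UP k\<^esub> \<one>\<^bsub>UP k\<^esub> \<in> PIdl\<^bsub>UP k\<^esub> q"
          using k.P.cgenideal_self[OF q] k.P.m_comm[OF hb X] by (simp add: q_def)
        fix p assume "p \<in> carrier (UP A)" "E p = \<zero>"
        then have "p = \<zero>\<^bsub>UP A\<^esub>" using True by blast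
        then have "h p = \<zero>\<^bsub>UP k\<^esub>" using ring_hom_zero[OF h(1) U.P.ring_axioms k.P.ring_axioms] by simp
        then show "h p \<in> PIdl\<^bsub>UP k\<^esub> q"
          using additive_subgroup.zero_closed[OF ideal.axioms(1)[OF k.P.cgenideal_ideal[OF q]]] by simp
      qed (use dq top f in auto)
    next
      case False
      then obtain p where p: "p \<in> carrier (UP A)" "p \<noteq> \<zero>\<^bsub>UP A\<^esub>" "E p = \<zero>"
        and minp: "\<And>g. g \<in> carrier (UP A) \<Longrightarrow> E g = \<zero> \<Longrightarrow> deg A g < deg A p \<Longrightarrow> g = \<zero>\<^bsub>UP A\<^esub>"
      proof -
        let ?K = "\<lambda>p. p \<in> carrier (UP A) \<and> E p = \<zero> \<and> p \<noteq> \<zero>\<^bsub>UP A\<^esub>"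
        obtain p0 where "?K p0" using False by blast
        then obtain p where "?K p" "\<forall>g. ?K g \<longrightarrow> deg A p \<le> deg A g" using ex_has_least_nat[of ?K p0 "deg A"]
          by blast
        then show ?thesis using that[of p] by (meson not_le)
      qed
      have inj: "E (monom (UP A) a 0) \<noteq> \<zero>" if "a \<in> carrier A" "a \<noteq> \<zero>\<^bsub>A\<^esub>" for a
        using that Econst by (simp add: A_def)
      obtain a0 s where as: "a0 \<in> carrier A" "a0 \<noteq> \<zero>\<^bsub>A\<^esub>" "s \<in> carrier (UP A)" "E (b \<otimes>\<^bsub>UP A\<^esub> s) =
        E (monom (UP A) a0 0)"
        by (rule U.constant_combination[OF domain_axioms E inj p minp b(1) Eb])
      let ?c = "coeff (UP A) p (deg A p)"
      have c: "?c \<in> carrier A" "?c \<noteq> \<zero>\<^bsub>A\<^esub>" using U.lcoeff_nonzero2[OF p(1,2)] p by auto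
      \<comment> \<open>One element stands for both: a homomorphism that sends the product to a unit
        sends \<open>a0\<close> and the leading coefficient of \<open>p\<close> to units.\<close>
      have "a0 \<otimes>\<^bsub>A\<^esub> ?c \<in> carrier A" "a0 \<otimes>\<^bsub>A\<^esub> ?c \<noteq> \<zero>\<^bsub>A\<^esub>" using c as A.integral_iff by auto
      moreover have "\<zero>\<^bsub>A\<^esub> = \<zero>" by (simp add: A_def)
      ultimately obtain k :: "nat ring" and f where k: "cring k" "finite (carrier k)" "\<one>\<^bsub>k\<^esub> \<noteq> \<zero>\<^bsub>k\<^esub>"
        and f: "f \<in> Ring.ring_hom A k" "f (a0 \<otimes>\<^bsub>A\<^esub> ?c) \<in> Units k" using sepA by metis
      interpret k: UP_cring k "UP k" using k by (auto intro: UP_cring.intro)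
      have fin: "f ?c \<in> carrier k" "f a0 \<in> carrier k" using ring_hom_closed[OF f(1)] c as by auto
      have fu: "f a0 \<in> Units k" "f ?c \<in> Units k"
        using f(2) fin ring_hom_mult[OF f(1) as(1) c(1)] k.R.unit_factor k.R.m_comm by metis+
      define h where "h p i = f (coeff (UP A) p i)" for p i
      note h = UP_map_ring_hom[OF A.is_cring k(1) f(1), of h, OF h_def]
      interpret h: ring_hom_cring "UP A" "UP k" h using h(1)
        by (simp add: ring_hom_cring_def ring_hom_cring_axioms_def U.P.is_cring k.P.is_cring)
      have hm: "h (monom (UP A) y 0) = monom (UP k) (f y) 0" if "y \<in> carrier A" for y
        by (rule k.up_eqI) (use that h(2) ring_hom_closed[OF f(1)] ring_hom_zero[OF f(1) A.ring_axioms
          k.R.ring_axioms] in auto)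
      have mU: "monom (UP k) y 0 \<in> Units (UP k)" if "y \<in> Units k" for y
        using ring_hom_Units[OF k.R.monoid_axioms k.P.monoid_axioms k.const_ring_hom that] .
      have fc0: "f ?c \<noteq> \<zero>\<^bsub>k\<^esub>"
        using fu(2) k(3) by (metis k.R.Units_r_inv k.R.Units_inv_closed k.R.l_null)
      have q: "h p \<in> carrier (UP k)" using p by simp
      have dq: "deg k (h p) = deg A p"
        by (intro antisym k.deg_aboveI k.deg_belowI)
          (use p q fc0 h(2) in \<open>auto simp: U.deg_aboveD ring_hom_zero[OF f(1) A.ring_axioms k.R.ring_axioms]\<close>)
      have dp: "deg A p \<noteq> 0"
      proof
        assume "deg A p = 0"
        then have pm: "p = monom (UP A) ?c 0" using U.deg_zero_impl_monom[OF p(1)] by simp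
        have "E (monom (UP A) ?c 0) \<noteq> \<zero>" using inj c by blast
        then show False using pm p(3) by simp
      qed
      interpret I: ideal "PIdl\<^bsub>UP k\<^esub> (h p)" "UP k" using k.P.cgenideal_ideal[OF q] .
      \<comment> \<open>Pseudo-division of \<open>g\<close> by \<open>p\<close> leaves a remainder
        that vanishes at \<open>x\<close>, so it is zero by \<open>minp\<close>. The power of the
        leading coefficient in front of \<open>g\<close> becomes a unit under \<open>h\<close> and
        can be cancelled.\<close>
      have ker: "h g \<in> PIdl\<^bsub>UP k\<^esub> (h p)" if g: "g \<in> carrier (UP A)" "E g = \<zero>" for g
      proof -
        obtain n s r where d: "s \<in> carrier (UP A)" "r \<in> carrier (UP A)"
          "monom (UP A) (?c [^]\<^bsub>A\<^esub> (n::nat)) 0 \<otimes>\<^bsub>UP A\<^esub> g = p \<otimes>\<^bsub>UP A\<^esub> s \<oplus>\<^bsub>UP A\<^esub> r" "r = \<zero>\<^bsub>UP A\<^esub> \<or>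
            deg A r < deg A p"
          using U.pseudo_division[OF p(1,2) g(1)] .
        let ?m = "monom (UP A) (?c [^]\<^bsub>A\<^esub> n) 0"
        have m: "?m \<in> carrier (UP A)" using c by simp
        have "E (?m \<otimes>\<^bsub>UP A\<^esub> g) = E (p \<otimes>\<^bsub>UP A\<^esub> s \<oplus>\<^bsub>UP A\<^esub> r)" using d(3) by simp
        then have "E ?m \<otimes> E g = E p \<otimes> E s \<oplus> E r" using d(1,2) p(1) g(1) m by (simp del: U.monom_mult)
        then have "E r = \<zero>" using p g m d by simp
        then have r0: "r = \<zero>\<^bsub>UP A\<^esub>" using minp d by blast
        have eq: "h ?m \<otimes>\<^bsub>UP k\<^esub> h g = h p \<otimes>\<^bsub>UP k\<^esub> h s"
        proof -
          have "h (?m \<otimes>\<^bsub>UP A\<^esub> g) = h (p \<otimes>\<^bsub>UP A\<^esub> s)" using d(1,3) p(1) r0 by simp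
          then show ?thesis using d(1) p(1) g(1) m by simp
        qed
        have "f (?c [^]\<^bsub>A\<^esub> n) = f ?c [^]\<^bsub>k\<^esub> n"
          using ring_hom_cring.hom_pow[of A k f ?c n] f(1) c A.is_cring k(1)
            by (simp add: ring_hom_cring_def ring_hom_cring_axioms_def)
        then have "h ?m \<in> Units (UP k)" using hm c fu(2) mU k.R.Units_pow_closed by simp
        then have hg: "h g = inv\<^bsub>UP k\<^esub> (h ?m) \<otimes>\<^bsub>UP k\<^esub> (h p \<otimes>\<^bsub>UP k\<^esub> h s)"
          and im: "inv\<^bsub>UP k\<^esub> (h ?m) \<in> carrier (UP k)"
          using eq g m by (auto simp: k.P.m_assoc[symmetric] k.P.Units_l_inv simp flip: eq)
        show ?thesis unfolding hg
          by (intro I.I_l_closed I.I_r_closed k.P.cgenideal_self q im) (use d in auto)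
      qed
      show ?thesis unfolding b(2) D'_def
      proof (rule unit_to_finite_image[OF A.is_cring is_cring E k h(1) q _ _ ker b(1)])
        show "h s \<in> carrier (UP k)" "monom (UP k) (f a0) 0 \<in> Units (UP k)" using as fu mU by auto
        have ma: "monom (UP A) a0 0 \<in> carrier (UP A)" using as by simp
        have "h (b \<otimes>\<^bsub>UP A\<^esub> s \<ominus>\<^bsub>UP A\<^esub> monom (UP A) a0 0) \<in> PIdl\<^bsub>UP k\<^esub> (h p)"
          by (rule ker) (use as b ma in \<open>auto simp: a_minus_def r_neg\<close>)
        then show "h b \<otimes>\<^bsub>UP k\<^esub> h s \<ominus>\<^bsub>UP k\<^esub> monom (UP k) (f a0) 0 \<in> PIdl\<^bsub>UP k\<^esub> (h p)"
          using as b ma hm[OF as(1)] by (simp add: a_minus_def)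
      qed (use dq dp fu h(2) p in auto)
    qed
  qed
  ultimately show ?thesis using that by blast
qed

section \<open>The prime subring and the induction over generators\<close>

lemma (in domain) finite_domain_Units:
  assumes "finite (carrier R)" "a \<in> carrier R" "a \<noteq> \<zero>" shows "a \<in> Units R"
proof -
  have "inj_on (\<lambda>x. a \<otimes> x) (carrier R)"
    using assms m_lcancel by (auto intro!: inj_onI)
  then have "(\<lambda>x. a \<otimes> x) ` carrier R = carrier R"
    using endo_inj_surj[OF assms(1)] assms(2) by blast
  then obtain b where "b \<in> carrier R" "a \<otimes> b = \<one>" using one_closed by (metis imageE)
  then show ?thesis using unit_factor[of a b] assms(2) Units_one_closed by simp
qed

lemma (in ring) int_pow_one_ring_hom: "(\<lambda>z::int. [z] \<cdot> \<one>) \<in> Ring.ring_hom INTEG R"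
proof (rule ring_hom_memI)
  fix x y :: int
  show "[(x \<otimes>\<^bsub>INTEG\<^esub> y)] \<cdot> \<one> = ([x] \<cdot> \<one>) \<otimes> ([y] \<cdot> \<one>)"
    using add_pow_ldistr_int[of \<one> "[y] \<cdot> \<one>" x] add.int_pow_pow[of \<one> x y]
    by (simp add: INTEG_def mult.commute)
  show "[(x \<oplus>\<^bsub>INTEG\<^esub> y)] \<cdot> \<one> = ([x] \<cdot> \<one>) \<oplus> ([y] \<cdot> \<one>)"
    using add.int_pow_mult[of \<one> x y] by (simp add: INTEG_def)
qed (auto simp: INTEG_def)

text \<open>In positive characteristic the image of the integers is a finite domain, so its nonzero
  elements are units and the identity is the required homomorphism. In characteristic zero it is a
  copy of the integers, and a nonzero \<open>z\<close> is a unit modulo \<open>abs z + 1\<close>: no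
  choice of a prime is involved.\<close>

lemma (in domain) unit_to_finite_prime_subring:
  obtains D where "subring D R" "\<And>a. a \<in> D \<Longrightarrow> a \<noteq> \<zero> \<Longrightarrow> unit_to_finite (R\<lparr>carrier := D\<rparr>) a"
proof -
  define E where "E z = [(z::int)] \<cdot> \<one>" for z
  have E: "E \<in> Ring.ring_hom INTEG R" using int_pow_one_ring_hom by (simp add: E_def[abs_def])
  have I: "ring INTEG" using INTEG_cring by (rule cring.axioms)
  interpret E: ring_hom_ring INTEG R E
    by (simp add: ring_hom_ring_def ring_hom_ring_axioms_def I ring_axioms E)
  define D where "D = E ` carrier INTEG"
  have D: "subring D R" unfolding D_def by (rule E.img_is_subring[OF ring.carrier_is_subring[OF I]])
  interpret A: domain "R\<lparr>carrier := D\<rparr>" by (rule subring_is_domain[OF D])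
  have "unit_to_finite (R\<lparr>carrier := D\<rparr>) a" if a: "a \<in> D" "a \<noteq> \<zero>" for a
  proof (cases "\<exists>n>0. E n = \<zero>")
    case True
    then obtain n where n: "n > 0" "E n = \<zero>" by blast
    have Emod: "E z = E (z mod n)" for z
    proof -
      have "E z = E ((n \<otimes>\<^bsub>INTEG\<^esub> (z div n)) \<oplus>\<^bsub>INTEG\<^esub> (z mod n))" by (simp add: INTEG_def)
      also have "\<dots> = E n \<otimes> E (z div n) \<oplus> E (z mod n)" by (subst E.hom_add, simp, simp, subst E.hom_mult) auto
      also have "\<dots> = E (z mod n)" using n by simp
      finally show ?thesis .
    qed
    have "D \<subseteq> E ` {0..<n}" unfolding D_def using Emod n by (force intro: image_eqI)
    then have fin: "finite (carrier (R\<lparr>carrier := D\<rparr>))" using finite_subset by auto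
    show ?thesis
    proof (rule unit_to_finiteI[OF A.is_cring fin A.one_not_zero])
      show "id \<in> Ring.ring_hom (R\<lparr>carrier := D\<rparr>) (R\<lparr>carrier := D\<rparr>)" by (auto simp: Ring.ring_hom_def)
      show "id a \<in> Units (R\<lparr>carrier := D\<rparr>)" using A.finite_domain_Units[OF fin] a by simp
    qed
  next
    case False
    have inj: "z = 0" if "E z = \<zero>" for z
    proof (rule ccontr)
      assume "z \<noteq> 0"
      have "E (\<ominus>\<^bsub>INTEG\<^esub> z) = \<zero>" using that by (subst E.hom_a_inv) auto
      moreover have "\<ominus>\<^bsub>INTEG\<^esub> z = - z" by (rule abelian_group.minus_equality[OF ring.is_abelian_group[OF I]])
        (auto simp: INTEG_def)
      ultimately show False using False that \<open>z \<noteq> 0\<close>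
        by (metis neg_0_less_iff_less linorder_neqE_linordered_idom)
    qed
    obtain z where z: "a = E z" using a by (auto simp: D_def)
    then have "z \<noteq> 0" using a E.hom_zero by (auto simp: INTEG_def)
    define m where "m = \<bar>z\<bar> + 1"
    have m: "m > 1" using \<open>z \<noteq> 0\<close> by (simp add: m_def)
    interpret k: residues m "residue_ring m" by unfold_locales (use m in auto)
    define H where "H y = y mod m" for y
    have H: "H \<in> Ring.ring_hom INTEG (residue_ring m)"
      by (rule ring_hom_memI) (use m in \<open>auto simp: H_def INTEG_def k.res_mult_eq k.res_add_eq k.res_one_eq
        k.res_carrier_eq mod_simps\<close>)
    obtain g where g: "g \<in> Ring.ring_hom (R\<lparr>carrier := E ` carrier INTEG\<rparr>) (residue_ring m)"
       "\<And>p. p \<in> carrier INTEG \<Longrightarrow> g (E p) = H p"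
      by (rule ring_hom_factor[OF I k.ring_axioms ring_axioms E H])
        (auto simp: H_def k.res_zero_eq dest!: inj)
    have "coprime z m"
    proof -
      have "coprime \<bar>z\<bar> (\<bar>z\<bar> + 1)" by simp
      then show ?thesis unfolding m_def by (metis coprime_abs_left_iff)
    qed
    then have "g (E z) \<in> Units (residue_ring m)" using g(2)[of z] m by (simp add: H_def)
    moreover have "\<one>\<^bsub>residue_ring m\<^esub> \<noteq> \<zero>\<^bsub>residue_ring m\<^esub>" by (simp add: k.res_one_eq k.res_zero_eq)
    ultimately show ?thesis using unit_to_finiteI[OF k.is_cring k.finite _ g(1)] z by (simp add: D_def)
  qed
  then show ?thesis using that D by blast
qed

theorem (in domain) exists_unit_to_finite_subring:
  assumes "finite S" "S \<subseteq> carrier R"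
  obtains D where "subring D R" "S \<subseteq> D" "\<And>a. a \<in> D \<Longrightarrow> a \<noteq> \<zero> \<Longrightarrow> unit_to_finite (R\<lparr>carrier := D\<rparr>) a"
  using assms
proof (induction S arbitrary: thesis rule: finite_induct)
  case empty
  show ?case by (rule unit_to_finite_prime_subring) (use empty in blast)
next
  case (insert x S)
  obtain D where D: "subring D R" "S \<subseteq> D" "\<And>a. a \<in> D \<Longrightarrow> a \<noteq> \<zero> \<Longrightarrow> unit_to_finite (R\<lparr>carrier := D\<rparr>) a"
    using insert by (metis insert_subset)
  obtain D' where "subring D' R" "D \<subseteq> D'" "x \<in> D'" "\<And>a. a \<in> D' \<Longrightarrow> a \<noteq> \<zero> \<Longrightarrow> unit_to_finite (R\<lparr>carrier := D'\<rparr>) a"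
    using unit_to_finite_adjoin[OF D(1,3), of x] insert.prems(2) by (metis insert_subset)
  then show ?case using insert.prems(1)[of D'] D(2) by blast
qed

section \<open>Finitary automorphisms of free modules\<close>

lemma BijGroup_simps [simp]:
  "carrier (BijGroup S) = Bij S"
  "\<one>\<^bsub>BijGroup S\<^esub> = (\<lambda>x\<in>S. x)"
  "f \<in> Bij S \<Longrightarrow> g \<in> Bij S \<Longrightarrow> f \<otimes>\<^bsub>BijGroup S\<^esub> g = compose S f g"
  by (auto simp: BijGroup_def)

lemma Bij_ext:
  assumes "f \<in> Bij S" "g \<in> Bij S" "\<And>x. x \<in> S \<Longrightarrow> f x = g x" shows "f = g"
  using assms by (auto simp: Bij_def intro: extensionalityI)

lemma module_Aut_simps:
  "carrier (module_Aut R M) = {A \<in> Bij (carrier M).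
        (\<forall>u\<in>carrier M. \<forall>v\<in>carrier M. A (u \<oplus>\<^bsub>M\<^esub> v) = A u \<oplus>\<^bsub>M\<^esub> A v) \<and>
        (\<forall>r\<in>carrier R. \<forall>v\<in>carrier M. A (r \<odot>\<^bsub>M\<^esub> v) = r \<odot>\<^bsub>M\<^esub> A v)}"
  "\<one>\<^bsub>module_Aut R M\<^esub> = (\<lambda>x\<in>carrier M. x)"
  "f \<otimes>\<^bsub>module_Aut R M\<^esub> g = f \<otimes>\<^bsub>BijGroup (carrier M)\<^esub> g"
  by (auto simp: module_Aut_def)

lemma subgroup_module_Aut:
  assumes add: "\<And>u v. u \<in> carrier M \<Longrightarrow> v \<in> carrier M \<Longrightarrow> u \<oplus>\<^bsub>M\<^esub> v \<in> carrier M"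
    and smult: "\<And>r v. r \<in> carrier R \<Longrightarrow> v \<in> carrier M \<Longrightarrow> r \<odot>\<^bsub>M\<^esub> v \<in> carrier M"
  shows "subgroup (carrier (module_Aut R M)) (BijGroup (carrier M))"
proof (rule group.subgroupI[OF group_BijGroup])
  show "carrier (module_Aut R M) \<noteq> {}"
    using id_Bij[of "carrier M"] add smult by (auto simp: module_Aut_simps intro!:
      exI[of _ "\<lambda>x\<in>carrier M. x"])
next
  fix A assume A: "A \<in> carrier (module_Aut R M)"
  then have AB: "A \<in> Bij (carrier M)" by (simp add: module_Aut_simps)
  let ?I = "\<lambda>x\<in>carrier M. inv_into (carrier M) A x"
  have I: "?I \<in> Bij (carrier M)" using restrict_inv_into_Bij[OF AB] .
  have inv: "inv\<^bsub>BijGroup (carrier M)\<^esub> A = ?I"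
    by (rule inv_BijGroup[OF AB])
  have AI: "A (inv_into (carrier M) A v) = v" "inv_into (carrier M) A v \<in> carrier M" if "v \<in> carrier M" for v
    using AB that by (auto simp: Bij_def bij_betw_def f_inv_into_f intro: inv_into_into)
  have IA: "inv_into (carrier M) A (A v) = v" if "v \<in> carrier M" for v
    using AB that by (auto simp: Bij_def bij_betw_def)
  have "inv_into (carrier M) A (u \<oplus>\<^bsub>M\<^esub> v) = inv_into (carrier M) A u \<oplus>\<^bsub>M\<^esub> inv_into (carrier M) A v"
    if "u \<in> carrier M" "v \<in> carrier M" for u v
  proof -
    have "A (inv_into (carrier M) A u \<oplus>\<^bsub>M\<^esub> inv_into (carrier M) A v) = u \<oplus>\<^bsub>M\<^esub> v"
      using A AI that by (simp add: module_Aut_simps)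
    then show ?thesis using IA[OF add] AI that by metis
  qed
  moreover have "inv_into (carrier M) A (r \<odot>\<^bsub>M\<^esub> v) = r \<odot>\<^bsub>M\<^esub> inv_into (carrier M) A v"
    if "r \<in> carrier R" "v \<in> carrier M" for r v
  proof -
    have "A (r \<odot>\<^bsub>M\<^esub> inv_into (carrier M) A v) = r \<odot>\<^bsub>M\<^esub> v"
      using A AI that by (simp add: module_Aut_simps)
    then show ?thesis using IA[OF smult] AI that by metis
  qed
  ultimately show "inv\<^bsub>BijGroup (carrier M)\<^esub> A \<in> carrier (module_Aut R M)"
    unfolding inv using I add smult by (simp add: module_Aut_simps)
next
  fix A B assume "A \<in> carrier (module_Aut R M)" "B \<in> carrier (module_Aut R M)"
  then show "A \<otimes>\<^bsub>BijGroup (carrier M)\<^esub> B \<in> carrier (module_Aut R M)"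
    using Bij_imp_funcset[of B "carrier M"] add smult
    by (auto simp: module_Aut_simps compose_Bij compose_eq Pi_def)
qed (auto simp: module_Aut_simps)

lemma group_module_Aut:
  assumes "\<And>u v. u \<in> carrier M \<Longrightarrow> v \<in> carrier M \<Longrightarrow> u \<oplus>\<^bsub>M\<^esub> v \<in> carrier M"
    and "\<And>r v. r \<in> carrier R \<Longrightarrow> v \<in> carrier M \<Longrightarrow> r \<odot>\<^bsub>M\<^esub> v \<in> carrier M"
  shows "group (module_Aut R M)"
proof -
  have "module_Aut R M = BijGroup (carrier M) \<lparr>carrier := carrier (module_Aut R M)\<rparr>"
    by (simp add: module_Aut_def)
  then show ?thesis using subgroup.subgroup_is_group[OF subgroup_module_Aut[of M R, OF assms] group_BijGroup]
    by simp
qed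

section \<open>Free modules and their finitary automorphisms\<close>

context cring begin

abbreviation fm :: "'x set \<Rightarrow> ('x \<Rightarrow> 'a) set" where "fm X \<equiv> carrier (free_module R X)"

lemma fm_iff: "f \<in> fm X \<longleftrightarrow> (\<forall>x\<in>X. f x \<in> carrier R) \<and> (\<forall>x. x \<notin> X \<longrightarrow> f x = \<zero>) \<and> finite {x\<in>X. f x \<noteq> \<zero>}"
  by (simp add: free_module_def)

lemma fm_simps [simp]:
  "f \<oplus>\<^bsub>free_module R X\<^esub> g = (\<lambda>x. f x \<oplus> g x)"
  "r \<odot>\<^bsub>free_module R X\<^esub> f = (\<lambda>x. r \<otimes> f x)"
  by (simp_all add: free_module_def)

lemma fm_closed: "f \<in> fm X \<Longrightarrow> f x \<in> carrier R"
  by (cases "x \<in> X") (auto simp: fm_iff)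

lemma fm_outside: "f \<in> fm X \<Longrightarrow> x \<notin> X \<Longrightarrow> f x = \<zero>"
  by (auto simp: fm_iff)

lemma fm_add: assumes "f \<in> fm X" "g \<in> fm X" shows "(\<lambda>x. f x \<oplus> g x) \<in> fm X"
proof -
  have "{x\<in>X. f x \<oplus> g x \<noteq> \<zero>} \<subseteq> {x\<in>X. f x \<noteq> \<zero>} \<union> {x\<in>X. g x \<noteq> \<zero>}" by auto
  then show ?thesis using assms by (auto simp: fm_iff intro: finite_subset)
qed

lemma fm_smult: assumes "r \<in> carrier R" "f \<in> fm X" shows "(\<lambda>x. r \<otimes> f x) \<in> fm X"
proof -
  have "{x\<in>X. r \<otimes> f x \<noteq> \<zero>} \<subseteq> {x\<in>X. f x \<noteq> \<zero>}" using assms by auto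
  then show ?thesis using assms by (auto simp: fm_iff intro: finite_subset)
qed

lemma fm_mono: assumes "Z \<subseteq> X" "f \<in> fm Z" shows "f \<in> fm X"
proof -
  have "{x\<in>X. f x \<noteq> \<zero>} = {x\<in>Z. f x \<noteq> \<zero>}" using assms by (auto simp: fm_iff)
  then show ?thesis using assms by (auto simp: fm_iff)
qed

lemma fm_finite: "finite X \<Longrightarrow> f \<in> fm X \<longleftrightarrow> (\<forall>x\<in>X. f x \<in> carrier R) \<and> (\<forall>x. x \<notin> X \<longrightarrow> f x = \<zero>)"
  by (auto simp: fm_iff)

lemma fm_restrict: assumes "f \<in> fm X" "Z \<subseteq> X" shows "(\<lambda>x. if x \<in> Z then f x else \<zero>) \<in> fm Z"
proof -
  have "{x\<in>Z. f x \<noteq> \<zero>} \<subseteq> {x\<in>X. f x \<noteq> \<zero>}" using assms by auto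
  moreover have "{x\<in>Z. (if x \<in> Z then f x else \<zero>) \<noteq> \<zero>} = {x\<in>Z. f x \<noteq> \<zero>}" by auto
  ultimately show ?thesis using assms by (auto simp: fm_iff intro: finite_subset)
qed

lemma fm_split:
  assumes "f \<in> fm X" "Z \<subseteq> X"
  obtains g h where "g \<in> fm Z" "h \<in> fm (X - Z)" "f = (\<lambda>x. g x \<oplus> h x)"
proof
  show "(\<lambda>x. if x \<in> Z then f x else \<zero>) \<in> fm Z" "(\<lambda>x. if x \<in> X - Z then f x else \<zero>) \<in> fm (X - Z)"
    using fm_restrict[OF assms] fm_restrict[OF assms(1), of "X - Z"] by auto
  show "f = (\<lambda>x. (if x \<in> Z then f x else \<zero>) \<oplus> (if x \<in> X - Z then f x else \<zero>))"
    using assms fm_closed[OF assms(1)] by (auto simp: fm_iff fun_eq_iff)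
qed

lemma basis_vec_fm: "x \<in> X \<Longrightarrow> basis_vec R x \<in> fm X"
  by (auto simp: fm_iff basis_vec_def)

abbreviation Aut :: "'x set \<Rightarrow> (('x \<Rightarrow> 'a) \<Rightarrow> 'x \<Rightarrow> 'a) monoid" where
  "Aut X \<equiv> module_Aut R (free_module R X)"

lemma Aut_iff: "A \<in> carrier (Aut X) \<longleftrightarrow> A \<in> Bij (fm X) \<and>
   (\<forall>u\<in>fm X. \<forall>v\<in>fm X. A (\<lambda>x. u x \<oplus> v x) = (\<lambda>x. A u x \<oplus> A v x)) \<and>
   (\<forall>r\<in>carrier R. \<forall>v\<in>fm X. A (\<lambda>x. r \<otimes> v x) = (\<lambda>x. r \<otimes> A v x))"
  by (simp add: module_Aut_simps)

lemma group_Aut: "group (Aut X)"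
  by (rule group_module_Aut) (auto simp: fm_add fm_smult)

lemma Aut_one: "\<one>\<^bsub>Aut X\<^esub> = (\<lambda>f\<in>fm X. f)"
  by (simp add: module_Aut_simps)

lemma Aut_mult: "A \<in> carrier (Aut X) \<Longrightarrow> B \<in> carrier (Aut X) \<Longrightarrow> A \<otimes>\<^bsub>Aut X\<^esub> B = compose (fm X) A B"
  by (simp add: module_Aut_simps)

lemma Aut_fm: "A \<in> carrier (Aut X) \<Longrightarrow> f \<in> fm X \<Longrightarrow> A f \<in> fm X"
  by (auto simp: Aut_iff dest!: Bij_imp_funcset)

lemma Aut_ext: "A \<in> carrier (Aut X) \<Longrightarrow> B \<in> carrier (Aut X) \<Longrightarrow> (\<And>f. f \<in> fm X \<Longrightarrow> A f = B f) \<Longrightarrow> A = B"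
  by (rule Bij_ext[of _ "fm X"]) (auto simp: Aut_iff)

lemma Aut_add: "A \<in> carrier (Aut X) \<Longrightarrow> u \<in> fm X \<Longrightarrow> v \<in> fm X \<Longrightarrow> A (\<lambda>x. u x \<oplus> v x) = (\<lambda>x. A u x \<oplus> A v x)"
  by (simp add: Aut_iff)

lemma Aut_smult: "A \<in> carrier (Aut X) \<Longrightarrow> r \<in> carrier R \<Longrightarrow> v \<in> fm X \<Longrightarrow> A (\<lambda>x. r \<otimes> v x) = (\<lambda>x. r \<otimes> A v x)"
  by (simp add: Aut_iff)

lemma zero_fm: "(\<lambda>x. \<zero>) \<in> fm X" by (simp add: fm_iff)

lemma Aut_zero: assumes "A \<in> carrier (Aut X)" shows "A (\<lambda>x. \<zero>) = (\<lambda>x. \<zero>)"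
proof -
  have "A (\<lambda>x. \<zero> \<otimes> \<zero>) = (\<lambda>x. \<zero> \<otimes> A (\<lambda>x. \<zero>) x)" using Aut_smult[OF assms zero_closed zero_fm] .
  then show ?thesis using Aut_fm[OF assms zero_fm] fm_closed by fastforce
qed

lemma Aut_inv_apply:
  assumes "A \<in> carrier (Aut X)" "f \<in> fm X"
  shows "A ((inv\<^bsub>Aut X\<^esub> A) f) = f" "(inv\<^bsub>Aut X\<^esub> A) (A f) = f"
proof -
  interpret G: group "Aut X" by (rule group_Aut)
  have i: "inv\<^bsub>Aut X\<^esub> A \<in> carrier (Aut X)" using assms by simp
  have "compose (fm X) A (inv\<^bsub>Aut X\<^esub> A) f = f" "compose (fm X) (inv\<^bsub>Aut X\<^esub> A) A f = f"
    using G.r_inv[OF assms(1)] G.l_inv[OF assms(1)] assms i by (simp_all add: Aut_mult Aut_one)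
  then show "A ((inv\<^bsub>Aut X\<^esub> A) f) = f" "(inv\<^bsub>Aut X\<^esub> A) (A f) = f" using assms(2) by (simp_all add: compose_eq)
qed

lemma AutI_inverse:
  assumes "A \<in> extensional (fm X)" "\<And>f. f \<in> fm X \<Longrightarrow> A f \<in> fm X" "\<And>f. f \<in> fm X \<Longrightarrow> B f \<in> fm X"
    "\<And>f. f \<in> fm X \<Longrightarrow> A (B f) = f" "\<And>f. f \<in> fm X \<Longrightarrow> B (A f) = f"
    "\<And>u v. u \<in> fm X \<Longrightarrow> v \<in> fm X \<Longrightarrow> A (\<lambda>x. u x \<oplus> v x) = (\<lambda>x. A u x \<oplus> A v x)"
    "\<And>r v. r \<in> carrier R \<Longrightarrow> v \<in> fm X \<Longrightarrow> A (\<lambda>x. r \<otimes> v x) = (\<lambda>x. r \<otimes> A v x)"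
  shows "A \<in> carrier (Aut X)"
proof -
  have "bij_betw A (fm X) (fm X)" by (rule bij_betw_byWitness[where f' = B]) (use assms in auto)
  then show ?thesis using assms unfolding Aut_iff Bij_def by blast
qed

text \<open>Asks for all of \<open>fm (X - Z)\<close> to be fixed instead of its basis vectors, so
  that \<open>A\<close> acts on a sum with parts in \<open>fm Z\<close> and
  \<open>fm (X - Z)\<close> through the first part only. \<open>carrier_GL_f\<close> shows that
  nothing changes.\<close>

definition supported :: "'x set \<Rightarrow> (('x \<Rightarrow> 'a) \<Rightarrow> 'x \<Rightarrow> 'a) \<Rightarrow> 'x set \<Rightarrow> bool" where
  "supported X A Z \<longleftrightarrow> A \<in> carrier (Aut X) \<and> Z \<subseteq> X \<and> A ` fm Z = fm Z \<and> (\<forall>f\<in>fm (X - Z). A f = f)"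

text \<open>Vectors have finite support, so one coordinate at a time can be split off; linearity and
  the hypothesis on basis vectors handle the coordinate.\<close>

lemma Aut_fix_fm:
  assumes A: "A \<in> carrier (Aut X)" and Y: "Y \<subseteq> X" and fixb: "\<And>x. x \<in> Y \<Longrightarrow> A (basis_vec R x) = basis_vec R x"
    and f: "f \<in> fm Y"
  shows "A f = f"
proof -
  have "\<forall>f\<in>fm Y. {x\<in>Y. f x \<noteq> \<zero>} \<subseteq> T \<longrightarrow> A f = f" if "finite T" for T
    using that
  proof (induction T rule: finite_induct)
    case empty
    show ?case
    proof (intro ballI impI)
      fix f assume "f \<in> fm Y" "{x\<in>Y. f x \<noteq> \<zero>} \<subseteq> {}"
      then have "f = (\<lambda>x. \<zero>)" by (auto simp: fm_iff fun_eq_iff)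
      then show "A f = f" using Aut_zero[OF A] by simp
    qed
  next
    case (insert y T)
    show ?case
    proof (intro ballI impI)
      fix f assume f: "f \<in> fm Y" "{x\<in>Y. f x \<noteq> \<zero>} \<subseteq> insert y T"
      show "A f = f"
      proof (cases "y \<in> Y")
        case False
        then have "{x\<in>Y. f x \<noteq> \<zero>} \<subseteq> T" using f(2) by auto
        then show ?thesis using insert.IH f by blast
      next
        case True
        define g where "g = (\<lambda>x. if x \<in> Y - {y} then f x else \<zero>)"
        have g: "g \<in> fm Y" using fm_mono[OF _ fm_restrict[OF f(1), of "Y - {y}"], of Y] by (auto simp: g_def)
        have "{x\<in>Y. g x \<noteq> \<zero>} \<subseteq> T" using f(2) by (auto simp: g_def)
        then have Ag: "A g = g" using insert.IH g by blast
        have fy: "f y \<in> carrier R" using fm_closed[OF f(1)] .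
        have b: "basis_vec R y \<in> fm X" using basis_vec_fm True Y by (metis subsetD)
        define k where "k = (\<lambda>x. g x \<oplus> (\<lambda>x. f y \<otimes> basis_vec R y x) x)"
        have fe: "f = k"
          using f fy fm_closed[OF f(1)] by (auto simp: k_def g_def basis_vec_def fun_eq_iff fm_iff)
        have "A f = A k" using fe by (rule arg_cong)
        also have "\<dots> = (\<lambda>x. A g x \<oplus> A (\<lambda>x. f y \<otimes> basis_vec R y x) x)"
          unfolding k_def by (rule Aut_add[OF A fm_mono[OF Y g] fm_smult[OF fy b]])
        also have "\<dots> = k" by (simp add: k_def Ag Aut_smult[OF A fy b] fixb[OF True])
        also have "\<dots> = f" using fe ..
        finally show ?thesis .
      qed
    qed
  qed
  then show ?thesis using f by (auto simp: fm_iff)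
qed

lemma carrier_GL_f: "carrier (GL_f X R) = {A. \<exists>Z. finite Z \<and> supported X A Z}"
proof -
  have "(\<forall>x\<in>X - Z. A (basis_vec R x) = basis_vec R x) \<longleftrightarrow> (\<forall>f\<in>fm (X - Z). A f = f)"
    if "A \<in> carrier (Aut X)" for A Z
    using Aut_fix_fm[OF that, of "X - Z"] basis_vec_fm[of _ "X - Z"] by blast
  then show ?thesis by (auto simp: GL_f_def supported_def)
qed

lemma supportedD:
  assumes "supported X A Z"
  shows "A \<in> carrier (Aut X)" "Z \<subseteq> X" "\<And>f. f \<in> fm Z \<Longrightarrow> A f \<in> fm Z" "\<And>f. f \<in> fm Z \<Longrightarrow> \<exists>g\<in>fm Z. f = A g"
    "\<And>f. f \<in> fm (X - Z) \<Longrightarrow> A f = f" "\<And>f. f \<in> fm Z \<Longrightarrow> f \<in> fm X" "\<And>f. f \<in> fm (X - Z) \<Longrightarrow> f \<in> fm X"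
  using assms fm_mono[of Z X] fm_mono[of "X - Z" X] unfolding supported_def by blast+

lemma supportedI:
  assumes "A \<in> carrier (Aut X)" "Z \<subseteq> X" "\<And>f. f \<in> fm Z \<Longrightarrow> A f \<in> fm Z" "\<And>f. f \<in> fm Z \<Longrightarrow> \<exists>g\<in>fm Z. f = A g"
    "\<And>f. f \<in> fm (X - Z) \<Longrightarrow> A f = f"
  shows "supported X A Z"
  unfolding supported_def using assms by blast

lemma supported_split:
  assumes "supported X A Z" "g \<in> fm Z" "h \<in> fm (X - Z)"
  shows "A (\<lambda>x. g x \<oplus> h x) = (\<lambda>x. A g x \<oplus> h x)"
  using Aut_add[OF supportedD(1)[OF assms(1)] supportedD(6)[OF assms(1,2)] supportedD(7)[OF assms(1,3)]]
    supportedD(5)[OF assms(1,3)] by simp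

text \<open>On \<open>fm Z'\<close> the map is \<open>A\<close> on the part in \<open>fm Z\<close>
  and the identity on the rest. It provides common supports for finitely many automorphisms.\<close>

lemma supported_mono:
  assumes s: "supported X A Z" and Z: "Z \<subseteq> Z'" "Z' \<subseteq> X" shows "supported X A Z'"
proof (rule supportedI[OF supportedD(1)[OF s] Z(2)])
  have c: "(\<lambda>x. g x \<oplus> h x) \<in> fm Z'" "h \<in> fm (X - Z)" if "g \<in> fm Z" "h \<in> fm (Z' - Z)" for g h
    using that fm_mono[of Z Z' g] fm_mono[of "Z' - Z" Z' h] fm_mono[of "Z' - Z" "X - Z" h] Z fm_add by blast+
  fix f assume f: "f \<in> fm Z'"
  obtain g h where gh: "g \<in> fm Z" "h \<in> fm (Z' - Z)" "f = (\<lambda>x. g x \<oplus> h x)" using fm_split[OF f Z(1)] .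
  show "A f \<in> fm Z'"
    unfolding gh(3) supported_split[OF s gh(1) c(2)[OF gh(1,2)]]
      by (rule c(1)[OF supportedD(3)[OF s gh(1)] gh(2)])
  obtain g' where g': "g' \<in> fm Z" "g = A g'" using supportedD(4)[OF s gh(1)] by blast
  have "f = A (\<lambda>x. g' x \<oplus> h x)"
    unfolding gh(3) supported_split[OF s g'(1) c(2)[OF gh(1,2)]] g'(2) ..
  then show "\<exists>g\<in>fm Z'. f = A g" using c(1)[OF g'(1) gh(2)] by blast
next
  fix f assume "f \<in> fm (X - Z')"
  then show "A f = f" using supportedD(5)[OF s] fm_mono[of "X - Z'" "X - Z" f] Z by blast
qed

lemma supported_one: assumes "Z \<subseteq> X" shows "supported X \<one>\<^bsub>Aut X\<^esub> Z"
proof (rule supportedI[OF monoid.one_closed[OF group.is_monoid[OF group_Aut]] assms])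
  have o: "\<one>\<^bsub>Aut X\<^esub> f = f" if "f \<in> fm X" for f using that by (simp add: Aut_one)
  fix f assume "f \<in> fm Z"
  then show "\<one>\<^bsub>Aut X\<^esub> f \<in> fm Z" "\<exists>g\<in>fm Z. f = \<one>\<^bsub>Aut X\<^esub> g" using o fm_mono[OF assms] by auto
next
  fix f assume "f \<in> fm (X - Z)"
  then show "\<one>\<^bsub>Aut X\<^esub> f = f" using fm_mono[of "X - Z" X f] by (simp add: Aut_one)
qed

lemma Aut_mult_apply: "A \<in> carrier (Aut X) \<Longrightarrow> B \<in> carrier (Aut X) \<Longrightarrow> f \<in> fm X \<Longrightarrow> (A \<otimes>\<^bsub>Aut X\<^esub> B) f = A (B f)"
  by (simp add: Aut_mult compose_eq)

lemma supported_mult: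
  assumes A: "supported X A Z" and B: "supported X B Z" shows "supported X (A \<otimes>\<^bsub>Aut X\<^esub> B) Z"
proof -
  interpret G: group "Aut X" by (rule group_Aut)
  note m = Aut_mult_apply[OF supportedD(1)[OF A] supportedD(1)[OF B]]
  show ?thesis
  proof (rule supportedI)
    show "A \<otimes>\<^bsub>Aut X\<^esub> B \<in> carrier (Aut X)" using A B by (simp add: supportedD(1))
    show "Z \<subseteq> X" using supportedD(2)[OF A] .
    fix f assume f: "f \<in> fm Z"
    show "(A \<otimes>\<^bsub>Aut X\<^esub> B) f \<in> fm Z"
      using m[OF supportedD(6)[OF A f]] supportedD(3)[OF A supportedD(3)[OF B f]] by simp
    show "\<exists>g\<in>fm Z. f = (A \<otimes>\<^bsub>Aut X\<^esub> B) g"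
      using supportedD(4)[OF A f] supportedD(4)[OF B] supportedD(6)[OF B] m by metis
  next
    fix f assume f: "f \<in> fm (X - Z)"
    show "(A \<otimes>\<^bsub>Aut X\<^esub> B) f = f"
      using m[OF supportedD(7)[OF A f]] supportedD(5)[OF A f] supportedD(5)[OF B f] by simp
  qed
qed

lemma supported_inv:
  assumes A: "supported X A Z" shows "supported X (inv\<^bsub>Aut X\<^esub> A) Z"
proof -
  interpret G: group "Aut X" by (rule group_Aut)
  note i = Aut_inv_apply[OF supportedD(1)[OF A]]
  show ?thesis
  proof (rule supportedI)
    show "inv\<^bsub>Aut X\<^esub> A \<in> carrier (Aut X)" using supportedD(1)[OF A] by simp
    show "Z \<subseteq> X" using supportedD(2)[OF A] .
    fix f assume f: "f \<in> fm Z"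
    obtain g where g: "g \<in> fm Z" "f = A g" using supportedD(4)[OF A f] by blast
    show "(inv\<^bsub>Aut X\<^esub> A) f \<in> fm Z" using g i(2)[OF supportedD(6)[OF A g(1)]] by simp
    show "\<exists>g\<in>fm Z. f = (inv\<^bsub>Aut X\<^esub> A) g"
      using i(2)[OF supportedD(6)[OF A f]] supportedD(3)[OF A f] by metis
  next
    fix f assume f: "f \<in> fm (X - Z)"
    show "(inv\<^bsub>Aut X\<^esub> A) f = f"
      using i(2)[OF supportedD(7)[OF A f]] supportedD(5)[OF A f] by simp
  qed
qed

lemma subgroup_GL_f: "subgroup (carrier (GL_f X R)) (Aut X)"
proof -
  interpret G: group "Aut X" by (rule group_Aut)
  show ?thesis
  proof (rule G.subgroupI)
    show "carrier (GL_f X R) \<subseteq> carrier (Aut X)" by (auto simp: carrier_GL_f supported_def)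
    show "carrier (GL_f X R) \<noteq> {}" using supported_one[of "{}" X] unfolding carrier_GL_f by blast
    fix A assume "A \<in> carrier (GL_f X R)"
    then show "inv\<^bsub>Aut X\<^esub> A \<in> carrier (GL_f X R)" using supported_inv unfolding carrier_GL_f by blast
  next
    fix A B assume "A \<in> carrier (GL_f X R)" "B \<in> carrier (GL_f X R)"
    then obtain Y Z where "finite Y" "supported X A Y" "finite Z" "supported X B Z"
      by (auto simp: carrier_GL_f)
    moreover from this have "Y \<union> Z \<subseteq> X" using supportedD(2) by blast
    ultimately have "finite (Y \<union> Z)" "supported X A (Y \<union> Z)" "supported X B (Y \<union> Z)"
      using supported_mono[OF _ Un_upper1] supported_mono[OF _ Un_upper2] by blast+
    then show "A \<otimes>\<^bsub>Aut X\<^esub> B \<in> carrier (GL_f X R)" using supported_mult unfolding carrier_GL_f by blast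
  qed
qed

lemma GL_f_eq: "GL_f X R = Aut X \<lparr>carrier := carrier (GL_f X R)\<rparr>"
  by (simp add: GL_f_def)

lemma group_GL_f: "group (GL_f X R)"
  using subgroup.subgroup_is_group[OF subgroup_GL_f group_Aut] GL_f_eq by metis

lemma GL_f_simps: "\<one>\<^bsub>GL_f X R\<^esub> = \<one>\<^bsub>Aut X\<^esub>" "(\<otimes>\<^bsub>GL_f X R\<^esub>) = (\<otimes>\<^bsub>Aut X\<^esub>)"
  by (simp_all add: GL_f_def)

end

section \<open>Semidirect products\<close>

lemma group_semidirect:
  assumes "group N" "group \<Gamma>" and hom: "\<And>g. g \<in> carrier \<Gamma> \<Longrightarrow> \<theta> g \<in> hom N N"
    and comp: "\<And>g h a. g \<in> carrier \<Gamma> \<Longrightarrow> h \<in> carrier \<Gamma> \<Longrightarrow> a \<in> carrier N \<Longrightarrow> \<theta> (g \<otimes>\<^bsub>\<Gamma>\<^esub> h) a = \<theta> g (\<theta> h a)"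
    and one: "\<And>a. a \<in> carrier N \<Longrightarrow> \<theta> \<one>\<^bsub>\<Gamma>\<^esub> a = a"
  shows "group (semidirect N \<Gamma> \<theta>)"
proof -
  interpret N: group N by fact
  interpret G: group \<Gamma> by fact
  have cl: "\<theta> g a \<in> carrier N" if "g \<in> carrier \<Gamma>" "a \<in> carrier N" for g a using hom_in_carrier[OF hom] that
    by blast
  have hm: "\<theta> g (a \<otimes>\<^bsub>N\<^esub> b) = \<theta> g a \<otimes>\<^bsub>N\<^esub> \<theta> g b" if "g \<in> carrier \<Gamma>" "a \<in> carrier N" "b \<in> carrier N" for g a b
    using hom_mult[OF hom] that by blast
  show ?thesis
  proof (rule groupI)
    fix x assume "x \<in> carrier (semidirect N \<Gamma> \<theta>)"
    then obtain a g where x: "x = (a, g)" "a \<in> carrier N" "g \<in> carrier \<Gamma>" by (auto simp: semidirect_def)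
    let ?y = "(\<theta> (inv\<^bsub>\<Gamma>\<^esub> g) (inv\<^bsub>N\<^esub> a), inv\<^bsub>\<Gamma>\<^esub> g)"
    have "\<theta> (inv\<^bsub>\<Gamma>\<^esub> g) (inv\<^bsub>N\<^esub> a) \<otimes>\<^bsub>N\<^esub> \<theta> (inv\<^bsub>\<Gamma>\<^esub> g) a = \<theta> (inv\<^bsub>\<Gamma>\<^esub> g) \<one>\<^bsub>N\<^esub>"
      using x by (simp flip: hm)
    also have "\<dots> = \<one>\<^bsub>N\<^esub>" using hom_one[OF hom assms(1) assms(1)] x by simp
    finally show "\<exists>y\<in>carrier (semidirect N \<Gamma> \<theta>). y \<otimes>\<^bsub>semidirect N \<Gamma> \<theta>\<^esub> x = \<one>\<^bsub>semidirect N \<Gamma> \<theta>\<^esub>"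
      using x cl by (intro bexI[of _ ?y]) (auto simp: semidirect_def)
  next
    fix x y z assume "x \<in> carrier (semidirect N \<Gamma> \<theta>)" "y \<in> carrier (semidirect N \<Gamma> \<theta>)"
      "z \<in> carrier (semidirect N \<Gamma> \<theta>)"
    then show "x \<otimes>\<^bsub>semidirect N \<Gamma> \<theta>\<^esub> y \<otimes>\<^bsub>semidirect N \<Gamma> \<theta>\<^esub> z =
      x \<otimes>\<^bsub>semidirect N \<Gamma> \<theta>\<^esub> (y \<otimes>\<^bsub>semidirect N \<Gamma> \<theta>\<^esub> z)"
      by (auto simp: semidirect_def N.m_assoc G.m_assoc cl hm comp)
  qed (auto simp: semidirect_def cl one)
qed

section \<open>Transport of automorphisms along an injection\<close>

context cring begin

text \<open>The automorphism \<open>A\<close> of \<open>R[Z]\<close>, transported along the injection \<open>p\<close> and extended by the identity to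
  \<open>R[B]\<close>; the values of \<open>p\<close> outside \<open>Z\<close> are irrelevant.\<close>

definition lift :: "'x set \<Rightarrow> 'p set \<Rightarrow> ('x \<Rightarrow> 'p) \<Rightarrow> (('x \<Rightarrow> 'a) \<Rightarrow> 'x \<Rightarrow> 'a) \<Rightarrow> ('p \<Rightarrow> 'a) \<Rightarrow> 'p \<Rightarrow> 'a" where
  "lift Z B p A = (\<lambda>f\<in>fm B. \<lambda>b. if b \<in> p ` Z then A (\<lambda>x. if x \<in> Z then f (p x) else \<zero>) (inv_into Z p b) else
    f b)"

definition pull :: "'x set \<Rightarrow> ('x \<Rightarrow> 'p) \<Rightarrow> ('p \<Rightarrow> 'a) \<Rightarrow> 'x \<Rightarrow> 'a" where
  "pull Z p f = (\<lambda>x. if x \<in> Z then f (p x) else \<zero>)"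

context
  fixes X Z :: "'x set" and B :: "'p set" and p :: "'x \<Rightarrow> 'p"
  assumes fin: "finite Z" "finite B" and p: "inj_on p Z" "p ` Z \<subseteq> B"
begin

lemma pull_fm: "f \<in> fm B \<Longrightarrow> pull Z p f \<in> fm Z"
  using p(2) fin by (auto simp: fm_finite pull_def)

lemma lift_inside: "f \<in> fm B \<Longrightarrow> x \<in> Z \<Longrightarrow> lift Z B p A f (p x) = A (pull Z p f) x"
  using p(1) by (simp add: lift_def pull_def)

lemma lift_outside: "f \<in> fm B \<Longrightarrow> b \<notin> p ` Z \<Longrightarrow> lift Z B p A f b = f b"
  by (simp add: lift_def)

lemma lift_eqI:
  assumes "f \<in> fm B" "\<And>x. x \<in> Z \<Longrightarrow> g (p x) = A (pull Z p f) x" "\<And>b. b \<notin> p ` Z \<Longrightarrow> g b = f b"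
  shows "lift Z B p A f = g"
proof
  fix b show "lift Z B p A f b = g b"
    using lift_inside[OF assms(1)] lift_outside[OF assms(1)] assms(2,3) by (cases "b \<in> p ` Z") auto
qed

lemma lift_fm:
  assumes A: "supported X A Z" and f: "f \<in> fm B" shows "lift Z B p A f \<in> fm B"
proof -
  have "A (pull Z p f) \<in> fm Z" using supportedD(3)[OF A pull_fm[OF f]] .
  then have "lift Z B p A f (p x) \<in> carrier R" if "x \<in> Z" for x
    using lift_inside[OF f that, of A] fm_closed by simp
  then have 1: "lift Z B p A f b \<in> carrier R" if "b \<in> p ` Z" for b using that by blast
  have 2: "lift Z B p A f b = f b" if "b \<notin> p ` Z" for b using lift_outside[OF f that] .
  have "lift Z B p A f b \<in> carrier R" for b
    using 1 2 fm_closed[OF f] by (cases "b \<in> p ` Z") auto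
  moreover have "lift Z B p A f b = \<zero>" if "b \<notin> B" for b
    using 2[of b] fm_outside[OF f that] p(2) that by (metis subsetD)
  ultimately show ?thesis using fin by (simp add: fm_finite)
qed

text \<open>\<open>pull\<close> intertwines the transported automorphism with the original one;
  multiplicativity of the transport rests on this.\<close>

lemma pull_lift:
  assumes A: "supported X A Z" and f: "f \<in> fm B" shows "pull Z p (lift Z B p A f) = A (pull Z p f)"
proof
  fix x show "pull Z p (lift Z B p A f) x = A (pull Z p f) x"
    using lift_inside[OF f] fm_outside[OF supportedD(3)[OF A pull_fm[OF f]]]
      by (cases "x \<in> Z") (simp_all add: pull_def)
qed

lemma lift_comp:
  assumes A: "supported X A Z" and C: "supported X C Z" and f: "f \<in> fm B"
  shows "lift Z B p (A \<otimes>\<^bsub>Aut X\<^esub> C) f = lift Z B p A (lift Z B p C f)"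
proof (rule lift_eqI[OF f])
  fix x assume x: "x \<in> Z"
  show "lift Z B p A (lift Z B p C f) (p x) = (A \<otimes>\<^bsub>Aut X\<^esub> C) (pull Z p f) x"
    unfolding lift_inside[OF lift_fm[OF C f] x] pull_lift[OF C f]
    using Aut_mult_apply[OF supportedD(1)[OF A] supportedD(1)[OF C] supportedD(6)[OF C pull_fm[OF f]]] by simp
next
  fix b assume b: "b \<notin> p ` Z"
  show "lift Z B p A (lift Z B p C f) b = f b"
    using lift_outside[OF lift_fm[OF C f] b] lift_outside[OF f b] by simp
qed

lemma lift_one_apply:
  assumes Z: "Z \<subseteq> X" and f: "f \<in> fm B" shows "lift Z B p \<one>\<^bsub>Aut X\<^esub> f = f"
proof (rule lift_eqI[OF f])
  fix x assume x: "x \<in> Z"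
  show "f (p x) = \<one>\<^bsub>Aut X\<^esub> (pull Z p f) x"
    using fm_mono[OF Z pull_fm[OF f]] x by (simp add: Aut_one) (simp add: pull_def)
qed simp

lemma lift_Aut:
  assumes A: "supported X A Z" shows "lift Z B p A \<in> carrier (Aut B)"
proof (rule AutI_inverse)
  interpret G: group "Aut X" by (rule group_Aut)
  let ?I = "lift Z B p (inv\<^bsub>Aut X\<^esub> A)"
  note I = supported_inv[OF A]
  show "lift Z B p A \<in> extensional (fm B)" by (simp add: lift_def)
  fix f assume f: "f \<in> fm B"
  show "lift Z B p A f \<in> fm B" by (rule lift_fm[OF A f])
  show "?I f \<in> fm B" by (rule lift_fm[OF I f])
  show "lift Z B p A (?I f) = f" "?I (lift Z B p A f) = f"
    using lift_comp[OF A I f] lift_comp[OF I A f] lift_one_apply[OF supportedD(2)[OF A] f]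
      supportedD(1)[OF A] by simp_all
next
  fix u v assume u: "u \<in> fm B" and v: "v \<in> fm B"
  have pl: "pull Z p (\<lambda>x. u x \<oplus> v x) = (\<lambda>x. pull Z p u x \<oplus> pull Z p v x)" by (auto simp: pull_def)
  show "lift Z B p A (\<lambda>x. u x \<oplus> v x) = (\<lambda>x. lift Z B p A u x \<oplus> lift Z B p A v x)"
    by (rule lift_eqI[OF fm_add[OF u v]])
      (simp_all add: pl lift_inside lift_outside u v Aut_add[OF supportedD(1)[OF A]
        supportedD(6)[OF A pull_fm[OF u]] supportedD(6)[OF A pull_fm[OF v]]])
next
  fix r v assume r: "r \<in> carrier R" and v: "v \<in> fm B"
  have pl: "pull Z p (\<lambda>x. r \<otimes> v x) = (\<lambda>x. r \<otimes> pull Z p v x)" using r by (auto simp: pull_def)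
  show "lift Z B p A (\<lambda>x. r \<otimes> v x) = (\<lambda>x. r \<otimes> lift Z B p A v x)"
    by (rule lift_eqI[OF fm_smult[OF r v]])
      (simp_all add: pl lift_inside lift_outside v Aut_smult[OF supportedD(1)[OF A] r
        supportedD(6)[OF A pull_fm[OF v]]])
qed

lemma lift_mult:
  assumes A: "supported X A Z" and C: "supported X C Z"
  shows "lift Z B p (A \<otimes>\<^bsub>Aut X\<^esub> C) = lift Z B p A \<otimes>\<^bsub>Aut B\<^esub> lift Z B p C"
proof (rule Aut_ext)
  interpret G: group "Aut B" by (rule group_Aut)
  show "lift Z B p (A \<otimes>\<^bsub>Aut X\<^esub> C) \<in> carrier (Aut B)" using lift_Aut supported_mult[OF A C] .
  show "lift Z B p A \<otimes>\<^bsub>Aut B\<^esub> lift Z B p C \<in> carrier (Aut B)" using lift_Aut A C by simp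
  fix f assume "f \<in> fm B"
  then show "lift Z B p (A \<otimes>\<^bsub>Aut X\<^esub> C) f = (lift Z B p A \<otimes>\<^bsub>Aut B\<^esub> lift Z B p C) f"
    using lift_comp[OF A C] Aut_mult_apply[OF lift_Aut[OF A] lift_Aut[OF C]] by simp
qed

lemma lift_one: "Z \<subseteq> X \<Longrightarrow> lift Z B p \<one>\<^bsub>Aut X\<^esub> = \<one>\<^bsub>Aut B\<^esub>"
  by (rule Aut_ext[OF lift_Aut[OF supported_one] monoid.one_closed[OF group.is_monoid[OF group_Aut]]])
    (simp_all add: lift_one_apply, simp add: Aut_one)

text \<open>Transport is faithful, which the separation of elements \<open>(a, 1)\<close> needs: by
  injectivity of \<open>p\<close> every vector of \<open>fm Z\<close> is the \<open>pull\<close> of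
  one in \<open>fm B\<close>, so \<open>A\<close> fixes \<open>fm Z\<close>, and it fixes the rest
  by its support.\<close>

lemma lift_eq_one:
  assumes A: "supported X A Z" and 1: "lift Z B p A = \<one>\<^bsub>Aut B\<^esub>" shows "A = \<one>\<^bsub>Aut X\<^esub>"
proof (rule Aut_ext[OF supportedD(1)[OF A] monoid.one_closed[OF group.is_monoid[OF group_Aut]]])
  fix f assume f: "f \<in> fm X"
  obtain g h where gh: "g \<in> fm Z" "h \<in> fm (X - Z)" "f = (\<lambda>x. g x \<oplus> h x)"
    using fm_split[OF f supportedD(2)[OF A]] .
  define f' where "f' b = (if b \<in> p ` Z then g (inv_into Z p b) else \<zero>)" for b
  have f': "f' \<in> fm B" using gh(1) p(2) fin fm_closed[OF gh(1)] by (auto simp: fm_finite f'_def)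
  have pf: "pull Z p f' = g" using p(1) fm_outside[OF gh(1)] by (auto simp: pull_def f'_def fun_eq_iff)
  have "A g = g"
  proof
    fix x show "A g x = g x"
    proof (cases "x \<in> Z")
      case True
      have "A g x = lift Z B p A f' (p x)" using lift_inside[OF f' True, of A] pf by simp
      also have "\<dots> = f' (p x)" using 1 f' by (simp add: Aut_one)
      also have "\<dots> = pull Z p f' x" using True by (simp add: pull_def)
      finally show ?thesis using pf by simp
    next
      case False then show ?thesis using fm_outside[OF gh(1)] fm_outside[OF supportedD(3)[OF A gh(1)]] by simp
    qed
  qed
  then have "A f = f" unfolding gh(3) supported_split[OF A gh(1,2)] by simp
  then show "A f = \<one>\<^bsub>Aut X\<^esub> f" using f by (simp add: Aut_one)
qed

text \<open>The elements of \<open>F\<close> and the conjugates \<open>\<theta> g b\<close> have to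
  be transported from one common set, whereas the effect of conjugation is computed on the smaller
  support of \<open>b\<close>.\<close>

lemma lift_enlarge:
  assumes A: "supported X A Y" and Y: "Y \<subseteq> Z" and Z: "Z \<subseteq> X"
  shows "lift Z B p A = lift Y B p A"
proof -
  have "lift Z B p A f = lift Y B p A f" if f: "f \<in> fm B" for f
  proof (rule lift_eqI[OF f])
    have pY: "inj_on p Y" "p ` Y \<subseteq> B" using p Y inj_on_subset by auto
    have g: "pull Y p f \<in> fm Y" using pY(2) fin f finite_subset[OF Y] by (auto simp: fm_finite pull_def)
    have "pull (Z - Y) p f \<in> fm (Z - Y)" using p(2) fin f by (auto simp: fm_finite pull_def)
    then have h: "pull (Z - Y) p f \<in> fm (X - Y)" by (rule fm_mono[rotated]) (use Z in blast)
    have e: "pull Z p f = (\<lambda>x. pull Y p f x \<oplus> pull (Z - Y) p f x)"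
      using Y fm_closed[OF f] by (auto simp: pull_def fun_eq_iff)
    fix x assume x: "x \<in> Z"
    have inY: "p x \<in> p ` Y \<longleftrightarrow> x \<in> Y" using x p(1) Y by (auto simp: inj_on_def)
    have inv: "inv_into Y p (p x) = x" if "x \<in> Y" using pY(1) that by simp
    show "lift Y B p A f (p x) = A (pull Z p f) x"
      unfolding e supported_split[OF A g h]
      using f x inY inv fm_closed[OF supportedD(3)[OF A g], of x] fm_outside[OF supportedD(3)[OF A g], of x]
        fm_closed[OF f]
      by (cases "x \<in> Y") (simp_all add: lift_def, simp_all add: pull_def)
  next
    fix b assume "b \<notin> p ` Z"
    then show "lift Y B p A f b = f b" using f Y by (auto simp: lift_def)
  qed
  then show ?thesis by (auto simp: lift_def fun_eq_iff restrict_def)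
qed
end

end

section \<open>The action on the free module and the linear enrichment as a group\<close>

locale enrichment = cring R for R :: "('r, 'b) ring_scheme" (structure) +
  fixes \<Gamma> :: "('g, 'a) monoid_scheme" and X :: "'x set" and \<alpha> :: "'g \<Rightarrow> 'x \<Rightarrow> 'x"
  assumes group: "group \<Gamma>" and action: "group_action \<Gamma> X \<alpha>"
begin

sublocale G: group \<Gamma> by (rule group)
sublocale act: group_action \<Gamma> X \<alpha> by (rule action)

abbreviation U :: "'g \<Rightarrow> ('x \<Rightarrow> 'r) \<Rightarrow> 'x \<Rightarrow> 'r" where "U \<equiv> lin_action \<Gamma> X \<alpha> R"
abbreviation \<theta> :: "'g \<Rightarrow> (('x \<Rightarrow> 'r) \<Rightarrow> 'x \<Rightarrow> 'r) \<Rightarrow> ('x \<Rightarrow> 'r) \<Rightarrow> 'x \<Rightarrow> 'r" where "\<theta> \<equiv> conj_action \<Gamma> X \<alpha> R"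

lemma act_closed: "g \<in> carrier \<Gamma> \<Longrightarrow> x \<in> X \<Longrightarrow> \<alpha> g x \<in> X"
  using act.element_image by blast

lemma act_comp: "g \<in> carrier \<Gamma> \<Longrightarrow> h \<in> carrier \<Gamma> \<Longrightarrow> x \<in> X \<Longrightarrow> \<alpha> (g \<otimes>\<^bsub>\<Gamma>\<^esub> h) x = \<alpha> g (\<alpha> h x)"
  using act.composition_rule by blast

lemma act_one: "x \<in> X \<Longrightarrow> \<alpha> \<one>\<^bsub>\<Gamma>\<^esub> x = x"
  using fun_cong[OF act.id_eq_one, of x] by simp

lemma act_inv: "g \<in> carrier \<Gamma> \<Longrightarrow> x \<in> X \<Longrightarrow> \<alpha> (inv\<^bsub>\<Gamma>\<^esub> g) (\<alpha> g x) = x" "g \<in> carrier \<Gamma> \<Longrightarrow> x \<in> X \<Longrightarrow>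
  \<alpha> g (\<alpha> (inv\<^bsub>\<Gamma>\<^esub> g) x) = x"
  by (simp_all flip: act_comp add: act_one)

lemma U_apply: "f \<in> fm X \<Longrightarrow> U g f x = (if x \<in> X then f (\<alpha> (inv\<^bsub>\<Gamma>\<^esub> g) x) else \<zero>)"
  by (simp add: lin_action_def)

lemma U_fm:
  assumes g: "g \<in> carrier \<Gamma>" and Z: "Z \<subseteq> X" and f: "f \<in> fm Z" shows "U g f \<in> fm (\<alpha> g ` Z)"
proof -
  have fX: "f \<in> fm X" by (rule fm_mono[OF Z f])
  have sub: "\<alpha> g ` Z \<subseteq> X" using act_closed[OF g] Z by auto
  have ap: "U g f (\<alpha> g z) = f z" if "z \<in> X" for z using that act_closed[OF g that] act_inv(1)[OF g that]
    by (simp add: U_apply[OF fX])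
  have "{x \<in> \<alpha> g ` Z. U g f x \<noteq> \<zero>} = \<alpha> g ` {z \<in> Z. f z \<noteq> \<zero>}" using ap Z by force
  then have "finite {x \<in> \<alpha> g ` Z. U g f x \<noteq> \<zero>}" using f by (simp add: fm_iff)
  moreover have "U g f x = \<zero>" if "x \<notin> \<alpha> g ` Z" for x
  proof (cases "x \<in> X")
    case True
    then have "\<alpha> (inv\<^bsub>\<Gamma>\<^esub> g) x \<notin> Z" using act_inv(2)[OF g True] that by (metis image_eqI)
    then show ?thesis using fm_outside[OF f] U_apply[OF fX] by simp
  qed (simp add: U_apply[OF fX])
  moreover have "U g f x \<in> carrier R" for x using fm_closed[OF f] by (simp add: U_apply[OF fX])
  ultimately show ?thesis by (simp add: fm_iff)
qed

lemma act_image: "g \<in> carrier \<Gamma> \<Longrightarrow> \<alpha> g ` X = X"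
  using act_closed act_inv(2) by (metis G.inv_closed image_subsetI subsetI subset_antisym image_eqI)

lemma U_fm_X: "g \<in> carrier \<Gamma> \<Longrightarrow> f \<in> fm X \<Longrightarrow> U g f \<in> fm X"
  using U_fm[of g X f] act_image by simp

lemma U_comp:
  assumes "g \<in> carrier \<Gamma>" "h \<in> carrier \<Gamma>" "f \<in> fm X" shows "U g (U h f) = U (g \<otimes>\<^bsub>\<Gamma>\<^esub> h) f"
proof
  fix x show "U g (U h f) x = U (g \<otimes>\<^bsub>\<Gamma>\<^esub> h) f x"
    using act_comp[of "inv\<^bsub>\<Gamma>\<^esub> h" "inv\<^bsub>\<Gamma>\<^esub> g" x] act_closed[of "inv\<^bsub>\<Gamma>\<^esub> g" x] assms
    by (simp add: U_apply[OF U_fm_X[OF assms(2,3)]] U_apply[OF assms(3)] G.inv_mult_group)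
qed

lemma U_one: assumes "f \<in> fm X" shows "U \<one>\<^bsub>\<Gamma>\<^esub> f = f"
proof
  fix x show "U \<one>\<^bsub>\<Gamma>\<^esub> f x = f x" using fm_outside[OF assms, of x] by (auto simp: U_apply[OF assms] act_one)
qed

lemma U_Aut: assumes g: "g \<in> carrier \<Gamma>" shows "U g \<in> carrier (Aut X)"
proof (rule AutI_inverse[where B = "U (inv\<^bsub>\<Gamma>\<^esub> g)"])
  fix u v assume u: "u \<in> fm X" and v: "v \<in> fm X"
  show "U g (\<lambda>x. u x \<oplus> v x) = (\<lambda>x. U g u x \<oplus> U g v x)"
    by (auto simp: U_apply[OF fm_add[OF u v]] U_apply[OF u] U_apply[OF v])
next
  fix r v assume r: "r \<in> carrier R" and v: "v \<in> fm X"
  show "U g (\<lambda>x. r \<otimes> v x) = (\<lambda>x. r \<otimes> U g v x)" using r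
    by (auto simp: U_apply[OF fm_smult[OF r v]] U_apply[OF v])
qed (use g in \<open>simp_all add: U_fm_X U_comp U_one\<close>, simp add: lin_action_def)

lemma U_mult: "g \<in> carrier \<Gamma> \<Longrightarrow> h \<in> carrier \<Gamma> \<Longrightarrow> U g \<otimes>\<^bsub>Aut X\<^esub> U h = U (g \<otimes>\<^bsub>\<Gamma>\<^esub> h)"
  by (rule Aut_ext[OF _ U_Aut]) (simp_all add: U_Aut Aut_mult_apply U_comp
    monoid.m_closed[OF group.is_monoid[OF group_Aut]])

lemma U_one_Aut: "U \<one>\<^bsub>\<Gamma>\<^esub> = \<one>\<^bsub>Aut X\<^esub>"
  by (rule Aut_ext[OF U_Aut monoid.one_closed[OF group.is_monoid[OF group_Aut]]])
    (simp_all add: U_one, simp add: Aut_one)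

lemma U_inv: "g \<in> carrier \<Gamma> \<Longrightarrow> inv\<^bsub>Aut X\<^esub> (U g) = U (inv\<^bsub>\<Gamma>\<^esub> g)"
  by (rule group.inv_equality[OF group_Aut]) (simp_all add: U_Aut U_mult U_one_Aut)

lemma \<theta>_eq: "g \<in> carrier \<Gamma> \<Longrightarrow> \<theta> g A = U g \<otimes>\<^bsub>Aut X\<^esub> A \<otimes>\<^bsub>Aut X\<^esub> U (inv\<^bsub>\<Gamma>\<^esub> g)"
  by (simp add: conj_action_def Let_def U_inv)

lemma \<theta>_apply:
  assumes g: "g \<in> carrier \<Gamma>" and A: "A \<in> carrier (Aut X)" and f: "f \<in> fm X"
  shows "\<theta> g A f = U g (A (U (inv\<^bsub>\<Gamma>\<^esub> g) f))"
proof -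
  interpret H: group "Aut X" by (rule group_Aut)
  have g': "inv\<^bsub>\<Gamma>\<^esub> g \<in> carrier \<Gamma>" using g by simp
  show ?thesis unfolding \<theta>_eq[OF g]
    using Aut_mult_apply[OF H.m_closed[OF U_Aut[OF g] A] U_Aut[OF g'] f] Aut_mult_apply[OF U_Aut[OF g] A
      U_fm_X[OF g' f]] by simp
qed

lemma supported_conj_action:
  assumes g: "g \<in> carrier \<Gamma>" and A: "supported X A Z" shows "supported X (\<theta> g A) (\<alpha> g ` Z)"
proof (rule supportedI)
  interpret H: group "Aut X" by (rule group_Aut)
  have g': "inv\<^bsub>\<Gamma>\<^esub> g \<in> carrier \<Gamma>" using g by simp
  note A1 = supportedD(1)[OF A] and Z = supportedD(2)[OF A]
  show gZ: "\<alpha> g ` Z \<subseteq> X" using Z act_closed[OF g] by auto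
  show "\<theta> g A \<in> carrier (Aut X)" unfolding \<theta>_eq[OF g] using U_Aut[OF g] U_Aut[OF g'] A1 by simp
  have im: "\<alpha> (inv\<^bsub>\<Gamma>\<^esub> g) ` \<alpha> g ` Z = Z" using act_inv(1)[OF g] Z by (force simp: image_image)
  have U': "U (inv\<^bsub>\<Gamma>\<^esub> g) f \<in> fm Z" if "f \<in> fm (\<alpha> g ` Z)" for f
    using U_fm[OF g' gZ that] im by simp
  fix f assume f: "f \<in> fm (\<alpha> g ` Z)"
  have fX: "f \<in> fm X" by (rule fm_mono[OF gZ f])
  show "\<theta> g A f \<in> fm (\<alpha> g ` Z)"
    unfolding \<theta>_apply[OF g A1 fX] by (rule U_fm[OF g Z supportedD(3)[OF A U'[OF f]]])
  obtain k where k: "k \<in> fm Z" "U (inv\<^bsub>\<Gamma>\<^esub> g) f = A k" using supportedD(4)[OF A U'[OF f]] by blast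
  have kX: "k \<in> fm X" by (rule fm_mono[OF Z k(1)])
  have "\<theta> g A (U g k) = f"
    unfolding \<theta>_apply[OF g A1 U_fm_X[OF g kX]] using g g' kX fX by (simp add: U_comp U_one flip: k(2))
  then show "\<exists>k\<in>fm (\<alpha> g ` Z). f = \<theta> g A k" using U_fm[OF g Z k(1)] by blast
next
  have g': "inv\<^bsub>\<Gamma>\<^esub> g \<in> carrier \<Gamma>" using g by simp
  note A1 = supportedD(1)[OF A] and Z = supportedD(2)[OF A]
  fix f assume f: "f \<in> fm (X - \<alpha> g ` Z)"
  have fX: "f \<in> fm X" using fm_mono[OF _ f] by blast
  have "\<alpha> (inv\<^bsub>\<Gamma>\<^esub> g) ` (X - \<alpha> g ` Z) \<subseteq> X - Z" using act_closed[OF g'] act_inv(2)[OF g] by force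
  then have "U (inv\<^bsub>\<Gamma>\<^esub> g) f \<in> fm (X - Z)" using U_fm[OF g' _ f] fm_mono by blast
  then have "A (U (inv\<^bsub>\<Gamma>\<^esub> g) f) = U (inv\<^bsub>\<Gamma>\<^esub> g) f" by (rule supportedD(5)[OF A])
  then show "\<theta> g A f = f" unfolding \<theta>_apply[OF g A1 fX] using g g' fX by (simp add: U_comp U_one)
qed

lemma group_linear_enrichment: "group (linear_enrichment \<Gamma> X \<alpha> R)"
  unfolding linear_enrichment_def
proof (rule group_semidirect[OF group_GL_f group])
  interpret H: group "Aut X" by (rule group_Aut)
  have N: "A \<in> carrier (Aut X)" if "A \<in> carrier (GL_f X R)" for A
    using subgroup.mem_carrier[OF subgroup_GL_f that] .
  have cancel: "y \<otimes>\<^bsub>Aut X\<^esub> (x \<otimes>\<^bsub>Aut X\<^esub> z) = z" if "y \<otimes>\<^bsub>Aut X\<^esub> x = \<one>\<^bsub>Aut X\<^esub>"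
    "x \<in> carrier (Aut X)" "y \<in> carrier (Aut X)" "z \<in> carrier (Aut X)" for x y z
    using that H.m_assoc[of y x z] by simp
  fix g assume g: "g \<in> carrier \<Gamma>"
  have g': "inv\<^bsub>\<Gamma>\<^esub> g \<in> carrier \<Gamma>" using g by simp
  have gg: "U (inv\<^bsub>\<Gamma>\<^esub> g) \<otimes>\<^bsub>Aut X\<^esub> U g = \<one>\<^bsub>Aut X\<^esub>" using g by (simp add: U_mult U_one_Aut)
  show "\<theta> g \<in> hom (GL_f X R) (GL_f X R)"
  proof (rule homI)
    fix A assume "A \<in> carrier (GL_f X R)"
    then show "\<theta> g A \<in> carrier (GL_f X R)" using supported_conj_action[OF g] unfolding carrier_GL_f by blast
  next
    fix A B assume "A \<in> carrier (GL_f X R)" "B \<in> carrier (GL_f X R)"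
    then have AB: "A \<in> carrier (Aut X)" "B \<in> carrier (Aut X)" using N by auto
    show "\<theta> g (A \<otimes>\<^bsub>GL_f X R\<^esub> B) = \<theta> g A \<otimes>\<^bsub>GL_f X R\<^esub> \<theta> g B"
      using AB U_Aut[OF g] U_Aut[OF g'] cancel[OF gg] by (simp add: GL_f_simps \<theta>_eq[OF g] H.m_assoc)
  qed
  show "\<theta> (g \<otimes>\<^bsub>\<Gamma>\<^esub> h) A = \<theta> g (\<theta> h A)" if h: "h \<in> carrier \<Gamma>" and A: "A \<in> carrier (GL_f X R)" for h A
    using g h N[OF A] by (simp add: \<theta>_eq U_Aut H.m_assoc G.inv_mult_group flip: U_mult)
next
  interpret H: group "Aut X" by (rule group_Aut)
  fix A assume "A \<in> carrier (GL_f X R)"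
  then have "A \<in> carrier (Aut X)" using subgroup.mem_carrier[OF subgroup_GL_f] by blast
  then show "\<theta> \<one>\<^bsub>\<Gamma>\<^esub> A = A" by (simp add: \<theta>_eq U_one_Aut)
qed

text \<open>The transport of \<open>\<theta> g A\<close> along \<open>q\<close> sees only the labels
  \<open>q (\<alpha> g z)\<close>. The orbit approximation says that these are the labels
  \<open>p z\<close> attached to another point of the permuted set, so conjugation in the semidirect
  product becomes a change of that point.\<close>

lemma lift_conj_action:
  assumes g: "g \<in> carrier \<Gamma>" and A: "supported X A Z" and fin: "finite Z" "finite B"
    and q: "inj_on q (\<alpha> g ` Z)" "q ` \<alpha> g ` Z \<subseteq> B" and p: "\<And>z. z \<in> Z \<Longrightarrow> p z = q (\<alpha> g z)"
  shows "lift (\<alpha> g ` Z) B q (\<theta> g A) = lift Z B p A"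
proof -
  have g': "inv\<^bsub>\<Gamma>\<^esub> g \<in> carrier \<Gamma>" using g by simp
  note A1 = supportedD(1)[OF A] and Z = supportedD(2)[OF A]
  have injg: "inj_on (\<alpha> g) Z" using act_inv(1)[OF g] Z by (metis inj_onI subsetD)
  have p1: "inj_on p Z" using comp_inj_on[OF injg q(1)] p by (simp add: inj_on_def)
  have p2: "p ` Z \<subseteq> B" and pim: "p ` Z = q ` \<alpha> g ` Z" using q(2) p by (auto simp: image_iff)
  have gZ: "\<alpha> g ` Z \<subseteq> X" using Z act_closed[OF g] by auto
  have "lift (\<alpha> g ` Z) B q (\<theta> g A) f = lift Z B p A f" if f: "f \<in> fm B" for f
  proof (rule lift_eqI[OF finite_imageI[OF fin(1)] fin(2) q f])
    have pf: "pull (\<alpha> g ` Z) q f \<in> fm (\<alpha> g ` Z)" by (rule pull_fm[OF finite_imageI[OF fin(1)] fin(2) q f])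
    have pfX: "pull (\<alpha> g ` Z) q f \<in> fm X" by (rule fm_mono[OF gZ pf])
    have e: "U (inv\<^bsub>\<Gamma>\<^esub> g) (pull (\<alpha> g ` Z) q f) = pull Z p f"
    proof
      fix y
      have "y \<in> Z" if y: "y \<in> X" "\<alpha> g y \<in> \<alpha> g ` Z"
      proof -
        obtain z where "z \<in> Z" "\<alpha> g y = \<alpha> g z" using y(2) by blast
        then show ?thesis using act_inv(1)[OF g y(1)] act_inv(1)[OF g, of z] Z by auto
      qed
      then show "U (inv\<^bsub>\<Gamma>\<^esub> g) (pull (\<alpha> g ` Z) q f) y = pull Z p f y"
        unfolding U_apply[OF pfX] using g Z p by (auto simp: pull_def)
    qed
    fix x assume "x \<in> \<alpha> g ` Z"
    then obtain z where z: "z \<in> Z" "x = \<alpha> g z" by blast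
    have AX: "A (pull Z p f) \<in> fm X" using supportedD(6)[OF A supportedD(3)[OF A pull_fm[OF fin p1 p2 f]]] .
    have "lift Z B p A f (q x) = A (pull Z p f) z" using lift_inside[OF fin p1 p2 f z(1), of A] p[OF z(1)]
      z(2) by simp
    also have "\<dots> = \<theta> g A (pull (\<alpha> g ` Z) q f) x"
      unfolding \<theta>_apply[OF g A1 pfX] e using z Z act_closed[OF g] act_inv(1)[OF g]
        by (auto simp: U_apply[OF AX])
    finally show "lift Z B p A f (q x) = \<theta> g A (pull (\<alpha> g ` Z) q f) x" .
  next
    fix b assume "b \<notin> q ` \<alpha> g ` Z"
    then show "lift Z B p A f b = f b" using lift_outside[OF fin p1 p2 f, of b] pim by simp
  qed
  then show ?thesis by (auto simp: lift_def fun_eq_iff restrict_def)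
qed

end

section \<open>Approximation of the linear enrichment\<close>

text \<open>Fixes \<open>F\<close> and \<open>c\<close> and keeps all precisions: the constant may
  depend on \<open>F\<close>, and maps that lose precision can be composed with the
  approximations.\<close>

definition approximable_on :: "'g set \<Rightarrow> real \<Rightarrow> ('h monoid \<times> ('h \<Rightarrow> 'h \<Rightarrow> real)) set \<Rightarrow> ('g, 'a) monoid_scheme \<Rightarrow>
  bool" where
  "approximable_on F c \<G> \<Gamma> \<longleftrightarrow> (\<forall>\<epsilon>>0. \<exists>(G, d)\<in>\<G>. \<exists>\<phi> \<in> carrier \<Gamma> \<rightarrow> carrier G.
        unital \<Gamma> G \<phi> \<and> multiplicative \<Gamma> G d F \<epsilon> \<phi> \<and> separating \<Gamma> G d F c \<phi>)"

definition approximable_at :: "real \<Rightarrow> ('h monoid \<times> ('h \<Rightarrow> 'h \<Rightarrow> real)) set \<Rightarrow> ('g, 'a) monoid_scheme \<Rightarrow> bool"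
  where
  "approximable_at c \<G> \<Gamma> \<longleftrightarrow> (\<forall>F. finite F \<longrightarrow> F \<subseteq> carrier \<Gamma> \<longrightarrow> approximable_on F c \<G> \<Gamma>)"

lemma approximable_iff: "approximable \<G> \<Gamma> \<longleftrightarrow> group \<Gamma> \<and> (\<exists>c>0. approximable_at c \<G> \<Gamma>)"
  unfolding approximable_def approximable_at_def approximable_on_def by meson

lemma approximable_onE:
  assumes "approximable_on F c \<G> \<Gamma>" "\<epsilon> > 0"
  obtains G d \<phi> where "(G, d) \<in> \<G>" "\<phi> \<in> carrier \<Gamma> \<rightarrow> carrier G" "unital \<Gamma> G \<phi>" "multiplicative \<Gamma> G d F \<epsilon> \<phi>"
    "separating \<Gamma> G d F c \<phi>"
proof -
  have "\<exists>(G, d)\<in>\<G>. \<exists>\<phi> \<in> carrier \<Gamma> \<rightarrow> carrier G.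
        unital \<Gamma> G \<phi> \<and> multiplicative \<Gamma> G d F \<epsilon> \<phi> \<and> separating \<Gamma> G d F c \<phi>"
    using assms unfolding approximable_on_def by simp
  then show ?thesis by (elim bexE case_prodE conjE) (simp add: that)
qed

lemma approximable_onI:
  assumes "\<And>\<epsilon>. \<epsilon> > 0 \<Longrightarrow> \<exists>G d \<phi>. (G, d) \<in> \<G> \<and> \<phi> \<in> carrier \<Gamma> \<rightarrow> carrier G \<and>
        unital \<Gamma> G \<phi> \<and> multiplicative \<Gamma> G d F \<epsilon> \<phi> \<and> separating \<Gamma> G d F c \<phi>"
  shows "approximable_on F c \<G> \<Gamma>"
  unfolding approximable_on_def
proof (intro allI impI)
  fix \<epsilon> :: real assume "\<epsilon> > 0"
  then obtain G d \<phi> where "(G, d) \<in> \<G>" "\<phi> \<in> carrier \<Gamma> \<rightarrow> carrier G"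
    "unital \<Gamma> G \<phi> \<and> multiplicative \<Gamma> G d F \<epsilon> \<phi> \<and> separating \<Gamma> G d F c \<phi>" using assms by metis
  then show "\<exists>(G, d)\<in>\<G>. \<exists>\<phi> \<in> carrier \<Gamma> \<rightarrow> carrier G.
        unital \<Gamma> G \<phi> \<and> multiplicative \<Gamma> G d F \<epsilon> \<phi> \<and> separating \<Gamma> G d F c \<phi>"
    by (intro bexI[of _ "(G, d)"]) auto
qed

text \<open>\<open>W\<close> is a homomorphism of the permutational wreath product of \<open>G\<close> and \<open>Sym(A)\<close> to \<open>H\<close>. The last two
  clauses
  relate the metrics with bounds that are weak enough to hold for all four families of groups; the
  square root is needed for the Hilbert--Schmidt metric.\<close>

definition wreath_map where
  "wreath_map G d A H e W \<longleftrightarrow>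
    (\<forall>u \<sigma>. u \<in> A \<rightarrow> carrier G \<longrightarrow> \<sigma> \<in> Bij A \<longrightarrow> W u \<sigma> \<in> carrier H) \<and>
    W (\<lambda>_. \<one>\<^bsub>G\<^esub>) (\<lambda>x\<in>A. x) = \<one>\<^bsub>H\<^esub> \<and>
    (\<forall>u v \<sigma>. (\<forall>t\<in>A. u t = v t) \<longrightarrow> W u \<sigma> = W v \<sigma>) \<and>
    (\<forall>u \<sigma> v \<tau>. u \<in> A \<rightarrow> carrier G \<longrightarrow> v \<in> A \<rightarrow> carrier G \<longrightarrow> \<sigma> \<in> Bij A \<longrightarrow> \<tau> \<in> Bij A \<longrightarrow>
      W u \<sigma> \<otimes>\<^bsub>H\<^esub> W v \<tau> = W (\<lambda>t. u (\<tau> t) \<otimes>\<^bsub>G\<^esub> v t) (compose A \<sigma> \<tau>)) \<and>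
    (\<forall>u \<sigma> v \<tau> T \<epsilon>. u \<in> A \<rightarrow> carrier G \<longrightarrow> v \<in> A \<rightarrow> carrier G \<longrightarrow> \<sigma> \<in> Bij A \<longrightarrow> \<tau> \<in> Bij A \<longrightarrow>
      0 < \<epsilon> \<longrightarrow> \<epsilon> \<le> 1 \<longrightarrow> T \<subseteq> A \<longrightarrow> (1 - \<epsilon>) * real (card A) \<le> real (card T) \<longrightarrow>
      (\<forall>t\<in>T. \<sigma> t = \<tau> t \<and> d (u t) (v t) < \<epsilon>) \<longrightarrow> e (W u \<sigma>) (W v \<tau>) \<le> 3 * sqrt \<epsilon>) \<and>
    (\<forall>u T c. u \<in> A \<rightarrow> carrier G \<longrightarrow> T \<subseteq> A \<longrightarrow> card A \<le> 2 * card T \<longrightarrow> 0 < c \<longrightarrow>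
      (\<forall>t\<in>T. c \<le> d (u t) \<one>\<^bsub>G\<^esub>) \<longrightarrow> c / 2 \<le> e (W u (\<lambda>x\<in>A. x)) \<one>\<^bsub>H\<^esub>)"

lemma wreath_mapD:
  assumes "wreath_map G d A H e W"
  shows "u \<in> A \<rightarrow> carrier G \<Longrightarrow> \<sigma> \<in> Bij A \<Longrightarrow> W u \<sigma> \<in> carrier H"
    "W (\<lambda>_. \<one>\<^bsub>G\<^esub>) (\<lambda>x\<in>A. x) = \<one>\<^bsub>H\<^esub>"
    "u \<in> A \<rightarrow> carrier G \<Longrightarrow> v \<in> A \<rightarrow> carrier G \<Longrightarrow> \<sigma> \<in> Bij A \<Longrightarrow> \<tau> \<in> Bij A \<Longrightarrow>
      W u \<sigma> \<otimes>\<^bsub>H\<^esub> W v \<tau> = W (\<lambda>t. u (\<tau> t) \<otimes>\<^bsub>G\<^esub> v t) (compose A \<sigma> \<tau>)"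
    "u \<in> A \<rightarrow> carrier G \<Longrightarrow> v \<in> A \<rightarrow> carrier G \<Longrightarrow> \<sigma> \<in> Bij A \<Longrightarrow> \<tau> \<in> Bij A \<Longrightarrow>
      0 < \<epsilon> \<Longrightarrow> \<epsilon> \<le> 1 \<Longrightarrow> T \<subseteq> A \<Longrightarrow> (1 - \<epsilon>) * real (card A) \<le> real (card T) \<Longrightarrow>
      (\<And>t. t \<in> T \<Longrightarrow> \<sigma> t = \<tau> t \<and> d (u t) (v t) < \<epsilon>) \<Longrightarrow> e (W u \<sigma>) (W v \<tau>) \<le> 3 * sqrt \<epsilon>"
    "u \<in> A \<rightarrow> carrier G \<Longrightarrow> T \<subseteq> A \<Longrightarrow> card A \<le> 2 * card T \<Longrightarrow> 0 < c \<Longrightarrow>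
      (\<And>t. t \<in> T \<Longrightarrow> c \<le> d (u t) \<one>\<^bsub>G\<^esub>) \<Longrightarrow> c / 2 \<le> e (W u (\<lambda>x\<in>A. x)) \<one>\<^bsub>H\<^esub>"
    "(\<And>t. t \<in> A \<Longrightarrow> u t = v t) \<Longrightarrow> W u \<sigma> = W v \<sigma>"
  using assms unfolding wreath_map_def by simp_all

definition wreath_closed :: "('h monoid \<times> ('h \<Rightarrow> 'h \<Rightarrow> real)) set \<Rightarrow> bool" where
  "wreath_closed \<G> \<longleftrightarrow> (\<forall>G d. \<forall>A :: nat set. (G, d) \<in> \<G> \<longrightarrow> finite A \<longrightarrow> A \<noteq> {} \<longrightarrow>
    (\<exists>H e W. (H, e) \<in> \<G> \<and> wreath_map G d A H e W))"

text \<open>A uniformly continuous homomorphism from the direct product of \<open>G\<close> and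
  \<open>H\<close> to \<open>K\<close>. The loss in \<open>c / 4\<close> is that of two block
  constructions in a row, repetition to a common size and then a pair, each costing a factor
  2.\<close>

definition sum_map where
  "sum_map \<delta> \<eta> G d H e K k J \<longleftrightarrow>
    (\<forall>x\<in>carrier G. \<forall>y\<in>carrier H. J x y \<in> carrier K) \<and> J \<one>\<^bsub>G\<^esub> \<one>\<^bsub>H\<^esub> = \<one>\<^bsub>K\<^esub> \<and>
    (\<forall>x\<in>carrier G. \<forall>x'\<in>carrier G. \<forall>y\<in>carrier H. \<forall>y'\<in>carrier H. J x y \<otimes>\<^bsub>K\<^esub> J x' y' = J (x \<otimes>\<^bsub>G\<^esub> x')
      (y \<otimes>\<^bsub>H\<^esub> y')) \<and>
    (\<forall>x\<in>carrier G. \<forall>x'\<in>carrier G. \<forall>y\<in>carrier H. \<forall>y'\<in>carrier H. d x x' < \<delta> \<longrightarrow> e y y' < \<delta> \<longrightarrow> k (J x y) (J x' y')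
      < \<eta>) \<and>
    (\<forall>x\<in>carrier G. \<forall>y\<in>carrier H. \<forall>c>0. c \<le> d x \<one>\<^bsub>G\<^esub> \<or> c \<le> e y \<one>\<^bsub>H\<^esub> \<longrightarrow> c / 4 \<le> k (J x y) \<one>\<^bsub>K\<^esub>)"

lemma sum_mapD:
  assumes "sum_map \<delta> \<eta> G d H e K k J" and x: "x \<in> carrier G" and y: "y \<in> carrier H"
  shows "J x y \<in> carrier K" "J \<one>\<^bsub>G\<^esub> \<one>\<^bsub>H\<^esub> = \<one>\<^bsub>K\<^esub>"
    "x' \<in> carrier G \<Longrightarrow> y' \<in> carrier H \<Longrightarrow> J x y \<otimes>\<^bsub>K\<^esub> J x' y' = J (x \<otimes>\<^bsub>G\<^esub> x') (y \<otimes>\<^bsub>H\<^esub> y')"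
    "x' \<in> carrier G \<Longrightarrow> y' \<in> carrier H \<Longrightarrow> d x x' < \<delta> \<Longrightarrow> e y y' < \<delta> \<Longrightarrow> k (J x y) (J x' y') < \<eta>"
    "0 < c \<Longrightarrow> c \<le> d x \<one>\<^bsub>G\<^esub> \<or> c \<le> e y \<one>\<^bsub>H\<^esub> \<Longrightarrow> c / 4 \<le> k (J x y) \<one>\<^bsub>K\<^esub>"
proof -
  note m = assms(1)[unfolded sum_map_def]
  show "J x y \<in> carrier K" "J \<one>\<^bsub>G\<^esub> \<one>\<^bsub>H\<^esub> = \<one>\<^bsub>K\<^esub>"
    "x' \<in> carrier G \<Longrightarrow> y' \<in> carrier H \<Longrightarrow> J x y \<otimes>\<^bsub>K\<^esub> J x' y' = J (x \<otimes>\<^bsub>G\<^esub> x') (y \<otimes>\<^bsub>H\<^esub> y')"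
    "x' \<in> carrier G \<Longrightarrow> y' \<in> carrier H \<Longrightarrow> d x x' < \<delta> \<Longrightarrow> e y y' < \<delta> \<Longrightarrow> k (J x y) (J x' y') < \<eta>"
    using m x y by simp_all
  have "\<forall>x\<in>carrier G. \<forall>y\<in>carrier H. \<forall>c>0. c \<le> d x \<one>\<^bsub>G\<^esub> \<or> c \<le> e y \<one>\<^bsub>H\<^esub> \<longrightarrow> c / 4 \<le> k (J x y) \<one>\<^bsub>K\<^esub>"
    using m by (elim conjE)
  then show "0 < c \<Longrightarrow> c \<le> d x \<one>\<^bsub>G\<^esub> \<or> c \<le> e y \<one>\<^bsub>H\<^esub> \<Longrightarrow> c / 4 \<le> k (J x y) \<one>\<^bsub>K\<^esub>"
    using x y by blast
qed

definition sum_closed :: "('h monoid \<times> ('h \<Rightarrow> 'h \<Rightarrow> real)) set \<Rightarrow> bool" where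
  "sum_closed \<G> \<longleftrightarrow> (\<forall>\<eta>>0. \<exists>\<delta>>0. \<forall>G d H e. (G, d) \<in> \<G> \<longrightarrow> (H, e) \<in> \<G> \<longrightarrow>
    (\<exists>K k J. (K, k) \<in> \<G> \<and> sum_map \<delta> \<eta> G d H e K k J))"

lemma card_Bij_vimage:
  assumes "\<sigma> \<in> Bij A" "S \<subseteq> A" shows "card {t\<in>A. \<sigma> t \<in> S} = card S"
proof -
  have b: "bij_betw \<sigma> A A" using assms by (simp add: Bij_def)
  have "\<sigma> ` {t\<in>A. \<sigma> t \<in> S} = S" using b assms(2) unfolding bij_betw_def by force
  moreover have "inj_on \<sigma> {t\<in>A. \<sigma> t \<in> S}" using b by (auto simp: bij_betw_def intro: inj_on_subset)
  ultimately show ?thesis using card_image by metis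
qed

lemma card_Int_ge:
  assumes "finite A" "P \<subseteq> A" "Q \<subseteq> A" shows "real (card P) + real (card Q) - real (card A) \<le>
    real (card (P \<inter> Q))"
proof -
  have "card P + card Q = card (P \<union> Q) + card (P \<inter> Q)"
    using assms finite_subset by (intro card_Un_Int) auto
  moreover have "card (P \<union> Q) \<le> card A" using assms by (intro card_mono) auto
  ultimately show ?thesis by linarith
qed

section \<open>The approximating maps of the linear enrichment\<close>

context enrichment begin

lemma linear_enrichment_simps:
  "carrier (linear_enrichment \<Gamma> X \<alpha> R) = carrier (GL_f X R) \<times> carrier \<Gamma>"
  "\<one>\<^bsub>linear_enrichment \<Gamma> X \<alpha> R\<^esub> = (\<one>\<^bsub>Aut X\<^esub>, \<one>\<^bsub>\<Gamma>\<^esub>)"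
  "(a, g) \<otimes>\<^bsub>linear_enrichment \<Gamma> X \<alpha> R\<^esub> (b, h) = (a \<otimes>\<^bsub>Aut X\<^esub> \<theta> g b, g \<otimes>\<^bsub>\<Gamma>\<^esub> h)"
  by (simp_all add: linear_enrichment_def semidirect_def GL_f_simps)

text \<open>\<open>E\<close> contains the supports of the conjugates \<open>\<theta> g b\<close> as
  well. The individual supports \<open>Z b\<close> are kept, because only their translates, and not
  those of \<open>E\<close>, are known to lie in \<open>E\<close>.\<close>

lemma common_support:
  assumes "finite F" "F \<subseteq> carrier (linear_enrichment \<Gamma> X \<alpha> R)"
  obtains E Z where "finite E" "E \<subseteq> X" "\<And>a g. (a, g) \<in> F \<Longrightarrow> supported X a (Z a) \<and> Z a \<subseteq> E \<and> finite (Z a)"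
    "\<And>a g b h. (a, g) \<in> F \<Longrightarrow> (b, h) \<in> F \<Longrightarrow> \<alpha> g ` Z b \<subseteq> E"
proof -
  have ex: "\<exists>Z. finite Z \<and> supported X a Z" if "(a, g) \<in> F" for a g
    using that assms(2) by (force simp: linear_enrichment_simps carrier_GL_f)
  define Z where "Z a = (SOME Z. finite Z \<and> supported X a Z)" for a
  have Z: "finite (Z a) \<and> supported X a (Z a)" if "(a, g) \<in> F" for a g
    unfolding Z_def by (rule someI_ex[OF ex[OF that]])
  define E where "E = (\<Union>x\<in>F. Z (fst x)) \<union> (\<Union>x\<in>F. \<Union>y\<in>F. \<alpha> (snd x) ` Z (fst y))"
  have "finite E" unfolding E_def using assms(1) Z by auto
  moreover have "E \<subseteq> X"
  proof -
    have ZX: "Z a \<subseteq> X" if "(a, g) \<in> F" for a g using Z[OF that] supportedD(2) by blast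
    have gc: "g \<in> carrier \<Gamma>" if "(a, g) \<in> F" for a g using that assms(2)
      by (auto simp: linear_enrichment_simps)
    have "Z (fst x) \<subseteq> X" if "x \<in> F" for x using ZX[of "fst x" "snd x"] that by simp
    moreover have "\<alpha> (snd x) ` Z (fst y) \<subseteq> X" if "x \<in> F" "y \<in> F" for x y
      using ZX[of "fst y" "snd y"] gc[of "fst x" "snd x"] act_closed that by auto
    ultimately show ?thesis unfolding E_def by blast
  qed
  ultimately show ?thesis
  proof (rule that)
    fix a g b h assume "(a, g) \<in> F" "(b, h) \<in> F"
    then show "\<alpha> g ` Z b \<subseteq> E" unfolding E_def by fastforce
  next
    fix a g assume "(a, g) \<in> F"
    then show "supported X a (Z a) \<and> Z a \<subseteq> E \<and> finite (Z a)" using Z unfolding E_def by fastforce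
  qed
qed

text \<open>The order of the choices matters: \<open>\<delta>\<close> for the final sum, then
  \<open>\<epsilon>1\<close>, then \<open>A\<close> and \<open>B\<close> from the sofic action, then
  \<open>F'\<close>, and only then the approximation \<open>\<psi>\<close> of \<open>Aut B\<close>.
  Hence \<open>c0\<close> must serve all finite \<open>Z\<close>.\<close>

theorem approximable_linear_enrichment:
  fixes \<G> :: "('h monoid \<times> ('h \<Rightarrow> 'h \<Rightarrow> real)) set"
  assumes grp: "\<And>G d. (G, d) \<in> \<G> \<Longrightarrow> group G" and sofic: "sofic_action \<Gamma> X \<alpha>" and wr: "wreath_closed \<G>"
    and sm: "sum_closed \<G>"
    and Gapp: "approximable_at c1 \<G> \<Gamma>" "c1 > 0"
    and Aapp: "\<And>Z :: nat set. finite Z \<Longrightarrow> approximable_at c0 \<G> (Aut Z)" "c0 > 0"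
  shows "approximable \<G> (linear_enrichment \<Gamma> X \<alpha> R)"
  unfolding approximable_iff
proof (intro conjI exI)
  let ?L = "linear_enrichment \<Gamma> X \<alpha> R"
  show "group ?L" by (rule group_linear_enrichment)
  \<comment> \<open>\<open>c0 / 2\<close> is what the wreath product leaves of \<open>c0\<close>;
    the sum costs a further factor 4, and \<open>c / 8\<close> instead of \<open>c / 4\<close> makes
    the inequality strict.\<close>
  define c where "c = min c1 (c0 / 2)"
  have c: "c > 0" "c \<le> c1" "c \<le> c0 / 2" using Gapp(2) Aapp(2) by (auto simp: c_def)
  show "c / 8 > 0" using c by simp
  show "approximable_at (c / 8) \<G> ?L"
    unfolding approximable_at_def
  proof (intro allI impI approximable_onI)
    fix F :: "((('x \<Rightarrow> 'r) \<Rightarrow> 'x \<Rightarrow> 'r) \<times> 'g) set" and \<epsilon> :: real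
    assume F: "finite F" "F \<subseteq> carrier ?L" and \<epsilon>: "\<epsilon> > 0"
    obtain E Z where EX: "finite E" "E \<subseteq> X" and Z: "\<And>a g. (a, g) \<in> F \<Longrightarrow> supported X a (Z a) \<and> Z a \<subseteq> E \<and>
      finite (Z a)"
      and gZ: "\<And>a g b h. (a, g) \<in> F \<Longrightarrow> (b, h) \<in> F \<Longrightarrow> \<alpha> g ` Z b \<subseteq> E"
      using common_support[OF F] by metis
    have FG: "finite (snd ` F)" "snd ` F \<subseteq> carrier \<Gamma>" using F by (auto simp: linear_enrichment_simps)
    have gF: "g \<in> carrier \<Gamma>" "g \<in> snd ` F" if "(a, g) \<in> F" for a g using FG that by force+
    have suppE: "supported X a E" if "(a, g) \<in> F" for a g
      using supported_mono[of X a "Z a" E] Z[OF that] EX by blast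
    obtain \<delta> where \<delta>: "\<delta> > 0" and sum: "\<And>G d H e. (G, d) \<in> \<G> \<Longrightarrow> (H, e) \<in> \<G> \<Longrightarrow>
        \<exists>K k J. (K, k) \<in> \<G> \<and> sum_map \<delta> \<epsilon> G d H e K k J"
      using sm \<epsilon> unfolding sum_closed_def by metis
    \<comment> \<open>Inverts the bound \<open>3 * sqrt \<epsilon>1\<close> of
      \<open>wreath_map\<close>, which becomes at most \<open>\<delta> / 2\<close>.\<close>
    define \<epsilon>1 where "\<epsilon>1 = min 1 ((\<delta> / 6)\<^sup>2)"
    have \<epsilon>1: "\<epsilon>1 > 0" "\<epsilon>1 \<le> 1" using \<delta> by (auto simp: \<epsilon>1_def)
    have "sqrt \<epsilon>1 \<le> sqrt ((\<delta> / 6)\<^sup>2)" unfolding \<epsilon>1_def by (intro real_sqrt_le_mono) simp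
    then have s\<epsilon>1: "3 * sqrt \<epsilon>1 < \<delta>" using \<delta> by simp
    \<comment> \<open>A third of \<open>\<epsilon>1\<close> for each of the three exceptional sets
      below: points at which \<open>\<phi>\<close> fails to be multiplicative, and points sent
      outside \<open>S\<close> by the permutation of the product or by that of the second
      factor.\<close>
    obtain A :: "nat set" and \<phi> where A: "finite A" and \<phi>: "\<phi> \<in> carrier \<Gamma> \<rightarrow> carrier (BijGroup A)"
        "unital \<Gamma> (BijGroup A) \<phi>" "multiplicative \<Gamma> (BijGroup A) (hamming_dist A) (snd ` F) (\<epsilon>1 / 3) \<phi>"
      and orb: "orbit_approximation \<Gamma> \<alpha> (snd ` F) E (\<epsilon>1 / 3) A \<phi>"
      using sofic FG EX \<epsilon>1 unfolding sofic_action_def by (metis divide_pos_pos zero_less_numeral)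
    obtain B :: "nat set" and S \<pi> where B: "finite B"
      and S: "S \<subseteq> A" "real (card S) > (1 - \<epsilon>1 / 3) * real (card A)"
      and \<pi>: "\<And>s. s \<in> S \<Longrightarrow> inj_on (\<pi> s) E" "\<And>s. s \<in> S \<Longrightarrow> \<pi> s ` E \<subseteq> B"
      and \<pi>eq: "\<And>g x s. g \<in> snd ` F \<Longrightarrow> x \<in> E \<Longrightarrow> s \<in> S \<Longrightarrow> \<phi> g s \<in> S \<Longrightarrow> \<alpha> (inv\<^bsub>\<Gamma>\<^esub> g) x \<in> E \<Longrightarrow>
        \<pi> (\<phi> g s) x = \<pi> s (\<alpha> (inv\<^bsub>\<Gamma>\<^esub> g) x)"
      using orb unfolding orbit_approximation_def by metis
    have A0: "A \<noteq> {}" using S by auto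
    have \<phi>B: "\<phi> g \<in> Bij A" if "g \<in> carrier \<Gamma>" for g using \<phi>(1) that by (auto simp: Pi_def)
    have \<phi>1: "\<phi> \<one>\<^bsub>\<Gamma>\<^esub> = (\<lambda>x\<in>A. x)" using \<phi>(2) by (simp add: unital_def)
    interpret AB: group "Aut B" by (rule group_Aut)
    define F' where "F' = (\<lambda>(s, a). lift E B (\<pi> s) a) ` (S \<times> fst ` F)"
    have liftc: "lift E B (\<pi> s) a \<in> carrier (Aut B)" if "s \<in> S" "supported X a E" for s a
      using lift_Aut[OF EX(1) B \<pi>[OF that(1)] that(2)] .
    have F': "finite F'" "F' \<subseteq> carrier (Aut B)"
      using F(1) finite_subset[OF S(1) A] liftc suppE by (auto simp: F'_def)
    obtain G d \<psi> where Gd: "(G, d) \<in> \<G>" and \<psi>: "\<psi> \<in> carrier (Aut B) \<rightarrow> carrier G" "unital (Aut B) G \<psi>"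
      "multiplicative (Aut B) G d F' \<epsilon>1 \<psi>" "separating (Aut B) G d F' c0 \<psi>"
      using approximable_onE[OF Aapp(1)[OF B, unfolded approximable_at_def, rule_format, OF F'] \<epsilon>1(1)] .
    obtain H e W where He: "(H, e) \<in> \<G>" and W: "wreath_map G d A H e W"
      using wr Gd A A0 unfolding wreath_closed_def by blast
    obtain G2 d2 th where G2: "(G2, d2) \<in> \<G>" and th: "th \<in> carrier \<Gamma> \<rightarrow> carrier G2" "unital \<Gamma> G2 th"
      "multiplicative \<Gamma> G2 d2 (snd ` F) \<delta> th" "separating \<Gamma> G2 d2 (snd ` F) c1 th"
      using approximable_onE[OF Gapp(1)[unfolded approximable_at_def, rule_format, OF FG] \<delta>] .
    obtain K k J where Kk: "(K, k) \<in> \<G>" and J: "sum_map \<delta> \<epsilon> H e G2 d2 K k J" using sum[OF He G2] by blast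
    \<comment> \<open>The product rule of \<open>wreath_map\<close> indexes blocks by their column:
      the block in column \<open>t\<close> stands in row \<open>s\<close>, and the injection used is
      that of the row. Where no injection is available the block is \<open>1\<close>.\<close>
    define u where "u x t = (let s = \<phi> (snd x) t in if s \<in> S \<and>
      supported X (fst x) E then \<psi> (lift E B (\<pi> s) (fst x)) else \<one>\<^bsub>G\<^esub>)" for x t
    have one_G: "\<one>\<^bsub>G\<^esub> \<in> carrier G" using \<psi>(1,2) AB.one_closed unfolding unital_def by (metis PiE)
    have u: "u x \<in> A \<rightarrow> carrier G" for x
      using liftc \<psi>(1) one_G by (auto simp: u_def Let_def Pi_def)
    define \<Psi> where "\<Psi> x = J (W (u x) (\<phi> (snd x))) (th (snd x))" for x
    have thc: "th g \<in> carrier G2" if "g \<in> carrier \<Gamma>" for g using th(1) that by auto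
    have Wc: "W (u x) (\<phi> g) \<in> carrier H" if "g \<in> carrier \<Gamma>" for x g using wreath_mapD(1)[OF W u \<phi>B[OF that]] .
    have "\<Psi> \<in> carrier ?L \<rightarrow> carrier K"
      using J Wc thc unfolding sum_map_def \<Psi>_def by (auto simp: linear_enrichment_simps)
    moreover have "unital ?L K \<Psi>"
    proof -
      have l: "lift E B (\<pi> s) \<one>\<^bsub>Aut X\<^esub> = \<one>\<^bsub>Aut B\<^esub>" if "s \<in> S" for s
        by (rule lift_one[OF EX(1) B \<pi>[OF that] EX(2)])
      have "u (\<one>\<^bsub>Aut X\<^esub>, \<one>\<^bsub>\<Gamma>\<^esub>) t = \<one>\<^bsub>G\<^esub>" for t
        using l \<psi>(2) by (simp add: u_def Let_def unital_def)
      then have "u (\<one>\<^bsub>Aut X\<^esub>, \<one>\<^bsub>\<Gamma>\<^esub>) = (\<lambda>_. \<one>\<^bsub>G\<^esub>)" by blast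
      then show ?thesis using J th(2) wreath_mapD(2)[OF W] \<phi>1
        unfolding unital_def \<Psi>_def sum_map_def by (simp add: linear_enrichment_simps)
    qed
    moreover have "multiplicative ?L K k F \<epsilon> \<Psi>"
      unfolding multiplicative_def
    proof (intro ballI impI)
      fix x y assume x: "x \<in> F" and y: "y \<in> F" and xy: "x \<otimes>\<^bsub>?L\<^esub> y \<in> F"
      obtain a g where xe: "x = (a, g)" by (cases x)
      obtain b h where ye: "y = (b, h)" by (cases y)
      define z where "z = x \<otimes>\<^bsub>?L\<^esub> y"
      have ze: "z = (a \<otimes>\<^bsub>Aut X\<^esub> \<theta> g b, g \<otimes>\<^bsub>\<Gamma>\<^esub> h)" by (simp add: z_def xe ye linear_enrichment_simps)
      note xF = x[unfolded xe] and yF = y[unfolded ye] and zF = xy[folded z_def, unfolded ze]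
      note g = gF[OF xF] and h = gF[OF yF] and gh = gF[OF zF]
      let ?v = "\<lambda>t. u x (\<phi> h t) \<otimes>\<^bsub>G\<^esub> u y t"
      have prod: "\<Psi> x \<otimes>\<^bsub>K\<^esub> \<Psi> y = J (W ?v (compose A (\<phi> g) (\<phi> h))) (th g \<otimes>\<^bsub>G2\<^esub> th h)"
      proof -
        have "\<Psi> x \<otimes>\<^bsub>K\<^esub> \<Psi> y = J (W (u x) (\<phi> g) \<otimes>\<^bsub>H\<^esub> W (u y) (\<phi> h)) (th g \<otimes>\<^bsub>G2\<^esub> th h)"
          using J Wc[OF g(1)] Wc[OF h(1)] thc[OF g(1)] thc[OF h(1)] unfolding sum_map_def \<Psi>_def
            by (simp add: xe ye)
        then show ?thesis using wreath_mapD(3)[OF W u u \<phi>B[OF g(1)] \<phi>B[OF h(1)]] by simp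
      qed
      have Gmem: "\<phi> (g \<otimes>\<^bsub>\<Gamma>\<^esub> h) \<in> Bij A" "compose A (\<phi> g) (\<phi> h) \<in> Bij A"
        using \<phi>B[OF gh(1)] compose_Bij[OF \<phi>B[OF g(1)] \<phi>B[OF h(1)]] by auto
      define T1 where "T1 = {t\<in>A. \<phi> (g \<otimes>\<^bsub>\<Gamma>\<^esub> h) t = compose A (\<phi> g) (\<phi> h) t}"
      define T2 where "T2 = {t\<in>A. \<phi> (g \<otimes>\<^bsub>\<Gamma>\<^esub> h) t \<in> S}"
      define T3 where "T3 = {t\<in>A. \<phi> h t \<in> S}"
      have cA: "real (card A) > 0" using A A0 by (simp add: card_gt_0_iff)
      have "real (card T1) \<ge> (1 - \<epsilon>1 / 3) * real (card A)"
      proof -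
        have "hamming_dist A (\<phi> (g \<otimes>\<^bsub>\<Gamma>\<^esub> h)) (compose A (\<phi> g) (\<phi> h)) < \<epsilon>1 / 3"
          using \<phi>(3) g h gh \<phi>B unfolding multiplicative_def by (metis BijGroup_simps(3))
        then have "1 - \<epsilon>1 / 3 < real (card T1) / real (card A)" unfolding hamming_dist_def T1_def by simp
        then show ?thesis using cA by (simp add: field_simps)
      qed
      moreover have "card T2 = card S" "card T3 = card S"
        unfolding T2_def T3_def using card_Bij_vimage[OF \<phi>B[OF gh(1)] S(1)] card_Bij_vimage[OF \<phi>B[OF h(1)]
          S(1)] by auto
      moreover have "real (card T1) + real (card T2) - real (card A) \<le> real (card (T1 \<inter> T2))"
        "real (card (T1 \<inter> T2)) + real (card T3) - real (card A) \<le> real (card (T1 \<inter> T2 \<inter> T3))"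
        by (auto intro!: card_Int_ge[OF A] simp: T1_def T2_def T3_def)
      ultimately have cT: "(1 - \<epsilon>1) * real (card A) \<le> real (card (T1 \<inter> T2 \<inter> T3))"
        using S(2) by (simp add: algebra_simps)
      have vc: "?v \<in> A \<rightarrow> carrier G"
      proof -
        have "u x (\<phi> h t) \<otimes>\<^bsub>G\<^esub> u y t \<in> carrier G" if "t \<in> A" for t
          using monoid.m_closed[OF group.is_monoid[OF grp[OF Gd]]] u Bij_imp_funcset[OF \<phi>B[OF h(1)]] that
          by (meson PiE)
        then show ?thesis by blast
      qed
      have "e (W (u z) (\<phi> (g \<otimes>\<^bsub>\<Gamma>\<^esub> h))) (W ?v (compose A (\<phi> g) (\<phi> h))) \<le> 3 * sqrt \<epsilon>1"
      proof (rule wreath_mapD(4)[OF W u vc Gmem \<epsilon>1 _ cT])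
        show "T1 \<inter> T2 \<inter> T3 \<subseteq> A" by (auto simp: T1_def)
        fix t assume t: "t \<in> T1 \<inter> T2 \<inter> T3"
        \<comment> \<open>The point moves from \<open>t\<close> to \<open>t'\<close> and on to
          \<open>s\<close>. The product of the blocks in column \<open>t\<close> belongs to
          \<open>a\<close> at \<open>s\<close> and \<open>b\<close> at \<open>t'\<close>; the block
          of the product belongs to \<open>a\<close> and \<open>\<theta> g b\<close> at
          \<open>s\<close>. So it remains to see that \<open>\<theta> g b\<close> at
          \<open>s\<close> and \<open>b\<close> at \<open>t'\<close> have the same
          transport.\<close>
        define t' where "t' = \<phi> h t"
        define s where "s = \<phi> g t'"
        have ts: "t \<in> A" "t' \<in> S" "s \<in> S" "\<phi> (g \<otimes>\<^bsub>\<Gamma>\<^esub> h) t = s"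
          using t by (auto simp: T1_def T2_def T3_def t'_def s_def compose_eq)
        have sb: "supported X b (Z b)" "Z b \<subseteq> E" "finite (Z b)" using Z[OF yF] by auto
        have gb: "\<alpha> g ` Z b \<subseteq> E" using gZ[OF xF yF] .
        have s\<theta>: "supported X (\<theta> g b) (\<alpha> g ` Z b)" by (rule supported_conj_action[OF g(1) sb(1)])
        have s\<theta>E: "supported X (\<theta> g b) E" by (rule supported_mono[OF s\<theta> gb EX(2)])
        have "lift E B (\<pi> s) (\<theta> g b) = lift (\<alpha> g ` Z b) B (\<pi> s) (\<theta> g b)"
          by (rule lift_enlarge[OF EX(1) B \<pi>[OF ts(3)] s\<theta> gb EX(2)])
        also have "\<dots> = lift (Z b) B (\<pi> t') b"
        proof (rule lift_conj_action[OF g(1) sb(1) sb(3) B])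
          show "inj_on (\<pi> s) (\<alpha> g ` Z b)" using \<pi>(1)[OF ts(3)] gb inj_on_subset by blast
          show "\<pi> s ` \<alpha> g ` Z b \<subseteq> B" using \<pi>(2)[OF ts(3)] gb by blast
          fix y assume y: "y \<in> Z b"
          have yX: "y \<in> X" using y sb EX by blast
          show "\<pi> t' y = \<pi> s (\<alpha> g y)"
            using \<pi>eq[OF g(2) _ ts(2), of "\<alpha> g y"] gb y sb(2) ts(3) act_inv(1)[OF g(1) yX]
              unfolding s_def[symmetric]
            by (simp add: image_subset_iff subset_iff)
        qed
        also have "\<dots> = lift E B (\<pi> t') b"
          by (rule lift_enlarge[OF EX(1) B \<pi>[OF ts(2)] sb(1,2) EX(2), symmetric])
        finally have l: "lift E B (\<pi> s) (\<theta> g b) = lift E B (\<pi> t') b" .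
        have lm: "lift E B (\<pi> s) (a \<otimes>\<^bsub>Aut X\<^esub> \<theta> g b) = lift E B (\<pi> s) a \<otimes>\<^bsub>Aut B\<^esub> lift E B (\<pi> t') b"
          using lift_mult[OF EX(1) B \<pi>[OF ts(3)] suppE[OF xF] s\<theta>E] l by simp
        have mem: "lift E B (\<pi> s) a \<in> F'" "lift E B (\<pi> t') b \<in> F'" "lift E B (\<pi> s) (a \<otimes>\<^bsub>Aut X\<^esub> \<theta> g b) \<in> F'"
          using ts xF yF zF unfolding F'_def by force+
        have "d (\<psi> (lift E B (\<pi> s) (a \<otimes>\<^bsub>Aut X\<^esub> \<theta> g b))) (\<psi> (lift E B (\<pi> s) a) \<otimes>\<^bsub>G\<^esub> \<psi> (lift E B (\<pi> t') b)) <
          \<epsilon>1"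
          using \<psi>(3) mem unfolding multiplicative_def lm by blast
        moreover have "u z t = \<psi> (lift E B (\<pi> s) (a \<otimes>\<^bsub>Aut X\<^esub> \<theta> g b))"
          using ts suppE[OF zF] by (simp add: u_def ze)
        moreover have "u x (\<phi> h t) = \<psi> (lift E B (\<pi> s) a)"
          using ts suppE[OF xF] by (simp add: u_def xe s_def t'_def)
        moreover have "u y t = \<psi> (lift E B (\<pi> t') b)"
          using ts suppE[OF yF] by (simp add: u_def ye t'_def)
        ultimately show "\<phi> (g \<otimes>\<^bsub>\<Gamma>\<^esub> h) t = compose A (\<phi> g) (\<phi> h) t \<and> d (u z t) (?v t) < \<epsilon>1"
          using t by (simp add: T1_def)
      qed
      then have e1: "e (W (u z) (\<phi> (g \<otimes>\<^bsub>\<Gamma>\<^esub> h))) (W ?v (compose A (\<phi> g) (\<phi> h))) < \<delta>" using s\<epsilon>1 by linarith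
      have e2: "d2 (th (g \<otimes>\<^bsub>\<Gamma>\<^esub> h)) (th g \<otimes>\<^bsub>G2\<^esub> th h) < \<delta>"
        using th(3) g h gh unfolding multiplicative_def by blast
      have "th g \<otimes>\<^bsub>G2\<^esub> th h \<in> carrier G2"
        using monoid.m_closed[OF group.is_monoid[OF grp[OF G2]]] thc[OF g(1)] thc[OF h(1)] by simp
      then have "k (\<Psi> z) (J (W ?v (compose A (\<phi> g) (\<phi> h))) (th g \<otimes>\<^bsub>G2\<^esub> th h)) < \<epsilon>"
        using J e1 e2 Wc[OF gh(1)] wreath_mapD(1)[OF W vc Gmem(2)] thc[OF gh(1)] unfolding sum_map_def \<Psi>_def
          by (simp add: ze)
      then show "k (\<Psi> (x \<otimes>\<^bsub>?L\<^esub> y)) (\<Psi> x \<otimes>\<^bsub>K\<^esub> \<Psi> y) < \<epsilon>" unfolding prod z_def .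
    qed
    moreover have "separating ?L K k F (c / 8) \<Psi>"
      unfolding separating_def
    proof (intro ballI impI)
      fix x assume x: "x \<in> F" "x \<noteq> \<one>\<^bsub>?L\<^esub>"
      obtain a g where xe: "x = (a, g)" by (cases x)
      note xF = x(1)[unfolded xe]
      note g = gF[OF xF]
      have "c \<le> e (W (u x) (\<phi> g)) \<one>\<^bsub>H\<^esub> \<or> c \<le> d2 (th g) \<one>\<^bsub>G2\<^esub>"
      proof (cases "g = \<one>\<^bsub>\<Gamma>\<^esub>")
        case False
        then have "d2 (th g) \<one>\<^bsub>G2\<^esub> > c1" using th(4) g unfolding separating_def by blast
        then show ?thesis using c(2) by linarith
      next
        case True
        then have a1: "a \<noteq> \<one>\<^bsub>Aut X\<^esub>" using x(2) by (simp add: xe linear_enrichment_simps)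
        have "c0 / 2 \<le> e (W (u x) (\<lambda>x\<in>A. x)) \<one>\<^bsub>H\<^esub>"
        proof (rule wreath_mapD(5)[OF W u S(1) _ Aapp(2)])
          have "(1 - \<epsilon>1 / 3) * real (card A) \<ge> (1/2) * real (card A)" using \<epsilon>1 by (intro mult_right_mono) auto
          then show "card A \<le> 2 * card S" using S(2) by linarith
          fix t assume t: "t \<in> S"
          have "u x t = \<psi> (lift E B (\<pi> t) a)" using t S(1) suppE[OF xF] True \<phi>1 by (auto simp: u_def xe)
          moreover have "lift E B (\<pi> t) a \<in> F'" using t xF unfolding F'_def by force
          moreover have "lift E B (\<pi> t) a \<noteq> \<one>\<^bsub>Aut B\<^esub>"
            using lift_eq_one[OF EX(1) B \<pi>[OF t] suppE[OF xF]] a1 by blast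
          ultimately show "c0 \<le> d (u x t) \<one>\<^bsub>G\<^esub>" using \<psi>(4) unfolding separating_def by force
        qed
        then have "c \<le> e (W (u x) (\<phi> g)) \<one>\<^bsub>H\<^esub>" using c(3) unfolding True \<phi>1 by linarith
        then show ?thesis ..
      qed
      then have "c / 4 \<le> k (\<Psi> x) \<one>\<^bsub>K\<^esub>" using sum_mapD(5)[OF J Wc[OF g(1)] thc[OF g(1)] c(1)] unfolding \<Psi>_def
        by (simp add: xe)
      then show "c / 8 < k (\<Psi> x) \<one>\<^bsub>K\<^esub>" using c(1) by linarith
    qed
    ultimately show "\<exists>G d \<phi>. (G, d) \<in> \<G> \<and> \<phi> \<in> carrier ?L \<rightarrow> carrier G \<and> unital ?L G \<phi> \<and>
        multiplicative ?L G d F \<epsilon> \<phi> \<and> separating ?L G d F (c / 8) \<phi>"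
      using Kk by blast
  qed
qed

end

section \<open>Families of metric groups\<close>

lemma small_sqrt:
  assumes "\<eta> > (0::real)" obtains \<epsilon> where "\<epsilon> > 0" "\<epsilon> \<le> 1" "3 * sqrt \<epsilon> < \<eta>"
proof
  let ?e = "min 1 ((\<eta> / 6)\<^sup>2)"
  show "?e > 0" "?e \<le> 1" using assms by auto
  have "sqrt ?e \<le> sqrt ((\<eta> / 6)\<^sup>2)" by (intro real_sqrt_le_mono) simp
  then show "3 * sqrt ?e < \<eta>" using assms by simp
qed

section \<open>Families indexed by size, and amplification\<close>

definition indexed_family :: "(nat \<Rightarrow> 'h monoid) \<Rightarrow> (nat \<Rightarrow> 'h \<Rightarrow> 'h \<Rightarrow> real) \<Rightarrow> ('h monoid \<times> ('h \<Rightarrow> 'h \<Rightarrow> real))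
  set" where
  "indexed_family G d = {(G n, d n) | n. n > 0}"

lemma wreath_map_const_block:
  assumes W: "wreath_map G d A H e W" and G: "group G" and A: "finite A" "A \<noteq> {}"
  defines "D \<equiv> \<lambda>x. W (\<lambda>_. x) (\<lambda>x\<in>A. x)"
  shows "x \<in> carrier G \<Longrightarrow> D x \<in> carrier H" "D \<one>\<^bsub>G\<^esub> = \<one>\<^bsub>H\<^esub>"
    "x \<in> carrier G \<Longrightarrow> y \<in> carrier G \<Longrightarrow> D x \<otimes>\<^bsub>H\<^esub> D y = D (x \<otimes>\<^bsub>G\<^esub> y)"
    "x \<in> carrier G \<Longrightarrow> y \<in> carrier G \<Longrightarrow> 0 < \<epsilon> \<Longrightarrow> \<epsilon> \<le> 1 \<Longrightarrow> d x y < \<epsilon> \<Longrightarrow> e (D x) (D y) \<le> 3 * sqrt \<epsilon>"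
    "x \<in> carrier G \<Longrightarrow> 0 < c \<Longrightarrow> c \<le> d x \<one>\<^bsub>G\<^esub> \<Longrightarrow> c / 2 \<le> e (D x) \<one>\<^bsub>H\<^esub>"
proof -
  note id = id_Bij[of A]
  show "x \<in> carrier G \<Longrightarrow> D x \<in> carrier H" unfolding D_def by (rule wreath_mapD(1)[OF W _ id]) auto
  show "D \<one>\<^bsub>G\<^esub> = \<one>\<^bsub>H\<^esub>" unfolding D_def by (rule wreath_mapD(2)[OF W])
  show "x \<in> carrier G \<Longrightarrow> y \<in> carrier G \<Longrightarrow> D x \<otimes>\<^bsub>H\<^esub> D y = D (x \<otimes>\<^bsub>G\<^esub> y)"
    unfolding D_def using wreath_mapD(3)[OF W _ _ id id, of "\<lambda>_. x" "\<lambda>_. y"] by simp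
  show "x \<in> carrier G \<Longrightarrow> y \<in> carrier G \<Longrightarrow> 0 < \<epsilon> \<Longrightarrow> \<epsilon> \<le> 1 \<Longrightarrow> d x y < \<epsilon> \<Longrightarrow> e (D x) (D y) \<le> 3 * sqrt \<epsilon>"
    unfolding D_def by (rule wreath_mapD(4)[OF W _ _ id id, where T = A]) (auto simp: algebra_simps)
  show "x \<in> carrier G \<Longrightarrow> 0 < c \<Longrightarrow> c \<le> d x \<one>\<^bsub>G\<^esub> \<Longrightarrow> c / 2 \<le> e (D x) \<one>\<^bsub>H\<^esub>"
    unfolding D_def by (rule wreath_mapD(5)[OF W, where T = A]) auto
qed

text \<open>The block sum of \<open>x\<close> and \<open>y\<close> as a wreath product over two
  points. A single block is half of the index set, so a lower bound for one of the two distances is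
  enough.\<close>

lemma wreath_map_pair:
  assumes W: "wreath_map G d {..<2::nat} H e W" and G: "group G"
  defines "P \<equiv> \<lambda>x y. W (\<lambda>t. if t = 0 then x else y) (\<lambda>x\<in>{..<2}. x)"
  shows "x \<in> carrier G \<Longrightarrow> y \<in> carrier G \<Longrightarrow> P x y \<in> carrier H" "P \<one>\<^bsub>G\<^esub> \<one>\<^bsub>G\<^esub> = \<one>\<^bsub>H\<^esub>"
    "x \<in> carrier G \<Longrightarrow> y \<in> carrier G \<Longrightarrow> x' \<in> carrier G \<Longrightarrow> y' \<in> carrier G \<Longrightarrow>
      P x y \<otimes>\<^bsub>H\<^esub> P x' y' = P (x \<otimes>\<^bsub>G\<^esub> x') (y \<otimes>\<^bsub>G\<^esub> y')"
    "x \<in> carrier G \<Longrightarrow> y \<in> carrier G \<Longrightarrow> x' \<in> carrier G \<Longrightarrow> y' \<in> carrier G \<Longrightarrow> 0 < \<epsilon> \<Longrightarrow> \<epsilon> \<le> 1 \<Longrightarrow>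
      d x x' < \<epsilon> \<Longrightarrow> d y y' < \<epsilon> \<Longrightarrow> e (P x y) (P x' y') \<le> 3 * sqrt \<epsilon>"
    "x \<in> carrier G \<Longrightarrow> y \<in> carrier G \<Longrightarrow> 0 < c \<Longrightarrow> c \<le> d x \<one>\<^bsub>G\<^esub> \<or> c \<le> d y \<one>\<^bsub>G\<^esub> \<Longrightarrow> c / 2 \<le> e (P x y) \<one>\<^bsub>H\<^esub>"
proof -
  note id = id_Bij[of "{..<2::nat}"]
  show "x \<in> carrier G \<Longrightarrow> y \<in> carrier G \<Longrightarrow> P x y \<in> carrier H" unfolding P_def
    by (rule wreath_mapD(1)[OF W _ id]) auto
  show "P \<one>\<^bsub>G\<^esub> \<one>\<^bsub>G\<^esub> = \<one>\<^bsub>H\<^esub>" unfolding P_def using wreath_mapD(2)[OF W] by simp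
  show "P x y \<otimes>\<^bsub>H\<^esub> P x' y' = P (x \<otimes>\<^bsub>G\<^esub> x') (y \<otimes>\<^bsub>G\<^esub> y')"
    if "x \<in> carrier G" "y \<in> carrier G" "x' \<in> carrier G" "y' \<in> carrier G"
  proof -
    show ?thesis
      unfolding P_def using wreath_mapD(3)[OF W _ _ id id, of "\<lambda>t. if t = 0 then x else y"
        "\<lambda>t. if t = 0 then x' else y'"] that
      by (auto intro!: wreath_mapD(6)[OF W])
  qed
  show "x \<in> carrier G \<Longrightarrow> y \<in> carrier G \<Longrightarrow> x' \<in> carrier G \<Longrightarrow> y' \<in> carrier G \<Longrightarrow> 0 < \<epsilon> \<Longrightarrow> \<epsilon> \<le> 1 \<Longrightarrow>
      d x x' < \<epsilon> \<Longrightarrow> d y y' < \<epsilon> \<Longrightarrow> e (P x y) (P x' y') \<le> 3 * sqrt \<epsilon>"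
    unfolding P_def by (rule wreath_mapD(4)[OF W _ _ id id, where T = "{..<2}"]) (auto simp: algebra_simps)
  show "x \<in> carrier G \<Longrightarrow> y \<in> carrier G \<Longrightarrow> 0 < c \<Longrightarrow> c \<le> d x \<one>\<^bsub>G\<^esub> \<or> c \<le> d y \<one>\<^bsub>G\<^esub> \<Longrightarrow> c / 2 \<le> e (P x y) \<one>\<^bsub>H\<^esub>"
    unfolding P_def by (rule wreath_mapD(5)[OF W, where T = "if c \<le> d x \<one>\<^bsub>G\<^esub> then {0} else {1}"])
      (auto split: if_splits)
qed

lemma indexed_wreath_closed:
  assumes "\<And>n A. n > 0 \<Longrightarrow> finite A \<Longrightarrow> A \<noteq> {} \<Longrightarrow> \<exists>W. wreath_map (G n) (d n) (A :: nat set) (G (n * card A))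
    (d (n * card A)) W"
  shows "wreath_closed (indexed_family G d)"
  unfolding wreath_closed_def
proof (intro allI impI)
  fix G' d' and A :: "nat set" assume "(G', d') \<in> indexed_family G d" and A: "finite A" "A \<noteq> {}"
  then obtain n where n: "n > 0" "G' = G n" "d' = d n" by (auto simp: indexed_family_def)
  have "n * card A > 0" using n A by (simp add: card_gt_0_iff)
  then have "(G (n * card A), d (n * card A)) \<in> indexed_family G d" by (auto simp: indexed_family_def)
  then show "\<exists>H e W. (H, e) \<in> indexed_family G d \<and> wreath_map G' d' A H e W" using assms[OF n(1) A] n by blast
qed

text \<open>The blocks \<open>x\<close> and \<open>y\<close> of different sizes \<open>n\<close> and \<open>m\<close> are first brought to the common size
  \<open>n * m\<close> by repetition.\<close>

lemma indexed_sum_closed: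
  assumes grp: "\<And>n. n > 0 \<Longrightarrow> group (G n)"
    and wr: "\<And>n A. n > 0 \<Longrightarrow> finite A \<Longrightarrow> A \<noteq> {} \<Longrightarrow> \<exists>W. wreath_map (G n) (d n) (A :: nat set) (G (n * card A))
      (d (n * card A)) W"
  shows "sum_closed (indexed_family G d)"
  unfolding sum_closed_def
proof (intro allI impI)
  fix \<eta> :: real assume "\<eta> > 0"
  \<comment> \<open>The square root bound is inverted twice, for the final pair and for the
    repetitions that precede it.\<close>
  then obtain \<epsilon> where \<epsilon>: "\<epsilon> > 0" "\<epsilon> \<le> 1" "3 * sqrt \<epsilon> < \<eta>" using small_sqrt by blast
  obtain \<delta> where \<delta>: "\<delta> > 0" "\<delta> \<le> 1" "3 * sqrt \<delta> < \<epsilon>" using small_sqrt[OF \<epsilon>(1)] by blast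
  show "\<exists>\<delta>>0. \<forall>G' d' H e. (G', d') \<in> indexed_family G d \<longrightarrow> (H, e) \<in> indexed_family G d \<longrightarrow>
    (\<exists>K k J. (K, k) \<in> indexed_family G d \<and> sum_map \<delta> \<eta> G' d' H e K k J)"
  proof (intro exI[of _ \<delta>] conjI \<delta>(1) allI impI)
    fix G' d' H e assume "(G', d') \<in> indexed_family G d" "(H, e) \<in> indexed_family G d"
    then obtain n m where n: "n > 0" "G' = G n" "d' = d n" and m: "m > 0" "H = G m" "e = d m"
      by (auto simp: indexed_family_def)
    have nm: "n * m > 0" using n m by simp
    have An: "finite {..<n}" "{..<n} \<noteq> {}" and Am: "finite {..<m}" "{..<m} \<noteq> {}"
      and A2: "finite {..<2::nat}" "{..<2::nat} \<noteq> {}"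
      using n m by (auto simp: lessThan_empty_iff)
    obtain W1 where W1: "wreath_map (G n) (d n) {..<m} (G (n * m)) (d (n * m)) W1" using wr[OF n(1) Am]
      by auto
    obtain W2 where W2: "wreath_map (G m) (d m) {..<n} (G (n * m)) (d (n * m)) W2" using wr[OF m(1) An]
      by (auto simp: mult.commute)
    obtain W3 where W3: "wreath_map (G (n * m)) (d (n * m)) {..<2::nat} (G (n * m * 2)) (d (n * m * 2)) W3"
      using wr[OF nm A2] by auto
    define D1 where "D1 x = W1 (\<lambda>_. x) (\<lambda>x\<in>{..<m}. x)" for x
    define D2 where "D2 x = W2 (\<lambda>_. x) (\<lambda>x\<in>{..<n}. x)" for x
    define P where "P x y = W3 (\<lambda>t. if t = 0 then x else y) (\<lambda>x\<in>{..<2::nat}. x)" for x y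
    note D1 = wreath_map_const_block[OF W1 grp[OF n(1)] Am, folded D1_def]
    note D2 = wreath_map_const_block[OF W2 grp[OF m(1)] An, folded D2_def]
    note P = wreath_map_pair[OF W3 grp[OF nm], folded P_def]
    have "sum_map \<delta> \<eta> (G n) (d n) (G m) (d m) (G (n * m * 2)) (d (n * m * 2)) (\<lambda>x y. P (D1 x) (D2 y))"
      unfolding sum_map_def
    proof (intro conjI ballI allI impI)
      fix x y assume x: "x \<in> carrier (G n)" and y: "y \<in> carrier (G m)"
      show "P (D1 x) (D2 y) \<in> carrier (G (n * m * 2))" using P(1) D1(1)[OF x] D2(1)[OF y] .
      { fix c :: real assume c: "c > 0" "c \<le> d n x \<one>\<^bsub>G n\<^esub> \<or> c \<le> d m y \<one>\<^bsub>G m\<^esub>"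
        then have "c / 2 \<le> d (n * m) (D1 x) \<one>\<^bsub>G (n * m)\<^esub> \<or> c / 2 \<le> d (n * m) (D2 y) \<one>\<^bsub>G (n * m)\<^esub>"
          using D1(5)[OF x c(1)] D2(5)[OF y c(1)] by blast
        then show "c / 4 \<le> d (n * m * 2) (P (D1 x) (D2 y)) \<one>\<^bsub>G (n * m * 2)\<^esub>"
          using P(5)[OF D1(1)[OF x] D2(1)[OF y], of "c / 2"] c(1) by simp }
      fix x' y' assume x': "x' \<in> carrier (G n)" and y': "y' \<in> carrier (G m)"
      show "P (D1 x) (D2 y) \<otimes>\<^bsub>G (n * m * 2)\<^esub> P (D1 x') (D2 y') = P (D1 (x \<otimes>\<^bsub>G n\<^esub> x')) (D2 (y \<otimes>\<^bsub>G m\<^esub> y'))"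
        using P(3)[OF D1(1)[OF x] D2(1)[OF y] D1(1)[OF x'] D2(1)[OF y']] D1(3)[OF x x'] D2(3)[OF y y'] by simp
      assume dx: "d n x x' < \<delta>" and dy: "d m y y' < \<delta>"
      have "d (n * m) (D1 x) (D1 x') < \<epsilon>" "d (n * m) (D2 y) (D2 y') < \<epsilon>"
        using D1(4)[OF x x' \<delta>(1,2) dx] D2(4)[OF y y' \<delta>(1,2) dy] \<delta>(3) by linarith+
      then show "d (n * m * 2) (P (D1 x) (D2 y)) (P (D1 x') (D2 y')) < \<eta>"
        using P(4)[OF D1(1)[OF x] D2(1)[OF y] D1(1)[OF x'] D2(1)[OF y'] \<epsilon>(1,2)] \<epsilon>(3) by linarith
    qed (use P(2) D1(2) D2(2) in simp)
    moreover have "(G (n * m * 2), d (n * m * 2)) \<in> indexed_family G d" using nm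
      by (force simp: indexed_family_def)
    ultimately show "\<exists>K k J. (K, k) \<in> indexed_family G d \<and> sum_map \<delta> \<eta> G' d' H e K k J"
      unfolding n(2,3) m(2,3) by blast
  qed
qed

text \<open>Iterating the maps \<open>S\<close> brings every separation constant up to \<open>\<kappa> / 2\<close>. The point is that the result does
  not depend on the initial constant: the theorem assumes a separation constant for each
  \<open>Aut(R[Z])\<close>, but its proof needs one that is good for all \<open>Z\<close>.\<close>

definition amplification :: "real \<Rightarrow> ('h monoid \<times> ('h \<Rightarrow> 'h \<Rightarrow> real)) set \<Rightarrow> bool" where
  "amplification \<kappa> \<G> \<longleftrightarrow> \<kappa> > 0 \<and> (\<forall>\<eta>>0. \<exists>\<delta>>0. \<forall>G d. (G, d) \<in> \<G> \<longrightarrow> (\<exists>H e S. (H, e) \<in> \<G> \<and> S \<in> hom G H \<and>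
    S \<one>\<^bsub>G\<^esub> = \<one>\<^bsub>H\<^esub> \<and>
     (\<forall>x\<in>carrier G. \<forall>y\<in>carrier G. d x y < \<delta> \<longrightarrow> e (S x) (S y) < \<eta>) \<and>
     (\<forall>x\<in>carrier G. min \<kappa> (11 / 10 * d x \<one>\<^bsub>G\<^esub>) \<le> e (S x) \<one>\<^bsub>H\<^esub>)))"

lemma approximable_on_amplify:
  assumes grp: "\<And>G d. (G, d) \<in> \<G> \<Longrightarrow> group G" and am: "amplification \<kappa> \<G>" and Q: "approximable_on F c \<G> \<Gamma>"
    and F: "F \<subseteq> carrier \<Gamma>" and c: "c > 0"
  shows "approximable_on F (min (\<kappa> / 2) (11 / 10 * c)) \<G> \<Gamma>"
proof (rule approximable_onI)
  fix \<epsilon> :: real assume "\<epsilon> > 0"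
  then obtain \<delta> where \<delta>: "\<delta> > 0" and S: "\<And>G d. (G, d) \<in> \<G> \<Longrightarrow> \<exists>H e S. (H, e) \<in> \<G> \<and> S \<in> hom G H \<and> S \<one>\<^bsub>G\<^esub> = \<one>\<^bsub>H\<^esub> \<and>
     (\<forall>x\<in>carrier G. \<forall>y\<in>carrier G. d x y < \<delta> \<longrightarrow> e (S x) (S y) < \<epsilon>) \<and>
     (\<forall>x\<in>carrier G. min \<kappa> (11 / 10 * d x \<one>\<^bsub>G\<^esub>) \<le> e (S x) \<one>\<^bsub>H\<^esub>)"
    using am unfolding amplification_def by metis
  obtain G d \<phi> where Gd: "(G, d) \<in> \<G>" and \<phi>: "\<phi> \<in> carrier \<Gamma> \<rightarrow> carrier G"
        "unital \<Gamma> G \<phi>" "multiplicative \<Gamma> G d F \<delta> \<phi>" "separating \<Gamma> G d F c \<phi>"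
    using approximable_onE[OF Q \<delta>] .
  obtain H e S where He: "(H, e) \<in> \<G>" and S: "S \<in> hom G H" "S \<one>\<^bsub>G\<^esub> = \<one>\<^bsub>H\<^esub>"
     "\<And>x y. x\<in>carrier G \<Longrightarrow> y\<in>carrier G \<Longrightarrow> d x y < \<delta> \<Longrightarrow> e (S x) (S y) < \<epsilon>"
     "\<And>x. x\<in>carrier G \<Longrightarrow> min \<kappa> (11 / 10 * d x \<one>\<^bsub>G\<^esub>) \<le> e (S x) \<one>\<^bsub>H\<^esub>"
    using S[OF Gd] by metis
  interpret G: group G by (rule grp[OF Gd])
  have \<phi>c: "\<phi> g \<in> carrier G" if "g \<in> F" for g using \<phi>(1) F that by blast
  have "S \<circ> \<phi> \<in> carrier \<Gamma> \<rightarrow> carrier H" using \<phi>(1) S(1) by (auto simp: hom_def Pi_def)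
  moreover have "unital \<Gamma> H (S \<circ> \<phi>)" using \<phi>(2) S(2) by (simp add: unital_def)
  moreover have "multiplicative \<Gamma> H e F \<epsilon> (S \<circ> \<phi>)"
    unfolding multiplicative_def
  proof (intro ballI impI)
    fix g h assume g: "g \<in> F" "h \<in> F" "g \<otimes>\<^bsub>\<Gamma>\<^esub> h \<in> F"
    then have "d (\<phi> (g \<otimes>\<^bsub>\<Gamma>\<^esub> h)) (\<phi> g \<otimes>\<^bsub>G\<^esub> \<phi> h) < \<delta>" using \<phi>(3) by (simp add: multiplicative_def)
    then show "e ((S \<circ> \<phi>) (g \<otimes>\<^bsub>\<Gamma>\<^esub> h)) ((S \<circ> \<phi>) g \<otimes>\<^bsub>H\<^esub> (S \<circ> \<phi>) h) < \<epsilon>"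
      using S(3) g \<phi>c by (simp flip: hom_mult[OF S(1)])
  qed
  moreover have "separating \<Gamma> H e F (min (\<kappa> / 2) (11 / 10 * c)) (S \<circ> \<phi>)"
    unfolding separating_def
  proof (intro ballI impI)
    fix g assume g: "g \<in> F" "g \<noteq> \<one>\<^bsub>\<Gamma>\<^esub>"
    then have "c < d (\<phi> g) \<one>\<^bsub>G\<^esub>" using \<phi>(4) by (simp add: separating_def)
    moreover have "\<kappa> > 0" using am by (simp add: amplification_def)
    \<comment> \<open>Halving \<open>\<kappa>\<close> makes this strict, as separation
      demands.\<close>
    ultimately have "min (\<kappa> / 2) (11 / 10 * c) < min \<kappa> (11 / 10 * d (\<phi> g) \<one>\<^bsub>G\<^esub>)"
      by (auto simp: min_less_iff_disj)
    then show "min (\<kappa> / 2) (11 / 10 * c) < e ((S \<circ> \<phi>) g) \<one>\<^bsub>H\<^esub>"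
      unfolding comp_apply using S(4)[OF \<phi>c[OF g(1)]] by (rule less_le_trans)
  qed
  ultimately show "\<exists>G d \<phi>. (G, d) \<in> \<G> \<and> \<phi> \<in> carrier \<Gamma> \<rightarrow> carrier G \<and>
        unital \<Gamma> G \<phi> \<and> multiplicative \<Gamma> G d F \<epsilon> \<phi> \<and> separating \<Gamma> G d F (min (\<kappa> / 2) (11 / 10 * c)) \<phi>"
    using He by blast
qed

text \<open>The number \<open>k\<close> of repetitions is chosen from \<open>c\<close> and
  \<open>\<kappa>\<close> before any precision. Since \<open>approximable_on\<close> covers all
  precisions, every repetition may start from a better one than it has to deliver.\<close>

lemma approximable_at_amplify:
  assumes grp: "\<And>G d. (G, d) \<in> \<G> \<Longrightarrow> group G" and am: "amplification \<kappa> \<G>"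
    and Q: "\<And>F. finite F \<Longrightarrow> F \<subseteq> carrier \<Gamma> \<Longrightarrow> \<exists>c>0. approximable_on F c \<G> \<Gamma>"
  shows "approximable_at (\<kappa> / 2) \<G> \<Gamma>"
  unfolding approximable_at_def
proof (intro allI impI)
  fix F assume F: "finite F" "F \<subseteq> carrier \<Gamma>"
  obtain c where c: "c > 0" "approximable_on F c \<G> \<Gamma>" using Q[OF F] by blast
  have \<kappa>: "\<kappa> > 0" using am by (simp add: amplification_def)
  have it: "approximable_on F (min (\<kappa> / 2) ((11 / 10) ^ k * c)) \<G> \<Gamma>" for k
  proof (induction k)
    case 0
    show ?case
    proof (rule approximable_onI)
      fix \<epsilon> :: real assume "\<epsilon> > 0"
      from approximable_onE[OF c(2) this] obtain G d \<phi> where "(G, d) \<in> \<G>" "\<phi> \<in> carrier \<Gamma> \<rightarrow> carrier G"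
        "unital \<Gamma> G \<phi>" "multiplicative \<Gamma> G d F \<epsilon> \<phi>" "separating \<Gamma> G d F c \<phi>" .
      moreover from this(5) have "separating \<Gamma> G d F (min (\<kappa> / 2) ((11 / 10) ^ 0 * c)) \<phi>"
        by (auto simp: separating_def min_less_iff_disj)
      ultimately show "\<exists>G d \<phi>. (G, d) \<in> \<G> \<and> \<phi> \<in> carrier \<Gamma> \<rightarrow> carrier G \<and> unital \<Gamma> G \<phi> \<and>
        multiplicative \<Gamma> G d F \<epsilon> \<phi> \<and> separating \<Gamma> G d F (min (\<kappa> / 2) ((11 / 10) ^ 0 * c)) \<phi>" by blast
    qed
  next
    case (Suc k)
    have "approximable_on F (min (\<kappa> / 2) (11 / 10 * min (\<kappa> / 2) ((11 / 10) ^ k * c))) \<G> \<Gamma>"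
      by (rule approximable_on_amplify[OF grp am Suc F(2)]) (use \<kappa> c in auto)
    moreover have "min (\<kappa> / 2) (11 / 10 * min (\<kappa> / 2) ((11 / 10) ^ k * c)) =
      min (\<kappa> / 2) ((11 / 10) ^ Suc k * c)"
      using \<kappa> by (auto simp: min_def)
    ultimately show ?case by simp
  qed
  obtain k where "\<kappa> / 2 / c < (11 / 10 :: real) ^ k" using real_arch_pow[of "11/10"] by auto
  then have "min (\<kappa> / 2) ((11 / 10) ^ k * c) = \<kappa> / 2" using c(1) by (simp add: field_simps)
  then show "approximable_on F (\<kappa> / 2) \<G> \<Gamma>" using it[of k] by simp
qed

section \<open>From local embeddings into finite groups to approximations\<close>

definition locally_embeddable_into_finite :: "('g, 'a) monoid_scheme \<Rightarrow> bool" where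
  "locally_embeddable_into_finite \<Gamma> \<longleftrightarrow> (\<forall>F. finite F \<longrightarrow> F \<subseteq> carrier \<Gamma> \<longrightarrow>
    (\<exists>(Q :: nat monoid) \<phi>. group Q \<and> finite (carrier Q) \<and> \<phi> \<in> carrier \<Gamma> \<rightarrow> carrier Q \<and> unital \<Gamma> Q \<phi> \<and>
      (\<forall>g\<in>F. \<forall>h\<in>F. g \<otimes>\<^bsub>\<Gamma>\<^esub> h \<in> F \<longrightarrow> \<phi> (g \<otimes>\<^bsub>\<Gamma>\<^esub> h) = \<phi> g \<otimes>\<^bsub>Q\<^esub> \<phi> h) \<and> (\<forall>g\<in>F. g \<noteq> \<one>\<^bsub>\<Gamma>\<^esub> \<longrightarrow> \<phi> g \<noteq> \<one>\<^bsub>Q\<^esub>)))"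

text \<open>The families are sets of arbitrary pairs, so \<open>d (j x) (j x) = 0\<close>, an axiom
  for metrics, is requested explicitly.\<close>

definition contains_finite_groups :: "('h monoid \<times> ('h \<Rightarrow> 'h \<Rightarrow> real)) set \<Rightarrow> bool" where
  "contains_finite_groups \<G> \<longleftrightarrow> (\<forall>Q :: nat monoid. group Q \<longrightarrow> finite (carrier Q) \<longrightarrow>
    (\<exists>G d j. (G, d) \<in> \<G> \<and> j \<in> hom Q G \<and> j \<one>\<^bsub>Q\<^esub> = \<one>\<^bsub>G\<^esub> \<and> (\<forall>x\<in>carrier Q. d (j x) (j x) = 0) \<and>
      (\<forall>x\<in>carrier Q. x \<noteq> \<one>\<^bsub>Q\<^esub> \<longrightarrow> 0 < d (j x) \<one>\<^bsub>G\<^esub>)))"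

text \<open>The composite map is exactly multiplicative on \<open>F\<close>, so it serves every
  precision. Its separation is the least distance of finitely many elements from \<open>1\<close>
  and therefore depends on \<open>F\<close>.\<close>

lemma approximable_on_if_locally_embeddable:
  assumes L: "locally_embeddable_into_finite \<Gamma>" and C: "contains_finite_groups \<G>"
    and F: "finite F" "F \<subseteq> carrier \<Gamma>"
  shows "\<exists>c>0. approximable_on F c \<G> \<Gamma>"
proof -
  obtain Q :: "nat monoid" and \<phi> where Q: "group Q" "finite (carrier Q)"
    and \<phi>: "\<phi> \<in> carrier \<Gamma> \<rightarrow> carrier Q" "unital \<Gamma> Q \<phi>"
      "\<And>g h. g\<in>F \<Longrightarrow> h\<in>F \<Longrightarrow> g \<otimes>\<^bsub>\<Gamma>\<^esub> h \<in> F \<Longrightarrow> \<phi> (g \<otimes>\<^bsub>\<Gamma>\<^esub> h) = \<phi> g \<otimes>\<^bsub>Q\<^esub> \<phi> h" "\<And>g. g\<in>F \<Longrightarrow> g \<noteq> \<one>\<^bsub>\<Gamma>\<^esub> \<Longrightarrow> \<phi> g \<noteq> \<one>\<^bsub>Q\<^esub>"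
    using L F unfolding locally_embeddable_into_finite_def by metis
  obtain G d j where G: "(G, d) \<in> \<G>" "j \<in> hom Q G" "j \<one>\<^bsub>Q\<^esub> = \<one>\<^bsub>G\<^esub>" "\<And>x. x\<in>carrier Q \<Longrightarrow> d (j x) (j x) = 0"
     "\<And>x. x\<in>carrier Q \<Longrightarrow> x \<noteq> \<one>\<^bsub>Q\<^esub> \<Longrightarrow> 0 < d (j x) \<one>\<^bsub>G\<^esub>"
    using C Q unfolding contains_finite_groups_def by metis
  \<comment> \<open>The additional \<open>1\<close> keeps \<open>Min\<close> meaningful if
    \<open>F\<close> has no nontrivial element.\<close>
  define c where "c = Min (insert 1 ((\<lambda>g. d (j (\<phi> g)) \<one>\<^bsub>G\<^esub>) ` (F - {\<one>\<^bsub>\<Gamma>\<^esub>})))"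
  have \<phi>c: "\<phi> g \<in> carrier Q" if "g \<in> F" for g using \<phi>(1) F that by blast
  have c: "c > 0" unfolding c_def using F(1) G(5) \<phi>c \<phi>(4) by (subst Min_gr_iff) auto
  have "approximable_on F (c / 2) \<G> \<Gamma>"
  proof (intro approximable_onI exI conjI)
    fix \<epsilon> :: real assume \<epsilon>: "\<epsilon> > 0"
    show "(G, d) \<in> \<G>" by fact
    show "j \<circ> \<phi> \<in> carrier \<Gamma> \<rightarrow> carrier G" using \<phi>(1) G(2) by (auto simp: hom_def Pi_def)
    show "unital \<Gamma> G (j \<circ> \<phi>)" using \<phi>(2) G(3) by (simp add: unital_def)
    show "multiplicative \<Gamma> G d F \<epsilon> (j \<circ> \<phi>)"
      unfolding multiplicative_def
    proof (intro ballI impI)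
      fix g h assume g: "g \<in> F" "h \<in> F" "g \<otimes>\<^bsub>\<Gamma>\<^esub> h \<in> F"
      then show "d ((j \<circ> \<phi>) (g \<otimes>\<^bsub>\<Gamma>\<^esub> h)) ((j \<circ> \<phi>) g \<otimes>\<^bsub>G\<^esub> (j \<circ> \<phi>) h) < \<epsilon>"
        using G(4)[OF \<phi>c[OF g(3)]] \<epsilon> \<phi>(3)[OF g] \<phi>c by (simp add: hom_mult[OF G(2)])
    qed
    show "separating \<Gamma> G d F (c / 2) (j \<circ> \<phi>)"
      unfolding separating_def
    proof (intro ballI impI)
      fix g assume "g \<in> F" "g \<noteq> \<one>\<^bsub>\<Gamma>\<^esub>"
      then have "c \<le> d (j (\<phi> g)) \<one>\<^bsub>G\<^esub>" unfolding c_def using F(1) by (intro Min_le) auto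
      then show "c / 2 < d ((j \<circ> \<phi>) g) \<one>\<^bsub>G\<^esub>" using c by simp
    qed
  qed
  then show ?thesis using c by (intro exI[of _ "c / 2"]) simp
qed

section \<open>Symmetric groups\<close>

text \<open>Conjugation by an enumeration \<open>\<beta>\<close>, so that permutations can be built
  on products of index sets and still end up in a group of the family.\<close>

definition relabel :: "nat \<Rightarrow> (nat \<Rightarrow> 'i) \<Rightarrow> ('i \<Rightarrow> 'i) \<Rightarrow> nat \<Rightarrow> nat" where
  "relabel N \<beta> f = (\<lambda>x\<in>{..<N}. inv_into {..<N} \<beta> (f (\<beta> x)))"

lemma card_relabel:
  assumes \<beta>: "bij_betw \<beta> {..<N} I" shows "card {x\<in>{..<N}. P (\<beta> x)} = card {i\<in>I. P i}"
proof -
  have "bij_betw \<beta> {x\<in>{..<N}. P (\<beta> x)} {i\<in>I. P i}"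
    using \<beta> by (auto simp: bij_betw_def inj_on_def image_iff)
  then show ?thesis by (rule bij_betw_same_card)
qed

context
  fixes N :: nat and \<beta> :: "nat \<Rightarrow> 'i" and I :: "'i set"
  assumes \<beta>: "bij_betw \<beta> {..<N} I"
begin

lemma relabel_simps:
  "x < N \<Longrightarrow> f \<in> I \<rightarrow> I \<Longrightarrow> \<beta> (relabel N \<beta> f x) = f (\<beta> x)"
  "x < N \<Longrightarrow> f \<in> I \<rightarrow> I \<Longrightarrow> relabel N \<beta> f x < N"
proof -
  assume x: "x < N" and f: "f \<in> I \<rightarrow> I"
  have "f (\<beta> x) \<in> I" using \<beta> x f by (auto simp: bij_betw_def)
  then show "\<beta> (relabel N \<beta> f x) = f (\<beta> x)" "relabel N \<beta> f x < N"
    using \<beta> x inv_into_into[of "f (\<beta> x)" \<beta> "{..<N}"] by (auto simp: relabel_def bij_betw_def f_inv_into_f)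
qed

lemma relabel_eq_iff:
  assumes "x < N" "f \<in> I \<rightarrow> I" "g \<in> I \<rightarrow> I" shows "relabel N \<beta> f x = relabel N \<beta> g x \<longleftrightarrow> f (\<beta> x) = g (\<beta> x)"
  using relabel_simps[OF assms(1)] assms \<beta> by (metis bij_betw_imp_inj_on inj_onD lessThan_iff)

lemma relabel_Bij:
  assumes "bij_betw f I I" shows "relabel N \<beta> f \<in> Bij {..<N}"
proof -
  have f: "f \<in> I \<rightarrow> I" using assms by (auto simp: bij_betw_def)
  have "inj_on (relabel N \<beta> f) {..<N}"
  proof (rule inj_onI)
    fix x y assume xy: "x \<in> {..<N}" "y \<in> {..<N}" "relabel N \<beta> f x = relabel N \<beta> f y"
    then have "f (\<beta> x) = f (\<beta> y)" using relabel_simps(1)[OF _ f] by (metis lessThan_iff)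
    then show "x = y" using assms \<beta> xy by (metis bij_betwE bij_betw_imp_inj_on inj_onD)
  qed
  moreover have "relabel N \<beta> f ` {..<N} \<subseteq> {..<N}" using relabel_simps(2)[OF _ f] by auto
  ultimately have "bij_betw (relabel N \<beta> f) {..<N} {..<N}" by (simp add: bij_betw_def endo_inj_surj)
  then show ?thesis by (auto simp: Bij_def relabel_def)
qed

lemma relabel_compose:
  assumes "f \<in> I \<rightarrow> I" "g \<in> I \<rightarrow> I" shows "compose {..<N} (relabel N \<beta> f) (relabel N \<beta> g) =
    relabel N \<beta> (\<lambda>i. f (g i))"
proof
  fix x
  have "\<beta> x \<in> I" if "x < N" using \<beta> that by (auto simp: bij_betw_def)
  then show "compose {..<N} (relabel N \<beta> f) (relabel N \<beta> g) x = relabel N \<beta> (\<lambda>i. f (g i)) x"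
    using relabel_simps[OF _ assms(2)] by (auto simp: compose_def relabel_def)
qed

lemma relabel_cong: "(\<And>i. i \<in> I \<Longrightarrow> f i = g i) \<Longrightarrow> relabel N \<beta> f = relabel N \<beta> g"
  using \<beta> by (auto simp: relabel_def bij_betw_def)

lemma relabel_id: "(\<And>i. i \<in> I \<Longrightarrow> f i = i) \<Longrightarrow> relabel N \<beta> f = (\<lambda>x\<in>{..<N}. x)"
  using \<beta> by (auto simp: relabel_def bij_betw_def fun_eq_iff)

lemma hamming_relabel:
  assumes "f \<in> I \<rightarrow> I" "g \<in> I \<rightarrow> I" shows "hamming_dist {..<N} (relabel N \<beta> f) (relabel N \<beta> g) =
    1 - card {i\<in>I. f i = g i} / card I"
proof -
  have "{x\<in>{..<N}. relabel N \<beta> f x = relabel N \<beta> g x} = {x\<in>{..<N}. f (\<beta> x) = g (\<beta> x)}"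
    using relabel_eq_iff assms by auto
  moreover have "N = card I" using bij_betw_same_card[OF \<beta>] by simp
  ultimately show ?thesis using card_relabel[OF \<beta>, of "\<lambda>i. f i = g i"] by (simp add: hamming_dist_def)
qed
end

lemma exists_enumeration:
  assumes "finite I" "card I = N" obtains \<beta> where "bij_betw \<beta> {..<N} I"
  using ex_bij_betw_nat_finite[OF assms(1)] assms(2) by (auto simp: atLeast0LessThan)

lemma card_pairs: "finite A \<Longrightarrow> finite C \<Longrightarrow> card {p\<in>A \<times> C. P (fst p) (snd p)} = (\<Sum>t\<in>A. card {i\<in>C. P t i})"
proof -
  assume "finite A" "finite C"
  moreover have "{p\<in>A \<times> C. P (fst p) (snd p)} = Sigma A (\<lambda>t. {i\<in>C. P t i})" by auto
  ultimately show ?thesis by (simp add: card_SigmaI)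
qed

lemma hamming_card: "card A > 0 \<Longrightarrow> real (card {a\<in>A. f a = g a}) = (1 - hamming_dist A f g) * real (card A)"
  by (simp add: hamming_dist_def field_simps)

lemma BijD: "f \<in> Bij S \<Longrightarrow> bij_betw f S S" by (simp add: Bij_def)

text \<open>In the Hamming, rank and averaged metrics the loss is linear, \<open>\<epsilon>\<close>
  from the exceptional blocks and \<open>\<epsilon>\<close> from the others; this fits it under the
  bound of \<open>wreath_map\<close>.\<close>

lemma double_le_three_sqrt: "0 < \<epsilon> \<Longrightarrow> \<epsilon> \<le> 1 \<Longrightarrow> 2 * \<epsilon> \<le> 3 * sqrt (\<epsilon>::real)"
proof -
  assume e: "0 < \<epsilon>" "\<epsilon> \<le> 1"
  have "\<epsilon> = sqrt \<epsilon> * sqrt \<epsilon>" using e by simp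
  also have "\<dots> \<le> 1 * sqrt \<epsilon>" using e by (intro mult_right_mono) auto
  finally show ?thesis using e by (simp add: real_sqrt_ge_zero)
qed

section \<open>Wreath products and amplification of permutations\<close>

abbreviation "sym_group n \<equiv> BijGroup {..<n::nat}"
abbreviation "sym_dist n \<equiv> hamming_dist {..<n::nat}"

text \<open>The imprimitive action of the wreath product on pairs: \<open>(t, i)\<close> goes to
  \<open>(\<sigma> t, u t i)\<close>. Agreement of two images is counted fibre by fibre.\<close>

lemma wreath_map_sym:
  assumes n: "n > 0" and A: "finite (A :: nat set)" "A \<noteq> {}"
  shows "\<exists>W. wreath_map (sym_group n) (sym_dist n) A (sym_group (n * card A)) (sym_dist (n * card A)) W"
proof -
  let ?I = "A \<times> {..<n}" and ?N = "n * card A"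
  obtain \<beta> where \<beta>: "bij_betw \<beta> {..<?N} ?I" using exists_enumeration[of ?I ?N] A
    by (auto simp: card_cartesian_product)
  have cA: "card A > 0" using A by (simp add: card_gt_0_iff)
  define f :: "(nat \<Rightarrow> nat \<Rightarrow> nat) \<Rightarrow> (nat \<Rightarrow> nat) \<Rightarrow> nat \<times> nat \<Rightarrow> nat \<times> nat"
    where "f u \<sigma> = (\<lambda>(t, i). (\<sigma> t, u t i))" for u \<sigma>
  define W where "W u \<sigma> = relabel ?N \<beta> (f u \<sigma>)" for u \<sigma>
  have fin: "f u \<sigma> \<in> ?I \<rightarrow> ?I" if "u \<in> A \<rightarrow> Bij {..<n}" "\<sigma> \<in> Bij A" for u \<sigma>
    using that by (auto simp: f_def dest!: Bij_imp_funcset)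
  have fb: "bij_betw (f u \<sigma>) ?I ?I" if u: "u \<in> A \<rightarrow> Bij {..<n}" and s: "\<sigma> \<in> Bij A" for u \<sigma>
  proof -
    have "inj_on (f u \<sigma>) ?I"
    proof (rule inj_onI)
      fix p q assume pq: "p \<in> ?I" "q \<in> ?I" "f u \<sigma> p = f u \<sigma> q"
      obtain t i t' i' where p: "p = (t, i)" and q: "q = (t', i')" by (cases p, cases q) auto
      have t: "t \<in> A" "t' \<in> A" "i \<in> {..<n}" "i' \<in> {..<n}" "f u \<sigma> (t, i) = f u \<sigma> (t', i')" using pq p q by auto
      then have tt: "t = t'" using BijD[OF s] by (auto simp: f_def bij_betw_def inj_on_def)
      have "bij_betw (u t) {..<n} {..<n}" using u t BijD by blast
      then show "p = q" unfolding p q using tt t by (auto simp: f_def bij_betw_def inj_on_def)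
    qed
    moreover have "f u \<sigma> ` ?I \<subseteq> ?I" using funcset_image[OF fin[OF that]] .
    ultimately show ?thesis using A(1) by (simp add: bij_betw_def endo_inj_surj)
  qed
  have dist: "hamming_dist {..<?N} (W u \<sigma>) (W v \<tau>) =
    1 - (\<Sum>t\<in>A. real (card {i\<in>{..<n}. \<sigma> t = \<tau> t \<and> u t i = v t i})) / (real n * real (card A))"
    if "u \<in> A \<rightarrow> Bij {..<n}" "\<sigma> \<in> Bij A" "v \<in> A \<rightarrow> Bij {..<n}" "\<tau> \<in> Bij A" for u \<sigma> v \<tau>
  proof -
    have "{p\<in>?I. f u \<sigma> p = f v \<tau> p} = {p\<in>?I. \<sigma> (fst p) = \<tau> (fst p) \<and> u (fst p) (snd p) = v (fst p) (snd p)}"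
      by (auto simp: f_def)
    then have "card {p\<in>?I. f u \<sigma> p = f v \<tau> p} = (\<Sum>t\<in>A. card {i\<in>{..<n}. \<sigma> t = \<tau> t \<and> u t i = v t i})"
      using card_pairs[OF A(1), of "{..<n}" "\<lambda>t i. \<sigma> t = \<tau> t \<and> u t i = v t i"] by simp
    then show ?thesis unfolding W_def hamming_relabel[OF \<beta> fin[OF that(1,2)] fin[OF that(3,4)]]
      by (simp add: card_cartesian_product mult.commute)
  qed
  have "wreath_map (sym_group n) (sym_dist n) A (sym_group ?N) (sym_dist ?N) W"
    unfolding wreath_map_def
  proof (intro conjI allI impI; (simp only: BijGroup_simps(1))?)
    show "W u \<sigma> \<in> Bij {..<?N}" if "u \<in> A \<rightarrow> Bij {..<n}" "\<sigma> \<in> Bij A" for u \<sigma>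
      unfolding W_def by (rule relabel_Bij[OF \<beta> fb[OF that]])
    show "W (\<lambda>_. \<one>\<^bsub>sym_group n\<^esub>) (\<lambda>x\<in>A. x) = \<one>\<^bsub>sym_group ?N\<^esub>"
      unfolding W_def BijGroup_simps(2) by (rule relabel_id[OF \<beta>]) (auto simp: f_def)
    show "W u \<sigma> = W v \<sigma>" if "\<forall>t\<in>A. u t = v t" for u v \<sigma>
      unfolding W_def by (rule relabel_cong[OF \<beta>]) (use that in \<open>auto simp: f_def\<close>)
    show "W u \<sigma> \<otimes>\<^bsub>sym_group ?N\<^esub> W v \<tau> = W (\<lambda>t. u (\<tau> t) \<otimes>\<^bsub>sym_group n\<^esub> v t) (compose A \<sigma> \<tau>)"
      if "u \<in> A \<rightarrow> Bij {..<n}" "v \<in> A \<rightarrow> Bij {..<n}" "\<sigma> \<in> Bij A" "\<tau> \<in> Bij A" for u \<sigma> v \<tau>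
    proof -
      have "W u \<sigma> \<otimes>\<^bsub>sym_group ?N\<^esub> W v \<tau> = compose {..<?N} (W u \<sigma>) (W v \<tau>)"
        unfolding W_def by (rule BijGroup_simps(3)) (intro relabel_Bij[OF \<beta> fb] that)+
      also have "\<dots> = relabel ?N \<beta> (\<lambda>i. f u \<sigma> (f v \<tau> i))"
        unfolding W_def by (rule relabel_compose[OF \<beta>]) (intro fin that)+
      also have "\<dots> = W (\<lambda>t. u (\<tau> t) \<otimes>\<^bsub>sym_group n\<^esub> v t) (compose A \<sigma> \<tau>)"
        unfolding W_def
      proof (rule relabel_cong[OF \<beta>])
        fix p assume p: "p \<in> ?I"
        obtain t i where pe: "p = (t, i)" by (cases p)
        have t: "t \<in> A" "i \<in> {..<n}" using p pe by auto
        have "\<tau> t \<in> A" using Bij_imp_funcset[OF that(4)] t by blast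
        then have "u (\<tau> t) \<in> Bij {..<n}" "v t \<in> Bij {..<n}" using that t by auto
        then show "f u \<sigma> (f v \<tau> p) = f (\<lambda>t. u (\<tau> t) \<otimes>\<^bsub>sym_group n\<^esub> v t) (compose A \<sigma> \<tau>) p"
          unfolding pe using t by (simp add: f_def compose_eq)
      qed
      finally show ?thesis .
    qed
    show "hamming_dist {..<?N} (W u \<sigma>) (W v \<tau>) \<le> 3 * sqrt \<epsilon>"
      if u: "u \<in> A \<rightarrow> Bij {..<n}" "v \<in> A \<rightarrow> Bij {..<n}" "\<sigma> \<in> Bij A" "\<tau> \<in> Bij A" and e: "0 < \<epsilon>" "\<epsilon> \<le> 1"
        and T: "T \<subseteq> A" "(1 - \<epsilon>) * real (card A) \<le> real (card T)" and g: "\<forall>t\<in>T. \<sigma> t = \<tau> t \<and>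
          sym_dist n (u t) (v t) < \<epsilon>" for u \<sigma> v \<tau> T \<epsilon>
    proof -
      have "(1 - \<epsilon>) * ((1 - \<epsilon>) * real (card A) * real n) \<le> (1 - \<epsilon>) * (real (card T) * real n)"
        using T e by (intro mult_left_mono mult_right_mono) auto
      also have "\<dots> = (\<Sum>t\<in>T. (1 - \<epsilon>) * real n)" by simp
      also have "\<dots> \<le> (\<Sum>t\<in>T. real (card {i\<in>{..<n}. \<sigma> t = \<tau> t \<and> u t i = v t i}))"
      proof (rule sum_mono)
        fix t assume t: "t \<in> T"
        have "real (card {i\<in>{..<n}. u t i = v t i}) = (1 - sym_dist n (u t) (v t)) * real n"
          using hamming_card[of "{..<n}" "u t" "v t"] n by simp
        moreover have "(1 - \<epsilon>) * real n \<le> (1 - sym_dist n (u t) (v t)) * real n" using g t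
          by (intro mult_right_mono) auto
        ultimately show "(1 - \<epsilon>) * real n \<le> real (card {i\<in>{..<n}. \<sigma> t = \<tau> t \<and> u t i = v t i})" using g t
          by simp
      qed
      also have "\<dots> \<le> (\<Sum>t\<in>A. real (card {i\<in>{..<n}. \<sigma> t = \<tau> t \<and> u t i = v t i}))"
        using T A by (intro sum_mono2) auto
      finally have "(1 - \<epsilon>) * (1 - \<epsilon>) \<le> (\<Sum>t\<in>A. real (card {i\<in>{..<n}. \<sigma> t = \<tau> t \<and> u t i = v t i})) /
        (real n * real (card A))"
        using n cA by (simp add: pos_le_divide_eq mult_ac)
      then have "hamming_dist {..<?N} (W u \<sigma>) (W v \<tau>) \<le> 1 - (1 - \<epsilon>) * (1 - \<epsilon>)" unfolding dist[OF u(1,3,2,4)]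
        by simp
      also have "\<dots> \<le> 2 * \<epsilon>" by (simp add: algebra_simps)
      also have "\<dots> \<le> 3 * sqrt \<epsilon>" by (rule double_le_three_sqrt[OF e])
      finally show ?thesis .
    qed
    show "c / 2 \<le> hamming_dist {..<?N} (W u (\<lambda>x\<in>A. x)) \<one>\<^bsub>sym_group ?N\<^esub>"
      if u: "u \<in> A \<rightarrow> Bij {..<n}" and T: "T \<subseteq> A" "card A \<le> 2 * card T"
        and c: "0 < c" "\<forall>t\<in>T. c \<le> sym_dist n (u t) \<one>\<^bsub>sym_group n\<^esub>" for u T c
    proof -
      let ?o = "\<one>\<^bsub>sym_group n\<^esub>"
      have o: "(\<lambda>_. ?o) \<in> A \<rightarrow> Bij {..<n}" by (simp add: id_Bij)
      have W1: "\<one>\<^bsub>sym_group ?N\<^esub> = W (\<lambda>_. ?o) (\<lambda>x\<in>A. x)"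
        unfolding W_def BijGroup_simps(2) by (rule relabel_id[OF \<beta>, symmetric]) (auto simp: f_def)
      have cd: "real (card {i\<in>{..<n}. (\<lambda>x\<in>A. x) t = (\<lambda>x\<in>A. x) t \<and> u t i = ?o i}) = (1 - sym_dist n (u t) ?o)
        * real n" for t
        using hamming_card[of "{..<n}" "u t" ?o] n by simp
      have "(c / 2) * (real n * real (card A)) \<le> c * real n * real (card T)" using T c n
        by (simp add: field_simps)
      also have "\<dots> = (\<Sum>t\<in>T. c * real n)" by simp
      also have "\<dots> \<le> (\<Sum>t\<in>T. sym_dist n (u t) ?o * real n)" using c by (intro sum_mono mult_right_mono) auto
      also have "\<dots> \<le> (\<Sum>t\<in>A. sym_dist n (u t) ?o * real n)"
      proof (rule sum_mono2[OF A(1) T(1)])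
        fix t
        have "card {i\<in>{..<n}. u t i = ?o i} \<le> card {..<n}" by (rule card_mono) auto
        then show "0 \<le> sym_dist n (u t) ?o * real n" using n
          by (simp add: hamming_dist_def del: BijGroup_simps)
      qed
      also have "\<dots> = real n * real (card A) - (\<Sum>t\<in>A. (1 - sym_dist n (u t) ?o) * real n)"
        by (simp add: sum_subtractf left_diff_distrib)
      finally have "c / 2 \<le> 1 - (\<Sum>t\<in>A. (1 - sym_dist n (u t) ?o) * real n) / (real n * real (card A))"
        using n cA by (simp add: field_simps)
      then show ?thesis unfolding W1 dist[OF u id_Bij o id_Bij] cd .
    qed
  qed
  then show ?thesis by (rule exI[where x = W])
qed

text \<open>Here \<open>x \<otimes> (x \<oplus> 1)\<close> acts on pairs of points together with a
  flag saying whether the second point moves. Two permutations at distance \<open>a\<close> have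
  images that agree on the fraction \<open>(1 - a) * (2 - a) / 2\<close>, hence lie at distance
  \<open>a * (3 - a) / 2\<close>. The factor \<open>(3 - a) / 2\<close> is at least 11/10 up to
  \<open>a = 4/5\<close>; beyond, the product is at least 4/5.\<close>

lemma amplification_sym: "amplification (1/2) (indexed_family sym_group sym_dist)"
  unfolding amplification_def
proof (intro conjI allI impI)
  fix \<eta> :: real assume \<eta>: "\<eta> > 0"
  show "\<exists>\<delta>>0. \<forall>G d. (G, d) \<in> indexed_family sym_group sym_dist \<longrightarrow>
    (\<exists>H e S. (H, e) \<in> indexed_family sym_group sym_dist \<and> S \<in> hom G H \<and> S \<one>\<^bsub>G\<^esub> = \<one>\<^bsub>H\<^esub> \<and>
     (\<forall>x\<in>carrier G. \<forall>y\<in>carrier G. d x y < \<delta> \<longrightarrow> e (S x) (S y) < \<eta>) \<and>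
     (\<forall>x\<in>carrier G. min (1/2) (11 / 10 * d x \<one>\<^bsub>G\<^esub>) \<le> e (S x) \<one>\<^bsub>H\<^esub>))"
  proof (rule exI[of _ "\<eta> / 2"], intro conjI allI impI)
    fix G d assume "(G, d) \<in> indexed_family sym_group sym_dist"
    then obtain n where n: "n > 0" "G = sym_group n" "d = sym_dist n" by (auto simp: indexed_family_def)
    let ?I = "({..<n} \<times> {..<n}) \<times> (UNIV :: bool set)" and ?N = "n * n * 2"
    obtain \<beta> where \<beta>: "bij_betw \<beta> {..<?N} ?I" using exists_enumeration[of ?I ?N]
      by (auto simp: card_cartesian_product)
    define f :: "(nat \<Rightarrow> nat) \<Rightarrow> (nat \<times> nat) \<times> bool \<Rightarrow> (nat \<times> nat) \<times> bool"
      where "f x = (\<lambda>((i, j), b). ((x i, if b then x j else j), b))" for x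
    define S where "S x = relabel ?N \<beta> (f x)" for x
    have fin: "f x \<in> ?I \<rightarrow> ?I" if "x \<in> Bij {..<n}" for x using Bij_imp_funcset[OF that] by (auto simp: f_def)
    have fb: "bij_betw (f x) ?I ?I" if x: "x \<in> Bij {..<n}" for x
    proof -
      have "inj_on x {..<n}" using BijD[OF x] by (simp add: bij_betw_def)
      then have "inj_on (f x) ?I" by (auto simp: inj_on_def f_def split: if_splits)
      moreover have "f x ` ?I \<subseteq> ?I" using funcset_image[OF fin[OF that]] .
      ultimately show ?thesis by (simp add: bij_betw_def endo_inj_surj)
    qed
    have dist: "sym_dist ?N (S x) (S y) = sym_dist n x y * (3 - sym_dist n x y) / 2"
      if "x \<in> Bij {..<n}" "y \<in> Bij {..<n}" for x y
    proof -
      let ?E = "{i\<in>{..<n}. x i = y i}"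
      have "{p\<in>?I. f x p = f y p} = (?E \<times> ?E) \<times> {True} \<union> (?E \<times> {..<n}) \<times> {False}" by (auto simp: f_def)
      moreover have "card ((?E \<times> ?E) \<times> {True} \<union> (?E \<times> {..<n}) \<times> {False}) = card ?E * card ?E + card ?E * n"
        by (subst card_Un_disjoint) (auto simp: card_cartesian_product)
      ultimately have "real (card {p\<in>?I. f x p = f y p}) = real (card ?E) * real (card ?E) +
        real (card ?E) * real n" by simp
      also have "\<dots> = ((1 - sym_dist n x y) * real n) * ((1 - sym_dist n x y) * real n) +
        ((1 - sym_dist n x y) * real n) * real n"
        using hamming_card[of "{..<n}" x y] n by simp
      finally have c: "real (card {p\<in>?I. f x p = f y p}) =
        real n * real n * ((1 - sym_dist n x y) * (2 - sym_dist n x y))"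
        by (simp add: algebra_simps)
      have "sym_dist ?N (S x) (S y) = 1 - real n * real n * ((1 - sym_dist n x y) * (2 - sym_dist n x y)) /
        (real n * real n * 2)"
        unfolding S_def hamming_relabel[OF \<beta> fin[OF that(1)] fin[OF that(2)]] c
          by (simp add: card_cartesian_product)
      also have "\<dots> = 1 - (1 - sym_dist n x y) * (2 - sym_dist n x y) / 2" using n
        by (subst mult_divide_mult_cancel_left) auto
      finally show ?thesis by (simp add: field_simps)
    qed
    have d01: "0 \<le> sym_dist n x y" "sym_dist n x y \<le> 1" for x y
    proof -
      have "card {i\<in>{..<n}. x i = y i} \<le> card {..<n}" by (rule card_mono) auto
      then show "0 \<le> sym_dist n x y" "sym_dist n x y \<le> 1" using n by (auto simp: hamming_dist_def)
    qed
    have S1: "S \<one>\<^bsub>sym_group n\<^esub> = \<one>\<^bsub>sym_group ?N\<^esub>"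
      unfolding S_def BijGroup_simps(2) by (rule relabel_id[OF \<beta>]) (auto simp: f_def)
    have hom: "S \<in> hom (sym_group n) (sym_group ?N)"
    proof (rule homI; (simp only: BijGroup_simps(1))?)
      show "S x \<in> Bij {..<?N}" if "x \<in> Bij {..<n}" for x unfolding S_def
        by (rule relabel_Bij[OF \<beta> fb[OF that]])
      show "S (x \<otimes>\<^bsub>sym_group n\<^esub> y) = S x \<otimes>\<^bsub>sym_group ?N\<^esub> S y" if xy: "x \<in> Bij {..<n}" "y \<in> Bij {..<n}" for x y
      proof -
        have "S x \<otimes>\<^bsub>sym_group ?N\<^esub> S y = compose {..<?N} (S x) (S y)"
          unfolding S_def by (rule BijGroup_simps(3)) (intro relabel_Bij[OF \<beta> fb] xy)+
        also have "\<dots> = relabel ?N \<beta> (\<lambda>i. f x (f y i))"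
          unfolding S_def by (rule relabel_compose[OF \<beta>]) (intro fin xy)+
        also have "\<dots> = S (x \<otimes>\<^bsub>sym_group n\<^esub> y)"
          unfolding S_def by (rule relabel_cong[OF \<beta>]) (use xy in \<open>auto simp: f_def compose_eq\<close>)
        finally show ?thesis ..
      qed
    qed
    have "?N > 0" using n by simp
    then have "(sym_group ?N, sym_dist ?N) \<in> indexed_family sym_group sym_dist"
      by (auto simp: indexed_family_def)
    moreover have "sym_dist ?N (S x) (S y) < \<eta>" if "x \<in> Bij {..<n}" "y \<in> Bij {..<n}" "sym_dist n x y < \<eta> / 2"
      for x y
    proof -
      have "sym_dist n x y * (3 - sym_dist n x y) \<le> sym_dist n x y * 3" using d01[of x y]
        by (intro mult_left_mono) auto
      then show ?thesis unfolding dist[OF that(1,2)] using that(3) \<eta> by simp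
    qed
    moreover have "min (1/2) (11 / 10 * sym_dist n x \<one>\<^bsub>sym_group n\<^esub>) \<le> sym_dist ?N (S x) \<one>\<^bsub>sym_group ?N\<^esub>"
      if x: "x \<in> Bij {..<n}" for x
    proof -
      let ?c = "sym_dist n x \<one>\<^bsub>sym_group n\<^esub>"
      have e: "sym_dist ?N (S x) \<one>\<^bsub>sym_group ?N\<^esub> = ?c * (3 - ?c) / 2"
        unfolding S1[symmetric] by (rule dist[OF x]) (simp add: id_Bij)
      show ?thesis
      proof (cases "?c \<le> 4/5")
        case True
        have "?c * (22/10) \<le> ?c * (3 - ?c)" using d01[of x "\<one>\<^bsub>sym_group n\<^esub>"] True
          by (intro mult_left_mono) auto
        then show ?thesis unfolding e by simp
      next
        case False
        have "4/5 * 2 \<le> ?c * (3 - ?c)" using d01[of x "\<one>\<^bsub>sym_group n\<^esub>"] False by (intro mult_mono) auto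
        then show ?thesis unfolding e by simp
      qed
    qed
    ultimately show "\<exists>H e S. (H, e) \<in> indexed_family sym_group sym_dist \<and> S \<in> hom G H \<and> S \<one>\<^bsub>G\<^esub> = \<one>\<^bsub>H\<^esub> \<and>
     (\<forall>x\<in>carrier G. \<forall>y\<in>carrier G. d x y < \<eta> / 2 \<longrightarrow> e (S x) (S y) < \<eta>) \<and>
     (\<forall>x\<in>carrier G. min (1/2) (11 / 10 * d x \<one>\<^bsub>G\<^esub>) \<le> e (S x) \<one>\<^bsub>H\<^esub>)"
      using hom S1 unfolding n(2,3) BijGroup_simps(1) by blast
  qed (use \<eta> in simp)
qed simp

text \<open>Cayley's theorem: a left translation by a nontrivial element has no fixed point.\<close>

lemma contains_finite_groups_sym: "contains_finite_groups (indexed_family sym_group sym_dist)"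
  unfolding contains_finite_groups_def
proof (intro allI impI)
  fix Q :: "nat monoid" assume Q: "group Q" "finite (carrier Q)"
  interpret group Q by fact
  define N where "N = card (carrier Q)"
  have N: "N > 0" using Q one_closed by (auto simp: N_def card_gt_0_iff)
  obtain \<beta> where \<beta>: "bij_betw \<beta> {..<N} (carrier Q)" using exists_enumeration[OF Q(2)] N_def by metis
  define j where "j x = relabel N \<beta> (\<lambda>y. x \<otimes>\<^bsub>Q\<^esub> y)" for x
  have fin: "(\<lambda>y. x \<otimes>\<^bsub>Q\<^esub> y) \<in> carrier Q \<rightarrow> carrier Q" if "x \<in> carrier Q" for x using that by auto
  have fb: "bij_betw (\<lambda>y. x \<otimes>\<^bsub>Q\<^esub> y) (carrier Q) (carrier Q)" if "x \<in> carrier Q" for x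
    using that by (intro bij_betw_byWitness[where f' = "\<lambda>y. inv\<^bsub>Q\<^esub> x \<otimes>\<^bsub>Q\<^esub> y"]) (auto simp flip: m_assoc)
  have j1: "j \<one>\<^bsub>Q\<^esub> = \<one>\<^bsub>sym_group N\<^esub>" unfolding j_def BijGroup_simps(2) by (rule relabel_id[OF \<beta>]) simp
  have "j \<in> hom Q (sym_group N)"
  proof (rule homI)
    show "j x \<in> carrier (sym_group N)" if "x \<in> carrier Q" for x using relabel_Bij[OF \<beta> fb[OF that]]
      by (simp add: j_def)
    show "j (x \<otimes>\<^bsub>Q\<^esub> y) = j x \<otimes>\<^bsub>sym_group N\<^esub> j y" if xy: "x \<in> carrier Q" "y \<in> carrier Q" for x y
      using relabel_compose[OF \<beta> fin[OF xy(1)] fin[OF xy(2)]] relabel_Bij[OF \<beta> fb] xy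
      by (auto simp: j_def m_assoc intro!: relabel_cong[OF \<beta>])
  qed
  moreover have "sym_dist N (j x) (j x) = 0" for x using N by (simp add: hamming_dist_def)
  moreover have "0 < sym_dist N (j x) \<one>\<^bsub>sym_group N\<^esub>" if x: "x \<in> carrier Q" "x \<noteq> \<one>\<^bsub>Q\<^esub>" for x
  proof -
    have "{y\<in>carrier Q. x \<otimes>\<^bsub>Q\<^esub> y = \<one>\<^bsub>Q\<^esub> \<otimes>\<^bsub>Q\<^esub> y} = {}" using x by auto
    then show ?thesis unfolding j1[symmetric] j_def hamming_relabel[OF \<beta> fin[OF x(1)] fin[OF one_closed]]
      by (simp only: card.empty)
  qed
  moreover have "(sym_group N, sym_dist N) \<in> indexed_family sym_group sym_dist" using N
    by (auto simp: indexed_family_def)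
  ultimately show "\<exists>G d j. (G, d) \<in> indexed_family sym_group sym_dist \<and> j \<in> hom Q G \<and> j \<one>\<^bsub>Q\<^esub> = \<one>\<^bsub>G\<^esub> \<and>
    (\<forall>x\<in>carrier Q. d (j x) (j x) = 0) \<and>
      (\<forall>x\<in>carrier Q. x \<noteq> \<one>\<^bsub>Q\<^esub> \<longrightarrow> 0 < d (j x) \<one>\<^bsub>G\<^esub>)" using j1 by blast
qed

section \<open>Matrices over index sets\<close>

text \<open>Matrices are functions of two indices, so that block and tensor constructions use products of index
  sets;
  \<open>to_mat\<close> below enumerates the indices.\<close>

definition mmult :: "'j set \<Rightarrow> ('i \<Rightarrow> 'j \<Rightarrow> 'k::semiring_0) \<Rightarrow> ('j \<Rightarrow> 'l \<Rightarrow> 'k) \<Rightarrow> 'i \<Rightarrow> 'l \<Rightarrow> 'k" where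
  "mmult J A B = (\<lambda>i l. \<Sum>j\<in>J. A i j * B j l)"

definition delta :: "'i \<Rightarrow> 'i \<Rightarrow> 'k::zero_neq_one" where
  "delta i j = (if i = j then 1 else 0)"

lemma mmult_assoc: "mmult J (mmult I A B) C = mmult I A (mmult J B C)"
proof (intro ext)
  fix i l
  have "mmult J (mmult I A B) C i l = (\<Sum>j\<in>J. \<Sum>k\<in>I. A i k * B k j * C j l)"
    by (simp add: mmult_def sum_distrib_right)
  also have "\<dots> = (\<Sum>k\<in>I. \<Sum>j\<in>J. A i k * B k j * C j l)" by (rule sum.swap)
  also have "\<dots> = mmult I A (mmult J B C) i l" by (simp add: mmult_def sum_distrib_left mult.assoc)
  finally show "mmult J (mmult I A B) C i l = mmult I A (mmult J B C) i l" .
qed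

lemma mmult_delta_left: "finite I \<Longrightarrow> i \<in> I \<Longrightarrow> mmult I delta A i l = (A i l :: 'k::semiring_1)"
  by (simp add: mmult_def delta_def if_distrib[of "\<lambda>x. x * _"] cong: if_cong)

lemma mmult_delta_right: "finite I \<Longrightarrow> l \<in> I \<Longrightarrow> mmult I A delta i l = (A i l :: 'k::semiring_1)"
  by (simp add: mmult_def delta_def if_distrib[of "\<lambda>x. _ * x"] cong: if_cong)

lemma mmult_cong: "(\<And>j. j \<in> J \<Longrightarrow> A i j = A' i j) \<Longrightarrow> (\<And>j. j \<in> J \<Longrightarrow> B j l = B' j l) \<Longrightarrow>
  mmult J A B i l = mmult J A' B' i l"
  by (simp add: mmult_def)

lemma mmult_diff_left: "mmult J (\<lambda>i j. A i j - A' i j) B i l =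
  mmult J A B i l - (mmult J A' B i l :: 'k::ring)"
  by (simp add: mmult_def left_diff_distrib sum_subtractf)

lemma mmult_diff_right: "mmult J A (\<lambda>i j. B i j - B' i j) i l =
  mmult J A B i l - (mmult J A B' i l :: 'k::ring)"
  by (simp add: mmult_def right_diff_distrib sum_subtractf)

definition kron :: "('i \<Rightarrow> 'j \<Rightarrow> 'k::comm_semiring_0) \<Rightarrow> ('i2 \<Rightarrow> 'j2 \<Rightarrow> 'k) \<Rightarrow> 'i \<times> 'i2 \<Rightarrow> 'j \<times> 'j2 \<Rightarrow> 'k" where
  "kron A B = (\<lambda>(i, i') (j, j'). A i j * B i' j')"

lemma kron_simp [simp]: "kron A B (i, i') (j, j') = A i j * B i' j'" by (simp add: kron_def)

lemma mmult_kron: "mmult (J \<times> J') (kron A B) (kron C D) = kron (mmult J A C) (mmult J' B D)"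
proof (intro ext, clarify)
  fix i i' l l'
  have "mmult (J \<times> J') (kron A B) (kron C D) (i, i') (l, l') =
    (\<Sum>j\<in>J. \<Sum>j'\<in>J'. (A i j * C j l) * (B i' j' * D j' l'))"
    by (simp add: mmult_def sum.cartesian_product split_def kron_def mult_ac)
  then show "mmult (J \<times> J') (kron A B) (kron C D) (i, i') (l, l') = kron (mmult J A C) (mmult J' B D) (i, i')
    (l, l')"
    by (simp add: mmult_def sum_product)
qed

definition to_mat :: "nat \<Rightarrow> (nat \<Rightarrow> 'i) \<Rightarrow> ('i \<Rightarrow> 'i \<Rightarrow> 'k) \<Rightarrow> 'k mat" where
  "to_mat N \<beta> F = mat N N (\<lambda>(x, y). F (\<beta> x) (\<beta> y))"

definition entries :: "'k mat \<Rightarrow> nat \<Rightarrow> nat \<Rightarrow> 'k" where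
  "entries M i j = M $$ (i, j)"

lemma to_mat_carrier [simp]: "to_mat N \<beta> F \<in> carrier_mat N N" by (simp add: to_mat_def)

lemma to_mat_index [simp]: "x < N \<Longrightarrow> y < N \<Longrightarrow> to_mat N \<beta> F $$ (x, y) = F (\<beta> x) (\<beta> y)" by (simp add: to_mat_def)

lemma to_mat_dim [simp]: "dim_row (to_mat N \<beta> F) = N" "dim_col (to_mat N \<beta> F) = N"
  by (simp_all add: to_mat_def)

lemma entries_mult:
  assumes "A \<in> carrier_mat n n" "B \<in> carrier_mat n n" "i < n" "j < n"
  shows "entries (A * B) i j = mmult {..<n} (entries A) (entries B) i j"
  using assms by (simp add: entries_def mmult_def scalar_prod_def atLeast0LessThan)

lemma entries_one: "i < n \<Longrightarrow> j < n \<Longrightarrow> entries (1\<^sub>m n) i j = delta i j"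
  by (simp add: entries_def delta_def)

context
  fixes N :: nat and \<beta> :: "nat \<Rightarrow> 'i" and I :: "'i set"
  assumes \<beta>: "bij_betw \<beta> {..<N} I"
begin

lemma \<beta>_in: "x < N \<Longrightarrow> \<beta> x \<in> I" using \<beta> by (auto simp: bij_betw_def)

lemma to_mat_eqI: "(\<And>i j. i \<in> I \<Longrightarrow> j \<in> I \<Longrightarrow> F i j = G i j) \<Longrightarrow> to_mat N \<beta> F = to_mat N \<beta> G"
  by (intro eq_matI) (simp_all add: \<beta>_in)

lemma to_mat_mult: "to_mat N \<beta> F * to_mat N \<beta> G = (to_mat N \<beta> (mmult I F G) :: 'k::semiring_0 mat)"
proof (rule eq_matI)
  fix x y assume "x < dim_row (to_mat N \<beta> (mmult I F G))" "y < dim_col (to_mat N \<beta> (mmult I F G))"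
  then have xy: "x < N" "y < N" by auto
  have "(to_mat N \<beta> F * to_mat N \<beta> G) $$ (x, y) = (\<Sum>z<N. F (\<beta> x) (\<beta> z) * G (\<beta> z) (\<beta> y))"
    using xy by (simp add: scalar_prod_def atLeast0LessThan)
  also have "\<dots> = mmult I F G (\<beta> x) (\<beta> y)" unfolding mmult_def by (rule sum.reindex_bij_betw[OF \<beta>])
  finally show "(to_mat N \<beta> F * to_mat N \<beta> G) $$ (x, y) = to_mat N \<beta> (mmult I F G) $$ (x, y)" using xy by simp
qed auto

lemma to_mat_delta: "to_mat N \<beta> delta = 1\<^sub>m N"
proof (rule eq_matI)
  fix x y assume "x < dim_row (1\<^sub>m N)" "y < dim_col (1\<^sub>m N)"
  then have "x < N" "y < N" by auto
  moreover have "\<beta> x = \<beta> y \<longleftrightarrow> x = y" if "x < N" "y < N" for x y using \<beta> that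
    by (auto simp: bij_betw_def inj_on_def)
  ultimately show "to_mat N \<beta> delta $$ (x, y) = 1\<^sub>m N $$ (x, y)" by (simp add: delta_def)
qed auto

lemma to_mat_one: "(\<And>i j. i \<in> I \<Longrightarrow> j \<in> I \<Longrightarrow> F i j = delta i j) \<Longrightarrow> to_mat N \<beta> F = 1\<^sub>m N"
  using to_mat_eqI[of F delta] to_mat_delta by simp

end

section \<open>Monomial, amplified and regular matrices\<close>

abbreviation gl_group :: "'k::field itself \<Rightarrow> nat \<Rightarrow> 'k mat monoid" where
  "gl_group K n \<equiv> units_of (ring_mat K n ())"

lemma gl_group_iff: "M \<in> carrier (gl_group TYPE('k::field) n) \<longleftrightarrow> M \<in> carrier_mat n n \<and>
  (\<exists>M'\<in>carrier_mat n n. M * M' = 1\<^sub>m n \<and> M' * M = 1\<^sub>m n)"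
  by (auto simp: units_of_def Units_def ring_mat_def)

lemma gl_group_simps:
  "\<one>\<^bsub>gl_group TYPE('k::field) n\<^esub> = (1\<^sub>m n :: 'k mat)"
  "M \<otimes>\<^bsub>gl_group TYPE('k::field) n\<^esub> M' = (M * M' :: 'k mat)"
  by (simp_all add: units_of_def ring_mat_def)

lemma group_gl_group: "group (gl_group TYPE('k::field) n)"
  by (rule monoid.units_group) (rule ring.is_monoid[OF ring_mat])

text \<open>The monomial block matrix with block \<open>u t\<close> in row \<open>\<sigma> t\<close> and column \<open>t\<close>.\<close>

definition monomial :: "(nat \<Rightarrow> 'k::zero mat) \<Rightarrow> (nat \<Rightarrow> nat) \<Rightarrow> nat \<times> nat \<Rightarrow> nat \<times> nat \<Rightarrow> 'k" where
  "monomial u \<sigma> = (\<lambda>(s, i) (t, j). if s = \<sigma> t then entries (u t) i j else 0)"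

lemma mmult_monomial:
  assumes A: "finite A" and u: "\<And>t. t \<in> A \<Longrightarrow> u t \<in> carrier_mat n n" and v: "\<And>t. t \<in> A \<Longrightarrow> v t \<in> carrier_mat n n"
    and \<tau>: "\<tau> \<in> Bij A"
    and p: "p \<in> A \<times> {..<n}" "q \<in> A \<times> {..<n}"
  shows "mmult (A \<times> {..<n}) (monomial u \<sigma>) (monomial v \<tau>) p q = monomial (\<lambda>t. u (\<tau> t) * v t) (compose A \<sigma> \<tau>)
    p (q :: nat \<times> nat) "
proof -
  obtain s i t j where e: "p = (s, i)" "q = (t, j)" by (cases p, cases q)
  have m: "s \<in> A" "i < n" "t \<in> A" "j < n" using p e by auto
  have \<tau>t: "\<tau> t \<in> A" using Bij_imp_funcset[OF \<tau>] m by auto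
  have "mmult (A \<times> {..<n}) (monomial u \<sigma>) (monomial v \<tau>) p q =
    (\<Sum>r\<in>A. \<Sum>k<n. (if s = \<sigma> r then entries (u r) i k else 0) * (if r = \<tau> t then entries (v t) k j else 0))"
    by (simp add: mmult_def monomial_def e sum.cartesian_product split_def cong: if_cong)
  also have "\<dots> = (\<Sum>r\<in>A. if r = \<tau> t then (\<Sum>k<n. (if s = \<sigma> r then entries (u r) i k else 0) * entries (v t) k
    j) else 0)"
    by (rule sum.cong) auto
  also have "\<dots> = (\<Sum>k<n. (if s = \<sigma> (\<tau> t) then entries (u (\<tau> t)) i k else 0) * entries (v t) k j)"
    using A \<tau>t by simp
  also have "\<dots> = (if s = \<sigma> (\<tau> t) then mmult {..<n} (entries (u (\<tau> t))) (entries (v t)) i j else 0)"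
    by (simp add: mmult_def)
  also have "\<dots> = monomial (\<lambda>t. u (\<tau> t) * v t) (compose A \<sigma> \<tau>) p q"
    using m entries_mult[OF u[OF \<tau>t] v[OF m(3)] m(2,4)] by (simp add: monomial_def e compose_eq)
  finally show ?thesis .
qed

lemma monomial_one: "p \<in> A \<times> {..<n} \<Longrightarrow> q \<in> A \<times> {..<n} \<Longrightarrow> monomial (\<lambda>_. 1\<^sub>m n) (\<lambda>x\<in>A. x) p q = delta p q"
  by (cases p, cases q) (auto simp: monomial_def entries_one delta_def)

lemma mmult_monomial_entries: "p \<in> A \<times> {..<n} \<Longrightarrow> q \<in> A \<times> {..<n} \<Longrightarrow> (\<And>t. t \<in> A \<Longrightarrow> u t = v t) \<Longrightarrow>
  monomial u \<sigma> p q = monomial v \<sigma> p q"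
  by (cases p, cases q) (auto simp: monomial_def)

text \<open>The matrix of \<open>x \<otimes> (x \<oplus> 1)\<close>.\<close>

definition padded :: "'k::zero_neq_one mat \<Rightarrow> nat \<times> bool \<Rightarrow> nat \<times> bool \<Rightarrow> 'k" where
  "padded x = (\<lambda>(i, b) (j, b'). if b \<noteq> b' then 0 else if b then entries x i j else delta i j)"

definition amplified :: "'k::comm_semiring_1 mat \<Rightarrow> nat \<times> (nat \<times> bool) \<Rightarrow> nat \<times> (nat \<times> bool) \<Rightarrow> 'k" where
  "amplified x = kron (entries x) (padded x)"

lemma mmult_padded:
  fixes x y :: "'k::comm_semiring_1 mat"
  assumes x: "x \<in> carrier_mat n n" "y \<in> carrier_mat n n" and p: "p \<in> {..<n} \<times> UNIV" "q \<in> {..<n} \<times> UNIV"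
  shows "mmult ({..<n} \<times> UNIV) (padded x) (padded y) p q = padded (x * y) p (q :: nat \<times> bool) "
proof -
  obtain i b j b' where e: "p = (i, b)" "q = (j, b')" by (cases p, cases q)
  have m: "i < n" "j < n" using p e by auto
  have "mmult ({..<n} \<times> UNIV) (padded x) (padded y) p q =
    (\<Sum>k<n. \<Sum>c\<in>UNIV. padded x (i, b) (k, c) * padded y (k, c) (j, b'))"
    by (simp add: mmult_def sum.cartesian_product e split_def)
  also have "\<dots> = (if b \<noteq> b' then 0 else if b then mmult {..<n} (entries x) (entries y) i j else mmult {..<n}
    delta delta i j)"
    by (simp add: UNIV_bool padded_def mmult_def)
  also have "\<dots> = padded (x * y) p q"
    using entries_mult[OF x m] m by (simp add: padded_def e mmult_delta_left)
  finally show ?thesis .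
qed

lemma padded_one: "p \<in> {..<n} \<times> UNIV \<Longrightarrow> q \<in> {..<n} \<times> UNIV \<Longrightarrow> padded (1\<^sub>m n) p q = delta p q"
  by (cases p, cases q) (auto simp: padded_def entries_one delta_def)

lemma mmult_amplified:
  assumes x: "x \<in> carrier_mat n n" "y \<in> carrier_mat n n"
    and p: "p \<in> {..<n} \<times> ({..<n} \<times> UNIV)" "q \<in> {..<n} \<times> ({..<n} \<times> UNIV)"
  shows "mmult ({..<n} \<times> ({..<n} \<times> UNIV)) (amplified x) (amplified y) p q =
    amplified (x * y) p (q :: nat \<times> (nat \<times> bool))"
  using p mmult_padded[OF x] entries_mult[OF x] unfolding amplified_def mmult_kron
    by (cases p, cases q) (auto simp: kron_def)

lemma amplified_one: "p \<in> {..<n} \<times> ({..<n} \<times> UNIV) \<Longrightarrow> q \<in> {..<n} \<times> ({..<n} \<times> UNIV) \<Longrightarrow>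
  amplified (1\<^sub>m n) p q = delta p q"
  unfolding amplified_def by (cases p, cases q) (auto simp: kron_def entries_one padded_one delta_def)

lemma inv_Bij:
  assumes \<sigma>: "\<sigma> \<in> Bij A"
  defines "\<sigma>' \<equiv> \<lambda>x\<in>A. inv_into A \<sigma> x"
  shows "\<sigma>' \<in> Bij A" "compose A \<sigma> \<sigma>' = (\<lambda>x\<in>A. x)" "compose A \<sigma>' \<sigma> = (\<lambda>x\<in>A. x)"
    "t \<in> A \<Longrightarrow> \<sigma> (\<sigma>' t) = t" "t \<in> A \<Longrightarrow> \<sigma>' (\<sigma> t) = t" "t \<in> A \<Longrightarrow> \<sigma>' t \<in> A"
proof -
  have b: "bij_betw \<sigma> A A" by (rule BijD[OF \<sigma>])
  show "\<sigma>' \<in> Bij A" unfolding \<sigma>'_def by (rule restrict_inv_into_Bij[OF \<sigma>])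
  then show m: "\<sigma>' t \<in> A" if "t \<in> A" for t using that Bij_imp_funcset by blast
  show 1: "\<sigma> (\<sigma>' t) = t" if "t \<in> A" for t using b that by (simp add: \<sigma>'_def bij_betw_def f_inv_into_f)
  show 2: "\<sigma>' (\<sigma> t) = t" if "t \<in> A" for t using b that by (auto simp: \<sigma>'_def bij_betw_def)
  show "compose A \<sigma> \<sigma>' = (\<lambda>x\<in>A. x)" "compose A \<sigma>' \<sigma> = (\<lambda>x\<in>A. x)" using 1 2
    by (auto simp: compose_def fun_eq_iff)
qed

context
  fixes n :: nat and A :: "nat set" and N :: nat and \<beta> :: "nat \<Rightarrow> nat \<times> nat"
  assumes A: "finite A" and \<beta>: "bij_betw \<beta> {..<N} (A \<times> {..<n})"
begin

lemma to_mat_monomial_mult: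
  fixes u v :: "nat \<Rightarrow> 'k::comm_semiring_1 mat"
  assumes "\<And>t. t \<in> A \<Longrightarrow> u t \<in> carrier_mat n n" "\<And>t. t \<in> A \<Longrightarrow> v t \<in> carrier_mat n n" "\<tau> \<in> Bij A"
  shows "to_mat N \<beta> (monomial u \<sigma>) * to_mat N \<beta> (monomial v \<tau>) =
    to_mat N \<beta> (monomial (\<lambda>t. u (\<tau> t) * v t) (compose A \<sigma> \<tau>))"
  unfolding to_mat_mult[OF \<beta>] by (rule to_mat_eqI[OF \<beta> mmult_monomial[OF A assms]])

lemma to_mat_monomial_cong: "(\<And>t. t \<in> A \<Longrightarrow> u t = v t) \<Longrightarrow> to_mat N \<beta> (monomial u \<sigma>) = to_mat N \<beta> (monomial v \<sigma>)"
  by (rule to_mat_eqI[OF \<beta>]) (rule mmult_monomial_entries)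

lemma to_mat_monomial_one: "to_mat N \<beta> (monomial (\<lambda>_. 1\<^sub>m n) (\<lambda>x\<in>A. x)) = (1\<^sub>m N :: 'k::comm_semiring_1 mat)"
  by (rule to_mat_one[OF \<beta>]) (rule monomial_one)

text \<open>Inversion in the wreath product: the inverse permutation \<open>\<sigma>'\<close>
  carries in column \<open>t\<close> the inverse of the block that stands in column
  \<open>\<sigma>' t\<close>, which is the one in row \<open>t\<close>.\<close>

lemma to_mat_monomial_inverse:
  fixes u v :: "nat \<Rightarrow> 'k::comm_semiring_1 mat"
  assumes \<sigma>: "\<sigma> \<in> Bij A" and u: "\<And>t. t \<in> A \<Longrightarrow> u t \<in> carrier_mat n n" and v: "\<And>t. t \<in> A \<Longrightarrow> v t \<in> carrier_mat n n"
    and uv: "\<And>t. t \<in> A \<Longrightarrow> u t * v t = 1\<^sub>m n" "\<And>t. t \<in> A \<Longrightarrow> v t * u t = 1\<^sub>m n"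
  defines "\<sigma>' \<equiv> \<lambda>x\<in>A. inv_into A \<sigma> x"
  shows "to_mat N \<beta> (monomial u \<sigma>) * to_mat N \<beta> (monomial (\<lambda>t. v (\<sigma>' t)) \<sigma>') = 1\<^sub>m N"
    "to_mat N \<beta> (monomial (\<lambda>t. v (\<sigma>' t)) \<sigma>') * to_mat N \<beta> (monomial u \<sigma>) = 1\<^sub>m N"
proof -
  note i = inv_Bij[OF \<sigma>, folded \<sigma>'_def]
  have "to_mat N \<beta> (monomial u \<sigma>) * to_mat N \<beta> (monomial (\<lambda>t. v (\<sigma>' t)) \<sigma>') =
    to_mat N \<beta> (monomial (\<lambda>t. u (\<sigma>' t) * v (\<sigma>' t)) (\<lambda>x\<in>A. x))"
    using to_mat_monomial_mult[of u "\<lambda>t. v (\<sigma>' t)" \<sigma>' \<sigma>] u v i by simp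
  also have "\<dots> = to_mat N \<beta> (monomial (\<lambda>_. 1\<^sub>m n) (\<lambda>x\<in>A. x))"
    by (rule to_mat_monomial_cong) (use uv i(6) in simp)
  finally show "to_mat N \<beta> (monomial u \<sigma>) * to_mat N \<beta> (monomial (\<lambda>t. v (\<sigma>' t)) \<sigma>') = 1\<^sub>m N"
    using to_mat_monomial_one by simp
  have "to_mat N \<beta> (monomial (\<lambda>t. v (\<sigma>' t)) \<sigma>') * to_mat N \<beta> (monomial u \<sigma>) =
    to_mat N \<beta> (monomial (\<lambda>t. v (\<sigma>' (\<sigma> t)) * u t) (\<lambda>x\<in>A. x))"
    using to_mat_monomial_mult[of "\<lambda>t. v (\<sigma>' t)" u \<sigma> \<sigma>'] u v i \<sigma> by simp
  also have "\<dots> = to_mat N \<beta> (monomial (\<lambda>_. 1\<^sub>m n) (\<lambda>x\<in>A. x))"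
    by (rule to_mat_monomial_cong) (use uv i(5) in simp)
  finally show "to_mat N \<beta> (monomial (\<lambda>t. v (\<sigma>' t)) \<sigma>') * to_mat N \<beta> (monomial u \<sigma>) = 1\<^sub>m N"
    using to_mat_monomial_one by simp
qed

end

abbreviation amplified_index :: "nat \<Rightarrow> (nat \<times> nat \<times> bool) set" where
  "amplified_index n \<equiv> {..<n} \<times> ({..<n} \<times> UNIV)"

lemma card_amplified_index: "card (amplified_index n) = n * n * 2"
  by (simp add: card_cartesian_product)

lemma to_mat_amplified:
  assumes \<beta>: "bij_betw \<beta> {..<N} (amplified_index n)"
  shows "x \<in> carrier_mat n n \<Longrightarrow> y \<in> carrier_mat n n \<Longrightarrow> to_mat N \<beta> (amplified x) * to_mat N \<beta> (amplified y) =
    to_mat N \<beta> (amplified (x * y :: 'k::comm_semiring_1 mat))"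
    "to_mat N \<beta> (amplified (1\<^sub>m n)) = (1\<^sub>m N :: 'k mat)"
   apply (simp only: to_mat_mult[OF \<beta>])
   apply (rule to_mat_eqI[OF \<beta>], rule mmult_amplified, assumption+)
  by (rule to_mat_one[OF \<beta>]) (rule amplified_one)

definition regular_rep :: "(nat, 'm) monoid_scheme \<Rightarrow> nat \<Rightarrow> nat \<Rightarrow> nat \<Rightarrow> 'k::zero_neq_one" where
  "regular_rep Q x = (\<lambda>y z. if y = x \<otimes>\<^bsub>Q\<^esub> z then 1 else 0)"

lemma mmult_regular_rep:
  fixes G :: "(nat, 'm) monoid_scheme" (structure)
  assumes "group G" "finite (carrier G)" "x \<in> carrier G" "y \<in> carrier G" "p \<in> carrier G" "q \<in> carrier G"
  shows "mmult (carrier G) (regular_rep G x) (regular_rep G y) p q =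
    (regular_rep G (x \<otimes> y) p q :: 'k::semiring_1)"
proof -
  interpret group G by fact
  have "mmult (carrier G) (regular_rep G x) (regular_rep G y) p q =
    (\<Sum>r\<in>carrier G. if r = y \<otimes> q then (if p = x \<otimes> r then 1 else 0) else 0 :: 'k)"
    unfolding mmult_def regular_rep_def by (rule sum.cong) auto
  then show ?thesis using assms by (simp add: regular_rep_def m_assoc)
qed

section \<open>Rank\<close>

text \<open>Rank at most \<open>r\<close> is a factorization through dimension \<open>r\<close>, rank at least \<open>r\<close> a factorization of the
  identity matrix of size \<open>r\<close> through \<open>A\<close>; both need no enumeration of \<open>I\<close> and \<open>J\<close>.\<close>

definition rank_at_most :: "'i set \<Rightarrow> 'j set \<Rightarrow> ('i \<Rightarrow> 'j \<Rightarrow> 'k::field) \<Rightarrow> nat \<Rightarrow> bool" where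
  "rank_at_most I J A r \<longleftrightarrow> (\<exists>P Q. \<forall>i\<in>I. \<forall>j\<in>J. A i j = mmult {..<r} P Q i j)"

definition rank_at_least :: "'i set \<Rightarrow> 'j set \<Rightarrow> ('i \<Rightarrow> 'j \<Rightarrow> 'k::field) \<Rightarrow> nat \<Rightarrow> bool" where
  "rank_at_least I J A r \<longleftrightarrow> (\<exists>U V. \<forall>p<r. \<forall>q<r. mmult J (mmult I U A) V p q = delta p q)"

lemma mmult_reindex: "bij_betw \<beta> K R \<Longrightarrow> mmult K (\<lambda>i k. P i (\<beta> k)) (\<lambda>k j. Q (\<beta> k) j) i j = mmult R P Q i j"
  by (simp add: mmult_def sum.reindex_bij_betw[of \<beta> K R "\<lambda>k. P i k * Q k j"])

lemma rank_at_mostI: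
  assumes R: "finite R" "card R \<le> r" and A: "\<And>i j. i \<in> I \<Longrightarrow> j \<in> J \<Longrightarrow> A i j = mmult R P Q i j"
  shows "rank_at_most I J A r"
proof -
  obtain \<beta> where \<beta>: "bij_betw \<beta> {..<card R} R" using exists_enumeration[OF R(1)] by blast
  let ?P = "\<lambda>i k. if k < card R then P i (\<beta> k) else 0"
  have "mmult {..<r} ?P (\<lambda>k j. Q (\<beta> k) j) i j = mmult R P Q i j" for i j
  proof -
    have "mmult {..<r} ?P (\<lambda>k j. Q (\<beta> k) j) i j = mmult {..<card R} ?P (\<lambda>k j. Q (\<beta> k) j) i j"
      unfolding mmult_def using R(2) by (intro sum.mono_neutral_right) auto
    also have "\<dots> = mmult {..<card R} (\<lambda>i k. P i (\<beta> k)) (\<lambda>k j. Q (\<beta> k) j) i j" by (simp add: mmult_def)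
    also have "\<dots> = mmult R P Q i j" by (rule mmult_reindex[OF \<beta>])
    finally show ?thesis .
  qed
  then show ?thesis unfolding rank_at_most_def using A
    by (intro exI[of _ ?P] exI[of _ "\<lambda>k j. Q (\<beta> k) j"] ballI) simp
qed

lemma rank_at_leastI:
  assumes R: "finite R" and A: "\<And>p q. p \<in> R \<Longrightarrow> q \<in> R \<Longrightarrow> mmult J (mmult I U A) V p q = delta p q"
  shows "rank_at_least I J A (card R)"
proof -
  obtain \<beta> where \<beta>: "bij_betw \<beta> {..<card R} R" using exists_enumeration[OF R] by blast
  have "mmult J (mmult I (\<lambda>p. U (\<beta> p)) A) (\<lambda>j q. V j (\<beta> q)) p q = delta p q" if "p < card R" "q < card R"
    for p q
  proof -
    have "\<beta> p \<in> R" "\<beta> q \<in> R" "\<beta> p = \<beta> q \<longleftrightarrow> p = q" using \<beta> that by (auto simp: bij_betw_def inj_on_def)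
    then show ?thesis using A[of "\<beta> p" "\<beta> q"] by (simp add: mmult_def delta_def)
  qed
  then show ?thesis unfolding rank_at_least_def by blast
qed

text \<open>A factorization through dimension \<open>r\<close> writes \<open>M\<close> as a sum of
  \<open>r\<close> matrices of rank at most one.\<close>

lemma rank_le_if_rank_at_most:
  fixes M :: "'k::field mat"
  assumes M: "M \<in> carrier_mat n n" and r: "rank_at_most {..<n} {..<n} (entries M) r"
  shows "vec_space.rank n M \<le> r"
proof -
  interpret vec_space "TYPE('k)" n .
  obtain P Q where PQ: "\<And>i j. i < n \<Longrightarrow> j < n \<Longrightarrow> M $$ (i, j) = (\<Sum>p<r. P i p * Q p j)"
    using r by (auto simp: rank_at_most_def mmult_def entries_def)
  define B where "B k = mat n n (\<lambda>(i, j). \<Sum>p<k. P i p * Q p j)" for k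
  have "rank (B k) \<le> k" for k
  proof (induction k)
    case 0
    have "B 0 = 0\<^sub>m n n" by (auto simp: B_def)
    then show ?case using rank_0I by simp
  next
    case (Suc k)
    let ?C = "mat n n (\<lambda>(i, j). P i k * Q k j)"
    have "B (Suc k) = B k + ?C" by (intro eq_matI) (auto simp: B_def)
    then have "rank (B (Suc k)) \<le> rank (B k) + rank ?C" using rank_subadditive[of "B k" n ?C]
      by (simp add: B_def)
    moreover have "rank ?C \<le> 1" by (rule rank_le_1_product_entries[of _ n "\<lambda>i. P i k" "\<lambda>j. Q k j"]) auto
    ultimately show ?case using Suc by simp
  qed
  moreover have "M = B r" using M PQ by (intro eq_matI) (auto simp: B_def)
  ultimately show ?thesis by simp
qed

text \<open>\<open>M\<close> factors through a maximal linearly independent set \<open>S\<close> of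
  its columns: by maximality every column is a combination of elements of \<open>S\<close>.\<close>

lemma rank_at_most_rank:
  fixes M :: "'k::field mat"
  assumes M: "M \<in> carrier_mat n n"
  shows "rank_at_most {..<n} {..<n} (entries M) (vec_space.rank n M)"
proof -
  interpret vec_space "TYPE('k)" n .
  obtain S where S: "maximal S (\<lambda>T. T \<subseteq> set (cols M) \<and> lin_indpt T)"
    using maximal_exists[of "(\<lambda>T. T \<subseteq> set (cols M) \<and> lin_indpt T)" "card (set (cols M))" "{}"]
    by (meson List.finite_set card_mono empty_iff empty_subsetI finite_lin_indpt2 rev_finite_subset)
  have Ssub: "S \<subseteq> set (cols M)" and Sli: "lin_indpt S" using S unfolding maximal_def by auto
  have Sc: "S \<subseteq> carrier_vec n" using Ssub cols_dim[of M] M by auto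
  have fS: "finite S" using Ssub finite_subset by blast
  have span: "col M j \<in> span S" if j: "j < n" for j
  proof (rule ccontr)
    assume c: "col M j \<notin> span S"
    have mem: "col M j \<in> set (cols M)" using j M by (metis cols_length cols_nth carrier_matD(2) nth_mem)
    have cv: "col M j \<in> carrier_vec n" using M j by auto
    have "lin_indpt (S \<union> {col M j})" using lin_dep_iff_in_span[OF Sc Sli cv] c Sc span_mem by blast
    then have "S = S \<union> {col M j}" using S mem Ssub unfolding maximal_def
      by (metis Un_subset_iff Un_upper1 empty_subsetI insert_subset)
    then have "col M j \<in> S" by blast
    then show False using c span_mem[OF Sc] by blast
  qed
  have "\<exists>a A. col M j = lincomb a A \<and> finite A \<and> A \<subseteq> S" if "j < n" for j
    using in_spanE[OF span[OF that]] .
  then obtain a A where aA: "\<And>j. j < n \<Longrightarrow> col M j = lincomb (a j) (A j) \<and> finite (A j) \<and> A j \<subseteq> S" by metis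
  show ?thesis
  proof (rule rank_at_mostI[OF fS])
    show "card S \<le> rank M" using rank_card_indpt[OF M S] by simp
    fix i j assume ij: "i \<in> {..<n}" "j \<in> {..<n}"
    then have A: "col M j = lincomb (a j) (A j)" "finite (A j)" "A j \<subseteq> S" using aA by auto
    have "entries M i j = col M j $ i" using ij M by (simp add: entries_def)
    also have "\<dots> = (\<Sum>x\<in>A j. a j x * x $ i)" unfolding A(1) using ij A Sc by (subst lincomb_index) auto
    also have "\<dots> = (\<Sum>x\<in>S. if x \<in> A j then a j x * x $ i else 0)"
      using A fS by (simp add: sum.If_cases Int_absorb1)
    also have "\<dots> = mmult S (\<lambda>i x. x $ i) (\<lambda>x j. if x \<in> A j then a j x else 0) i j"
      by (auto simp: mmult_def intro!: sum.cong)
    finally show "entries M i j = mmult S (\<lambda>i x. x $ i) (\<lambda>x j. if x \<in> A j then a j x else 0) i j" .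
  qed
qed

lemma rank_one_mat: "vec_space.rank n (1\<^sub>m n :: 'k::field mat) = n"
  using vec_space.det_rank_iff[of "1\<^sub>m n :: 'k mat" n] by simp

text \<open>Composing both factorizations sends the identity matrix of size \<open>r\<close>, whose
  rank is \<open>r\<close>, through dimension \<open>s\<close>.\<close>

lemma rank_at_least_le_rank_at_most:
  assumes "rank_at_least I J A r" "rank_at_most I J A s" shows "r \<le> s"
proof -
  obtain U V where UV: "\<And>p q. p < r \<Longrightarrow> q < r \<Longrightarrow> mmult J (mmult I U A) V p q = delta p q" using assms(1)
    by (auto simp: rank_at_least_def)
  obtain P Q where PQ: "\<And>i j. i \<in> I \<Longrightarrow> j \<in> J \<Longrightarrow> A i j = mmult {..<s} P Q i j" using assms(2)
    by (auto simp: rank_at_most_def)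
  have "mmult J (mmult I U A) V p q = mmult {..<s} (mmult I U P) (mmult J Q V) p q" for p q
  proof -
    have "mmult J (mmult I U A) V p q = mmult J (mmult I U (mmult {..<s} P Q)) V p q"
      by (rule mmult_cong) (auto intro!: mmult_cong PQ)
    then show ?thesis by (simp only: mmult_assoc)
  qed
  then have "rank_at_most {..<r} {..<r} (entries (1\<^sub>m r :: 'c mat)) s"
    using UV by (intro rank_at_mostI[of "{..<s}" s _ _ _ "mmult I U P" "mmult J Q V"])
      (auto simp: entries_one)
  then show ?thesis using rank_le_if_rank_at_most[OF one_carrier_mat] by (simp add: rank_one_mat)
qed

text \<open>Gaussian elimination by induction on the number of columns: factorizations of both kinds
  for the matrix without the pivot row and column extend to \<open>A\<close> with one dimension
  more.\<close>

lemma exists_rank_normal_form: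
  assumes "finite J" "finite I"
  shows "\<exists>r. rank_at_most I J (A :: 'i \<Rightarrow> 'j \<Rightarrow> 'k::field) r \<and> rank_at_least I J A r"
  using assms
proof (induction "card J" arbitrary: I J A rule: less_induct)
  case less
  show ?case
  proof (cases "\<forall>i\<in>I. \<forall>j\<in>J. A i j = 0")
    case True
    then have "rank_at_most I J A 0" "rank_at_least I J A 0"
      by (auto simp: rank_at_most_def rank_at_least_def mmult_def)
    then show ?thesis by blast
  next
    case False
    then obtain i0 j0 where p: "i0 \<in> I" "j0 \<in> J" "A i0 j0 \<noteq> 0" by blast
    define a where "a = A i0 j0"
    \<comment> \<open>The Schur complement of the pivot; it vanishes in the pivot row and in the
      pivot column.\<close>
    define A' where "A' i j = A i j - A i j0 * A i0 j / a" for i j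
    define I' where "I' = I - {i0}"
    define J' where "J' = J - {j0}"
    have fin: "finite I'" "finite J'" using less.prems by (auto simp: I'_def J'_def)
    have a: "a \<noteq> 0" using p by (simp add: a_def)
    have "card J' < card J" unfolding J'_def by (rule card_Diff1_less[OF less.prems(1) p(2)])
    then obtain r where r: "rank_at_most I' J' A' r" "rank_at_least I' J' A' r" using less.hyps fin by blast
    obtain P Q where PQ: "\<And>i j. i \<in> I' \<Longrightarrow> j \<in> J' \<Longrightarrow> A' i j = mmult {..<r} P Q i j" using r(1)
      by (auto simp: rank_at_most_def)
    obtain U V where UV: "\<And>p q. p < r \<Longrightarrow> q < r \<Longrightarrow> mmult J' (mmult I' U A') V p q = delta p q" using r(2)
      by (auto simp: rank_at_least_def)
    have A'0: "A' i0 j = 0" "A' i j0 = 0" for i j using a by (simp_all add: A'_def a_def)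
    have sJ: "sum f J = f j0 + sum f J'" for f :: "'j \<Rightarrow> 'k" unfolding J'_def using less.prems p
      by (simp add: sum.remove)
    have sI: "sum f I = f i0 + sum f I'" for f :: "'i \<Rightarrow> 'k" unfolding I'_def using less.prems p
      by (simp add: sum.remove)
    have "rank_at_most I J A (Suc r)"
    proof (rule rank_at_mostI[of "{..<Suc r}" "Suc r" I J A
        "\<lambda>i p. if p = r then A i j0 / a else if i = i0 then 0 else P i p" "\<lambda>p j. if p =
          r then A i0 j else if j = j0 then 0 else Q p j"])
      fix i j assume ij: "i \<in> I" "j \<in> J"
      have "A i j = A' i j + A i j0 / a * A i0 j" by (simp add: A'_def)
      also have "A' i j = (\<Sum>p<r. (if i = i0 then 0 else P i p) * (if j = j0 then 0 else Q p j))"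
        using ij A'0 PQ[of i j] by (cases "i = i0"; cases "j = j0") (simp_all add: I'_def J'_def mmult_def)
      finally show "A i j = mmult {..<Suc r} (\<lambda>i p. if p = r then A i j0 / a else if i = i0 then 0 else P i p)
         (\<lambda>p j. if p = r then A i0 j else if j = j0 then 0 else Q p j) i j"
        by (simp add: mmult_def)
    qed auto
    moreover have "rank_at_least I J A (Suc r)"
    proof -
      \<comment> \<open>Row \<open>r\<close> of \<open>U'\<close> picks the pivot row divided by
        \<open>a\<close>; in the other rows the entry at \<open>i0\<close> is chosen so that the
        product with \<open>A\<close> vanishes in the pivot column. \<open>V'\<close> is built in
        the same way from columns: column \<open>r\<close> picks the pivot column, and the others
        make the product with \<open>A\<close> vanish in the pivot row.\<close>
      define U' where "U' p i = (if p = r then (if i = i0 then 1 / a else 0) else if i = i0 then -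
        (\<Sum>i\<in>I'. U p i * A i j0) / a else U p i)" for p i
      define V' where "V' j p = (if p = r then (if j = j0 then 1 else 0) else if j = j0 then -
        (\<Sum>j\<in>J'. A i0 j * V j p) / a else V j p)" for p j
      have i0: "i0 \<notin> I'" and j0: "j0 \<notin> J'" by (auto simp: I'_def J'_def)
      have AV: "mmult J A V' i q = (if q = r then A i j0 else mmult J' A' V i q)" for i q
      proof (cases "q = r")
        case True
        then have "mmult J A V' i q = A i j0 + (\<Sum>j\<in>J'. A i j * V' j q)" by (simp add: mmult_def sJ V'_def)
        also have "(\<Sum>j\<in>J'. A i j * V' j q) = 0" using True j0 by (intro sum.neutral) (auto simp: V'_def)
        finally show ?thesis using True by simp
      next
        case False
        have "mmult J A V' i q = A i j0 * (- (\<Sum>j\<in>J'. A i0 j * V j q) / a) + (\<Sum>j\<in>J'. A i j * V' j q)"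
          using False by (simp add: mmult_def sJ V'_def)
        also have "(\<Sum>j\<in>J'. A i j * V' j q) = (\<Sum>j\<in>J'. A i j * V j q)"
          using False j0 by (intro sum.cong) (auto simp: V'_def)
        also have "A i j0 * (- (\<Sum>j\<in>J'. A i0 j * V j q) / a) + (\<Sum>j\<in>J'. A i j * V j q) = mmult J' A' V i q"
          by (simp add: mmult_def A'_def left_diff_distrib sum_subtractf sum_distrib_left sum_divide_distrib
            mult.assoc)
        finally show ?thesis using False by simp
      qed
      have "mmult J (mmult I U' A) V' p q = delta p q" if pq: "p < Suc r" "q < Suc r" for p q
      proof -
        have "mmult J (mmult I U' A) V' p q = U' p i0 * mmult J A V' i0 q +
          (\<Sum>i\<in>I'. U' p i * mmult J A V' i q)"
          unfolding mmult_assoc by (subst mmult_def) (simp add: sI)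
        also have "\<dots> = delta p q"
        proof (cases "p = r")
          case True
          then have "(\<Sum>i\<in>I'. U' p i * mmult J A V' i q) = 0" using i0
            by (intro sum.neutral) (auto simp: U'_def)
          moreover have "mmult J A V' i0 q = (if q = r then a else 0)"
            by (simp add: AV a_def) (simp add: mmult_def A'0)
          ultimately show ?thesis using True a by (auto simp: U'_def delta_def)
        next
          case pF: False
          have s: "(\<Sum>i\<in>I'. U' p i * f i) = (\<Sum>i\<in>I'. U p i * f i)" for f using pF i0
            by (intro sum.cong) (auto simp: U'_def)
          show ?thesis
          proof (cases "q = r")
            case True
            then show ?thesis using pF a unfolding s by (simp add: AV U'_def delta_def a_def)
          next
            case False
            have "mmult J A V' i0 q = 0" using False by (simp add: AV) (simp add: mmult_def A'0)
            moreover have "(\<Sum>i\<in>I'. U p i * mmult J A V' i q) = mmult I' U (mmult J' A' V) p q" using False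
              by (simp add: AV mmult_def[of I'])
            ultimately show ?thesis unfolding s using UV[of p q] pq pF False by (simp add: mmult_assoc)
          qed
        qed
        finally show ?thesis .
      qed
      then show ?thesis unfolding rank_at_least_def by blast
    qed
    ultimately show ?thesis by blast
  qed
qed

text \<open>By \<open>exists_rank_normal_form\<close> this is also the greatest \<open>r\<close>
  with \<open>rank_at_least\<close>, so upper and lower bounds are both proved by exhibiting
  factorizations.\<close>

definition rank_on :: "'i set \<Rightarrow> 'j set \<Rightarrow> ('i \<Rightarrow> 'j \<Rightarrow> 'k::field) \<Rightarrow> nat" where
  "rank_on I J A = (LEAST r. rank_at_most I J A r)"

lemma rank_on_facts:
  assumes "finite I" "finite J"
  shows "rank_at_most I J A (rank_on I J A)" "rank_at_least I J A (rank_on I J A)" "rank_at_most I J A r \<Longrightarrow>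
    rank_on I J A \<le> r" "rank_at_least I J A r \<Longrightarrow> r \<le> rank_on I J A"
proof -
  obtain s where s: "rank_at_most I J A s" "rank_at_least I J A s" using exists_rank_normal_form assms
    by blast
  have "rank_on I J A = s" unfolding rank_on_def by (rule Least_equality[of "rank_at_most I J A", OF s(1)])
    (rule rank_at_least_le_rank_at_most[OF s(2)])
  then show "rank_at_most I J A (rank_on I J A)" "rank_at_least I J A (rank_on I J A)"
    "rank_at_most I J A r \<Longrightarrow> rank_on I J A \<le> r" "rank_at_least I J A r \<Longrightarrow> r \<le> rank_on I J A"
    using s rank_at_least_le_rank_at_most by auto
qed

lemma rank_eq_rank_on: "M \<in> carrier_mat n n \<Longrightarrow> vec_space.rank n M = rank_on {..<n} {..<n} (entries M)"
  by (intro antisym rank_le_if_rank_at_most rank_on_facts(3) rank_at_most_rank rank_on_facts(1)) auto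

lemma rank_on_cong: "(\<And>i j. i \<in> I \<Longrightarrow> j \<in> J \<Longrightarrow> A i j = B i j) \<Longrightarrow> rank_on I J A = rank_on I J B"
  by (simp add: rank_on_def rank_at_most_def)

lemma rank_on_reindex:
  assumes \<beta>: "bij_betw \<beta> K I" shows "rank_on K K (\<lambda>x y. F (\<beta> x) (\<beta> y)) = rank_on I I F"
proof -
  have "rank_at_most K K (\<lambda>x y. F (\<beta> x) (\<beta> y)) r \<longleftrightarrow> rank_at_most I I F r" for r
  proof
    assume "rank_at_most I I F r"
    then obtain P Q where "\<forall>i\<in>I. \<forall>j\<in>I. F i j = mmult {..<r} P Q i j" by (auto simp: rank_at_most_def)
    then have "\<forall>x\<in>K. \<forall>y\<in>K. F (\<beta> x) (\<beta> y) = mmult {..<r} (\<lambda>x. P (\<beta> x)) (\<lambda>p y. Q p (\<beta> y)) x y"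
      using \<beta> by (auto simp: mmult_def bij_betw_def)
    then show "rank_at_most K K (\<lambda>x y. F (\<beta> x) (\<beta> y)) r" unfolding rank_at_most_def by blast
  next
    let ?g = "inv_into K \<beta>"
    assume "rank_at_most K K (\<lambda>x y. F (\<beta> x) (\<beta> y)) r"
    then obtain P Q where PQ: "\<And>x y. x \<in> K \<Longrightarrow> y \<in> K \<Longrightarrow> F (\<beta> x) (\<beta> y) = mmult {..<r} P Q x y"
      by (auto simp: rank_at_most_def)
    have g: "?g i \<in> K" "\<beta> (?g i) = i" if "i \<in> I" for i using \<beta> that
      by (auto simp: bij_betw_def f_inv_into_f intro: inv_into_into)
    have "\<forall>i\<in>I. \<forall>j\<in>I. F i j = mmult {..<r} (\<lambda>i. P (?g i)) (\<lambda>p j. Q p (?g j)) i j"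
    proof (intro ballI)
      fix i j assume "i \<in> I" "j \<in> I"
      then show "F i j = mmult {..<r} (\<lambda>i. P (?g i)) (\<lambda>p j. Q p (?g j)) i j"
        using PQ[OF g(1)[of i] g(1)[of j]] g(2) by (simp add: mmult_def)
    qed
    then show "rank_at_most I I F r" unfolding rank_at_most_def by blast
  qed
  then show ?thesis by (simp add: rank_on_def)
qed

lemma rank_dist_entries:
  assumes "M \<in> carrier_mat n n" "M' \<in> carrier_mat n n"
  shows "rank_dist n M M' = real (rank_on {..<n} {..<n} (\<lambda>i j. entries M i j - entries M' i j)) / real n"
proof -
  have "rank_on {..<n} {..<n} (entries (M - M')) = rank_on {..<n} {..<n} (\<lambda>i j. entries M i j - entries M' i
    j)"
    by (rule rank_on_cong) (use assms in \<open>auto simp: entries_def\<close>)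
  then show ?thesis unfolding rank_dist_def using rank_eq_rank_on[OF minus_carrier_mat[OF assms(2), of M]]
    by simp
qed

lemma rank_dist_to_mat:
  assumes \<beta>: "bij_betw \<beta> {..<N} I"
  shows "rank_dist N (to_mat N \<beta> F) (to_mat N \<beta> G) = real (rank_on I I (\<lambda>i j. F i j - G i j)) / real N"
proof -
  have "rank_on {..<N} {..<N} (\<lambda>i j. entries (to_mat N \<beta> F) i j - entries (to_mat N \<beta> G) i j) =
    rank_on {..<N} {..<N} (\<lambda>x y. F (\<beta> x) (\<beta> y) - G (\<beta> x) (\<beta> y))"
    by (rule rank_on_cong) (auto simp: entries_def)
  also have "\<dots> = rank_on I I (\<lambda>i j. F i j - G i j)" by (rule rank_on_reindex[OF \<beta>])
  finally show ?thesis by (simp add: rank_dist_entries)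
qed

section \<open>Generalized inverses and the rank of tensor and block matrices\<close>

lemma mmult_zero_left: "(\<And>j. j \<in> J \<Longrightarrow> A i j = 0) \<Longrightarrow> mmult J A B i l = 0"
  by (simp add: mmult_def)

lemma square_inverse_swap:
  fixes X Y :: "nat \<Rightarrow> nat \<Rightarrow> 'k::field"
  assumes "\<And>p q. p < r \<Longrightarrow> q < r \<Longrightarrow> mmult {..<r} X Y p q = delta p q" "p < r" "q < r"
  shows "mmult {..<r} Y X p q = delta p q"
proof -
  have b: "bij_betw (\<lambda>x. x) {..<r} {..<r}" by (simp add: bij_betw_def)
  let ?M = "to_mat r (\<lambda>x. x)"
  have "?M X * ?M Y = 1\<^sub>m r" unfolding to_mat_mult[OF b] by (rule to_mat_one[OF b]) (use assms(1) in auto)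
  then have "?M Y * ?M X = 1\<^sub>m r" using mat_mult_left_right_inverse[of "?M X" r "?M Y"] by simp
  then have "?M (mmult {..<r} Y X) $$ (p, q) = 1\<^sub>m r $$ (p, q)" unfolding to_mat_mult[OF b] by simp
  then show ?thesis using assms(2,3) by (simp add: delta_def)
qed

text \<open>The second claim is \<open>N V U N = N\<close>. With \<open>N = P Q\<close> through
  dimension \<open>r\<close>, the relation \<open>U N V = 1\<close> says that the square matrices
  \<open>U P\<close> and \<open>Q V\<close> have product \<open>1\<close>. Then so does the product
  in the other order, and inserting it between \<open>P\<close> and \<open>Q\<close> gives the
  claim.\<close>

lemma exists_generalized_inverse:
  fixes N :: "'i \<Rightarrow> 'j \<Rightarrow> 'k::field"
  assumes "finite I" "finite J"
  obtains U V where "\<And>p q. p < rank_on I J N \<Longrightarrow> q < rank_on I J N \<Longrightarrow> mmult J (mmult I U N) V p q = delta p q"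
    "\<And>i j. i \<in> I \<Longrightarrow> j \<in> J \<Longrightarrow> mmult {..<rank_on I J N} (mmult J N V) (mmult I U N) i j = N i j"
proof -
  let ?r = "rank_on I J N"
  obtain U V where UV: "\<And>p q. p < ?r \<Longrightarrow> q < ?r \<Longrightarrow> mmult J (mmult I U N) V p q = delta p q"
    using rank_on_facts(2)[OF assms, of N] by (auto simp: rank_at_least_def)
  obtain P Q where PQ: "\<And>i j. i \<in> I \<Longrightarrow> j \<in> J \<Longrightarrow> N i j = mmult {..<?r} P Q i j"
    using rank_on_facts(1)[OF assms, of N] by (auto simp: rank_at_most_def)
  have UN: "mmult I U N p j = mmult {..<?r} (mmult I U P) Q p j" if "j \<in> J" for p j
  proof -
    have "mmult I U N p j = mmult I U (mmult {..<?r} P Q) p j" by (rule mmult_cong) (use PQ that in auto)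
    then show ?thesis by (simp add: mmult_assoc)
  qed
  have NV: "mmult J N V i q = mmult {..<?r} P (mmult J Q V) i q" if "i \<in> I" for i q
  proof -
    have "mmult J N V i q = mmult J (mmult {..<?r} P Q) V i q" by (rule mmult_cong) (use PQ that in auto)
    then show ?thesis by (simp add: mmult_assoc)
  qed
  have "mmult {..<?r} (mmult I U P) (mmult J Q V) p q = delta p q" if "p < ?r" "q < ?r" for p q
  proof -
    have "mmult {..<?r} (mmult I U P) (mmult J Q V) p q = mmult J (mmult {..<?r} (mmult I U P) Q) V p q"
      by (simp add: mmult_assoc)
    also have "\<dots> = mmult J (mmult I U N) V p q" by (rule mmult_cong) (auto simp: UN)
    finally show ?thesis using UV that by simp
  qed
  then have sw: "mmult {..<?r} (mmult J Q V) (mmult I U P) p q = delta p q" if "p < ?r" "q < ?r" for p q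
    using square_inverse_swap[of ?r "mmult I U P" "mmult J Q V"] that by blast
  have "mmult {..<?r} (mmult J N V) (mmult I U N) i j = N i j" if "i \<in> I" "j \<in> J" for i j
  proof -
    have "mmult {..<?r} (mmult J N V) (mmult I U N) i j = mmult {..<?r} (mmult {..<?r} P (mmult J Q V))
      (mmult {..<?r} (mmult I U P) Q) i j"
      by (rule mmult_cong) (use that UN NV in auto)
    also have "\<dots> = mmult {..<?r} P (mmult {..<?r} (mmult {..<?r} (mmult J Q V) (mmult I U P)) Q) i j"
      by (simp add: mmult_assoc)
    also have "\<dots> = mmult {..<?r} P (mmult {..<?r} delta Q) i j"
      by (intro mmult_cong) (auto simp: sw)
    also have "\<dots> = mmult {..<?r} P Q i j" by (rule mmult_cong) (auto simp: mmult_delta_left)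
    finally show ?thesis using PQ that by simp
  qed
  then show ?thesis using UV that by blast
qed

lemma rank_at_least_delta: "finite I \<Longrightarrow> rank_at_least I I (delta :: _ \<Rightarrow> _ \<Rightarrow> 'k::field) (card I)"
  by (rule rank_at_leastI[where U = delta and V = delta]) (simp_all add: mmult_delta_left mmult_assoc)

lemma rank_at_most_add:
  assumes "rank_at_most I J A r" "rank_at_most I J B s" shows "rank_at_most I J (\<lambda>i j. A i j + B i j) (r + s)"
proof -
  obtain P Q where PQ: "\<And>i j. i \<in> I \<Longrightarrow> j \<in> J \<Longrightarrow> A i j = mmult {..<r} P Q i j" using assms(1)
    by (auto simp: rank_at_most_def)
  obtain P' Q' where PQ': "\<And>i j. i \<in> I \<Longrightarrow> j \<in> J \<Longrightarrow> B i j = mmult {..<s} P' Q' i j" using assms(2)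
    by (auto simp: rank_at_most_def)
  show ?thesis
  proof (rule rank_at_mostI[of "{..<r} <+> {..<s}" _ _ _ _ "\<lambda>i. case_sum (P i) (P' i)"
    "\<lambda>p j. case_sum (\<lambda>p. Q p j) (\<lambda>p. Q' p j) p"])
    show "A i j + B i j = mmult ({..<r} <+> {..<s}) (\<lambda>i. case_sum (P i) (P' i))
      (\<lambda>p j. case_sum (\<lambda>p. Q p j) (\<lambda>p. Q' p j) p) i j"
      if "i \<in> I" "j \<in> J" for i j
      using PQ PQ' that by (simp add: mmult_def sum.Plus)
  qed (auto simp: card_Plus)
qed

lemma complement_rank:
  fixes A :: "'i \<Rightarrow> 'i \<Rightarrow> 'k::field"
  assumes "finite I" "rank_at_most I I A r" shows "card I - r \<le> rank_on I I (\<lambda>i j. delta i j - A i j)"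
proof -
  have "rank_at_most I I (\<lambda>i j. (delta i j - A i j) + A i j) (rank_on I I (\<lambda>i j. delta i j - A i j) + r)"
    by (rule rank_at_most_add[OF rank_on_facts(1)[OF assms(1,1)] assms(2)])
  then have "rank_at_most I I (delta :: 'i \<Rightarrow> 'i \<Rightarrow> 'k) (rank_on I I (\<lambda>i j. delta i j - A i j) + r)" by simp
  then show ?thesis using rank_at_least_le_rank_at_most[OF rank_at_least_delta[OF assms(1)]] by fastforce
qed

text \<open>With respect to the two families of test rows and columns \<open>T\<close> is block
  triangular with identity matrices on the diagonal. Passing from \<open>V2\<close> to
  \<open>V2'\<close> is the column operation that clears the remaining block
  \<open>C\<close>.\<close>

lemma rank_at_least_combine:
  fixes T :: "'i \<Rightarrow> 'j \<Rightarrow> 'k::field"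
  assumes fin: "finite R1" "finite R2"
    and 1: "\<And>p q. p \<in> R1 \<Longrightarrow> q \<in> R1 \<Longrightarrow> mmult I U1 (mmult J T V1) p q = delta p q"
    and 2: "\<And>p q. p \<in> R2 \<Longrightarrow> q \<in> R2 \<Longrightarrow> mmult I U2 (mmult J T V2) p q = delta p q"
    and 3: "\<And>p q. p \<in> R2 \<Longrightarrow> q \<in> R1 \<Longrightarrow> mmult I U2 (mmult J T V1) p q = 0"
  shows "rank_at_least I J T (card R1 + card R2)"
proof -
  define C where "C = mmult I U1 (mmult J T V2)"
  define V2' where "V2' j q = V2 j q - mmult R1 V1 C j q" for j q
  define U where "U p = case_sum U1 U2 p" for p
  define V where "V j p = case_sum (V1 j) (V2' j) p" for j p
  have TV2: "mmult J T V2' i q = mmult J T V2 i q - mmult R1 (mmult J T V1) C i q" for i q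
    unfolding V2'_def mmult_diff_right by (simp add: mmult_assoc)
  have UTV2: "mmult I W (mmult J T V2') p q = mmult I W (mmult J T V2) p q - mmult R1
    (mmult I W (mmult J T V1)) C p q" for W :: "'x \<Rightarrow> 'i \<Rightarrow> 'k" and p q
  proof -
    have "mmult I W (mmult J T V2') p q = mmult I W (\<lambda>i q. mmult J T V2 i q - mmult R1 (mmult J T V1) C i q)
      p q" by (rule mmult_cong) (simp_all add: TV2)
    then show ?thesis by (simp add: mmult_diff_right mmult_assoc)
  qed
  have "rank_at_least I J T (card (R1 <+> R2))"
  proof (rule rank_at_leastI[where U = U and V = V])
    fix p q assume pq: "p \<in> R1 <+> R2" "q \<in> R1 <+> R2"
    have inl: "mmult J T V i (Inl b) = mmult J T V1 i b" "mmult J T V i (Inr c) = mmult J T V2' i c"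
      for i b c by (simp_all add: mmult_def V_def)
    have "mmult J (mmult I U T) V p q = mmult I U (mmult J T V) p q" by (simp add: mmult_assoc)
    also have "\<dots> = delta p q"
    proof (cases p)
      case (Inl p')
      then have p': "p' \<in> R1" using pq by auto
      have e: "mmult I U Y p q = mmult I U1 Y p' q" for Y :: "'i \<Rightarrow> _ \<Rightarrow> 'k" and q
        by (simp add: mmult_def U_def Inl)
      show ?thesis
      proof (cases q)
        case q: (Inl q')
        then have "mmult I U (mmult J T V) p q = mmult I U1 (mmult J T V1) p' q'" unfolding e
          by (simp add: mmult_def[of I] inl)
        then show ?thesis using 1[OF p'] q pq Inl by (auto simp: delta_def)
      next
        case q: (Inr q')
        then have "mmult I U (mmult J T V) p q = mmult I U1 (mmult J T V2') p' q'" unfolding e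
          by (simp add: mmult_def[of I] inl)
        also have "\<dots> = C p' q' - mmult R1 delta C p' q'" unfolding UTV2 C_def[symmetric]
          using 1[OF p'] by (auto intro!: arg_cong2[of _ _ _ _ "(-)"] mmult_cong)
        also have "\<dots> = 0" using p' fin by (simp add: mmult_delta_left)
        finally show ?thesis using Inl q by (simp add: delta_def)
      qed
    next
      case (Inr p')
      then have p': "p' \<in> R2" using pq by auto
      have e: "mmult I U Y p q = mmult I U2 Y p' q" for Y :: "'i \<Rightarrow> _ \<Rightarrow> 'k" and q
        by (simp add: mmult_def U_def Inr)
      show ?thesis
      proof (cases q)
        case q: (Inl q')
        then have "mmult I U (mmult J T V) p q = mmult I U2 (mmult J T V1) p' q'" unfolding e
          by (simp add: mmult_def[of I] inl)
        then show ?thesis using 3[OF p'] q pq Inr by (auto simp: delta_def)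
      next
        case q: (Inr q')
        then have "mmult I U (mmult J T V) p q = mmult I U2 (mmult J T V2') p' q'" unfolding e
          by (simp add: mmult_def[of I] inl)
        also have "\<dots> = mmult I U2 (mmult J T V2) p' q'" unfolding UTV2 using 3[OF p']
          by (simp add: mmult_zero_left)
        finally show ?thesis using 2[OF p'] q pq Inr by (auto simp: delta_def)
      qed
    qed
    finally show "mmult J (mmult I U T) V p q = delta p q" .
  qed (use fin in auto)
  then show ?thesis using fin by (simp add: card_Plus)
qed

text \<open>Frobenius' trick: \<open>A \<otimes> B - 1\<close> restricted to \<open>ker (A - 1) \<otimes> J\<close> is \<open>1 \<otimes> (B - 1)\<close>,
  and modulo \<open>I \<otimes> im (B - 1)\<close> it is \<open>(A - 1) \<otimes> 1\<close>.\<close>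

lemma rank_on_kron_minus_one:
  fixes A :: "'i \<Rightarrow> 'i \<Rightarrow> 'k::field" and B :: "'j \<Rightarrow> 'j \<Rightarrow> 'k"
  assumes fin: "finite I" "finite J"
  defines "N \<equiv> \<lambda>i i'. A i i' - delta i i'" and "L \<equiv> \<lambda>j j'. B j j' - delta j j'"
  shows "(card I - rank_on I I N) * rank_on J J L + rank_on I I N * (card J - rank_on J J L)
    \<le> rank_on (I \<times> J) (I \<times> J) (\<lambda>x y. kron A B x y - delta x y)"
proof -
  let ?r = "rank_on I I N" and ?l = "rank_on J J L" and ?IJ = "I \<times> J"
  obtain U V where UV: "\<And>p q. p < ?r \<Longrightarrow> q < ?r \<Longrightarrow> mmult I (mmult I U N) V p q = delta p q"
    and N: "\<And>i j. i \<in> I \<Longrightarrow> j \<in> I \<Longrightarrow> mmult {..<?r} (mmult I N V) (mmult I U N) i j = N i j"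
    using exists_generalized_inverse[OF fin(1,1), of N] by metis
  obtain U' V' where UV': "\<And>p q. p < ?l \<Longrightarrow> q < ?l \<Longrightarrow> mmult J (mmult J U' L) V' p q = delta p q"
    and L: "\<And>i j. i \<in> J \<Longrightarrow> j \<in> J \<Longrightarrow> mmult {..<?l} (mmult J L V') (mmult J U' L) i j = L i j"
    using exists_generalized_inverse[OF fin(2,2), of L] by metis
  \<comment> \<open>By the generalized inverses \<open>N e = 0\<close> and \<open>f L = 0\<close>:
    the image of \<open>e\<close> lies in the kernel of \<open>A - 1\<close>, and \<open>f\<close>
    annihilates the image of \<open>B - 1\<close>. Their ranks are bounded below as complements of
    matrices of rank at most \<open>?r\<close> and \<open>?l\<close>.\<close>
  define e where "e i j = delta i j - mmult {..<?r} V (mmult I U N) i j" for i j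
  define f where "f i j = delta i j - mmult {..<?l} (mmult J L V') U' i j" for i j
  let ?a = "rank_on I I e" and ?b = "rank_on J J f"
  have a: "card I - ?r \<le> ?a" unfolding e_def by (rule complement_rank[OF fin(1)])
    (auto simp: rank_at_most_def)
  have b: "card J - ?l \<le> ?b" unfolding f_def by (rule complement_rank[OF fin(2)])
    (auto simp: rank_at_most_def)
  obtain Ue Ve where UVe: "\<And>p q. p < ?a \<Longrightarrow> q < ?a \<Longrightarrow> mmult I (mmult I Ue e) Ve p q = delta p q"
    using rank_on_facts(2)[OF fin(1,1), of e] by (auto simp: rank_at_least_def)
  obtain Uf Vf where UVf: "\<And>p q. p < ?b \<Longrightarrow> q < ?b \<Longrightarrow> mmult J (mmult J Uf f) Vf p q = delta p q"
    using rank_on_facts(2)[OF fin(2,2), of f] by (auto simp: rank_at_least_def)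
  have Ne: "mmult I N e i j = 0" if "i \<in> I" "j \<in> I" for i j
    unfolding e_def mmult_diff_right using N[OF that] that fin
      by (simp add: mmult_delta_right flip: mmult_assoc)
  have fL: "mmult J f L i j = 0" if "i \<in> J" "j \<in> J" for i j
    unfolding f_def mmult_diff_left using L[OF that] that fin by (simp add: mmult_delta_left mmult_assoc)
  define x where "x = mmult I e Ve"
  define y where "y = mmult J Uf f"
  have Nx: "mmult I N x i q = 0" if "i \<in> I" for i q
  proof -
    have "mmult I N x i q = mmult I (mmult I N e) Ve i q" by (simp add: x_def mmult_assoc)
    then show ?thesis using Ne that by (simp add: mmult_zero_left)
  qed
  have yL: "mmult J y L p j = 0" if "j \<in> J" for p j
  proof -
    have "mmult J y L p j = mmult J Uf (mmult J f L) p j" by (simp add: y_def mmult_assoc)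
    also have "\<dots> = mmult J Uf (\<lambda>_ _. 0) p j" by (rule mmult_cong) (use fL that in auto)
    finally show ?thesis by (simp add: mmult_def)
  qed
  have Ax: "mmult I A x i q = x i q" if "i \<in> I" for i q
    using Nx[OF that, of q] that fin unfolding N_def mmult_diff_left by (simp add: mmult_delta_left)
  have BV: "mmult J B V' j q = mmult J L V' j q + V' j q" if "j \<in> J" for j q
    using that fin unfolding L_def mmult_diff_left by (simp add: mmult_delta_left)
  have UA: "mmult I U A p i = mmult I U N p i + U p i" if "i \<in> I" for p i
    using that fin unfolding N_def mmult_diff_right by (simp add: mmult_delta_right)
  have yB: "mmult J y B p j = y p j" if "j \<in> J" for p j
    using yL[OF that, of p] that fin unfolding L_def mmult_diff_right by (simp add: mmult_delta_right)
  define T where "T = (\<lambda>x y. kron A B x y - delta x y)"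
  have fIJ: "finite ?IJ" using fin by simp
  have TV1: "mmult ?IJ T (kron x V') s q = kron x (mmult J L V') s q" if s: "s \<in> ?IJ" for s q
  proof -
    have "mmult ?IJ T (kron x V') s q = kron (mmult I A x) (mmult J B V') s q - kron x V' s q"
      unfolding T_def mmult_diff_left mmult_kron using mmult_delta_left[OF fIJ s] by simp
    then show ?thesis using s Ax BV by (cases s, cases q) (auto simp: algebra_simps)
  qed
  have U2T: "mmult ?IJ (kron U y) T p s = kron (mmult I U N) y p s" if s: "s \<in> ?IJ" for s p
  proof -
    have "mmult ?IJ (kron U y) T p s = kron (mmult I U A) (mmult J y B) p s - kron U y p s"
      unfolding T_def mmult_diff_right mmult_kron using mmult_delta_right[OF fIJ s] by simp
    then show ?thesis using s UA yB by (cases s, cases p) (auto simp: algebra_simps)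
  qed
  have c: "mmult ?IJ W (mmult ?IJ T (kron x V')) p q = mmult ?IJ W (kron x (mmult J L V')) p q"
    for W :: "nat \<times> nat \<Rightarrow> _" and p q
    by (rule mmult_cong) (use TV1 in auto)
  have "rank_at_least ?IJ ?IJ T (card ({..<?a} \<times> {..<?l}) + card ({..<?r} \<times> {..<?b}))"
  proof (rule rank_at_least_combine[where ?U1.0 = "kron Ue U'" and ?V1.0 = "kron x V'" and ?U2.0 = "kron U y"
    and ?V2.0 = "kron V Vf"])
    show "mmult ?IJ (kron Ue U') (mmult ?IJ T (kron x V')) p q = delta p q"
      if "p \<in> {..<?a} \<times> {..<?l}" "q \<in> {..<?a} \<times> {..<?l}" for p q
      unfolding c mmult_kron using UVe UV' that by (cases p, cases q) (auto simp: x_def mmult_assoc delta_def)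
    show "mmult ?IJ (kron U y) (mmult ?IJ T (kron V Vf)) p q = delta p q"
      if "p \<in> {..<?r} \<times> {..<?b}" "q \<in> {..<?r} \<times> {..<?b}" for p q
    proof -
      have "mmult ?IJ (kron U y) (mmult ?IJ T (kron V Vf)) p q = mmult ?IJ (mmult ?IJ (kron U y) T)
        (kron V Vf) p q" by (simp add: mmult_assoc)
      also have "\<dots> = mmult ?IJ (kron (mmult I U N) y) (kron V Vf) p q" by (rule mmult_cong) (use U2T in auto)
      also have "\<dots> = delta p q" unfolding mmult_kron using UV UVf that
        by (cases p, cases q) (auto simp: y_def delta_def)
      finally show ?thesis .
    qed
    show "mmult ?IJ (kron U y) (mmult ?IJ T (kron x V')) p q = 0" for p q
    proof -
      have "mmult J y (mmult J L V') p' q' = 0" for p' q'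
      proof -
        have "mmult J y (mmult J L V') p' q' = mmult J (mmult J y L) V' p' q'" by (simp add: mmult_assoc)
        then show ?thesis using yL by (simp add: mmult_zero_left)
      qed
      then show ?thesis unfolding c mmult_kron by (cases p, cases q) simp
    qed
  qed auto
  then have "?a * ?l + ?r * ?b \<le> rank_on ?IJ ?IJ T" using rank_on_facts(4)[OF fIJ fIJ]
    by (simp add: card_cartesian_product)
  moreover have "(card I - ?r) * ?l \<le> ?a * ?l" "?r * (card J - ?l) \<le> ?r * ?b" using a b
    by (simp_all add: mult_le_mono)
  ultimately show ?thesis unfolding T_def by linarith
qed

definition block_diag :: "('t \<Rightarrow> 'i \<Rightarrow> 'j \<Rightarrow> 'k::zero) \<Rightarrow> 't \<times> 'i \<Rightarrow> 't \<times> 'j \<Rightarrow> 'k" where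
  "block_diag F = (\<lambda>(s, i) (t, j). if s = t then F t i j else 0)"

lemma mmult_block_diag_right:
  assumes "finite A" "\<And>t. t \<in> A \<Longrightarrow> finite (K t)" "t \<in> A"
  shows "mmult (Sigma A K) P (block_diag Q) z (t, j) = (\<Sum>p\<in>K t. P z (t, p) * Q t p j)"
proof -
  have "mmult (Sigma A K) P (block_diag Q) z (t, j) = (\<Sum>s\<in>A. \<Sum>p\<in>K s. P z (s, p) * block_diag Q (s, p) (t, j))"
    using assms by (simp add: mmult_def sum.Sigma split_def)
  also have "\<dots> = (\<Sum>s\<in>A. if s = t then \<Sum>p\<in>K t. P z (t, p) * Q t p j else 0)"
    by (rule sum.cong) (auto simp: block_diag_def)
  finally show ?thesis using assms by simp
qed

lemma mmult_block_diag:
  assumes "finite A" "\<And>t. t \<in> A \<Longrightarrow> finite (K t)" "t \<in> A"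
  shows "mmult (Sigma A K) (block_diag P) (block_diag Q) (s, i) (t, j) =
    block_diag (\<lambda>t. mmult (K t) (P t) (Q t)) (s, i) (t, j)"
proof -
  have "mmult (Sigma A K) (block_diag P) (block_diag Q) (s, i) (t, j) =
    (\<Sum>p\<in>K t. block_diag P (s, i) (t, p) * Q t p j)"
    by (rule mmult_block_diag_right) (use assms in auto)
  then show ?thesis by (simp add: block_diag_def mmult_def)
qed

section \<open>General linear groups\<close>

text \<open>For every \<open>t\<close> in \<open>T\<close> the identity matrix of size
  \<open>r t\<close> factors through the block \<open>u t - 1\<close>; these factorizations are
  assembled block-diagonally.\<close>

lemma rank_monomial_block:
  fixes u :: "nat \<Rightarrow> 'k::field mat" and n :: nat
  assumes A: "finite A" and T: "T \<subseteq> A"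
  defines "I \<equiv> A \<times> {..<n}"
  shows "(\<Sum>t\<in>T. rank_on {..<n} {..<n} (\<lambda>i j. entries (u t) i j - entries (1\<^sub>m n) i j))
    \<le> rank_on I I (\<lambda>p q. monomial u (\<lambda>x\<in>A. x) p q - monomial (\<lambda>_. 1\<^sub>m n) (\<lambda>x\<in>A. x) p q)"
proof -
  define E where "E t i j = entries (u t) i j - entries (1\<^sub>m n) i j" for t i j
  define r where "r t = rank_on {..<n} {..<n} (E t)" for t
  have fT: "finite T" using A T finite_subset by blast
  have "\<exists>U V. \<forall>p<r t. \<forall>q<r t. mmult {..<n} (mmult {..<n} U (E t)) V p q = delta p q" for t
    using rank_on_facts(2)[of "{..<n}" "{..<n}" "E t"] by (simp add: rank_at_least_def r_def)
  then obtain U V where UV: "\<And>t p q. p < r t \<Longrightarrow> q < r t \<Longrightarrow> mmult {..<n} (mmult {..<n} (U t) (E t)) (V t) p q =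
    delta p q" by metis
  have Eb: "monomial u (\<lambda>x\<in>A. x) p q - monomial (\<lambda>_. 1\<^sub>m n) (\<lambda>x\<in>A. x) p q = block_diag E p q" if "q \<in> I"
    for p q
    using that by (cases p, cases q) (auto simp: monomial_def block_diag_def E_def I_def)
  have "rank_at_least I I (block_diag E) (card (Sigma T (\<lambda>t. {..<r t})))"
  proof (rule rank_at_leastI[where U = "block_diag U" and V = "block_diag V"])
    fix p q assume pq: "p \<in> Sigma T (\<lambda>t. {..<r t})" "q \<in> Sigma T (\<lambda>t. {..<r t})"
    obtain t a s b where e: "p = (t, a)" "q = (s, b)" by (cases p, cases q)
    have m: "t \<in> A" "s \<in> A" "a < r t" "b < r s" using pq T e by auto
    have "mmult I (mmult I (block_diag U) (block_diag E)) (block_diag V) p q =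
      mmult I (block_diag (\<lambda>t. mmult {..<n} (U t) (E t))) (block_diag V) p q"
    proof (rule mmult_cong)
      fix j assume "j \<in> I"
      then show "mmult I (block_diag U) (block_diag E) p j = block_diag (\<lambda>t. mmult {..<n} (U t) (E t)) p j"
        unfolding I_def e using mmult_block_diag[of A "\<lambda>_. {..<n}"] A by (cases j) auto
    qed simp
    also have "\<dots> = block_diag (\<lambda>t. mmult {..<n} (mmult {..<n} (U t) (E t)) (V t)) p q"
      unfolding I_def e using mmult_block_diag[of A "\<lambda>_. {..<n}"] A m by auto
    also have "\<dots> = delta p q" using UV m by (auto simp: e block_diag_def delta_def)
    finally show "mmult I (mmult I (block_diag U) (block_diag E)) (block_diag V) p q = delta p q" .
  qed (use fT in auto)
  then have "(\<Sum>t\<in>T. r t) \<le> rank_on I I (block_diag E)"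
    using rank_on_facts(4)[of I I "block_diag E"] A fT by (simp add: I_def card_SigmaI)
  also have "rank_on I I (block_diag E) = rank_on I I (\<lambda>p q. monomial u (\<lambda>x\<in>A. x) p q - monomial (\<lambda>_. 1\<^sub>m n)
    (\<lambda>x\<in>A. x) p q)"
    by (rule rank_on_cong) (simp add: Eb)
  finally show ?thesis unfolding r_def E_def .
qed

text \<open>In a block column from \<open>T\<close> both blocks stand in the same row, so it
  contributes the rank of one difference of blocks. Any other block column contributes at most its
  width \<open>n\<close>.\<close>

lemma rank_monomial_diff:
  fixes u v :: "nat \<Rightarrow> 'k::field mat" and n :: nat
  assumes A: "finite A" and T: "T \<subseteq> A" and eq: "\<And>t. t \<in> T \<Longrightarrow> \<sigma> t = \<tau> t"
  defines "I \<equiv> A \<times> {..<n}"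
  shows "rank_on I I (\<lambda>p q. monomial u \<sigma> p q - monomial v \<tau> p q) \<le>
    (\<Sum>t\<in>T. rank_on {..<n} {..<n} (\<lambda>i j. entries (u t) i j - entries (v t) i j)) + card (A - T) * n"
proof -
  define D where "D t = (\<lambda>i j. entries (u t) i j - entries (v t) i j)" for t
  define r where "r t = (if t \<in> T then rank_on {..<n} {..<n} (D t) else n)" for t
  have "\<exists>P Q. \<forall>i\<in>{..<n}. \<forall>j\<in>{..<n}. D t i j = mmult {..<rank_on {..<n} {..<n} (D t)} P Q i j" for t
    using rank_on_facts(1)[of "{..<n}" "{..<n}" "D t"] by (simp add: rank_at_most_def)
  then obtain P Q where PQ: "\<And>t i j. i \<in> {..<n} \<Longrightarrow> j \<in> {..<n} \<Longrightarrow>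
    D t i j = mmult {..<rank_on {..<n} {..<n} (D t)} (P t) (Q t) i j" by metis
  \<comment> \<open>Outside \<open>T\<close> the block column is factored trivially, as itself times
    the identity matrix of size \<open>n\<close>.\<close>
  define P' where "P' = (\<lambda>(s, i) (t, p). if t \<in> T then (if s = \<sigma> t then P t i p else 0) else monomial u \<sigma>
    (s, i) (t, p) - monomial v \<tau> (s, i) (t, p))"
  define Q' where "Q' t p j = (if t \<in> T then Q t p j else delta p j)" for t p j
  have fin: "finite (Sigma A (\<lambda>t. {..<r t}))" using A by auto
  have "rank_at_most I I (\<lambda>p q. monomial u \<sigma> p q - monomial v \<tau> p q) (\<Sum>t\<in>A. r t)"
  proof (rule rank_at_mostI[OF fin])
    show "card (Sigma A (\<lambda>t. {..<r t})) \<le> (\<Sum>t\<in>A. r t)" using A by (simp add: card_SigmaI)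
    fix x y assume xy: "x \<in> I" "y \<in> I"
    obtain s i t j where e: "x = (s, i)" "y = (t, j)" by (cases x, cases y)
    have m: "s \<in> A" "i < n" "t \<in> A" "j < n" using xy e by (auto simp: I_def)
    have "mmult (Sigma A (\<lambda>t. {..<r t})) P' (block_diag Q') x y = (\<Sum>p<r t. P' x (t, p) * Q' t p j)"
      unfolding e by (rule mmult_block_diag_right) (use A m in auto)
    also have "\<dots> = monomial u \<sigma> x y - monomial v \<tau> x y"
    proof (cases "t \<in> T")
      case True
      then have "(\<Sum>p<r t. P' x (t, p) * Q' t p j) = (if s = \<sigma> t then mmult {..<r t} (P t) (Q t) i j else 0)"
        by (simp add: P'_def Q'_def e mmult_def)
      also have "\<dots> = (if s = \<sigma> t then D t i j else 0)" using PQ m True by (simp add: r_def)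
      finally show ?thesis using eq[OF True] by (simp add: monomial_def e D_def)
    next
      case False
      then have "(\<Sum>p<r t. P' x (t, p) * Q' t p j) = mmult {..<n} (\<lambda>_ p. monomial u \<sigma> (s, i) (t, p) - monomial
        v \<tau> (s, i) (t, p)) delta () j"
        by (simp add: P'_def Q'_def e mmult_def r_def)
      then show ?thesis using m by (simp add: mmult_delta_right e)
    qed
    finally show "monomial u \<sigma> x y - monomial v \<tau> x y = mmult (Sigma A (\<lambda>t. {..<r t})) P' (block_diag Q') x
      y" ..
  qed
  then have "rank_on I I (\<lambda>p q. monomial u \<sigma> p q - monomial v \<tau> p q) \<le> (\<Sum>t\<in>A. r t)"
    using rank_on_facts(3)[of I I] A by (simp add: I_def)
  also have "\<dots> = (\<Sum>t\<in>T. r t) + (\<Sum>t\<in>A - T. r t)" using A T by (metis add.commute sum.subset_diff)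
  also have "\<dots> = (\<Sum>t\<in>T. rank_on {..<n} {..<n} (D t)) + card (A - T) * n" by (simp add: r_def)
  finally show ?thesis unfolding D_def .
qed

lemma wreath_map_gl:
  assumes n: "n > 0" and A: "finite (A :: nat set)" "A \<noteq> {}"
  shows "\<exists>W. wreath_map (gl_group TYPE('k::field) n) (rank_dist n) A (gl_group TYPE('k) (n * card A))
    (rank_dist (n * card A)) W"
proof -
  let ?I = "A \<times> {..<n}" and ?N = "n * card A" and ?G = "gl_group TYPE('k)"
  obtain \<beta> where \<beta>: "bij_betw \<beta> {..<?N} ?I" using exists_enumeration[of ?I ?N] A
    by (auto simp: card_cartesian_product)
  have cA: "card A > 0" using A by (simp add: card_gt_0_iff)
  define W where "W u \<sigma> = to_mat ?N \<beta> (monomial u \<sigma> :: _ \<Rightarrow> _ \<Rightarrow> 'k)" for u \<sigma>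
  have c: "u t \<in> carrier_mat n n" if "u \<in> A \<rightarrow> carrier (?G n)" "t \<in> A" for u t using that gl_group_iff by blast
  have one: "1\<^sub>m ?N = W (\<lambda>_. 1\<^sub>m n) (\<lambda>x\<in>A. x)" by (simp only: W_def to_mat_monomial_one[OF A(1) \<beta>])
  have dist: "rank_dist ?N (W u \<sigma>) (W v \<tau>) = real (rank_on ?I ?I (\<lambda>p q. monomial u \<sigma> p q - monomial v \<tau> p q))
    / (real n * real (card A))" for u \<sigma> v \<tau>
    unfolding W_def rank_dist_to_mat[OF \<beta>] by simp
  have "wreath_map (?G n) (rank_dist n) A (?G ?N) (rank_dist ?N) W"
    unfolding wreath_map_def
  proof (intro conjI allI impI)
    show "W u \<sigma> \<in> carrier (?G ?N)" if u: "u \<in> A \<rightarrow> carrier (?G n)" and \<sigma>: "\<sigma> \<in> Bij A" for u \<sigma>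
    proof -
      have "\<forall>t\<in>A. \<exists>M. M \<in> carrier_mat n n \<and> u t * M = 1\<^sub>m n \<and> M * u t = 1\<^sub>m n" using u gl_group_iff by blast
      then obtain v where v: "\<And>t. t \<in> A \<Longrightarrow> v t \<in> carrier_mat n n \<and> u t * v t = 1\<^sub>m n \<and> v t * u t = 1\<^sub>m n"
        by metis
      show ?thesis unfolding gl_group_iff W_def
        using to_mat_monomial_inverse[OF A(1) \<beta> \<sigma>, of u v] c[OF u] v by (intro conjI bexI) auto
    qed
    show "W (\<lambda>_. \<one>\<^bsub>?G n\<^esub>) (\<lambda>x\<in>A. x) = \<one>\<^bsub>?G ?N\<^esub>" unfolding gl_group_simps by (rule one[symmetric])
    show "W u \<sigma> = W v \<sigma>" if "\<forall>t\<in>A. u t = v t" for u v \<sigma> unfolding W_def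
      by (rule to_mat_monomial_cong[OF A(1) \<beta>]) (use that in auto)
    show "W u \<sigma> \<otimes>\<^bsub>?G ?N\<^esub> W v \<tau> = W (\<lambda>t. u (\<tau> t) \<otimes>\<^bsub>?G n\<^esub> v t) (compose A \<sigma> \<tau>)"
      if "u \<in> A \<rightarrow> carrier (?G n)" "v \<in> A \<rightarrow> carrier (?G n)" "\<sigma> \<in> Bij A" "\<tau> \<in> Bij A" for u \<sigma> v \<tau>
      unfolding gl_group_simps W_def by (rule to_mat_monomial_mult[OF A(1) \<beta> c[OF that(1)] c[OF that(2)]
        that(4)])
    show "rank_dist ?N (W u \<sigma>) (W v \<tau>) \<le> 3 * sqrt \<epsilon>"
      if u: "u \<in> A \<rightarrow> carrier (?G n)" "v \<in> A \<rightarrow> carrier (?G n)" "\<sigma> \<in> Bij A" "\<tau> \<in> Bij A" and e: "0 < \<epsilon>" "\<epsilon> \<le> 1"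
        and T: "T \<subseteq> A" "(1 - \<epsilon>) * real (card A) \<le> real (card T)" and g: "\<forall>t\<in>T. \<sigma> t = \<tau> t \<and>
          rank_dist n (u t) (v t) < \<epsilon>" for u \<sigma> v \<tau> T \<epsilon>
    proof -
      let ?r = "\<lambda>t. rank_on {..<n} {..<n} (\<lambda>i j. entries (u t) i j - entries (v t) i j)"
      have "real (rank_on ?I ?I (\<lambda>p q. monomial u \<sigma> p q - monomial v \<tau> p q)) \<le>
        real ((\<Sum>t\<in>T. ?r t) + card (A - T) * n)"
        by (intro of_nat_mono rank_monomial_diff[OF A(1) T(1)]) (use g in auto)
      also have "\<dots> = (\<Sum>t\<in>T. real (?r t)) + real (card (A - T)) * real n" by simp
      also have "(\<Sum>t\<in>T. real (?r t)) \<le> (\<Sum>t\<in>T. \<epsilon> * real n)"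
      proof (rule sum_mono)
        fix t assume t: "t \<in> T"
        then have "rank_dist n (u t) (v t) < \<epsilon>" using g by blast
        moreover have "rank_dist n (u t) (v t) = real (?r t) / real n"
          by (rule rank_dist_entries[OF c[OF u(1)] c[OF u(2)]]) (use t T in auto)
        ultimately show "real (?r t) \<le> \<epsilon> * real n" using n by (simp add: pos_divide_less_eq)
      qed
      also have "\<dots> \<le> real (card A) * (\<epsilon> * real n)" using card_mono[OF A(1) T(1)] e n
        by (simp add: mult_right_mono)
      also have "real (card (A - T)) * real n \<le> \<epsilon> * real (card A) * real n"
      proof -
        have "real (card (A - T)) = real (card A) - real (card T)"
          using card_Diff_subset[OF finite_subset[OF T(1) A(1)] T(1)] card_mono[OF A(1) T(1)]
          by (simp add: of_nat_diff)
        then show ?thesis using T(2) by (intro mult_right_mono) (auto simp: algebra_simps)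
      qed
      finally have "real (rank_on ?I ?I (\<lambda>p q. monomial u \<sigma> p q - monomial v \<tau> p q)) \<le>
        2 * \<epsilon> * (real n * real (card A))" by (simp add: algebra_simps)
      then have "rank_dist ?N (W u \<sigma>) (W v \<tau>) \<le> 2 * \<epsilon>" unfolding dist using n cA by (simp add: field_simps)
      also have "\<dots> \<le> 3 * sqrt \<epsilon>" by (rule double_le_three_sqrt[OF e])
      finally show ?thesis .
    qed
    show "c' / 2 \<le> rank_dist ?N (W u (\<lambda>x\<in>A. x)) \<one>\<^bsub>?G ?N\<^esub>"
      if u: "u \<in> A \<rightarrow> carrier (?G n)" and T: "T \<subseteq> A" "card A \<le> 2 * card T"
        and c': "0 < c'" "\<forall>t\<in>T. c' \<le> rank_dist n (u t) \<one>\<^bsub>?G n\<^esub>" for u T c'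
    proof -
      let ?r = "\<lambda>t. rank_on {..<n} {..<n} (\<lambda>i j. entries (u t) i j - entries (1\<^sub>m n) i j)"
      have "(c' / 2) * (real n * real (card A)) \<le> c' * real n * real (card T)" using T c' n
        by (simp add: field_simps)
      also have "\<dots> = (\<Sum>t\<in>T. c' * real n)" by simp
      also have "\<dots> \<le> (\<Sum>t\<in>T. real (?r t))"
      proof (rule sum_mono)
        fix t assume t: "t \<in> T"
        then have "c' \<le> rank_dist n (u t) (1\<^sub>m n)" using c'(2) unfolding gl_group_simps by blast
        moreover have "rank_dist n (u t) (1\<^sub>m n) = real (?r t) / real n"
          by (rule rank_dist_entries[OF c[OF u] one_carrier_mat]) (use t T in auto)
        ultimately show "c' * real n \<le> real (?r t)" using n by (simp add: pos_le_divide_eq)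
      qed
      also have "\<dots> = real (\<Sum>t\<in>T. ?r t)" by simp
      also have "\<dots> \<le> real (rank_on ?I ?I (\<lambda>p q. monomial u (\<lambda>x\<in>A. x) p q - monomial (\<lambda>_. 1\<^sub>m n) (\<lambda>x\<in>A. x) p
        q))"
        by (intro of_nat_mono rank_monomial_block[OF A(1) T(1)])
      finally show ?thesis unfolding gl_group_simps one dist using n cA by (simp add: field_simps)
    qed
  qed
  then show ?thesis by (rule exI[where x = W])
qed

text \<open>The summand \<open>1\<close> cancels in the difference and leaves a zero block.\<close>

lemma rank_on_padded:
  fixes x y :: "'k::field mat"
  shows "rank_on ({..<n} \<times> UNIV) ({..<n} \<times> UNIV) (\<lambda>p q. padded x p q - padded y p q) =
    rank_on {..<n} {..<n} (\<lambda>i j. entries x i j - entries y i j)"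
proof (rule antisym)
  let ?J = "{..<n} \<times> (UNIV :: bool set)"
  define E where "E i j = entries x i j - entries y i j" for i j
  let ?r = "rank_on {..<n} {..<n} (\<lambda>i j. entries x i j - entries y i j)"
    and ?D = "\<lambda>p q. padded x p q - padded y p q"
  have r: "?r = rank_on {..<n} {..<n} E" by (rule rank_on_cong) (simp add: E_def)
  have fin: "finite {..<n}" "finite ?J" by auto
  have D: "?D (i, b) (j, b') = (if b \<and> b' then E i j else 0)" for i b j b' by (auto simp: padded_def E_def)
  obtain P Q where PQ: "\<And>i j. i \<in> {..<n} \<Longrightarrow> j \<in> {..<n} \<Longrightarrow> E i j = mmult {..<?r} P Q i j"
    using rank_on_facts(1)[OF fin(1,1), of E] unfolding r by (auto simp: rank_at_most_def)
  have "rank_at_most ?J ?J ?D ?r"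
  proof (rule rank_at_mostI[of "{..<?r}"])
    fix p q assume "p \<in> ?J" "q \<in> ?J"
    then show "?D p q = mmult {..<?r} (\<lambda>(i, b) p. if b then P i p else 0) (\<lambda>p (j, b). if b then Q p j else 0)
      p q"
      using PQ by (cases p, cases q) (auto simp: D mmult_def)
  qed auto
  then show "rank_on ?J ?J ?D \<le> ?r" by (rule rank_on_facts(3)[OF fin(2,2)])
  obtain U V where UV: "\<And>p q. p < ?r \<Longrightarrow> q < ?r \<Longrightarrow> mmult {..<n} (mmult {..<n} U E) V p q = delta p q"
    using rank_on_facts(2)[OF fin(1,1), of E] unfolding r by (auto simp: rank_at_least_def)
  have "rank_at_least ?J ?J ?D (card {..<?r})"
  proof (rule rank_at_leastI[where U = "\<lambda>p (i, b). if b then U p i else 0"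
    and V = "\<lambda>(j, b) q. if b then V j q else 0"])
    fix p q assume pq: "p \<in> {..<?r}" "q \<in> {..<?r}"
    have s: "(\<Sum>z\<in>?J. f z) = (\<Sum>i<n. f (i, True) + f (i, False))" for f :: "nat \<times> bool \<Rightarrow> 'k"
    proof -
      have "(\<Sum>z\<in>?J. f z) = (\<Sum>i<n. \<Sum>b\<in>UNIV. f (i, b))" by (simp add: sum.cartesian_product)
      then show ?thesis by (simp add: UNIV_bool add.commute)
    qed
    have "mmult ?J (mmult ?J (\<lambda>p (i, b). if b then U p i else 0) ?D) (\<lambda>(j, b) q. if b then V j q else 0) p q
      = mmult {..<n} (mmult {..<n} U E) V p q"
      unfolding mmult_def s by (simp add: D)
    then show "mmult ?J (mmult ?J (\<lambda>p (i, b). if b then U p i else 0) ?D) (\<lambda>(j, b) q. if b then V j q else 0)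
      p q = delta p q"
      using UV pq by simp
  qed simp
  then show "?r \<le> rank_on ?J ?J ?D" using rank_on_facts(4)[OF fin(2,2)] by simp
qed

text \<open>If \<open>A = P Q\<close>, then \<open>A \<otimes> B\<close> is the product of
  \<open>P \<otimes> 1\<close> and \<open>Q \<otimes> B\<close>, where \<open>1\<close> is the
  identity on \<open>J\<close>.\<close>

lemma rank_at_most_kron_left:
  assumes "finite J" "rank_at_most I I' A r" shows "rank_at_most (I \<times> J) (I' \<times> J') (kron A B) (r * card J)"
proof -
  obtain P Q where PQ: "\<And>i j. i \<in> I \<Longrightarrow> j \<in> I' \<Longrightarrow> A i j = mmult {..<r} P Q i j" using assms(2)
    by (auto simp: rank_at_most_def)
  show ?thesis
  proof (rule rank_at_mostI[of "{..<r} \<times> J" _ _ _ _ "kron P delta" "kron Q B"])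
    fix x y assume "x \<in> I \<times> J" "y \<in> I' \<times> J'"
    then show "kron A B x y = mmult ({..<r} \<times> J) (kron P delta) (kron Q B) x y"
      unfolding mmult_kron using PQ assms(1) by (cases x, cases y) (auto simp: mmult_delta_left)
  qed (use assms in \<open>auto simp: card_cartesian_product\<close>)
qed

lemma rank_at_most_kron_right:
  assumes "finite I" "rank_at_most J J' A r" shows "rank_at_most (I \<times> J) (I' \<times> J') (kron B A) (card I * r)"
proof -
  obtain P Q where PQ: "\<And>i j. i \<in> J \<Longrightarrow> j \<in> J' \<Longrightarrow> A i j = mmult {..<r} P Q i j" using assms(2)
    by (auto simp: rank_at_most_def)
  show ?thesis
  proof (rule rank_at_mostI[of "I \<times> {..<r}" _ _ _ _ "kron delta P" "kron B Q"])
    fix x y assume "x \<in> I \<times> J" "y \<in> I' \<times> J'"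
    then show "kron B A x y = mmult (I \<times> {..<r}) (kron delta P) (kron B Q) x y"
      unfolding mmult_kron using PQ assms(1) by (cases x, cases y) (auto simp: mmult_delta_left)
  qed (use assms in \<open>auto simp: card_cartesian_product\<close>)
qed

text \<open>Telescoping with the padded matrices \<open>x'\<close> and \<open>y'\<close>: the
  difference is \<open>(x - y) \<otimes> x' + y \<otimes> (x' - y')\<close>. The summands have rank
  at most \<open>2 * n * r n\<close> and \<open>n * r n\<close>, since \<open>x' - y'\<close> has
  the rank of \<open>x - y\<close>.\<close>

lemma rank_amplified_diff:
  fixes x y :: "'k::field mat"
  defines "r \<equiv> \<lambda>n. rank_on {..<n} {..<n} (\<lambda>i j. entries x i j - entries y i j)"
  shows "rank_on (amplified_index n) (amplified_index n) (\<lambda>p q. amplified x p q - amplified y p q) \<le>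
    3 * n * r n"
proof -
  let ?J = "{..<n} \<times> (UNIV :: bool set)" and ?I = "amplified_index n"
  let ?A = "\<lambda>i j. entries x i j - entries y i j" and ?B = "\<lambda>p q. padded x p q - padded y p q"
  have "rank_at_most ?I ?I (kron ?A (padded x)) (r n * card ?J)"
    by (rule rank_at_most_kron_left) (auto simp: r_def intro: rank_on_facts(1))
  moreover have "rank_at_most ?J ?J ?B (r n)" using rank_on_facts(1)[of ?J ?J ?B] unfolding rank_on_padded
    by (simp add: r_def)
  then have "rank_at_most ?I ?I (kron (entries y) ?B) (card {..<n} * r n)"
    by (intro rank_at_most_kron_right) auto
  ultimately have "rank_at_most ?I ?I (\<lambda>p q. kron ?A (padded x) p q + kron (entries y) ?B p q)
    (r n * card ?J + card {..<n} * r n)"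
    by (rule rank_at_most_add)
  moreover have "kron ?A (padded x) p q + kron (entries y) ?B p q = amplified x p q - amplified y p q" for p q
    by (cases p, cases q) (simp add: amplified_def kron_def algebra_simps)
  ultimately have "rank_at_most ?I ?I (\<lambda>p q. amplified x p q - amplified y p q) (r n * card ?J +
    card {..<n} * r n)" by simp
  then have "rank_on ?I ?I (\<lambda>p q. amplified x p q - amplified y p q) \<le> r n * card ?J + card {..<n} * r n"
    by (intro rank_on_facts(3)) auto
  then show ?thesis by (simp add: card_cartesian_product algebra_simps)
qed

lemma rank_on_le_card: "finite I \<Longrightarrow> rank_on I I (A :: 'i \<Rightarrow> 'i \<Rightarrow> 'k::field) \<le> card I"
  by (rule rank_on_facts(3), assumption+, rule rank_at_mostI[of I _ _ _ _ delta A])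
    (auto simp: mmult_delta_left)

text \<open>An instance of \<open>rank_on_kron_minus_one\<close>, with \<open>x - 1\<close> in size
  \<open>n\<close> and its padded version of the same rank in size \<open>2 * n\<close>. The doubled
  size keeps the second term alive: for \<open>r n = n\<close> the bound is \<open>n * n\<close>,
  whereas for \<open>x \<otimes> x\<close> it would be zero.\<close>

lemma rank_amplified_one:
  fixes x :: "'k::field mat"
  defines "r \<equiv> \<lambda>n. rank_on {..<n} {..<n} (\<lambda>i j. entries x i j - entries (1\<^sub>m n) i j)"
  shows "(n - r n) * r n + r n * (2 * n - r n) \<le> rank_on (amplified_index n) (amplified_index n)
    (\<lambda>p q. amplified x p q - amplified (1\<^sub>m n) p q)"
proof -
  let ?J = "{..<n} \<times> (UNIV :: bool set)"
  have 1: "rank_on {..<n} {..<n} (\<lambda>i j. entries x i j - delta i j) = r n"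
    unfolding r_def by (rule rank_on_cong) (auto simp: entries_one)
  have "rank_on ?J ?J (\<lambda>p q. padded x p q - delta p q) =
    rank_on ?J ?J (\<lambda>p q. padded x p q - padded (1\<^sub>m n) p q)"
    by (rule rank_on_cong) (simp add: padded_one)
  then have 2: "rank_on ?J ?J (\<lambda>p q. padded x p q - delta p q) = r n" unfolding rank_on_padded
    by (simp add: r_def)
  have "(card {..<n} - r n) * r n + r n * (card ?J - r n) \<le> rank_on (amplified_index n) (amplified_index n)
    (\<lambda>p q. kron (entries x) (padded x) p q - delta p q)"
    using rank_on_kron_minus_one[of "{..<n}" ?J "entries x" "padded x"] unfolding 1 2 by simp
  also have "\<dots> = rank_on (amplified_index n) (amplified_index n) (\<lambda>p q. amplified x p q - amplified (1\<^sub>m n) p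
    q)"
    by (rule rank_on_cong) (simp add: amplified_one, simp add: amplified_def)
  finally show ?thesis by (simp add: card_cartesian_product mult.commute)
qed

lemma amplification_gl: "amplification (2/5) (indexed_family (gl_group TYPE('k::field)) rank_dist)"
  unfolding amplification_def
proof (intro conjI allI impI)
  let ?G = "gl_group TYPE('k)"
  let ?F = "indexed_family ?G rank_dist"
  fix \<eta> :: real assume \<eta>: "\<eta> > 0"
  show "\<exists>\<delta>>0. \<forall>G d. (G, d) \<in> ?F \<longrightarrow> (\<exists>H e S. (H, e) \<in> ?F \<and> S \<in> hom G H \<and> S \<one>\<^bsub>G\<^esub> = \<one>\<^bsub>H\<^esub> \<and>
     (\<forall>x\<in>carrier G. \<forall>y\<in>carrier G. d x y < \<delta> \<longrightarrow> e (S x) (S y) < \<eta>) \<and>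
     (\<forall>x\<in>carrier G. min (2/5) (11 / 10 * d x \<one>\<^bsub>G\<^esub>) \<le> e (S x) \<one>\<^bsub>H\<^esub>))"
  proof (rule exI[of _ "\<eta> / 2"], intro conjI allI impI)
    fix G d assume "(G, d) \<in> ?F"
    then obtain n where n: "n > 0" "G = ?G n" "d = rank_dist n" by (auto simp: indexed_family_def)
    let ?I = "amplified_index n" and ?N = "n * n * 2"
    obtain \<beta> where \<beta>: "bij_betw \<beta> {..<?N} ?I" using exists_enumeration[of ?I ?N] card_amplified_index by auto
    define S where "S x = to_mat ?N \<beta> (amplified x :: _ \<Rightarrow> _ \<Rightarrow> 'k)" for x
    note Sm = to_mat_amplified[OF \<beta>, where 'k = 'k, folded S_def]
    have c: "x \<in> carrier_mat n n" if "x \<in> carrier (?G n)" for x using that gl_group_iff by blast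
    let ?r = "\<lambda>x y. rank_on {..<n} {..<n} (\<lambda>i j. entries x i j - entries (y :: 'k mat) i j)"
    have d: "rank_dist n x y = real (?r x y) / real n" if "x \<in> carrier_mat n n" "y \<in> carrier_mat n n"
      for x y :: "'k mat"
      using rank_dist_entries[OF that] .
    have dS: "rank_dist ?N (S x) (S y) = real (rank_on ?I ?I (\<lambda>p q. amplified x p q - amplified y p q)) /
      (2 * (real n * real n))" for x y
      unfolding S_def rank_dist_to_mat[OF \<beta>] by simp
    have "S \<in> hom (?G n) (?G ?N)"
    proof (rule homI)
      show "S x \<in> carrier (?G ?N)" if x: "x \<in> carrier (?G n)" for x
      proof -
        obtain y where y: "y \<in> carrier_mat n n" "x * y = 1\<^sub>m n" "y * x = 1\<^sub>m n" using x gl_group_iff by blast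
        have "S x * S y = 1\<^sub>m ?N" "S y * S x = 1\<^sub>m ?N" using Sm(1)[OF c[OF x] y(1)] Sm(1)[OF y(1) c[OF x]] y
          Sm(2) by auto
        then show ?thesis unfolding gl_group_iff using S_def to_mat_carrier by metis
      qed
      show "S (x \<otimes>\<^bsub>?G n\<^esub> y) = S x \<otimes>\<^bsub>?G ?N\<^esub> S y" if "x \<in> carrier (?G n)" "y \<in> carrier (?G n)" for x y
        unfolding gl_group_simps using Sm(1)[OF c[OF that(1)] c[OF that(2)]] by simp
    qed
    moreover have "S \<one>\<^bsub>?G n\<^esub> = \<one>\<^bsub>?G ?N\<^esub>" unfolding gl_group_simps by (rule Sm(2))
    moreover have "rank_dist ?N (S x) (S y) < \<eta>"
      if "x \<in> carrier (?G n)" "y \<in> carrier (?G n)" "rank_dist n x y < \<eta> / 2" for x y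
    proof -
      have "real (rank_on ?I ?I (\<lambda>p q. amplified x p q - amplified y p q)) \<le> real (3 * n * ?r x y)"
        by (rule of_nat_mono[OF rank_amplified_diff])
      then have "rank_dist ?N (S x) (S y) \<le> real (3 * n * ?r x y) / (2 * (real n * real n))" unfolding dS
        by (rule divide_right_mono) simp
      also have "\<dots> = 3 / 2 * rank_dist n x y" unfolding d[OF c[OF that(1)] c[OF that(2)]] using n by simp
      also have "\<dots> < \<eta>" using that(3) \<eta> by linarith
      finally show ?thesis .
    qed
    moreover have "min (2/5) (11 / 10 * rank_dist n x \<one>\<^bsub>?G n\<^esub>) \<le> rank_dist ?N (S x) \<one>\<^bsub>?G ?N\<^esub>"
      if x: "x \<in> carrier (?G n)" for x
    proof -
      define r where "r = ?r x (1\<^sub>m n)"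
      define a where "a = real r / real n"
      have rn: "r \<le> n" unfolding r_def using rank_on_le_card[of "{..<n}"] by simp
      then have a: "0 \<le> a" "a \<le> 1" using n by (auto simp: a_def)
      have da: "rank_dist n x (1\<^sub>m n) = a" unfolding a_def r_def by (rule d[OF c[OF x]]) simp
      have "(n - r) * r + r * (2 * n - r) \<le> rank_on ?I ?I (\<lambda>p q. amplified x p q - amplified (1\<^sub>m n) p q)"
        using rank_amplified_one[of n x] by (simp add: r_def)
      then have "real ((n - r) * r + r * (2 * n - r)) \<le>
        real (rank_on ?I ?I (\<lambda>p q. amplified x p q - amplified (1\<^sub>m n) p q))" by (rule of_nat_mono)
      then have h: "real ((n - r) * r + r * (2 * n - r)) / (2 * (real n * real n)) \<le>
        rank_dist ?N (S x) (S (1\<^sub>m n))"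
        unfolding dS by (rule divide_right_mono) simp
      have e: "real ((n - r) * r + r * (2 * n - r)) / (2 * (real n * real n)) = a * (3 - 2 * a) / 2"
        using rn n by (simp add: a_def of_nat_diff field_simps)
      have low: "a * (3 - 2 * a) / 2 \<le> rank_dist ?N (S x) (S (1\<^sub>m n))" using h unfolding e .
      \<comment> \<open>The factor \<open>(3 - 2 * a) / 2\<close> is at least 11/10 exactly up to
        \<open>a = 2/5\<close>, which is the origin of the constant 2/5. Beyond it, the
        factorization gives the lower bound 11/25.\<close>
      have "min (2/5) (11 / 10 * a) \<le> a * (3 - 2 * a) / 2"
      proof (cases "a \<le> 2/5")
        case True
        have "a * (22/10) \<le> a * (3 - 2 * a)" using a True by (intro mult_left_mono) auto
        then show ?thesis by simp
      next
        case False
        have "0 \<le> (a - 2/5) * (11/5 - 2 * a)" using False a by (intro mult_nonneg_nonneg) auto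
        moreover have "a * (3 - 2 * a) - 22/25 = (a - 2/5) * (11/5 - 2 * a)" by (simp add: field_simps)
        moreover have "min (2/5) (11 / 10 * a) \<le> 2/5" by simp
        ultimately show ?thesis by linarith
      qed
      then show ?thesis unfolding gl_group_simps Sm(2)[symmetric] da using low by linarith
    qed
    moreover have "(?G ?N, rank_dist ?N) \<in> ?F" using n by (force simp: indexed_family_def)
    ultimately show "\<exists>H e S. (H, e) \<in> ?F \<and> S \<in> hom G H \<and> S \<one>\<^bsub>G\<^esub> = \<one>\<^bsub>H\<^esub> \<and>
     (\<forall>x\<in>carrier G. \<forall>y\<in>carrier G. d x y < \<eta> / 2 \<longrightarrow> e (S x) (S y) < \<eta>) \<and>
     (\<forall>x\<in>carrier G. min (2/5) (11 / 10 * d x \<one>\<^bsub>G\<^esub>) \<le> e (S x) \<one>\<^bsub>H\<^esub>)"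
      unfolding n(2,3) by blast
  qed (use \<eta> in simp)
qed simp

text \<open>The regular representation: for nontrivial \<open>x\<close> the matrices of
  \<open>x\<close> and \<open>1\<close> differ in row \<open>x\<close> of the column indexed by the
  unit of \<open>Q\<close>, which already makes the distance positive.\<close>

lemma contains_finite_groups_gl: "contains_finite_groups (indexed_family (gl_group TYPE('k::field))
  rank_dist)"
  unfolding contains_finite_groups_def
proof (intro allI impI)
  let ?G = "gl_group TYPE('k)"
  fix Q :: "nat monoid" assume Q: "group Q" "finite (carrier Q)"
  interpret group Q by fact
  define N where "N = card (carrier Q)"
  have N: "N > 0" using Q one_closed by (auto simp: N_def card_gt_0_iff)
  obtain \<beta> where \<beta>: "bij_betw \<beta> {..<N} (carrier Q)" using exists_enumeration[OF Q(2)] N_def by metis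
  define j where "j x = to_mat N \<beta> (regular_rep Q x :: nat \<Rightarrow> nat \<Rightarrow> 'k)" for x
  have m: "j x * j y = j (x \<otimes>\<^bsub>Q\<^esub> y)" if "x \<in> carrier Q" "y \<in> carrier Q" for x y
    unfolding j_def to_mat_mult[OF \<beta>] by (rule to_mat_eqI[OF \<beta> mmult_regular_rep[OF Q that]])
  have j1: "j \<one>\<^bsub>Q\<^esub> = 1\<^sub>m N" unfolding j_def by (rule to_mat_one[OF \<beta>]) (simp add: regular_rep_def delta_def)
  have "j \<in> hom Q (?G N)"
  proof (rule homI)
    show "j x \<in> carrier (?G N)" if "x \<in> carrier Q" for x
    proof -
      have "j x * j (inv\<^bsub>Q\<^esub> x) = 1\<^sub>m N" "j (inv\<^bsub>Q\<^esub> x) * j x = 1\<^sub>m N" using m that j1 by auto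
      then show ?thesis unfolding gl_group_iff using j_def to_mat_carrier by metis
    qed
  qed (simp add: gl_group_simps m)
  moreover have "rank_dist N (j x) (j x) = 0" for x
    unfolding j_def rank_dist_to_mat[OF \<beta>] using rank_on_facts(3)[OF Q(2) Q(2), of "\<lambda>_ _. 0 :: 'k" 0]
      by (simp add: rank_at_most_def mmult_def)
  moreover have "0 < rank_dist N (j x) \<one>\<^bsub>?G N\<^esub>" if x: "x \<in> carrier Q" "x \<noteq> \<one>\<^bsub>Q\<^esub>" for x
  proof -
    let ?r = "rank_on (carrier Q) (carrier Q) (\<lambda>p q. regular_rep Q x p q - (regular_rep Q \<one>\<^bsub>Q\<^esub> p q :: 'k))"
    have "?r \<noteq> 0"
    proof
      assume "?r = 0"
      then have "rank_at_most (carrier Q) (carrier Q)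
        (\<lambda>p q. regular_rep Q x p q - (regular_rep Q \<one>\<^bsub>Q\<^esub> p q :: 'k)) 0" using rank_on_facts(1)[OF Q(2) Q(2)]
        by metis
      then have "regular_rep Q x x \<one>\<^bsub>Q\<^esub> - (regular_rep Q \<one>\<^bsub>Q\<^esub> x \<one>\<^bsub>Q\<^esub> :: 'k) = 0" using x
        unfolding rank_at_most_def by (auto simp: mmult_def)
      then show False using x by (simp add: regular_rep_def)
    qed
    then show ?thesis unfolding gl_group_simps j1[symmetric] unfolding j_def rank_dist_to_mat[OF \<beta>] using N
      by simp
  qed
  moreover have "(?G N, rank_dist N) \<in> indexed_family ?G rank_dist" using N by (auto simp: indexed_family_def)
  moreover have "j \<one>\<^bsub>Q\<^esub> = \<one>\<^bsub>?G N\<^esub>" using j1 by (simp add: gl_group_simps)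
  ultimately show "\<exists>G d j. (G, d) \<in> indexed_family ?G rank_dist \<and> j \<in> hom Q G \<and> j \<one>\<^bsub>Q\<^esub> = \<one>\<^bsub>G\<^esub> \<and>
    (\<forall>x\<in>carrier Q. d (j x) (j x) = 0) \<and>
      (\<forall>x\<in>carrier Q. x \<noteq> \<one>\<^bsub>Q\<^esub> \<longrightarrow> 0 < d (j x) \<one>\<^bsub>G\<^esub>)" by blast
qed

section \<open>Unitary groups\<close>

lemma adjoint_carrier [simp]: "A \<in> carrier_mat n n \<Longrightarrow> mat_adjoint A \<in> carrier_mat n n" for A :: "complex mat"
  by (auto simp: mat_adjoint_def)

lemma adjoint_dim [simp]: "dim_row (mat_adjoint A) = dim_col A" "dim_col (mat_adjoint A) = dim_row A"
  for A :: "complex mat"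
  by (simp_all add: mat_adjoint_def)

lemma adjoint_index: "A \<in> carrier_mat n n \<Longrightarrow> i < n \<Longrightarrow> j < n \<Longrightarrow> mat_adjoint A $$ (i, j) = cnj (A $$ (j, i))"
  for A :: "complex mat"
  by (simp add: mat_adjoint_def mat_of_rows_index conjugate_complex_def)

lemma unitary_group_simps:
  "M \<in> carrier (unitary_group n) \<longleftrightarrow> M \<in> carrier_mat n n \<and> M * mat_adjoint M = 1\<^sub>m n \<and>
    mat_adjoint M * M = 1\<^sub>m n"
  "\<one>\<^bsub>unitary_group n\<^esub> = 1\<^sub>m n"
  "M \<otimes>\<^bsub>unitary_group n\<^esub> M' = M * M'"
  by (simp_all add: unitary_group_def)

lemma adjoint_mult:
  fixes A B :: "complex mat"
  assumes "A \<in> carrier_mat n n" "B \<in> carrier_mat n n"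
    shows "mat_adjoint (A * B) = mat_adjoint B * mat_adjoint A"
proof (rule eq_matI)
  have c: "mat_adjoint A \<in> carrier_mat n n" "mat_adjoint B \<in> carrier_mat n n"
    "mat_adjoint (A * B) \<in> carrier_mat n n" "A * B \<in> carrier_mat n n"
    using assms by auto
  show "dim_row (mat_adjoint (A * B)) = dim_row (mat_adjoint B * mat_adjoint A)"
    "dim_col (mat_adjoint (A * B)) = dim_col (mat_adjoint B * mat_adjoint A)"
    using c by auto
  fix i j assume "i < dim_row (mat_adjoint B * mat_adjoint A)" "j < dim_col (mat_adjoint B * mat_adjoint A)"
  then have ij: "i < n" "j < n" using c by auto
  show "mat_adjoint (A * B) $$ (i, j) = (mat_adjoint B * mat_adjoint A) $$ (i, j)"
    unfolding adjoint_index[OF c(4) ij] using assms c ij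
    by (simp add: scalar_prod_def adjoint_index[OF assms(1)] adjoint_index[OF assms(2)] mult.commute)
qed

lemma adjoint_adjoint: "A \<in> carrier_mat n n \<Longrightarrow> mat_adjoint (mat_adjoint A) = A" for A :: "complex mat"
  by (intro eq_matI) (auto simp: adjoint_index[of _ n])

lemma adjoint_one: "mat_adjoint (1\<^sub>m n :: complex mat) = 1\<^sub>m n"
  by (intro eq_matI) (auto simp: adjoint_index[of _ n])

lemma group_unitary: "group (unitary_group n)"
proof (rule groupI; unfold unitary_group_simps)
  fix x y :: "complex mat"
  assume x: "x \<in> carrier_mat n n \<and> x * mat_adjoint x = 1\<^sub>m n \<and> mat_adjoint x * x = 1\<^sub>m n"
    and y: "y \<in> carrier_mat n n \<and> y * mat_adjoint y = 1\<^sub>m n \<and> mat_adjoint y * y = 1\<^sub>m n"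
  have c: "x \<in> carrier_mat n n" "y \<in> carrier_mat n n" "mat_adjoint x \<in> carrier_mat n n"
    "mat_adjoint y \<in> carrier_mat n n" using x y by auto
  have "x * y * (mat_adjoint y * mat_adjoint x) = x * (y * mat_adjoint y) * mat_adjoint x"
    using c by (simp add: assoc_mult_mat[of _ n n _ n _ n] mult_carrier_mat[of _ n n _ n])
  moreover have "mat_adjoint y * mat_adjoint x * (x * y) = mat_adjoint y * (mat_adjoint x * x) * y"
    using c by (simp add: assoc_mult_mat[of _ n n _ n _ n] mult_carrier_mat[of _ n n _ n])
  ultimately show "x * y \<in> carrier_mat n n \<and> x * y * mat_adjoint (x * y) = 1\<^sub>m n \<and>
    mat_adjoint (x * y) * (x * y) = 1\<^sub>m n"
    using x y c by (simp add: adjoint_mult[OF c(1,2)])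
next
  fix x y z :: "complex mat"
  assume "x \<in> carrier_mat n n \<and> x * mat_adjoint x = 1\<^sub>m n \<and> mat_adjoint x * x = 1\<^sub>m n"
    "y \<in> carrier_mat n n \<and> y * mat_adjoint y = 1\<^sub>m n \<and> mat_adjoint y * y = 1\<^sub>m n"
    "z \<in> carrier_mat n n \<and> z * mat_adjoint z = 1\<^sub>m n \<and> mat_adjoint z * z = 1\<^sub>m n"
  then show "x * y * z = x * (y * z)" by (simp add: assoc_mult_mat[of _ n n _ n _ n])
next
  fix x :: "complex mat"
  assume x: "x \<in> carrier_mat n n \<and> x * mat_adjoint x = 1\<^sub>m n \<and> mat_adjoint x * x = 1\<^sub>m n"
  then show "\<exists>y\<in>carrier (unitary_group n). y * x = 1\<^sub>m n"
    by (intro bexI[of _ "mat_adjoint x"]) (auto simp: unitary_group_simps adjoint_adjoint)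
qed (auto simp: adjoint_one)

text \<open>The squared Hilbert-Schmidt norm without normalization, summed column by column because
  unitarity and monomial matrices are used through their columns.\<close>

definition norm_sq :: "'i set \<Rightarrow> ('i \<Rightarrow> 'i \<Rightarrow> complex) \<Rightarrow> real" where
  "norm_sq I F = (\<Sum>q\<in>I. \<Sum>p\<in>I. (cmod (F p q))\<^sup>2)"

lemma sum_pairs: "(\<Sum>z\<in>A \<times> B. f z) = (\<Sum>x\<in>A. \<Sum>y\<in>B. f (x, y))"
  by (simp add: sum.cartesian_product)

lemma norm_sq_nonneg [simp]: "0 \<le> norm_sq I F"
  by (simp add: norm_sq_def sum_nonneg)

lemma hs_dist_entries:
  assumes "A \<in> carrier_mat n n" "B \<in> carrier_mat n n"
  shows "hs_dist n A B = sqrt (norm_sq {..<n} (\<lambda>i j. entries A i j - entries B i j) / real n)"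
proof -
  define C where "C = A - B"
  have C: "C \<in> carrier_mat n n" unfolding C_def by (rule minus_carrier_mat[OF assms(2)])
  have e: "C $$ (i, j) = entries A i j - entries B i j" if "i < n" "j < n" for i j using assms that
    by (simp add: C_def entries_def)
  have "mat_trace (C * mat_adjoint C) = (\<Sum>i<n. \<Sum>j<n. C $$ (i, j) * cnj (C $$ (i, j)))"
    using C by (simp add: mat_trace_def scalar_prod_def atLeast0LessThan adjoint_index[OF C]
      carrier_matD[OF adjoint_carrier[OF C]])
  also have "\<dots> = (\<Sum>i<n. \<Sum>j<n. complex_of_real ((cmod (C $$ (i, j)))\<^sup>2))" by (simp only: complex_norm_square)
  finally have "Re (mat_trace (C * mat_adjoint C)) = (\<Sum>i<n. \<Sum>j<n. (cmod (C $$ (i, j)))\<^sup>2)" by simp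
  also have "\<dots> = (\<Sum>i<n. \<Sum>j<n. (cmod (entries A i j - entries B i j))\<^sup>2)" by (intro sum.cong) (auto simp: e)
  also have "\<dots> = norm_sq {..<n} (\<lambda>i j. entries A i j - entries B i j)" unfolding norm_sq_def
    by (rule sum.swap)
  finally show ?thesis by (simp add: hs_dist_def C_def)
qed

lemma norm_sq_cong: "(\<And>p q. p \<in> I \<Longrightarrow> q \<in> I \<Longrightarrow> F p q = G p q) \<Longrightarrow> norm_sq I F = norm_sq I G"
  by (simp add: norm_sq_def)

lemma norm_sq_reindex:
  assumes "bij_betw \<beta> K I" shows "norm_sq K (\<lambda>a b. F (\<beta> a) (\<beta> b)) = norm_sq I F"
proof -
  have "(\<Sum>a\<in>K. (cmod (F (\<beta> a) q))\<^sup>2) = (\<Sum>p\<in>I. (cmod (F p q))\<^sup>2)" for q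
    by (rule sum.reindex_bij_betw[OF assms])
  then show ?thesis unfolding norm_sq_def
    using sum.reindex_bij_betw[OF assms, of "\<lambda>q. \<Sum>p\<in>I. (cmod (F p q))\<^sup>2"] by simp
qed

lemma hs_dist_to_mat:
  assumes \<beta>: "bij_betw \<beta> {..<N} I"
  shows "hs_dist N (to_mat N \<beta> F) (to_mat N \<beta> G) = sqrt (norm_sq I (\<lambda>p q. F p q - G p q) / real N)"
proof -
  have "norm_sq {..<N} (\<lambda>i j. entries (to_mat N \<beta> F) i j - entries (to_mat N \<beta> G) i j) =
    norm_sq {..<N} (\<lambda>x y. F (\<beta> x) (\<beta> y) - G (\<beta> x) (\<beta> y))"
    by (rule norm_sq_cong) (simp add: entries_def)
  also have "\<dots> = norm_sq I (\<lambda>p q. F p q - G p q)"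
    by (rule norm_sq_reindex[OF \<beta>])
  finally show ?thesis by (simp add: hs_dist_entries)
qed

lemma norm_sq_unitary: assumes "x \<in> carrier (unitary_group n)" shows "norm_sq {..<n} (entries x) = real n"
proof -
  have x: "x \<in> carrier_mat n n" "mat_adjoint x * x = 1\<^sub>m n" using assms by (auto simp: unitary_group_simps)
  have "(\<Sum>p<n. (cmod (entries x p q))\<^sup>2) = 1" if q: "q < n" for q
  proof -
    have "complex_of_real (\<Sum>p<n. (cmod (entries x p q))\<^sup>2) = (\<Sum>p<n. cnj (x $$ (p, q)) * x $$ (p, q))"
      unfolding of_real_sum by (intro sum.cong) (auto simp only: complex_norm_square entries_def mult.commute)
    also have "\<dots> = (mat_adjoint x * x) $$ (q, q)"
      using x(1) q by (simp add: scalar_prod_def atLeast0LessThan adjoint_index[OF x(1)])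
    also have "\<dots> = 1" using x q by simp
    finally show ?thesis by (metis of_real_eq_1_iff)
  qed
  then show ?thesis by (simp add: norm_sq_def)
qed

lemma adjoint_to_mat: "mat_adjoint (to_mat N \<beta> F) = to_mat N \<beta> (\<lambda>p q. cnj (F q p))"
  by (intro eq_matI) (auto simp: adjoint_index[of _ N] carrier_matD[OF adjoint_carrier[OF to_mat_carrier]])

lemma cmod_diff_sq: "(cmod (a - b))\<^sup>2 \<le> 2 * (cmod a)\<^sup>2 + 2 * (cmod b)\<^sup>2"
proof -
  have "(cmod (a - b))\<^sup>2 \<le> (cmod a + cmod b)\<^sup>2" by (intro power_mono norm_triangle_ineq4) simp
  also have "\<dots> \<le> 2 * (cmod a)\<^sup>2 + 2 * (cmod b)\<^sup>2" using sum_squares_bound[of "cmod a" "cmod b"]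
    by (simp add: power2_sum)
  finally show ?thesis .
qed

lemma column_monomial:
  assumes A: "finite A" and t: "\<sigma> t \<in> A"
  shows "(\<Sum>p\<in>A \<times> {..<n}. (cmod (monomial u \<sigma> p (t, j)))\<^sup>2) = (\<Sum>i<n. (cmod (entries (u t) i j))\<^sup>2)"
    "\<sigma> t = \<tau> t \<Longrightarrow> (\<Sum>p\<in>A \<times> {..<n}. (cmod (monomial u \<sigma> p (t, j) - monomial v \<tau> p (t, j)))\<^sup>2) =
      (\<Sum>i<n. (cmod (entries (u t) i j - entries (v t) i j))\<^sup>2)"
proof -
  have s: "(\<Sum>p\<in>A \<times> {..<n}. if fst p = \<sigma> t then f (snd p) else 0) = (\<Sum>i<n. f i)" for f :: "nat \<Rightarrow> real"
  proof -
    have "(\<Sum>p\<in>A \<times> {..<n}. if fst p = \<sigma> t then f (snd p) else 0) = (\<Sum>s\<in>A. \<Sum>i<n. if s = \<sigma> t then f i else 0)"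
      by (simp add: sum.cartesian_product split_def)
    also have "\<dots> = (\<Sum>s\<in>A. if s = \<sigma> t then (\<Sum>i<n. f i) else 0)" by (rule sum.cong) auto
    finally show ?thesis using A t by simp
  qed
  show "(\<Sum>p\<in>A \<times> {..<n}. (cmod (monomial u \<sigma> p (t, j)))\<^sup>2) = (\<Sum>i<n. (cmod (entries (u t) i j))\<^sup>2)"
    unfolding s[symmetric] by (rule sum.cong) (auto simp: monomial_def)
  show "(\<Sum>p\<in>A \<times> {..<n}. (cmod (monomial u \<sigma> p (t, j) - monomial v \<tau> p (t, j)))\<^sup>2) =
    (\<Sum>i<n. (cmod (entries (u t) i j - entries (v t) i j))\<^sup>2)" if "\<sigma> t = \<tau> t"
    unfolding s[symmetric] by (rule sum.cong) (use that in \<open>auto simp: monomial_def\<close>)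
qed

lemma wreath_map_unitary:
  assumes n: "n > 0" and A: "finite (A :: nat set)" "A \<noteq> {}"
  shows "\<exists>W. wreath_map (unitary_group n) (hs_dist n) A (unitary_group (n * card A)) (hs_dist (n * card A)) W"
proof -
  let ?I = "A \<times> {..<n}" and ?N = "n * card A"
  obtain \<beta> where \<beta>: "bij_betw \<beta> {..<?N} ?I" using exists_enumeration[of ?I ?N] A
    by (auto simp: card_cartesian_product)
  have cA: "card A > 0" using A by (simp add: card_gt_0_iff)
  define W where "W u \<sigma> = to_mat ?N \<beta> (monomial u \<sigma> :: _ \<Rightarrow> _ \<Rightarrow> complex)" for u \<sigma>
  have c: "u t \<in> carrier_mat n n" if "u \<in> A \<rightarrow> carrier (unitary_group n)" "t \<in> A" for u t
    using that unitary_group_simps by blast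
  have one: "1\<^sub>m ?N = W (\<lambda>_. 1\<^sub>m n) (\<lambda>x\<in>A. x)" by (simp only: W_def to_mat_monomial_one[OF A(1) \<beta>])
  define col where "col u \<sigma> v \<tau> t = (\<Sum>j<n. \<Sum>p\<in>?I. (cmod (monomial u \<sigma> p (t, j) - monomial v \<tau> p (t, j)))\<^sup>2)"
    for u v :: "nat \<Rightarrow> complex mat" and \<sigma> \<tau> t
  have dist: "hs_dist ?N (W u \<sigma>) (W v \<tau>) = sqrt ((\<Sum>t\<in>A. col u \<sigma> v \<tau> t) / (real n * real (card A)))"
    for u \<sigma> v \<tau>
  proof -
    have "norm_sq ?I (\<lambda>p q. monomial u \<sigma> p q - monomial v \<tau> p q) = (\<Sum>t\<in>A. col u \<sigma> v \<tau> t)"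
      unfolding norm_sq_def col_def by (rule sum_pairs)
    then show ?thesis unfolding W_def hs_dist_to_mat[OF \<beta>] by simp
  qed
  have col_eq: "col u \<sigma> v \<tau> t = real n * (hs_dist n (u t) (v t))\<^sup>2"
    if "\<sigma> t \<in> A" "\<sigma> t = \<tau> t" "u t \<in> carrier_mat n n" "v t \<in> carrier_mat n n" for u v \<sigma> \<tau> t
  proof -
    have "col u \<sigma> v \<tau> t = norm_sq {..<n} (\<lambda>i j. entries (u t) i j - entries (v t) i j)"
      unfolding col_def norm_sq_def using column_monomial(2)[OF A(1), of \<sigma> t \<tau>] that by simp
    then show ?thesis unfolding hs_dist_entries[OF that(3,4)] using n norm_sq_nonneg by simp
  qed
  have "wreath_map (unitary_group n) (hs_dist n) A (unitary_group ?N) (hs_dist ?N) W"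
    unfolding wreath_map_def
  proof (intro conjI allI impI)
    show "W u \<sigma> \<in> carrier (unitary_group ?N)" if u: "u \<in> A \<rightarrow> carrier (unitary_group n)" and \<sigma>: "\<sigma> \<in> Bij A"
      for u \<sigma>
    proof -
      define \<sigma>' where "\<sigma>' = (\<lambda>x\<in>A. inv_into A \<sigma> x)"
      note i = inv_Bij[OF \<sigma>, folded \<sigma>'_def]
      \<comment> \<open>The adjoint is the monomial matrix of the inverse in the wreath product, so
        unitarity reduces to \<open>to_mat_monomial_inverse\<close>.\<close>
      have "mat_adjoint (W u \<sigma>) = to_mat ?N \<beta> (monomial (\<lambda>t. mat_adjoint (u (\<sigma>' t))) \<sigma>')"
        unfolding W_def adjoint_to_mat
      proof (rule to_mat_eqI[OF \<beta>])
        fix p q assume pq: "p \<in> ?I" "q \<in> ?I"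
        obtain s k t j where e: "p = (s, k)" "q = (t, j)" by (cases p, cases q)
        have m: "s \<in> A" "k < n" "t \<in> A" "j < n" using pq e by auto
        have "t = \<sigma> s \<longleftrightarrow> s = \<sigma>' t" using i(4,5) m by metis
        then show "cnj (monomial u \<sigma> q p) = monomial (\<lambda>t. mat_adjoint (u (\<sigma>' t))) \<sigma>' p q"
          using adjoint_index[OF c[OF u m(1)] m(2,4)] by (auto simp: monomial_def e entries_def)
      qed
      then show ?thesis unfolding unitary_group_simps
        using to_mat_monomial_inverse[OF A(1) \<beta> \<sigma>, of u "\<lambda>t. mat_adjoint (u t)", folded \<sigma>'_def] c[OF u] u
        by (auto simp: W_def Pi_def unitary_group_simps)
    qed
    show "W (\<lambda>_. \<one>\<^bsub>unitary_group n\<^esub>) (\<lambda>x\<in>A. x) = \<one>\<^bsub>unitary_group ?N\<^esub>" unfolding unitary_group_simps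
      by (rule one[symmetric])
    show "W u \<sigma> = W v \<sigma>" if "\<forall>t\<in>A. u t = v t" for u v \<sigma> unfolding W_def
      by (rule to_mat_monomial_cong[OF A(1) \<beta>]) (use that in auto)
    show "W u \<sigma> \<otimes>\<^bsub>unitary_group ?N\<^esub> W v \<tau> = W (\<lambda>t. u (\<tau> t) \<otimes>\<^bsub>unitary_group n\<^esub> v t) (compose A \<sigma> \<tau>)"
      if "u \<in> A \<rightarrow> carrier (unitary_group n)" "v \<in> A \<rightarrow> carrier (unitary_group n)" "\<sigma> \<in> Bij A" "\<tau> \<in> Bij A"
        for u \<sigma> v \<tau>
      unfolding unitary_group_simps W_def by (rule to_mat_monomial_mult[OF A(1) \<beta> c[OF that(1)] c[OF that(2)]
        that(4)])
    show "hs_dist ?N (W u \<sigma>) (W v \<tau>) \<le> 3 * sqrt \<epsilon>"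
      if u: "u \<in> A \<rightarrow> carrier (unitary_group n)" "v \<in> A \<rightarrow> carrier (unitary_group n)" "\<sigma> \<in> Bij A" "\<tau> \<in> Bij A"
        and e: "0 < \<epsilon>" "\<epsilon> \<le> 1"
        and T: "T \<subseteq> A" "(1 - \<epsilon>) * real (card A) \<le> real (card T)" and g: "\<forall>t\<in>T. \<sigma> t = \<tau> t \<and>
          hs_dist n (u t) (v t) < \<epsilon>" for u \<sigma> v \<tau> T \<epsilon>
    proof -
      have \<sigma>A: "\<sigma> t \<in> A" "\<tau> t \<in> A" if "t \<in> A" for t using u(3,4) that Bij_imp_funcset by blast+
      have "(\<Sum>t\<in>A. col u \<sigma> v \<tau> t) = (\<Sum>t\<in>T. col u \<sigma> v \<tau> t) + (\<Sum>t\<in>A - T. col u \<sigma> v \<tau> t)"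
        using A T by (metis add.commute sum.subset_diff)
      also have "(\<Sum>t\<in>T. col u \<sigma> v \<tau> t) \<le> (\<Sum>t\<in>T. real n * \<epsilon>)"
      proof (rule sum_mono)
        fix t assume t: "t \<in> T"
        then have tA: "t \<in> A" using T by blast
        have "0 \<le> hs_dist n (u t) (v t)" unfolding hs_dist_entries[OF c[OF u(1) tA] c[OF u(2) tA]]
          using norm_sq_nonneg by simp
        moreover have "hs_dist n (u t) (v t) < \<epsilon>" using g t by blast
        ultimately have "(hs_dist n (u t) (v t))\<^sup>2 \<le> \<epsilon> * 1" unfolding power2_eq_square using e
          by (intro mult_mono) auto
        moreover have "col u \<sigma> v \<tau> t = real n * (hs_dist n (u t) (v t))\<^sup>2"
          by (rule col_eq[where \<sigma> = \<sigma> and \<tau> = \<tau> and u = u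
            and v = v, OF \<sigma>A(1)[OF tA] _ c[OF u(1) tA] c[OF u(2) tA]]) (use g t in blast)
        ultimately show "col u \<sigma> v \<tau> t \<le> real n * \<epsilon>" by (simp add: mult_left_mono)
      qed
      also have "\<dots> \<le> real (card A) * (real n * \<epsilon>)" using card_mono[OF A(1) T(1)] e
        by (simp add: mult_right_mono)
      \<comment> \<open>Nothing relates the blocks outside \<open>T\<close>, but unitary blocks have
        squared norm \<open>n\<close>, and \<open>cmod_diff_sq\<close> turns this into
        \<open>2 * n + 2 * n\<close> for a block column.\<close>
      also have "(\<Sum>t\<in>A - T. col u \<sigma> v \<tau> t) \<le> (\<Sum>t\<in>A - T. 4 * real n)"
      proof (rule sum_mono)
        fix t assume "t \<in> A - T"
        then have tA: "t \<in> A" by blast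
        have "col u \<sigma> v \<tau> t \<le> (\<Sum>j<n. \<Sum>p\<in>?I. 2 * (cmod (monomial u \<sigma> p (t, j)))\<^sup>2 +
          2 * (cmod (monomial v \<tau> p (t, j)))\<^sup>2)"
          unfolding col_def by (intro sum_mono cmod_diff_sq)
        also have "\<dots> = 2 * norm_sq {..<n} (entries (u t)) + 2 * norm_sq {..<n} (entries (v t))"
          unfolding norm_sq_def using column_monomial(1)[where \<sigma> = \<sigma> and t = t
            and u = u, OF A(1) \<sigma>A(1)[OF tA]]
            column_monomial(1)[where \<sigma> = \<tau> and t = t and u = v, OF A(1) \<sigma>A(2)[OF tA]]
          by (simp add: sum.distrib flip: sum_distrib_left)
        also have "\<dots> = 4 * real n" using norm_sq_unitary u(1,2) tA by (simp add: Pi_def)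
        finally show "col u \<sigma> v \<tau> t \<le> 4 * real n" .
      qed
      also have "\<dots> = 4 * (real n * real (card (A - T)))" by simp
      also have "\<dots> \<le> 4 * (real n * (\<epsilon> * real (card A)))"
      proof -
        have "real (card (A - T)) = real (card A) - real (card T)"
          using card_Diff_subset[OF finite_subset[OF T(1) A(1)] T(1)] card_mono[OF A(1) T(1)]
          by (simp add: of_nat_diff)
        then have "real (card (A - T)) \<le> \<epsilon> * real (card A)" using T(2) by (simp add: algebra_simps)
        then show ?thesis by (intro mult_left_mono) auto
      qed
      finally have "(\<Sum>t\<in>A. col u \<sigma> v \<tau> t) \<le> 5 * \<epsilon> * (real n * real (card A))" by (simp add: algebra_simps)
      then have "(\<Sum>t\<in>A. col u \<sigma> v \<tau> t) / (real n * real (card A)) \<le> 5 * \<epsilon>" using n cA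
        by (simp add: pos_divide_le_eq)
      \<comment> \<open>Rounded up to a perfect square; this accounts for the factor 3 in
        \<open>wreath_map\<close>.\<close>
      also have "\<dots> \<le> 9 * \<epsilon>" using e by simp
      finally have "sqrt ((\<Sum>t\<in>A. col u \<sigma> v \<tau> t) / (real n * real (card A))) \<le> sqrt (9 * \<epsilon>)"
        by (rule real_sqrt_le_mono)
      then show ?thesis unfolding dist by (simp add: real_sqrt_mult)
    qed
    show "c' / 2 \<le> hs_dist ?N (W u (\<lambda>x\<in>A. x)) \<one>\<^bsub>unitary_group ?N\<^esub>"
      if u: "u \<in> A \<rightarrow> carrier (unitary_group n)" and T: "T \<subseteq> A" "card A \<le> 2 * card T"
        and c': "0 < c'" "\<forall>t\<in>T. c' \<le> hs_dist n (u t) \<one>\<^bsub>unitary_group n\<^esub>" for u T c'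
    proof -
      let ?col = "col u (\<lambda>x\<in>A. x) (\<lambda>_. 1\<^sub>m n) (\<lambda>x\<in>A. x)"
      have "(c' / 2)\<^sup>2 * (real n * real (card A)) \<le> (c'\<^sup>2 / 2) * (real n * real (card A))"
        by (intro mult_right_mono) (auto simp: power2_eq_square)
      also have "\<dots> \<le> (c'\<^sup>2 / 2) * (real n * (2 * real (card T)))" using T by (intro mult_left_mono) auto
      also have "\<dots> = c'\<^sup>2 * (real n * real (card T))" by simp
      also have "\<dots> = (\<Sum>t\<in>T. real n * c'\<^sup>2)" by simp
      also have "\<dots> \<le> (\<Sum>t\<in>T. ?col t)"
      proof (rule sum_mono)
        fix t assume t: "t \<in> T"
        then have tA: "t \<in> A" using T by blast
        have "c' \<le> hs_dist n (u t) (1\<^sub>m n)" using c'(2) t unfolding unitary_group_simps by blast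
        then have "c'\<^sup>2 \<le> (hs_dist n (u t) (1\<^sub>m n))\<^sup>2" using c'(1) by (intro power_mono) auto
        moreover have "?col t = real n * (hs_dist n (u t) (1\<^sub>m n))\<^sup>2"
          using col_eq[of "\<lambda>x\<in>A. x" t "\<lambda>x\<in>A. x" u "\<lambda>_. 1\<^sub>m n"] tA c[OF u tA] by simp
        ultimately show "real n * c'\<^sup>2 \<le> ?col t" by (simp add: mult_left_mono)
      qed
      also have "\<dots> \<le> (\<Sum>t\<in>A. ?col t)" by (rule sum_mono2[OF A(1) T(1)]) (simp add: col_def sum_nonneg)
      finally have "(c' / 2)\<^sup>2 \<le> (\<Sum>t\<in>A. ?col t) / (real n * real (card A))" using n cA
        by (simp add: pos_le_divide_eq)
      then show ?thesis unfolding unitary_group_simps one dist by (rule real_le_rsqrt)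
    qed
  qed
  then show ?thesis by (rule exI[where x = W])
qed

section \<open>Norms and traces of amplified unitary matrices\<close>

lemma norm_sq_kron: "norm_sq (I \<times> J) (kron F G) = norm_sq I F * norm_sq J G"
proof -
  have "norm_sq (I \<times> J) (kron F G) = (\<Sum>q\<in>I. \<Sum>q'\<in>J. \<Sum>p\<in>I. \<Sum>p'\<in>J. (cmod (F p q))\<^sup>2 * (cmod (G p' q'))\<^sup>2)"
    by (simp add: norm_sq_def sum_pairs norm_mult power_mult_distrib)
  also have "\<dots> = (\<Sum>q\<in>I. \<Sum>p\<in>I. (cmod (F p q))\<^sup>2) * (\<Sum>q'\<in>J. \<Sum>p'\<in>J. (cmod (G p' q'))\<^sup>2)"
    by (simp add: sum_product)
  finally show ?thesis by (simp add: norm_sq_def)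
qed

text \<open>For a unitary matrix the norm on the right is \<open>card I\<close>, so the distance
  from \<open>1\<close> is determined by the real part of the trace, and traces of tensor products
  multiply.\<close>

lemma norm_sq_minus_delta:
  assumes "finite I" shows "norm_sq I (\<lambda>p q. F p q - delta p q) = norm_sq I F +
    real (card I) - 2 * Re (\<Sum>p\<in>I. F p p)"
proof -
  have e: "(cmod (F p q - delta p q))\<^sup>2 = (cmod (F p q))\<^sup>2 + (if p = q then 1 - 2 * Re (F q q) else 0)"
    for p q
    by (cases "p = q") (simp_all add: delta_def cmod_power2 power2_diff)
  have "norm_sq I (\<lambda>p q. F p q - delta p q) = norm_sq I F + (\<Sum>q\<in>I. 1 - 2 * Re (F q q))"
    unfolding norm_sq_def e using assms by (simp add: sum.distrib)
  then show ?thesis by (simp add: sum_subtractf sum_distrib_left)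
qed

lemma norm_sq_padded: "norm_sq ({..<n} \<times> UNIV) (padded x) = norm_sq {..<n} (entries x) + real n"
  "norm_sq ({..<n} \<times> UNIV) (\<lambda>p q. padded x p q - padded y p q) =
    norm_sq {..<n} (\<lambda>i j. entries x i j - entries y i j)"
proof -
  have s: "(\<Sum>z\<in>{..<n} \<times> UNIV. f z) = (\<Sum>i<n. f (i, True) + f (i, False))" for f :: "nat \<times> bool \<Rightarrow> real"
  proof -
    have "(\<Sum>z\<in>{..<n} \<times> UNIV. f z) = (\<Sum>i<n. \<Sum>b\<in>UNIV. f (i, b))" by (simp add: sum.cartesian_product)
    then show ?thesis by (simp add: UNIV_bool add.commute)
  qed
  have d: "(\<Sum>q<n. \<Sum>p<n. (cmod (delta p q))\<^sup>2) = real n"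
  proof -
    have "(cmod (delta p q))\<^sup>2 = (if p = q then 1 else 0)" for p q :: nat by (simp add: delta_def)
    then show ?thesis by simp
  qed
  show "norm_sq ({..<n} \<times> UNIV) (padded x) = norm_sq {..<n} (entries x) + real n"
    unfolding norm_sq_def s by (simp add: padded_def sum.distrib d)
  show "norm_sq ({..<n} \<times> UNIV) (\<lambda>p q. padded x p q - padded y p q) =
    norm_sq {..<n} (\<lambda>i j. entries x i j - entries y i j)"
    unfolding norm_sq_def s by (simp add: padded_def)
qed

text \<open>The telescoping of \<open>rank_amplified_diff\<close>. Squared norms of tensor products
  multiply, the padded \<open>x\<close> has squared norm \<open>2 * n\<close> and \<open>y\<close>
  has \<open>n\<close>; the factor 2 from \<open>cmod_diff_sq\<close> makes
  \<open>6 * n\<close>.\<close>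

lemma norm_sq_amplified_diff:
  assumes "x \<in> carrier (unitary_group n)" "y \<in> carrier (unitary_group n)"
  shows "norm_sq (amplified_index n) (\<lambda>p q. amplified x p q - amplified y p q) \<le> 6 * real n * norm_sq {..<n}
    (\<lambda>i j. entries x i j - entries y i j)"
proof -
  let ?D = "\<lambda>i j. entries x i j - entries y i j" and ?B = "\<lambda>p q. padded x p q - padded y p q"
  have e: "amplified x p q - amplified y p q = kron ?D (padded x) p q - kron (\<lambda>i j. - entries y i j) ?B p q"
    for p q
    by (cases p, cases q) (simp add: amplified_def kron_def algebra_simps)
  have "norm_sq (amplified_index n) (\<lambda>p q. amplified x p q - amplified y p q) \<le>
    (\<Sum>q\<in>amplified_index n. \<Sum>p\<in>amplified_index n. 2 * (cmod (kron ?D (padded x) p q))\<^sup>2 + 2 *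
    (cmod (kron (\<lambda>i j. - entries y i j) ?B p q))\<^sup>2)"
    unfolding norm_sq_def e by (intro sum_mono cmod_diff_sq)
  also have "\<dots> = 2 * norm_sq (amplified_index n) (kron ?D (padded x)) + 2 * norm_sq (amplified_index n)
    (kron (\<lambda>i j. - entries y i j) ?B)"
    by (simp add: norm_sq_def sum.distrib flip: sum_distrib_left)
  also have "norm_sq {..<n} (\<lambda>i j. - entries y i j) = real n" using norm_sq_unitary[OF assms(2)]
    by (simp add: norm_sq_def)
  then have "2 * norm_sq (amplified_index n) (kron ?D (padded x)) + 2 * norm_sq (amplified_index n)
    (kron (\<lambda>i j. - entries y i j) ?B) = 6 * real n * norm_sq {..<n} ?D"
    unfolding norm_sq_kron norm_sq_padded norm_sq_unitary[OF assms(1)] by (simp add: algebra_simps)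
  finally show ?thesis .
qed

lemma trace_amplified:
  "(\<Sum>p\<in>amplified_index n. amplified x p p) = (\<Sum>i<n. entries x i i) * ((\<Sum>i<n. entries x i i) + of_nat n)"
proof -
  have "(\<Sum>p\<in>amplified_index n. amplified x p p) = (\<Sum>i<n. \<Sum>q\<in>{..<n} \<times> UNIV. entries x i i * padded x q q)"
    by (simp add: sum.cartesian_product amplified_def kron_def split_def)
  also have "\<dots> = (\<Sum>i<n. entries x i i) * (\<Sum>q\<in>{..<n} \<times> UNIV. padded x q q)" by (simp add: sum_product)
  also have "(\<Sum>q\<in>{..<n} \<times> UNIV. padded x q q) = (\<Sum>i<n. \<Sum>b\<in>UNIV. padded x (i, b) (i, b))"
    by (simp add: sum.cartesian_product split_def)
  also have "\<dots> = (\<Sum>i<n. entries x i i) + of_nat n"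
    by (simp add: UNIV_bool padded_def delta_def sum.distrib add.commute)
  finally show ?thesis .
qed

lemma amplified_unitary:
  assumes \<beta>: "bij_betw \<beta> {..<N} (amplified_index n)" and x: "x \<in> carrier (unitary_group n)"
  shows "to_mat N \<beta> (amplified x) \<in> carrier (unitary_group N)"
proof -
  have xc: "x \<in> carrier_mat n n" "x * mat_adjoint x = 1\<^sub>m n" "mat_adjoint x * x = 1\<^sub>m n" using x
    by (auto simp: unitary_group_simps)
  have "mat_adjoint (to_mat N \<beta> (amplified x)) = to_mat N \<beta> (amplified (mat_adjoint x))"
    unfolding adjoint_to_mat
  proof (rule to_mat_eqI[OF \<beta>])
    fix p q assume "p \<in> amplified_index n" "q \<in> amplified_index n"
    then show "cnj (amplified x q p) = amplified (mat_adjoint x) p q"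
      using adjoint_index[OF xc(1)] by (cases p, cases q) (auto simp: amplified_def kron_def padded_def
        entries_def delta_def)
  qed
  then show ?thesis unfolding unitary_group_simps
    using to_mat_amplified(1)[OF \<beta> xc(1) adjoint_carrier[OF xc(1)]]
      to_mat_amplified(1)[OF \<beta> adjoint_carrier[OF xc(1)] xc(1)] xc to_mat_amplified(2)[OF \<beta>] by simp
qed

text \<open>Let \<open>z\<close> be the normalized trace of \<open>x\<close> and
  \<open>\<delta> = 1 - Re z\<close>. The squared distance from \<open>1\<close> is
  \<open>2 * \<delta>\<close> before amplification and \<open>2 - Re (z * (z + 1))\<close>, which is
  at least \<open>\<delta> * (3 - \<delta>)\<close>, afterwards. As \<open>\<delta>\<close> is at
  most 2, this does not collapse, not even at \<open>x = - 1\<close>.\<close>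

lemma amplification_unitary: "amplification 1 (indexed_family unitary_group hs_dist)"
  unfolding amplification_def
proof (intro conjI allI impI)
  let ?F = "indexed_family unitary_group hs_dist"
  fix \<eta> :: real assume \<eta>: "\<eta> > 0"
  show "\<exists>\<delta>>0. \<forall>G d. (G, d) \<in> ?F \<longrightarrow> (\<exists>H e S. (H, e) \<in> ?F \<and> S \<in> hom G H \<and> S \<one>\<^bsub>G\<^esub> = \<one>\<^bsub>H\<^esub> \<and>
     (\<forall>x\<in>carrier G. \<forall>y\<in>carrier G. d x y < \<delta> \<longrightarrow> e (S x) (S y) < \<eta>) \<and>
     (\<forall>x\<in>carrier G. min 1 (11 / 10 * d x \<one>\<^bsub>G\<^esub>) \<le> e (S x) \<one>\<^bsub>H\<^esub>))"
  proof (rule exI[of _ "\<eta> / 2"], intro conjI allI impI)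
    fix G d assume "(G, d) \<in> ?F"
    then obtain n where n: "n > 0" "G = unitary_group n" "d = hs_dist n" by (auto simp: indexed_family_def)
    let ?I = "amplified_index n" and ?N = "n * n * 2"
    obtain \<beta> where \<beta>: "bij_betw \<beta> {..<?N} ?I" using exists_enumeration[of ?I ?N] card_amplified_index by auto
    define S where "S x = to_mat ?N \<beta> (amplified x :: _ \<Rightarrow> _ \<Rightarrow> complex)" for x
    note Sm = to_mat_amplified[OF \<beta>, where 'k = complex, folded S_def]
    have c: "x \<in> carrier_mat n n" if "x \<in> carrier (unitary_group n)" for x using that unitary_group_simps
      by blast
    let ?D = "\<lambda>x y. norm_sq {..<n} (\<lambda>i j. entries x i j - entries y i j)"
    have d: "hs_dist n x y = sqrt (?D x y / real n)" if "x \<in> carrier_mat n n" "y \<in> carrier_mat n n" for x y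
      using hs_dist_entries[OF that] .
    have dS: "hs_dist ?N (S x) (S y) = sqrt (norm_sq ?I (\<lambda>p q. amplified x p q - amplified y p q) /
      (2 * (real n * real n)))" for x y
      unfolding S_def hs_dist_to_mat[OF \<beta>] by simp
    have Sc: "S x \<in> carrier (unitary_group ?N)" if "x \<in> carrier (unitary_group n)" for x
      unfolding S_def by (rule amplified_unitary[OF \<beta> that])
    have "S \<in> hom (unitary_group n) (unitary_group ?N)"
      by (rule homI[OF Sc]) (simp_all add: unitary_group_simps(3) Sm(1) c)
    moreover have "S \<one>\<^bsub>unitary_group n\<^esub> = \<one>\<^bsub>unitary_group ?N\<^esub>" unfolding unitary_group_simps by (rule Sm(2))
    moreover have "hs_dist ?N (S x) (S y) < \<eta>" if x: "x \<in> carrier (unitary_group n)"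
      and y: "y \<in> carrier (unitary_group n)" and xy: "hs_dist n x y < \<eta> / 2" for x y
    proof -
      have "norm_sq ?I (\<lambda>p q. amplified x p q - amplified y p q) / (2 * (real n * real n)) \<le>
        6 * real n * ?D x y / (2 * (real n * real n))"
        by (rule divide_right_mono[OF norm_sq_amplified_diff[OF x y]]) simp
      also have "\<dots> = 3 * (?D x y / real n)" using n by simp
      also have "\<dots> \<le> 4 * (?D x y / real n)" using norm_sq_nonneg by (intro mult_right_mono) auto
      finally have "hs_dist ?N (S x) (S y) \<le> sqrt (4 * (?D x y / real n))" unfolding dS
        by (rule real_sqrt_le_mono)
      also have "\<dots> = 2 * hs_dist n x y" unfolding d[OF c[OF x] c[OF y]] real_sqrt_mult by simp
      finally show ?thesis using xy by linarith
    qed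
    moreover have "min 1 (11 / 10 * hs_dist n x \<one>\<^bsub>unitary_group n\<^esub>) \<le> hs_dist ?N (S x) \<one>\<^bsub>unitary_group ?N\<^esub>"
      if x: "x \<in> carrier (unitary_group n)" for x
    proof -
      have Re_mult_real: "Re (complex_of_real r * w) = r * Re w" for r w by simp
      define z where "z = (\<Sum>i<n. entries x i i) / of_nat n"
      define \<delta> where "\<delta> = 1 - Re z"
      have tr: "(\<Sum>i<n. entries x i i) = of_nat n * z" using n by (simp add: z_def)
      have "?D x (1\<^sub>m n) = norm_sq {..<n} (\<lambda>i j. entries x i j - delta i j)"
        by (rule norm_sq_cong) (simp add: entries_one)
      then have "?D x (1\<^sub>m n) = real n * (2 * \<delta>)" using norm_sq_minus_delta[of "{..<n}" "entries x"]
        norm_sq_unitary[OF x]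
        by (simp add: tr \<delta>_def algebra_simps)
      then have d1: "hs_dist n x (1\<^sub>m n) = sqrt (2 * \<delta>)" using d[OF c[OF x] one_carrier_mat] n by simp
      have "?D x (1\<^sub>m n) \<le> (\<Sum>q<n. \<Sum>p<n. 2 * (cmod (entries x p q))\<^sup>2 + 2 * (cmod (entries (1\<^sub>m n) p q))\<^sup>2)"
        unfolding norm_sq_def by (intro sum_mono cmod_diff_sq)
      also have "\<dots> = 2 * norm_sq {..<n} (entries x) + 2 * norm_sq {..<n} (entries (1\<^sub>m n))"
        by (simp add: norm_sq_def sum.distrib flip: sum_distrib_left)
      also have "\<dots> = real n * 4" using norm_sq_unitary[OF x] norm_sq_unitary[of "1\<^sub>m n" n]
        by (simp add: unitary_group_simps adjoint_one)
      finally have "real n * (2 * \<delta>) \<le> real n * 4" using \<open>?D x (1\<^sub>m n) = real n * (2 * \<delta>)\<close> by simp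
      then have \<delta>2: "\<delta> \<le> 2" using n by simp
      have "0 \<le> real n * (2 * \<delta>)" using \<open>?D x (1\<^sub>m n) = real n * (2 * \<delta>)\<close> norm_sq_nonneg by metis
      then have \<delta>0: "0 \<le> \<delta>" using n by (simp add: zero_le_mult_iff)
      have "real ?N = norm_sq {..<?N} (entries (S x))" using norm_sq_unitary[OF Sc[OF x]] by simp
      also have "\<dots> = norm_sq ?I (amplified x)"
      proof -
        have "norm_sq {..<?N} (entries (S x)) = norm_sq {..<?N} (\<lambda>a b. amplified x (\<beta> a) (\<beta> b))"
          by (rule norm_sq_cong) (simp add: S_def entries_def)
        also have "\<dots> = norm_sq ?I (amplified x)" by (rule norm_sq_reindex[OF \<beta>])
        finally show ?thesis .
      qed
      finally have N: "norm_sq ?I (amplified x) = real ?N" ..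
      have "norm_sq ?I (\<lambda>p q. amplified x p q - amplified (1\<^sub>m n) p q) =
        norm_sq ?I (\<lambda>p q. amplified x p q - delta p q)" by (rule norm_sq_cong) (simp only: amplified_one)
      also have "\<dots> = 2 * real ?N - 2 * Re (of_nat n * z * (of_nat n * z + of_nat n))"
        using norm_sq_minus_delta[of ?I "amplified x"] N card_amplified_index[of n]
          by (simp add: trace_amplified tr)
      also have "of_nat n * z * (of_nat n * z + of_nat n) = complex_of_real (real n * real n) *
        (z * (z + 1))" by (simp add: algebra_simps)
      also have "2 * real ?N - 2 * Re (complex_of_real (real n * real n) * (z * (z + 1))) =
        (2 * (real n * real n)) * (2 - Re (z * (z + 1)))"
        unfolding Re_mult_real by (simp add: algebra_simps)
      finally have dS1: "hs_dist ?N (S x) (S (1\<^sub>m n)) = sqrt (2 - Re (z * (z + 1)))" unfolding dS using n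
        by simp
      \<comment> \<open>The difference of the two sides is the square of the imaginary part of
        \<open>z\<close>.\<close>
      have "\<delta> * (3 - \<delta>) \<le> 2 - Re (z * (z + 1))" unfolding \<delta>_def by (simp add: algebra_simps)
      then have low: "sqrt (\<delta> * (3 - \<delta>)) \<le> hs_dist ?N (S x) (S (1\<^sub>m n))" unfolding dS1
        by (rule real_sqrt_le_mono)
      have "min 1 (11 / 10 * sqrt (2 * \<delta>)) \<le> sqrt (\<delta> * (3 - \<delta>))"
      \<comment> \<open>The threshold solves \<open>3 - \<delta> = 2 * (11/10)\<^sup>2\<close>.
        Above it, the decomposition below bounds \<open>\<delta> * (3 - \<delta>)\<close> by 1 from
        below.\<close>
      proof (cases "\<delta> \<le> 29/50")
        case True
        have "\<delta> * (121/50) \<le> \<delta> * (3 - \<delta>)" using \<delta>0 True by (intro mult_left_mono) auto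
        then have "sqrt ((11/10)\<^sup>2 * (2 * \<delta>)) \<le> sqrt (\<delta> * (3 - \<delta>))"
          by (intro real_sqrt_le_mono) (simp add: power2_eq_square)
        then show ?thesis unfolding real_sqrt_mult by simp
      next
        case False
        have "0 \<le> (\<delta> - 29/50) * (2 - \<delta>)" using False \<delta>2 by (intro mult_nonneg_nonneg) auto
        moreover have "\<delta> * (3 - \<delta>) = (\<delta> - 29/50) * (2 - \<delta>) + (21/50 * \<delta> + 29/25)" by (simp add: field_simps)
        ultimately have "1 \<le> \<delta> * (3 - \<delta>)" using \<delta>0 by linarith
        then have "1 \<le> sqrt (\<delta> * (3 - \<delta>))" by simp
        then show ?thesis by linarith
      qed
      then show ?thesis unfolding unitary_group_simps Sm(2)[symmetric] d1 using low by linarith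
    qed
    moreover have "(unitary_group ?N, hs_dist ?N) \<in> ?F" using n by (force simp: indexed_family_def)
    ultimately show "\<exists>H e S. (H, e) \<in> ?F \<and> S \<in> hom G H \<and> S \<one>\<^bsub>G\<^esub> = \<one>\<^bsub>H\<^esub> \<and>
     (\<forall>x\<in>carrier G. \<forall>y\<in>carrier G. d x y < \<eta> / 2 \<longrightarrow> e (S x) (S y) < \<eta>) \<and>
     (\<forall>x\<in>carrier G. min 1 (11 / 10 * d x \<one>\<^bsub>G\<^esub>) \<le> e (S x) \<one>\<^bsub>H\<^esub>)"
      unfolding n(2,3) by blast
  qed (use \<eta> in simp)
qed simp

lemma contains_finite_groups_unitary: "contains_finite_groups (indexed_family unitary_group hs_dist)"
  unfolding contains_finite_groups_def
proof (intro allI impI)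
  fix Q :: "nat monoid" assume Q: "group Q" "finite (carrier Q)"
  interpret group Q by fact
  define N where "N = card (carrier Q)"
  have N: "N > 0" using Q one_closed by (auto simp: N_def card_gt_0_iff)
  obtain \<beta> where \<beta>: "bij_betw \<beta> {..<N} (carrier Q)" using exists_enumeration[OF Q(2)] N_def by metis
  define j where "j x = to_mat N \<beta> (regular_rep Q x :: nat \<Rightarrow> nat \<Rightarrow> complex)" for x
  have m: "j x * j y = j (x \<otimes>\<^bsub>Q\<^esub> y)" if "x \<in> carrier Q" "y \<in> carrier Q" for x y
    unfolding j_def to_mat_mult[OF \<beta>] by (rule to_mat_eqI[OF \<beta> mmult_regular_rep[OF Q that]])
  have j1: "j \<one>\<^bsub>Q\<^esub> = 1\<^sub>m N" unfolding j_def by (rule to_mat_one[OF \<beta>]) (simp add: regular_rep_def delta_def)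
  have "j \<in> hom Q (unitary_group N)"
  proof (rule homI)
    show "j x \<in> carrier (unitary_group N)" if x: "x \<in> carrier Q" for x
    proof -
      have "mat_adjoint (j x) = j (inv\<^bsub>Q\<^esub> x)" unfolding j_def adjoint_to_mat
        by (rule to_mat_eqI[OF \<beta>]) (use x in \<open>auto simp: regular_rep_def inv_solve_left\<close>)
      then show ?thesis unfolding unitary_group_simps using m x j1 by (auto simp: j_def)
    qed
  qed (simp add: unitary_group_simps m)
  moreover have "hs_dist N (j x) (j x) = 0" for x
    unfolding j_def hs_dist_to_mat[OF \<beta>] by (simp add: norm_sq_def)
  moreover have "0 < hs_dist N (j x) \<one>\<^bsub>unitary_group N\<^esub>" if x: "x \<in> carrier Q" "x \<noteq> \<one>\<^bsub>Q\<^esub>" for x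
  proof -
    let ?F = "\<lambda>p q. regular_rep Q x p q - (regular_rep Q \<one>\<^bsub>Q\<^esub> p q :: complex)"
    have "0 < (cmod (?F x \<one>\<^bsub>Q\<^esub>))\<^sup>2" using x by (simp add: regular_rep_def)
    also have "\<dots> \<le> (\<Sum>p\<in>carrier Q. (cmod (?F p \<one>\<^bsub>Q\<^esub>))\<^sup>2)" by (rule member_le_sum) (use x Q in auto)
    also have "\<dots> \<le> norm_sq (carrier Q) ?F" unfolding norm_sq_def
      by (rule member_le_sum[where f = "\<lambda>q. \<Sum>p\<in>carrier Q. (cmod (?F p q))\<^sup>2"])
        (use Q in \<open>auto intro: sum_nonneg\<close>)
    finally show ?thesis unfolding unitary_group_simps j1[symmetric] unfolding j_def hs_dist_to_mat[OF \<beta>]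
      using N by simp
  qed
  moreover have "(unitary_group N, hs_dist N) \<in> indexed_family unitary_group hs_dist" using N
    by (auto simp: indexed_family_def)
  moreover have "j \<one>\<^bsub>Q\<^esub> = \<one>\<^bsub>unitary_group N\<^esub>" using j1 by (simp add: unitary_group_simps)
  ultimately show "\<exists>G d j. (G, d) \<in> indexed_family unitary_group hs_dist \<and> j \<in> hom Q G \<and> j \<one>\<^bsub>Q\<^esub> = \<one>\<^bsub>G\<^esub> \<and>
    (\<forall>x\<in>carrier Q. d (j x) (j x) = 0) \<and>
      (\<forall>x\<in>carrier Q. x \<noteq> \<one>\<^bsub>Q\<^esub> \<longrightarrow> 0 < d (j x) \<one>\<^bsub>G\<^esub>)" by blast
qed

section \<open>Finite metric groups\<close>

text \<open>Replaces the supremum of \<open>weakly_sofic_group\<close>, which is attained because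
  the carriers are finite.\<close>

definition unit_diam :: "('h, 'b) monoid_scheme \<Rightarrow> ('h \<Rightarrow> 'h \<Rightarrow> real) \<Rightarrow> bool" where
  "unit_diam G d \<longleftrightarrow> (\<forall>x\<in>carrier G. \<forall>y\<in>carrier G. d x y \<le> 1) \<and> (\<exists>x\<in>carrier G. \<exists>y\<in>carrier G. d x y = 1)"

definition metric_group :: "('h, 'b) monoid_scheme \<Rightarrow> ('h \<Rightarrow> 'h \<Rightarrow> real) \<Rightarrow> bool" where
  "metric_group G d \<longleftrightarrow> group G \<and> finite (carrier G) \<and> Metric_space (carrier G) d \<and> bi_invariant G d \<and>
    unit_diam G d"

definition finite_metric_groups :: "(nat monoid \<times> (nat \<Rightarrow> nat \<Rightarrow> real)) set" where
  "finite_metric_groups = {(G, d). metric_group G d}"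

lemma SUP_eq_one_iff:
  assumes "finite (carrier G)" "carrier G \<noteq> {}"
  shows "(SUP (x, y) \<in> carrier G \<times> carrier G. d x y) = (1 :: real) \<longleftrightarrow> unit_diam G d"
proof -
  let ?S = "(\<lambda>(x, y). d x y) ` (carrier G \<times> carrier G)"
  have S: "finite ?S" "?S \<noteq> {}" using assms by auto
  have "Sup ?S = 1 \<longleftrightarrow> Max ?S = 1" by (simp only: cSup_eq_Max[OF S])
  also have "\<dots> \<longleftrightarrow> 1 \<in> ?S \<and> (\<forall>s\<in>?S. s \<le> 1)" by (rule Max_eq_iff[OF S])
  also have "\<dots> \<longleftrightarrow> unit_diam G d" by (force simp: unit_diam_def)
  finally show ?thesis .
qed

lemma weakly_sofic_group_iff: "weakly_sofic_group \<Gamma> \<longleftrightarrow> approximable finite_metric_groups \<Gamma>"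
proof -
  have "{(G :: nat monoid, d). group G \<and> finite (carrier G) \<and> Metric_space (carrier G) d \<and> bi_invariant G d \<and>
      (SUP (x, y) \<in> carrier G \<times> carrier G. d x y) = 1} = finite_metric_groups"
  proof (rule Set.set_eqI)
    fix p :: "nat monoid \<times> (nat \<Rightarrow> nat \<Rightarrow> real)"
    obtain G d where p: "p = (G, d)" by (cases p)
    have "carrier G \<noteq> {}" if "group G" using monoid.one_closed[OF group.is_monoid[OF that]] by blast
    then show "p \<in> {(G, d). group G \<and> finite (carrier G) \<and> Metric_space (carrier G) d \<and> bi_invariant G d \<and>
      (SUP (x, y) \<in> carrier G \<times> carrier G. d x y) = 1} \<longleftrightarrow> p \<in> finite_metric_groups"
      using SUP_eq_one_iff[of G d] unfolding p finite_metric_groups_def metric_group_def mem_Collect_eq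
        prod.case by blast
  qed
  then show ?thesis by (simp add: weakly_sofic_group_def)
qed

text \<open>The last two hypotheses range over the whole type because \<open>Metric_space\<close>
  demands nonnegativity and symmetry there, not only on the carrier.\<close>

lemma metric_groupI:
  assumes "group G" "finite (carrier G)"
    and "\<And>x y. x \<in> carrier G \<Longrightarrow> y \<in> carrier G \<Longrightarrow> 0 \<le> d x y \<and> d x y \<le> 1 \<and> d x y = d y x \<and> (d x y = 0 \<longleftrightarrow> x = y)"
    and "\<And>x y z. x \<in> carrier G \<Longrightarrow> y \<in> carrier G \<Longrightarrow> z \<in> carrier G \<Longrightarrow> d x z \<le> d x y + d y z"
    and "\<And>x y z. x \<in> carrier G \<Longrightarrow> y \<in> carrier G \<Longrightarrow> z \<in> carrier G \<Longrightarrow>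
      d (z \<otimes>\<^bsub>G\<^esub> x) (z \<otimes>\<^bsub>G\<^esub> y) = d x y \<and> d (x \<otimes>\<^bsub>G\<^esub> z) (y \<otimes>\<^bsub>G\<^esub> z) = d x y"
    and "x0 \<in> carrier G" "y0 \<in> carrier G" "d x0 y0 = 1"
    and "\<And>x y. 0 \<le> d x y" "\<And>x y. d x y = d y x"
  shows "metric_group G d"
proof -
  have "Metric_space (carrier G) d" using assms(3,4,9,10) by unfold_locales auto
  moreover have "bi_invariant G d" using assms(5) by (auto simp: bi_invariant_def)
  moreover have "unit_diam G d" using assms(3,6-8) by (auto simp: unit_diam_def)
  ultimately show ?thesis using assms(1,2) by (simp add: metric_group_def)
qed

lemma metric_groupD:
  assumes "metric_group G d"
  shows "group G" "finite (carrier G)" "\<And>x y. 0 \<le> d x y" "\<And>x y. d x y = d y x"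
    "\<And>x y. x \<in> carrier G \<Longrightarrow> y \<in> carrier G \<Longrightarrow> d x y \<le> 1" "\<And>x y. x \<in> carrier G \<Longrightarrow> y \<in> carrier G \<Longrightarrow> d x y = 0 \<longleftrightarrow>
      x = y"
    "\<And>x y z. x \<in> carrier G \<Longrightarrow> y \<in> carrier G \<Longrightarrow> z \<in> carrier G \<Longrightarrow> d x z \<le> d x y + d y z"
    "\<And>x y z. x \<in> carrier G \<Longrightarrow> y \<in> carrier G \<Longrightarrow> z \<in> carrier G \<Longrightarrow> d (z \<otimes>\<^bsub>G\<^esub> x) (z \<otimes>\<^bsub>G\<^esub> y) = d x y"
    "\<And>x y z. x \<in> carrier G \<Longrightarrow> y \<in> carrier G \<Longrightarrow> z \<in> carrier G \<Longrightarrow> d (x \<otimes>\<^bsub>G\<^esub> z) (y \<otimes>\<^bsub>G\<^esub> z) = d x y"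
    "\<exists>x\<in>carrier G. \<exists>y\<in>carrier G. d x y = 1"
proof -
  interpret Metric_space "carrier G" d using assms by (simp add: metric_group_def)
  show "0 \<le> d x y" "d x y = d y x" for x y by (auto intro: commute)
  show "d x y = 0 \<longleftrightarrow> x = y" if "x \<in> carrier G" "y \<in> carrier G" for x y using zero[OF that] .
  show "d x z \<le> d x y + d y z" if "x \<in> carrier G" "y \<in> carrier G" "z \<in> carrier G" for x y z
    using triangle[OF that] .
qed (use assms in \<open>auto simp: metric_group_def bi_invariant_def unit_diam_def\<close>)

lemma exists_nat_copy_of_finite_group:
  assumes "group H" "finite (carrier H)"
  obtains G :: "nat monoid" and f where "group G" "carrier G = f ` carrier H" "f \<in> hom H G" "f \<one>\<^bsub>H\<^esub> = \<one>\<^bsub>G\<^esub>"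
    "inj_on f (carrier H)"
proof -
  interpret H: group H by fact
  obtain f :: "_ \<Rightarrow> nat" where f: "inj_on f (carrier H)" using finite_imp_inj_to_nat_seg[OF assms(2)] by blast
  define i where "i = inv_into (carrier H) f"
  have i: "i (f x) = x" if "x \<in> carrier H" for x using f that by (simp add: i_def)
  define G :: "nat monoid" where "G = \<lparr>carrier = f ` carrier H, monoid.mult = (\<lambda>x y. f (i x \<otimes>\<^bsub>H\<^esub> i y)),
    monoid.one = f \<one>\<^bsub>H\<^esub>\<rparr>"
  have G: "carrier G = f ` carrier H" "\<one>\<^bsub>G\<^esub> = f \<one>\<^bsub>H\<^esub>" by (simp_all add: G_def)
  have Gm: "f x \<otimes>\<^bsub>G\<^esub> f y = f (x \<otimes>\<^bsub>H\<^esub> y)" if "x \<in> carrier H" "y \<in> carrier H" for x y using i that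
    by (simp add: G_def)
  have "group G"
  proof (rule groupI)
    fix x assume "x \<in> carrier G"
    then obtain a where a: "a \<in> carrier H" "x = f a" by (auto simp: G)
    show "\<exists>y\<in>carrier G. y \<otimes>\<^bsub>G\<^esub> x = \<one>\<^bsub>G\<^esub>" using a by (intro bexI[of _ "f (inv\<^bsub>H\<^esub> a)"]) (simp_all add: G Gm)
  qed (auto simp: G Gm H.m_assoc)
  moreover have "f \<in> hom H G" by (rule homI) (auto simp: G Gm)
  ultimately show ?thesis using that[of G f] f G by simp
qed

text \<open>The wreath products and direct products below have other carrier types, while the family
  only admits groups of naturals.\<close>

lemma exists_nat_copy_of_metric_group:
  assumes "metric_group H e"
  obtains G d f where "(G, d) \<in> finite_metric_groups" "f \<in> hom H G" "f \<one>\<^bsub>H\<^esub> = \<one>\<^bsub>G\<^esub>"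
    "\<And>x y. x \<in> carrier H \<Longrightarrow> y \<in> carrier H \<Longrightarrow> d (f x) (f y) = e x y"
proof -
  note H = metric_groupD[OF assms]
  interpret H: group H by (rule H(1))
  obtain G :: "nat monoid" and f where grp: "group G" and G: "carrier G = f ` carrier H"
    and fh: "f \<in> hom H G" "f \<one>\<^bsub>H\<^esub> = \<one>\<^bsub>G\<^esub>" and f: "inj_on f (carrier H)"
    by (rule exists_nat_copy_of_finite_group[OF H(1,2)])
  define i where "i = inv_into (carrier H) f"
  have i: "i (f x) = x" if "x \<in> carrier H" for x using f that by (simp add: i_def)
  define d where "d x y = e (i x) (i y)" for x y
  have Gm: "f x \<otimes>\<^bsub>G\<^esub> f y = f (x \<otimes>\<^bsub>H\<^esub> y)" if "x \<in> carrier H" "y \<in> carrier H" for x y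
    using hom_mult[OF fh(1) that] by simp
  obtain x0 y0 where "x0 \<in> carrier H" "y0 \<in> carrier H" "e x0 y0 = 1" using H(10) by blast
  then have "f x0 \<in> carrier G" "f y0 \<in> carrier G" "d (f x0) (f y0) = 1" by (simp_all add: G d_def i)
  have "metric_group G d"
  proof (rule metric_groupI[OF grp])
    show "finite (carrier G)" using H(2) by (simp add: G)
    show "f x0 \<in> carrier G" "f y0 \<in> carrier G" "d (f x0) (f y0) = 1" by fact+
    show "0 \<le> d x y" "d x y = d y x" for x y using H(3,4) by (auto simp: d_def)
    show "0 \<le> d x y \<and> d x y \<le> 1 \<and> d x y = d y x \<and> (d x y = 0 \<longleftrightarrow> x = y)" if "x \<in> carrier G" "y \<in> carrier G"
      for x y
      using that H(3-6) i by (auto simp: d_def G)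
    show "d x z \<le> d x y + d y z" if "x \<in> carrier G" "y \<in> carrier G" "z \<in> carrier G" for x y z
      using that H(7) i by (auto simp: d_def G)
    show "d (z \<otimes>\<^bsub>G\<^esub> x) (z \<otimes>\<^bsub>G\<^esub> y) = d x y \<and> d (x \<otimes>\<^bsub>G\<^esub> z) (y \<otimes>\<^bsub>G\<^esub> z) = d x y"
      if "x \<in> carrier G" "y \<in> carrier G" "z \<in> carrier G" for x y z
      using that H(8,9) i by (auto simp: d_def G Gm)
  qed
  then show ?thesis using that[of G d f] i fh by (simp add: finite_metric_groups_def d_def)
qed

section \<open>Wreath products, direct products and rescaling of finite metric groups\<close>

definition wreath_group :: "nat set \<Rightarrow> nat monoid \<Rightarrow> ((nat \<Rightarrow> nat) \<times> (nat \<Rightarrow> nat)) monoid" where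
  "wreath_group A G = \<lparr>carrier = (A \<rightarrow>\<^sub>E carrier G) \<times> Bij A,
     monoid.mult = (\<lambda>(u, \<sigma>) (v, \<tau>). (\<lambda>t\<in>A. u (\<tau> t) \<otimes>\<^bsub>G\<^esub> v t, compose A \<sigma> \<tau>)),
     monoid.one = (\<lambda>t\<in>A. \<one>\<^bsub>G\<^esub>, \<lambda>t\<in>A. t)\<rparr>"

text \<open>A point at which the permutations differ is charged with the diameter 1 of
  \<open>d\<close>; this preserves the triangle inequality and the diameter.\<close>

definition wreath_dist :: "nat set \<Rightarrow> (nat \<Rightarrow> nat \<Rightarrow> real) \<Rightarrow> (nat \<Rightarrow> nat) \<times> (nat \<Rightarrow> nat) \<Rightarrow> (nat \<Rightarrow> nat) \<times>
  (nat \<Rightarrow> nat) \<Rightarrow> real" where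
  "wreath_dist A d = (\<lambda>(u, \<sigma>) (v, \<tau>). (\<Sum>t\<in>A. if \<sigma> t = \<tau> t then d (u t) (v t) else 1) / real (card A))"

lemma finite_Bij:
  assumes "finite A" shows "finite (Bij A)"
proof (rule finite_subset)
  show "Bij A \<subseteq> A \<rightarrow>\<^sub>E A" by (rule subsetI) (simp add: PiE_def Bij_imp_funcset Bij_imp_extensional)
qed (use assms in \<open>simp add: finite_PiE\<close>)

lemma group_wreath_group:
  assumes "group G" shows "group (wreath_group A G)"
proof -
  interpret group G by fact
  show ?thesis
  proof (rule groupI)
    fix x assume "x \<in> carrier (wreath_group A G)"
    then obtain u \<sigma> where x: "x = (u, \<sigma>)" and u: "u \<in> A \<rightarrow>\<^sub>E carrier G" and \<sigma>: "\<sigma> \<in> Bij A"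
      by (auto simp: wreath_group_def)
    define \<sigma>' where "\<sigma>' = (\<lambda>x\<in>A. inv_into A \<sigma> x)"
    have b: "bij_betw \<sigma> A A" by (rule BijD[OF \<sigma>])
    have \<sigma>': "\<sigma>' \<in> Bij A" "compose A \<sigma>' \<sigma> = (\<lambda>t\<in>A. t)"
      unfolding \<sigma>'_def using restrict_inv_into_Bij[OF \<sigma>] Bij_compose_restrict_eq[OF \<sigma>] by simp_all
    have i: "\<sigma>' t \<in> A" if "t \<in> A" for t
      using Bij_imp_funcset[OF \<sigma>'(1)] that by (rule funcset_mem)
    have i': "\<sigma>' (\<sigma> t) = t" if "t \<in> A" for t
      using fun_cong[OF \<sigma>'(2), of t] that by (simp add: compose_eq)
    have \<sigma>A: "\<sigma> t \<in> A" if "t \<in> A" for t using Bij_imp_funcset[OF \<sigma>] that by blast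
    have uc: "u t \<in> carrier G" if "t \<in> A" for t using u that by auto
    let ?y = "(\<lambda>t\<in>A. inv\<^bsub>G\<^esub> (u (\<sigma>' t)), \<sigma>')"
    have "?y \<otimes>\<^bsub>wreath_group A G\<^esub> x = \<one>\<^bsub>wreath_group A G\<^esub>"
      using \<sigma>'(2) i i' \<sigma>A uc by (auto simp: x wreath_group_def fun_eq_iff)
    moreover have "?y \<in> carrier (wreath_group A G)" using \<sigma>'(1) i uc by (auto simp: wreath_group_def)
    ultimately show "\<exists>y\<in>carrier (wreath_group A G). y \<otimes>\<^bsub>wreath_group A G\<^esub> x = \<one>\<^bsub>wreath_group A G\<^esub>" by blast
  next
    fix x y z assume "x \<in> carrier (wreath_group A G)" "y \<in> carrier (wreath_group A G)"
      "z \<in> carrier (wreath_group A G)"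
    then obtain u \<sigma> v \<tau> w \<rho> where e: "x = (u, \<sigma>)" "y = (v, \<tau>)" "z = (w, \<rho>)"
      and m: "u \<in> A \<rightarrow>\<^sub>E carrier G" "v \<in> A \<rightarrow>\<^sub>E carrier G" "w \<in> A \<rightarrow>\<^sub>E carrier G" "\<sigma> \<in> Bij A" "\<tau> \<in> Bij A"
        "\<rho> \<in> Bij A"
      by (auto simp: wreath_group_def)
    have f: "\<tau> t \<in> A" "\<rho> t \<in> A" if "t \<in> A" for t using Bij_imp_funcset[OF m(5)] Bij_imp_funcset[OF m(6)] that
      by auto
    have "u t \<in> carrier G" "v t \<in> carrier G" "w t \<in> carrier G" if "t \<in> A" for t using m that by auto
    then show "x \<otimes>\<^bsub>wreath_group A G\<^esub> y \<otimes>\<^bsub>wreath_group A G\<^esub> z =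
      x \<otimes>\<^bsub>wreath_group A G\<^esub> (y \<otimes>\<^bsub>wreath_group A G\<^esub> z)"
      using f by (auto simp: e wreath_group_def fun_eq_iff compose_def m_assoc)
  next
    fix x y assume "x \<in> carrier (wreath_group A G)" "y \<in> carrier (wreath_group A G)"
    then show "x \<otimes>\<^bsub>wreath_group A G\<^esub> y \<in> carrier (wreath_group A G)"
      by (auto simp: wreath_group_def compose_Bij PiE_iff dest: Bij_imp_funcset[THEN funcset_mem])
  next
    fix x assume x: "x \<in> carrier (wreath_group A G)"
    obtain u \<sigma> where e: "x = (u, \<sigma>)" by (cases x)
    have u: "u \<in> A \<rightarrow>\<^sub>E carrier G" and \<sigma>: "\<sigma> \<in> Bij A" using x by (auto simp: wreath_group_def e)
    have "\<sigma> t \<in> A" if "t \<in> A" for t using Bij_imp_funcset[OF \<sigma>] that by (rule funcset_mem)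
    then have "(\<lambda>t\<in>A. (\<lambda>t\<in>A. \<one>\<^bsub>G\<^esub>) (\<sigma> t) \<otimes>\<^bsub>G\<^esub> u t) = u"
      using u by (intro ext) (auto simp: PiE_iff extensional_def)
    moreover have "compose A (\<lambda>t\<in>A. t) \<sigma> = \<sigma>"
      using Id_compose[OF Bij_imp_funcset[OF \<sigma>] Bij_imp_extensional[OF \<sigma>]] .
    ultimately show "\<one>\<^bsub>wreath_group A G\<^esub> \<otimes>\<^bsub>wreath_group A G\<^esub> x = x"
      by (simp add: wreath_group_def e)
  qed (auto simp: wreath_group_def id_Bij)
qed

lemma metric_group_wreath:
  assumes G: "metric_group G d" and A: "finite A" "A \<noteq> {}"
  shows "metric_group (wreath_group A G) (wreath_dist A d)"
proof -
  note D = metric_groupD[OF G]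
  interpret group G by (rule D(1))
  have cA: "real (card A) > 0" using A by (simp add: card_gt_0_iff)
  let ?H = "wreath_group A G"
  have grp: "group ?H" by (rule group_wreath_group[OF D(1)])
  have Hc: "carrier ?H = (A \<rightarrow>\<^sub>E carrier G) \<times> Bij A" by (simp add: wreath_group_def)
  obtain x0 y0 where xy0: "x0 \<in> carrier G" "y0 \<in> carrier G" "d x0 y0 = 1" using D(10) by blast
  define x1 where "x1 = (\<lambda>t\<in>A. x0, \<lambda>t\<in>A. t)"
  define y1 where "y1 = (\<lambda>t\<in>A. y0, \<lambda>t\<in>A. t)"
  show ?thesis
  proof (rule metric_groupI[OF grp])
    show "finite (carrier ?H)" unfolding Hc using A D(2) by (simp add: finite_PiE finite_Bij)
    show "x1 \<in> carrier ?H" "y1 \<in> carrier ?H" using xy0 by (auto simp: x1_def y1_def Hc id_Bij)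
    show "wreath_dist A d x1 y1 = 1" using xy0 cA by (simp add: x1_def y1_def wreath_dist_def)
    show n: "0 \<le> wreath_dist A d x y" for x y using D(3)
      by (cases x, cases y) (auto simp: wreath_dist_def intro!: divide_nonneg_nonneg sum_nonneg)
    show s: "wreath_dist A d x y = wreath_dist A d y x" for x y
      using D(4) by (cases x, cases y) (auto simp: wreath_dist_def intro!: arg_cong2[of _ _ _ _ "(/)"]
        sum.cong)
    show "0 \<le> wreath_dist A d x y \<and> wreath_dist A d x y \<le> 1 \<and> wreath_dist A d x y = wreath_dist A d y x \<and>
      (wreath_dist A d x y = 0 \<longleftrightarrow> x = y)"
      if "x \<in> carrier ?H" "y \<in> carrier ?H" for x y
    proof -
      obtain u \<sigma> v \<tau> where e: "x = (u, \<sigma>)" "y = (v, \<tau>)" by (cases x, cases y)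
      have m: "u \<in> A \<rightarrow>\<^sub>E carrier G" "v \<in> A \<rightarrow>\<^sub>E carrier G" "\<sigma> \<in> Bij A" "\<tau> \<in> Bij A" using that
        by (auto simp: Hc e)
      let ?f = "\<lambda>t. if \<sigma> t = \<tau> t then d (u t) (v t) else 1"
      have "(\<Sum>t\<in>A. ?f t) \<le> (\<Sum>t\<in>A. 1)" by (rule sum_mono) (use m D(5) in auto)
      then have "wreath_dist A d x y \<le> 1" using cA by (simp add: wreath_dist_def e pos_divide_le_eq)
      moreover have "wreath_dist A d x y = 0 \<longleftrightarrow> (\<forall>t\<in>A. ?f t = 0)"
        using cA sum_nonneg_eq_0_iff[OF A(1), of ?f] D(3) by (auto simp: wreath_dist_def e)
      moreover have "?f t = 0 \<longleftrightarrow> \<sigma> t = \<tau> t \<and> u t = v t" if "t \<in> A" for t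
        using D(6)[OF PiE_mem[OF m(1) that] PiE_mem[OF m(2) that]] by simp
      moreover have "(\<forall>t\<in>A. \<sigma> t = \<tau> t \<and> u t = v t) \<longleftrightarrow> x = y"
        using m unfolding e by (auto intro: PiE_ext Bij_ext)
      ultimately show ?thesis using n s by metis
    qed
    show "wreath_dist A d x z \<le> wreath_dist A d x y + wreath_dist A d y z"
      if "x \<in> carrier ?H" "y \<in> carrier ?H" "z \<in> carrier ?H" for x y z
    proof -
      obtain u \<sigma> v \<tau> w \<rho> where e: "x = (u, \<sigma>)" "y = (v, \<tau>)" "z = (w, \<rho>)" by (cases x, cases y, cases z)
      have m: "u \<in> A \<rightarrow>\<^sub>E carrier G" "v \<in> A \<rightarrow>\<^sub>E carrier G" "w \<in> A \<rightarrow>\<^sub>E carrier G" using that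
        by (auto simp: Hc e)
      have "(\<Sum>t\<in>A. if \<sigma> t = \<rho> t then d (u t) (w t) else 1) \<le>
        (\<Sum>t\<in>A. (if \<sigma> t = \<tau> t then d (u t) (v t) else 1) + (if \<tau> t = \<rho> t then d (v t) (w t) else 1))"
      proof (rule sum_mono)
        fix t assume "t \<in> A"
        then have "u t \<in> carrier G" "v t \<in> carrier G" "w t \<in> carrier G" using m by auto
        then show "(if \<sigma> t = \<rho> t then d (u t) (w t) else 1) \<le> (if \<sigma> t = \<tau> t then d (u t) (v t) else 1) +
          (if \<tau> t = \<rho> t then d (v t) (w t) else 1)"
          using D(7)[of "u t" "v t" "w t"] D(3)[of "u t" "v t"] D(3)[of "v t" "w t"] D(5)[of "u t" "w t"]
            by auto
      qed
      then show ?thesis using cA by (simp add: e wreath_dist_def sum.distrib divide_right_mono flip: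
        add_divide_distrib)
    qed
    show "wreath_dist A d (z \<otimes>\<^bsub>?H\<^esub> x) (z \<otimes>\<^bsub>?H\<^esub> y) = wreath_dist A d x y \<and>
      wreath_dist A d (x \<otimes>\<^bsub>?H\<^esub> z) (y \<otimes>\<^bsub>?H\<^esub> z) = wreath_dist A d x y"
      if "x \<in> carrier ?H" "y \<in> carrier ?H" "z \<in> carrier ?H" for x y z
    proof -
      obtain u \<sigma> v \<tau> w \<rho> where e: "x = (u, \<sigma>)" "y = (v, \<tau>)" "z = (w, \<rho>)" by (cases x, cases y, cases z)
      have m: "u \<in> A \<rightarrow>\<^sub>E carrier G" "v \<in> A \<rightarrow>\<^sub>E carrier G" "w \<in> A \<rightarrow>\<^sub>E carrier G" "\<sigma> \<in> Bij A" "\<tau> \<in> Bij A"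
        "\<rho> \<in> Bij A" using that by (auto simp: Hc e)
      have bA: "\<sigma> t \<in> A" "\<tau> t \<in> A" "\<rho> t \<in> A" if "t \<in> A" for t
        using that Bij_imp_funcset[OF m(4)] Bij_imp_funcset[OF m(5)] Bij_imp_funcset[OF m(6)] by auto
      have cG: "u t \<in> carrier G" "v t \<in> carrier G" "w t \<in> carrier G" if "t \<in> A" for t using m that by auto
      have inj: "\<rho> s = \<rho> t \<longleftrightarrow> s = t" if "s \<in> A" "t \<in> A" for s t
        using BijD[OF m(6)] that by (auto simp: bij_betw_def inj_on_def)
      have "(\<Sum>t\<in>A. if compose A \<rho> \<sigma> t = compose A \<rho> \<tau> t then d ((\<lambda>t\<in>A. w (\<sigma> t) \<otimes>\<^bsub>G\<^esub> u t) t)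
        ((\<lambda>t\<in>A. w (\<tau> t) \<otimes>\<^bsub>G\<^esub> v t) t) else 1)
          = (\<Sum>t\<in>A. if \<sigma> t = \<tau> t then d (u t) (v t) else 1)"
        by (rule sum.cong) (use inj bA cG D(8) in \<open>auto simp: compose_eq\<close>)
      then have 1: "wreath_dist A d (z \<otimes>\<^bsub>?H\<^esub> x) (z \<otimes>\<^bsub>?H\<^esub> y) = wreath_dist A d x y"
        by (simp add: e wreath_dist_def wreath_group_def)
      \<comment> \<open>Once \<open>w\<close> is cancelled by invariance of \<open>d\<close>, a
        right translation only reindexes the sum by \<open>\<rho>\<close>.\<close>
      have "(\<Sum>t\<in>A. if compose A \<sigma> \<rho> t = compose A \<tau> \<rho> t then d ((\<lambda>t\<in>A. u (\<rho> t) \<otimes>\<^bsub>G\<^esub> w t) t)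
        ((\<lambda>t\<in>A. v (\<rho> t) \<otimes>\<^bsub>G\<^esub> w t) t) else 1)
          = (\<Sum>t\<in>A. (\<lambda>s. if \<sigma> s = \<tau> s then d (u s) (v s) else 1) (\<rho> t))"
        by (rule sum.cong) (use bA cG D(9) in \<open>auto simp: compose_eq\<close>)
      also have "\<dots> = (\<Sum>t\<in>A. if \<sigma> t = \<tau> t then d (u t) (v t) else 1)"
        by (rule sum.reindex_bij_betw[OF BijD[OF m(6)]])
      finally have 2: "wreath_dist A d (x \<otimes>\<^bsub>?H\<^esub> z) (y \<otimes>\<^bsub>?H\<^esub> z) = wreath_dist A d x y"
        by (simp add: e wreath_dist_def wreath_group_def)
      show ?thesis using 1 2 by blast
    qed
  qed
qed

lemma wreath_closed_weak: "wreath_closed finite_metric_groups"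
  unfolding wreath_closed_def
proof (intro allI impI)
  fix G d and A :: "nat set" assume "(G, d) \<in> finite_metric_groups" and A: "finite A" "A \<noteq> {}"
  then have G: "metric_group G d" by (simp add: finite_metric_groups_def)
  note D = metric_groupD[OF G]
  interpret group G by (rule D(1))
  let ?W = "wreath_group A G"
  obtain H e f where H: "(H, e) \<in> finite_metric_groups" and f: "f \<in> hom ?W H" "f \<one>\<^bsub>?W\<^esub> = \<one>\<^bsub>H\<^esub>"
    "\<And>x y. x \<in> carrier ?W \<Longrightarrow> y \<in> carrier ?W \<Longrightarrow> e (f x) (f y) = wreath_dist A d x y"
    by (rule exists_nat_copy_of_metric_group[OF metric_group_wreath[OF G A]]) blast
  have cA: "real (card A) > 0" using A by (simp add: card_gt_0_iff)
  define W where "W u \<sigma> = f (restrict u A, \<sigma>)" for u \<sigma>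
  have mem: "(restrict u A, \<sigma>) \<in> carrier ?W" if "u \<in> A \<rightarrow> carrier G" "\<sigma> \<in> Bij A" for u \<sigma>
    using that by (auto simp: wreath_group_def)
  have one: "\<one>\<^bsub>?W\<^esub> = (restrict (\<lambda>_. \<one>\<^bsub>G\<^esub>) A, \<lambda>x\<in>A. x)" by (simp add: wreath_group_def)
  have "wreath_map G d A H e W"
    unfolding wreath_map_def
  proof (intro conjI allI impI)
    show "W u \<sigma> \<in> carrier H" if "u \<in> A \<rightarrow> carrier G" "\<sigma> \<in> Bij A" for u \<sigma>
      unfolding W_def using hom_in_carrier[OF f(1) mem[OF that]] .
    show "W (\<lambda>_. \<one>\<^bsub>G\<^esub>) (\<lambda>x\<in>A. x) = \<one>\<^bsub>H\<^esub>" unfolding W_def using f(2) one by simp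
    show "W u \<sigma> = W v \<sigma>" if "\<forall>t\<in>A. u t = v t" for u v \<sigma>
    proof -
      have "restrict u A = restrict v A" using that by (auto intro: restrict_ext)
      then show ?thesis by (simp add: W_def)
    qed
    show "W u \<sigma> \<otimes>\<^bsub>H\<^esub> W v \<tau> = W (\<lambda>t. u (\<tau> t) \<otimes>\<^bsub>G\<^esub> v t) (compose A \<sigma> \<tau>)"
      if "u \<in> A \<rightarrow> carrier G" "v \<in> A \<rightarrow> carrier G" "\<sigma> \<in> Bij A" "\<tau> \<in> Bij A" for u \<sigma> v \<tau>
    proof -
      have "\<tau> t \<in> A" if "t \<in> A" for t using Bij_imp_funcset[OF \<open>\<tau> \<in> Bij A\<close>] that by blast
      then have "(restrict u A, \<sigma>) \<otimes>\<^bsub>?W\<^esub> (restrict v A, \<tau>) = (restrict (\<lambda>t. u (\<tau> t) \<otimes>\<^bsub>G\<^esub> v t) A,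
        compose A \<sigma> \<tau>)"
        by (auto simp: wreath_group_def fun_eq_iff)
      then show ?thesis unfolding W_def using hom_mult[OF f(1) mem[OF that(1,3)] mem[OF that(2,4)]] by simp
    qed
    show "e (W u \<sigma>) (W v \<tau>) \<le> 3 * sqrt \<epsilon>"
      if u: "u \<in> A \<rightarrow> carrier G" "v \<in> A \<rightarrow> carrier G" "\<sigma> \<in> Bij A" "\<tau> \<in> Bij A" and e: "0 < \<epsilon>" "\<epsilon> \<le> 1"
        and T: "T \<subseteq> A" "(1 - \<epsilon>) * real (card A) \<le> real (card T)" and g: "\<forall>t\<in>T. \<sigma> t = \<tau> t \<and> d (u t) (v t) < \<epsilon>"
          for u \<sigma> v \<tau> T \<epsilon>
    proof -
      let ?f = "\<lambda>t. if \<sigma> t = \<tau> t then d (u t) (v t) else 1"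
      have dist: "e (W u \<sigma>) (W v \<tau>) = (\<Sum>t\<in>A. ?f t) / real (card A)"
        unfolding W_def f(3)[OF mem[OF u(1,3)] mem[OF u(2,4)]]
          by (auto simp: wreath_dist_def intro!: arg_cong2[of _ _ _ _ "(/)"] sum.cong)
      have "(\<Sum>t\<in>A. ?f t) = (\<Sum>t\<in>T. ?f t) + (\<Sum>t\<in>A - T. ?f t)" using sum.subset_diff[OF T(1) A(1), of ?f] by simp
      also have "\<dots> \<le> (\<Sum>t\<in>T. \<epsilon>) + (\<Sum>t\<in>A - T. 1)"
        by (intro add_mono sum_mono) (use g u D(5) in \<open>auto simp: Pi_def less_imp_le\<close>)
      also have "\<dots> \<le> real (card A) * \<epsilon> + (real (card A) - real (card T))"
        using card_mono[OF A(1) T(1)] e card_Diff_subset[OF finite_subset[OF T(1) A(1)] T(1)]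
          by (simp add: mult_right_mono of_nat_diff)
      also have "\<dots> \<le> 2 * \<epsilon> * real (card A)" using T(2) by (simp add: algebra_simps)
      finally have "e (W u \<sigma>) (W v \<tau>) \<le> 2 * \<epsilon>" unfolding dist using cA by (simp add: pos_divide_le_eq)
      then show ?thesis using double_le_three_sqrt[OF e] by linarith
    qed
    show "c / 2 \<le> e (W u (\<lambda>x\<in>A. x)) \<one>\<^bsub>H\<^esub>"
      if u: "u \<in> A \<rightarrow> carrier G" and T: "T \<subseteq> A" "card A \<le> 2 * card T" and c: "0 < c" "\<forall>t\<in>T. c \<le> d (u t) \<one>\<^bsub>G\<^esub>"
        for u T c
    proof -
      have o: "(\<lambda>_. \<one>\<^bsub>G\<^esub>) \<in> A \<rightarrow> carrier G" by simp
      have dist: "e (W u (\<lambda>x\<in>A. x)) \<one>\<^bsub>H\<^esub> = (\<Sum>t\<in>A. d (u t) \<one>\<^bsub>G\<^esub>) / real (card A)"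
        unfolding W_def f(2)[symmetric] one f(3)[OF mem[OF u id_Bij] mem[OF o id_Bij]]
          by (auto simp: wreath_dist_def intro!: arg_cong2[of _ _ _ _ "(/)"] sum.cong)
      have "c / 2 * real (card A) \<le> c / 2 * (2 * real (card T))" using T c by (intro mult_left_mono) auto
      also have "\<dots> = (\<Sum>t\<in>T. c)" by simp
      also have "\<dots> \<le> (\<Sum>t\<in>T. d (u t) \<one>\<^bsub>G\<^esub>)" by (rule sum_mono) (use c in auto)
      also have "\<dots> \<le> (\<Sum>t\<in>A. d (u t) \<one>\<^bsub>G\<^esub>)" by (rule sum_mono2[OF A(1) T(1)]) (rule D(3))
      finally show ?thesis unfolding dist using cA by (simp add: pos_le_divide_eq)
    qed
  qed
  then show "\<exists>H e W. (H, e) \<in> finite_metric_groups \<and> wreath_map G d A H e W" using H by blast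
qed

text \<open>The average, unlike the sum, keeps the diameter at 1.\<close>

lemma metric_group_product:
  assumes G: "metric_group G d" and H: "metric_group H e"
  shows "metric_group (G \<times>\<times> H) (\<lambda>(x, y) (x', y'). (d x x' + e y y') / 2)"
proof -
  note D = metric_groupD[OF G] and E = metric_groupD[OF H]
  obtain x0 x1 y0 y1 where "x0 \<in> carrier G" "x1 \<in> carrier G" "d x0 x1 = 1" "y0 \<in> carrier H" "y1 \<in> carrier H"
    "e y0 y1 = 1"
    using D(10) E(10) by blast
  then show ?thesis
  proof (intro metric_groupI[where ?x0.0 = "(x0, y0)" and ?y0.0 = "(x1, y1)"] DirProd_group D(1) E(1))
    fix x y assume xy: "x \<in> carrier (G \<times>\<times> H)" "y \<in> carrier (G \<times>\<times> H)"
    obtain a b a' b' where e: "x = (a, b)" "y = (a', b')" by (cases x, cases y)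
    have m: "a \<in> carrier G" "a' \<in> carrier G" "b \<in> carrier H" "b' \<in> carrier H" using xy by (auto simp: e)
    show "0 \<le> (case x of (x, y) \<Rightarrow> \<lambda>(x', y'). (d x x' + e y y') / 2) y \<and>
      (case x of (x, y) \<Rightarrow> \<lambda>(x', y'). (d x x' + e y y') / 2) y \<le> 1 \<and>
      (case x of (x, y) \<Rightarrow> \<lambda>(x', y'). (d x x' + e y y') / 2) y = (case y of (x, y) \<Rightarrow> \<lambda>(x', y').
        (d x x' + e y y') / 2) x \<and>
      ((case x of (x, y) \<Rightarrow> \<lambda>(x', y'). (d x x' + e y y') / 2) y = 0 \<longleftrightarrow> x = y)"
      using D(3)[of a a'] E(3)[of b b'] D(4)[of a a'] E(4)[of b b'] D(5)[OF m(1,2)] E(5)[OF m(3,4)]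
        D(6)[OF m(1,2)] E(6)[OF m(3,4)]
      by (auto simp: e)
  next
    fix x y z assume "x \<in> carrier (G \<times>\<times> H)" "y \<in> carrier (G \<times>\<times> H)" "z \<in> carrier (G \<times>\<times> H)"
    moreover obtain a b a' b' a'' b'' where e: "x = (a, b)" "y = (a', b')" "z = (a'', b'')"
      by (cases x, cases y, cases z)
    ultimately have m: "a \<in> carrier G" "a' \<in> carrier G" "a'' \<in> carrier G" "b \<in> carrier H" "b' \<in> carrier H"
      "b'' \<in> carrier H" by auto
    show "(case x of (x, y) \<Rightarrow> \<lambda>(x', y'). (d x x' + e y y') / 2) z \<le>
      (case x of (x, y) \<Rightarrow> \<lambda>(x', y'). (d x x' + e y y') / 2) y + (case y of (x, y) \<Rightarrow> \<lambda>(x', y').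
      (d x x' + e y y') / 2) z"
      using D(7)[OF m(1-3)] E(7)[OF m(4-6)] by (simp add: e field_simps)
    show "(case z \<otimes>\<^bsub>G \<times>\<times> H\<^esub> x of (x, y) \<Rightarrow> \<lambda>(x', y'). (d x x' + e y y') / 2) (z \<otimes>\<^bsub>G \<times>\<times> H\<^esub> y) =
      (case x of (x, y) \<Rightarrow> \<lambda>(x', y'). (d x x' + e y y') / 2) y \<and>
      (case x \<otimes>\<^bsub>G \<times>\<times> H\<^esub> z of (x, y) \<Rightarrow> \<lambda>(x', y'). (d x x' + e y y') / 2) (y \<otimes>\<^bsub>G \<times>\<times> H\<^esub> z) =
        (case x of (x, y) \<Rightarrow> \<lambda>(x', y'). (d x x' + e y y') / 2) y"
      using D(8,9)[OF m(1-3)] E(8,9)[OF m(4-6)] by (simp add: e)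
  qed (use D(2-4) E(2-4) in \<open>auto split: prod.splits\<close>)
qed

lemma sum_closed_weak: "sum_closed finite_metric_groups"
  unfolding sum_closed_def
proof (intro allI impI)
  fix \<eta> :: real assume \<eta>: "\<eta> > 0"
  show "\<exists>\<delta>>0. \<forall>G d H e. (G, d) \<in> finite_metric_groups \<longrightarrow> (H, e) \<in> finite_metric_groups \<longrightarrow>
    (\<exists>K k J. (K, k) \<in> finite_metric_groups \<and> sum_map \<delta> \<eta> G d H e K k J)"
  proof (intro exI[of _ \<eta>] conjI \<eta> allI impI)
    fix G d H e assume "(G, d) \<in> finite_metric_groups" "(H, e) \<in> finite_metric_groups"
    then have G: "metric_group G d" and H: "metric_group H e" by (auto simp: finite_metric_groups_def)
    note D = metric_groupD[OF G] and E = metric_groupD[OF H]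
    interpret G: group G by (rule D(1))
    interpret H: group H by (rule E(1))
    obtain K k f where K: "(K, k) \<in> finite_metric_groups" and f: "f \<in> hom (G \<times>\<times> H) K" "f \<one>\<^bsub>G \<times>\<times> H\<^esub> = \<one>\<^bsub>K\<^esub>"
      "\<And>x y. x \<in> carrier (G \<times>\<times> H) \<Longrightarrow> y \<in> carrier (G \<times>\<times> H) \<Longrightarrow> k (f x) (f y) =
        (case x of (x, y) \<Rightarrow> \<lambda>(x', y'). (d x x' + e y y') / 2) y"
      by (rule exists_nat_copy_of_metric_group[OF metric_group_product[OF G H]]) blast
    have "sum_map \<eta> \<eta> G d H e K k (\<lambda>x y. f (x, y))"
      unfolding sum_map_def
    proof (intro conjI ballI allI impI)
      fix x y assume xy: "x \<in> carrier G" "y \<in> carrier H"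
      show "f (x, y) \<in> carrier K" using hom_in_carrier[OF f(1)] xy by simp
      show "c / 4 \<le> k (f (x, y)) \<one>\<^bsub>K\<^esub>" if "0 < c" "c \<le> d x \<one>\<^bsub>G\<^esub> \<or> c \<le> e y \<one>\<^bsub>H\<^esub>" for c
        using that xy f(3)[of "(x, y)" "\<one>\<^bsub>G \<times>\<times> H\<^esub>"] D(3)[of x "\<one>\<^bsub>G\<^esub>"] E(3)[of y "\<one>\<^bsub>H\<^esub>"] unfolding f(2) by auto
      fix x' y' assume xy': "x' \<in> carrier G" "y' \<in> carrier H"
      show "f (x, y) \<otimes>\<^bsub>K\<^esub> f (x', y') = f (x \<otimes>\<^bsub>G\<^esub> x', y \<otimes>\<^bsub>H\<^esub> y')"
        using hom_mult[OF f(1), of "(x, y)" "(x', y')"] xy xy' by simp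
      show "k (f (x, y)) (f (x', y')) < \<eta>" if "d x x' < \<eta>" "e y y' < \<eta>"
        using f(3)[of "(x, y)" "(x', y')"] xy xy' that by simp
    qed (use f(2) in simp)
    then show "\<exists>K k J. (K, k) \<in> finite_metric_groups \<and> sum_map \<eta> \<eta> G d H e K k J" using K by blast
  qed
qed

text \<open>No amplification is necessary, because the family admits all bi-invariant metrics of
  diameter one: truncating \<open>d / c\<close> moves everything beyond \<open>c\<close> to distance
  1. The precision is scaled by \<open>c\<close> to compensate.\<close>

lemma approximable_at_half_weak:
  assumes Q: "\<And>F. finite F \<Longrightarrow> F \<subseteq> carrier \<Gamma> \<Longrightarrow> \<exists>c>0. approximable_on F c finite_metric_groups \<Gamma>"
  shows "approximable_at (1/2) finite_metric_groups \<Gamma>"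
  unfolding approximable_at_def
proof (intro allI impI approximable_onI)
  fix F and \<epsilon> :: real assume F: "finite F" "F \<subseteq> carrier \<Gamma>" and \<epsilon>: "\<epsilon> > 0"
  obtain c where c: "c > 0" and Qc: "approximable_on F c finite_metric_groups \<Gamma>" using Q[OF F] by blast
  show "\<exists>G d \<phi>. (G, d) \<in> finite_metric_groups \<and> \<phi> \<in> carrier \<Gamma> \<rightarrow> carrier G \<and> unital \<Gamma> G \<phi> \<and>
        multiplicative \<Gamma> G d F \<epsilon> \<phi> \<and> separating \<Gamma> G d F (1/2) \<phi>"
  \<comment> \<open>The truncated metric must attain the value 1, and a nontrivial element of
    \<open>F\<close> is the witness. Without one, separation is vacuous and the given metric is
    kept.\<close>
  proof (cases "F \<subseteq> {\<one>\<^bsub>\<Gamma>\<^esub>}")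
    case True
    obtain G d \<phi> where "(G, d) \<in> finite_metric_groups" "\<phi> \<in> carrier \<Gamma> \<rightarrow> carrier G" "unital \<Gamma> G \<phi>"
        "multiplicative \<Gamma> G d F \<epsilon> \<phi>" "separating \<Gamma> G d F c \<phi>" using approximable_onE[OF Qc \<epsilon>] .
    moreover have "separating \<Gamma> G d F (1/2) \<phi>" using True by (auto simp: separating_def)
    ultimately show ?thesis by blast
  next
    case False
    then obtain g0 where g0: "g0 \<in> F" "g0 \<noteq> \<one>\<^bsub>\<Gamma>\<^esub>" by blast
    have "\<epsilon> * c > 0" using \<epsilon> c by simp
    then obtain G d \<phi> where G: "(G, d) \<in> finite_metric_groups"
      and \<phi>: "\<phi> \<in> carrier \<Gamma> \<rightarrow> carrier G" "unital \<Gamma> G \<phi>"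
        "multiplicative \<Gamma> G d F (\<epsilon> * c) \<phi>" "separating \<Gamma> G d F c \<phi>" using approximable_onE[OF Qc] by metis
    have Gm: "metric_group G d" using G by (simp add: finite_metric_groups_def)
    note D = metric_groupD[OF Gm]
    interpret G: group G by (rule D(1))
    define d' where "d' x y = min 1 (d x y / c)" for x y
    have sep: "d' (\<phi> g) \<one>\<^bsub>G\<^esub> = 1" if "g \<in> F" "g \<noteq> \<one>\<^bsub>\<Gamma>\<^esub>" for g
    proof -
      have "c < d (\<phi> g) \<one>\<^bsub>G\<^esub>" using \<phi>(4) that by (simp add: separating_def)
      then have "1 \<le> d (\<phi> g) \<one>\<^bsub>G\<^esub> / c" using c by simp
      then show ?thesis by (simp add: d'_def)
    qed
    have "metric_group G d'"
    proof (rule metric_groupI[OF D(1,2)])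
      show "\<phi> g0 \<in> carrier G" using \<phi>(1) F g0 by blast
      show "d' (\<phi> g0) \<one>\<^bsub>G\<^esub> = 1" by (rule sep[OF g0])
      show "0 \<le> d' x y" "d' x y = d' y x" for x y using D(3,4) c by (auto simp: d'_def)
      show "0 \<le> d' x y \<and> d' x y \<le> 1 \<and> d' x y = d' y x \<and> (d' x y = 0 \<longleftrightarrow> x = y)"
        if "x \<in> carrier G" "y \<in> carrier G" for x y
        using D(3)[of x y] D(4)[of x y] D(6)[OF that] c by (auto simp: d'_def min_def)
      show "d' x z \<le> d' x y + d' y z" if "x \<in> carrier G" "y \<in> carrier G" "z \<in> carrier G" for x y z
      proof -
        have "d x z / c \<le> d x y / c + d y z / c" using D(7)[OF that] c
          by (simp add: divide_right_mono flip: add_divide_distrib)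
        moreover have "0 \<le> d x y / c" "0 \<le> d y z / c" using D(3) c by auto
        ultimately show ?thesis unfolding d'_def by linarith
      qed
      show "d' (z \<otimes>\<^bsub>G\<^esub> x) (z \<otimes>\<^bsub>G\<^esub> y) = d' x y \<and> d' (x \<otimes>\<^bsub>G\<^esub> z) (y \<otimes>\<^bsub>G\<^esub> z) = d' x y"
        if "x \<in> carrier G" "y \<in> carrier G" "z \<in> carrier G" for x y z
        using D(8,9)[OF that] by (simp add: d'_def)
    qed simp
    then have "(G, d') \<in> finite_metric_groups" by (simp add: finite_metric_groups_def)
    moreover have "multiplicative \<Gamma> G d' F \<epsilon> \<phi>"
      unfolding multiplicative_def
    proof (intro ballI impI)
      fix g h assume "g \<in> F" "h \<in> F" "g \<otimes>\<^bsub>\<Gamma>\<^esub> h \<in> F"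
      then have "d (\<phi> (g \<otimes>\<^bsub>\<Gamma>\<^esub> h)) (\<phi> g \<otimes>\<^bsub>G\<^esub> \<phi> h) < \<epsilon> * c" using \<phi>(3) by (simp add: multiplicative_def)
      then have "d (\<phi> (g \<otimes>\<^bsub>\<Gamma>\<^esub> h)) (\<phi> g \<otimes>\<^bsub>G\<^esub> \<phi> h) / c < \<epsilon>" using c by (simp add: pos_divide_less_eq)
      then show "d' (\<phi> (g \<otimes>\<^bsub>\<Gamma>\<^esub> h)) (\<phi> g \<otimes>\<^bsub>G\<^esub> \<phi> h) < \<epsilon>" unfolding d'_def by linarith
    qed
    moreover have "separating \<Gamma> G d' F (1/2) \<phi>" using sep by (simp add: separating_def)
    ultimately show ?thesis using \<phi>(1,2) by blast
  qed
qed

text \<open>The discrete metric has diameter one only if there are two elements; the factor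
  \<open>Sym(2)\<close> provides them even for trivial \<open>Q\<close>.\<close>

lemma contains_finite_groups_weak: "contains_finite_groups finite_metric_groups"
  unfolding contains_finite_groups_def
proof (intro allI impI)
  fix Q :: "nat monoid" assume Q: "group Q" "finite (carrier Q)"
  interpret group Q by fact
  let ?S = "BijGroup {..<2::nat}"
  let ?s = "\<lambda>x\<in>{..<2::nat}. 1 - x" and ?i = "\<lambda>x\<in>{..<2::nat}. x"
  have s: "?s \<in> Bij {..<2}"
    by (simp add: Bij_def, rule bij_betw_byWitness[where f' = "\<lambda>x. 1 - x"]) (auto simp: less_2_cases_iff)
  have "?s 0 \<noteq> ?i 0" by simp
  then have si: "?s \<noteq> ?i" by metis
  have fB: "finite (Bij {..<2::nat})" by (rule finite_Bij) simp
  let ?H = "Q \<times>\<times> ?S" and ?d = "\<lambda>x y. if x = y then 0 else 1 :: real"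
  have gH: "group ?H" by (intro DirProd_group Q group_BijGroup)
  interpret H: group ?H by (rule gH)
  have "metric_group ?H ?d"
    by (rule metric_groupI[OF gH, where ?x0.0 = "(\<one>\<^bsub>Q\<^esub>, ?s)" and ?y0.0 = "(\<one>\<^bsub>Q\<^esub>, ?i)"])
      (use Q fB s si id_Bij[of "{..<2::nat}"] in \<open>simp_all add: H.right_cancel\<close>)
  then obtain G d f where G: "(G, d) \<in> finite_metric_groups" and f: "f \<in> hom ?H G" "f \<one>\<^bsub>?H\<^esub> = \<one>\<^bsub>G\<^esub>"
    "\<And>x y. x \<in> carrier ?H \<Longrightarrow> y \<in> carrier ?H \<Longrightarrow> d (f x) (f y) = ?d x y"
    by (rule exists_nat_copy_of_metric_group) blast
  have m: "(x, \<one>\<^bsub>?S\<^esub>) \<in> carrier ?H" if "x \<in> carrier Q" for x using that id_Bij[of "{..<2::nat}"] by simp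
  have oo: "\<one>\<^bsub>?S\<^esub> \<otimes>\<^bsub>?S\<^esub> \<one>\<^bsub>?S\<^esub> = \<one>\<^bsub>?S\<^esub>" using monoid.l_one[OF group.is_monoid[OF group_BijGroup]]
    monoid.one_closed[OF group.is_monoid[OF group_BijGroup]] by metis
  let ?j = "\<lambda>x. f (x, \<one>\<^bsub>?S\<^esub>)"
  have "?j \<in> hom Q G"
  proof (rule homI)
    show "?j x \<in> carrier G" if "x \<in> carrier Q" for x using hom_in_carrier[OF f(1) m[OF that]] .
    show "?j (x \<otimes>\<^bsub>Q\<^esub> y) = ?j x \<otimes>\<^bsub>G\<^esub> ?j y" if "x \<in> carrier Q" "y \<in> carrier Q" for x y
      using hom_mult[OF f(1) m[OF that(1)] m[OF that(2)]] oo by (simp del: BijGroup_simps)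
  qed
  moreover have "?j \<one>\<^bsub>Q\<^esub> = \<one>\<^bsub>G\<^esub>" using f(2) by simp
  moreover have "d (?j x) (?j x) = 0" if "x \<in> carrier Q" for x using f(3)[OF m[OF that] m[OF that]] by simp
  moreover have "0 < d (?j x) \<one>\<^bsub>G\<^esub>" if x: "x \<in> carrier Q" "x \<noteq> \<one>\<^bsub>Q\<^esub>" for x
    using f(3)[OF m[OF x(1)] H.one_closed] x unfolding f(2) by (simp del: BijGroup_simps)
  ultimately show "\<exists>G d j. (G, d) \<in> finite_metric_groups \<and> j \<in> hom Q G \<and> j \<one>\<^bsub>Q\<^esub> = \<one>\<^bsub>G\<^esub> \<and>
    (\<forall>x\<in>carrier Q. d (j x) (j x) = 0) \<and>
      (\<forall>x\<in>carrier Q. x \<noteq> \<one>\<^bsub>Q\<^esub> \<longrightarrow> 0 < d (j x) \<one>\<^bsub>G\<^esub>)" using G by blast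
qed

section \<open>Automorphisms of free modules over integral domains\<close>

text \<open>The increments carry the coefficients of the final vector \<open>u\<close> itself, so
  \<open>P\<close> can exploit what is known about them, such as membership in a subring.\<close>

lemma (in cring) finite_fm_induct:
  assumes "finite Z" "u \<in> fm Z" "P (\<lambda>x. \<zero>)"
    and "\<And>v w. v \<in> fm Z \<Longrightarrow> w \<in> Z \<Longrightarrow> P v \<Longrightarrow> P (\<lambda>x. v x \<oplus> u w \<otimes> basis_vec R w x)"
  shows "P u"
proof -
  have "P (\<lambda>x. if x \<in> T then u x else \<zero>)" if "finite T" "T \<subseteq> Z" for T
    using that
  proof (induction T rule: finite_induct)
    case (insert w T)
    have c: "u x \<in> carrier R" for x using fm_closed[OF assms(2)] .
    have "(\<lambda>x. if x \<in> T then u x else \<zero>) \<in> fm Z"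
      using assms(1) insert.prems c by (auto simp: fm_finite)
    then have "P (\<lambda>x. (if x \<in> T then u x else \<zero>) \<oplus> u w \<otimes> basis_vec R w x)" using insert
      by (intro assms(4)) auto
    moreover have "(\<lambda>x. (if x \<in> T then u x else \<zero>) \<oplus> u w \<otimes> basis_vec R w x) =
      (\<lambda>x. if x \<in> insert w T then u x else \<zero>)"
      using insert.hyps c by (auto simp: fun_eq_iff basis_vec_def)
    ultimately show ?case by simp
  qed (use assms(3) in simp)
  from this[OF assms(1)] have "P (\<lambda>x. if x \<in> Z then u x else \<zero>)" by simp
  moreover have "(\<lambda>x. if x \<in> Z then u x else \<zero>) = u" using fm_outside[OF assms(2)] by (auto simp: fun_eq_iff)
  ultimately show ?thesis by simp
qed

lemma (in cring) Aut_add_smult_basis_vec: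
  assumes "A \<in> carrier (Aut Z)" "v \<in> fm Z" "w \<in> Z" "r \<in> carrier R"
  shows "A (\<lambda>x. v x \<oplus> r \<otimes> basis_vec R w x) = (\<lambda>x. A v x \<oplus> r \<otimes> A (basis_vec R w) x)"
  using Aut_add[OF assms(1,2) fm_smult[OF assms(4) basis_vec_fm[OF assms(3)]]]
    Aut_smult[OF assms(1,4) basis_vec_fm[OF assms(3)]] by simp

context domain begin

text \<open>The product of the elements. A homomorphism to a nonzero ring that takes a common
  multiple to a unit sends no element of \<open>E\<close> to zero.\<close>

lemma common_multiple_in_subring:
  assumes "finite E" and D: "subring D R" and "E \<subseteq> D - {\<zero>}"
  obtains a where "a \<in> D" "a \<noteq> \<zero>" "\<And>x. x \<in> E \<Longrightarrow> \<exists>b\<in>D. a = x \<otimes> b"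
  using assms(1,3)
proof (induction E arbitrary: thesis rule: finite_induct)
  case empty
  show ?case using empty(1)[of \<one>] subringE(3)[OF D] by simp
next
  case (insert y E)
  obtain a where a: "a \<in> D" "a \<noteq> \<zero>" "\<And>x. x \<in> E \<Longrightarrow> \<exists>b\<in>D. a = x \<otimes> b" using insert.IH insert.prems(2) by blast
  have y: "y \<in> D" "y \<noteq> \<zero>" using insert.prems by auto
  have c: "x \<in> carrier R" if "x \<in> D" for x using that subringE(1)[OF D] by blast
  show ?case
  proof (rule insert.prems(1))
    show "a \<otimes> y \<in> D" using subringE(6)[OF D] a y by blast
    show "a \<otimes> y \<noteq> \<zero>" using a y c integral by blast
    fix x assume "x \<in> insert y E"
    then consider "x = y" | "x \<in> E" by blast
    then show "\<exists>b\<in>D. a \<otimes> y = x \<otimes> b"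
    proof cases
      case 1
      then show ?thesis using a(1) c[OF a(1)] c[OF y(1)] m_comm by metis
    next
      case 2
      then obtain b where b: "b \<in> D" "a = x \<otimes> b" using a(3) by blast
      have x: "x \<in> D" using 2 insert.prems by auto
      have "a \<otimes> y = x \<otimes> (b \<otimes> y)" using b c[OF b(1)] c[OF x] c[OF y(1)] by (simp add: m_assoc)
      then show ?thesis using subringE(6)[OF D b(1) y(1)] by blast
    qed
  qed
qed

text \<open>Let \<open>D\<close> be a subring containing all entries of the matrices in \<open>F\<close> and of their inverses. A homomorphism
  \<open>f\<close> from \<open>D\<close> to a finite ring \<open>k\<close> turns these matrices into permutations of a finite set \<open>T\<close> of
  functions with values in \<open>k\<close>, and they remain nontrivial if \<open>f\<close> does not vanish on a nonzero entry of
  each \<open>A - 1\<close>. Working with \<open>T\<close> avoids matrix products over \<open>k\<close>.\<close>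

lemma locally_embeddable_Aut:
  fixes Z :: "nat set"
  assumes Z: "finite Z"
  shows "locally_embeddable_into_finite (Aut Z)"
  unfolding locally_embeddable_into_finite_def
proof (intro allI impI)
  fix F assume F: "finite F" "F \<subseteq> carrier (Aut Z)"
  interpret G: group "Aut Z" by (rule group_Aut)
  let ?e = "basis_vec R"
  \<comment> \<open>With the inverses included, the elements of \<open>F\<close> will permute the
    vectors with entries in \<open>D\<close>.\<close>
  define F' where "F' = F \<union> (\<lambda>A. inv\<^bsub>Aut Z\<^esub> A) ` F"
  have F': "finite F'" "F' \<subseteq> carrier (Aut Z)" using F by (auto simp: F'_def)
  define S where "S = (\<lambda>(A, w, z). A (?e w) z) ` (F' \<times> Z \<times> Z)"
  have "finite S" using F' Z by (simp add: S_def)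
  moreover have "S \<subseteq> carrier R"
  proof
    fix s assume "s \<in> S"
    then obtain A w z where s: "A \<in> F'" "w \<in> Z" "s = A (?e w) z" by (auto simp: S_def)
    show "s \<in> carrier R" unfolding s(3) by
      (rule fm_closed[OF Aut_fm[OF subsetD[OF F'(2) s(1)] basis_vec_fm[OF s(2)]]])
  qed
  ultimately obtain D where D: "subring D R" "S \<subseteq> D" and sep: "\<And>a. a \<in> D \<Longrightarrow> a \<noteq> \<zero> \<Longrightarrow>
    unit_to_finite (R\<lparr>carrier := D\<rparr>) a"
    using exists_unit_to_finite_subring by metis
  note Dc = subsetD[OF subringE(1)[OF D(1)]] and D01 = subringE(2,3)[OF D(1)] and Dop = subringE(5-7)[OF D(1)]
  have eD: "?e w z \<in> D" for w z using D01 by (simp add: basis_vec_def)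
  have sepA: "\<exists>w\<in>Z. \<exists>z\<in>Z. A (?e w) z \<noteq> ?e w z" if "A \<in> F" "A \<noteq> \<one>\<^bsub>Aut Z\<^esub>" for A
  proof (rule ccontr)
    assume *: "\<not> ?thesis"
    have A: "A \<in> carrier (Aut Z)" using that F by blast
    have "A (?e w) = ?e w" if "w \<in> Z" for w
    proof
      fix z show "A (?e w) z = ?e w z"
        using * that fm_outside[OF Aut_fm[OF A basis_vec_fm[OF that]], of z]
          fm_outside[OF basis_vec_fm[OF that], of z] by (cases "z \<in> Z") auto
    qed
    then have "A f = f" if "f \<in> fm Z" for f using Aut_fix_fm[OF A order_refl _ that] by blast
    then have "A = \<one>\<^bsub>Aut Z\<^esub>" by (intro Aut_ext[OF A G.one_closed]) (simp add: Aut_one)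
    then show False using that by blast
  qed
  then obtain w z where wz: "\<And>A. A \<in> F \<Longrightarrow> A \<noteq> \<one>\<^bsub>Aut Z\<^esub> \<Longrightarrow> w A \<in> Z \<and> z A \<in> Z \<and>
    A (?e (w A)) (z A) \<noteq> ?e (w A) (z A)" by metis
  have entD: "A (?e w) z \<in> D" if "A \<in> F'" "w \<in> Z" for A w z
  proof (cases "z \<in> Z")
    case True
    then show ?thesis using that D(2) by (force simp: S_def)
  next
    case False
    have "A (?e w) \<in> fm Z" by (rule Aut_fm[OF subsetD[OF F'(2) that(1)] basis_vec_fm[OF that(2)]])
    then show ?thesis using fm_outside[OF _ False] D01(1) by simp
  qed
  \<comment> \<open>One nonzero entry of \<open>A - 1\<close> for every nontrivial \<open>A\<close>;
    through a common multiple one homomorphism preserves all of them.\<close>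
  define E where "E = (\<lambda>A. A (?e (w A)) (z A) \<ominus> ?e (w A) (z A)) ` (F - {\<one>\<^bsub>Aut Z\<^esub>})"
  have E: "finite E" "E \<subseteq> D - {\<zero>}"
  proof -
    show "finite E" using F by (simp add: E_def)
    show "E \<subseteq> D - {\<zero>}"
    proof
      fix x assume "x \<in> E"
      then obtain A where A: "A \<in> F" "A \<noteq> \<one>\<^bsub>Aut Z\<^esub>" "x = A (?e (w A)) (z A) \<ominus> ?e (w A) (z A)"
        by (auto simp: E_def)
      have m: "A (?e (w A)) (z A) \<in> D" using entD[of A "w A" "z A"] A wz[OF A(1,2)] by (auto simp: F'_def)
      have "x \<in> D" using Dop(3)[OF m Dop(1)[OF eD[of "w A" "z A"]]] unfolding A(3) a_minus_def .
      moreover have "x \<noteq> \<zero>"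
        using wz[OF A(1,2)] r_right_minus_eq[OF Dc[OF m] Dc[OF eD[of "w A" "z A"]]] unfolding A(3) by blast
      ultimately show "x \<in> D - {\<zero>}" by blast
    qed
  qed
  obtain a where a: "a \<in> D" "a \<noteq> \<zero>" "\<And>x. x \<in> E \<Longrightarrow> \<exists>b\<in>D. a = x \<otimes> b"
    by (rule common_multiple_in_subring[OF E(1) D(1) E(2)]) blast
  obtain k :: "nat ring" and f where k: "cring k" "finite (carrier k)" "\<one>\<^bsub>k\<^esub> \<noteq> \<zero>\<^bsub>k\<^esub>"
    and f: "f \<in> Ring.ring_hom (R\<lparr>carrier := D\<rparr>) k" "f a \<in> Units k"
    using sep[OF a(1,2)] unfolding unit_to_finite_def by (elim exE conjE) blast
  interpret k: cring k by (rule k(1))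
  have fc: "f x \<in> carrier k" if "x \<in> D" for x using ring_hom_closed[OF f(1)] that by simp
  have fm: "f (x \<otimes> y) = f x \<otimes>\<^bsub>k\<^esub> f y" "f (x \<oplus> y) = f x \<oplus>\<^bsub>k\<^esub> f y" if "x \<in> D" "y \<in> D" for x y
    using ring_hom_mult[OF f(1), of x y] ring_hom_add[OF f(1), of x y] that by simp_all
  have f0: "f \<zero> = \<zero>\<^bsub>k\<^esub>" using fm(2)[OF D01(1) D01(1)] fc[OF D01(1)] by simp
  have fE: "f x \<noteq> \<zero>\<^bsub>k\<^esub>" if x: "x \<in> E" for x
  proof
    assume "f x = \<zero>\<^bsub>k\<^esub>"
    moreover obtain b where b: "b \<in> D" "a = x \<otimes> b" using a(3)[OF x] by blast
    ultimately have "f a = \<zero>\<^bsub>k\<^esub>" using fm(1)[of x b] fc[OF b(1)] x E(2) by auto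
    then have "\<zero>\<^bsub>k\<^esub> \<in> Units k" using f(2) by simp
    then show False using k(3) by (auto simp: Units_def)
  qed
  define DZ where "DZ = {v \<in> fm Z. \<forall>x. v x \<in> D}"
  \<comment> \<open>The automorphisms to which reduction by \<open>f\<close> applies: they and their
    inverses preserve the vectors with entries in \<open>D\<close>.\<close>
  define P where "P = {A \<in> carrier (Aut Z). A ` DZ \<subseteq> DZ \<and> (inv\<^bsub>Aut Z\<^esub> A) ` DZ \<subseteq> DZ}"
  have PA: "A \<in> carrier (Aut Z)" "\<And>v. v \<in> DZ \<Longrightarrow> A v \<in> DZ" "inv\<^bsub>Aut Z\<^esub> A \<in> P" if "A \<in> P" for A
    using that by (auto simp: P_def)
  have eDZ: "?e w \<in> DZ" if "w \<in> Z" for w using that eD basis_vec_fm by (auto simp: DZ_def)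
  have DZ: "A v \<in> DZ" if A: "A \<in> F'" and v: "v \<in> DZ" for A v
  proof -
    have Ac: "A \<in> carrier (Aut Z)" using A F' by blast
    have "\<forall>x. A v x \<in> D"
    proof (rule finite_fm_induct[OF Z, of v])
      show "v \<in> fm Z" using v by (simp add: DZ_def)
      show "\<forall>x. A (\<lambda>x. \<zero>) x \<in> D" using Aut_zero[OF Ac] D01 by simp
      fix u w assume u: "u \<in> fm Z" "w \<in> Z" "\<forall>x. A u x \<in> D"
      have vD: "v w \<in> D" using v by (simp add: DZ_def)
      show "\<forall>x. A (\<lambda>x. u x \<oplus> v w \<otimes> ?e w x) x \<in> D"
        unfolding Aut_add_smult_basis_vec[OF Ac u(1,2) Dc[OF vD]] using u(3) Dop(2,3) entD[OF A u(2)] vD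
          by blast
    qed
    then show ?thesis using Aut_fm[OF Ac] v by (simp add: DZ_def)
  qed
  have FP: "F \<subseteq> P" using F DZ by (auto simp: P_def F'_def)
  have ker: "f (A u x) = \<zero>\<^bsub>k\<^esub>" if A: "A \<in> P" and u: "u \<in> DZ" "\<And>x. f (u x) = \<zero>\<^bsub>k\<^esub>" for A u x
  proof -
    have Ac: "A \<in> carrier (Aut Z)" using PA A by blast
    have "\<forall>x. A u x \<in> D \<and> f (A u x) = \<zero>\<^bsub>k\<^esub>"
    proof (rule finite_fm_induct[OF Z, of u])
      show "u \<in> fm Z" using u by (simp add: DZ_def)
      show "\<forall>x. A (\<lambda>x. \<zero>) x \<in> D \<and> f (A (\<lambda>x. \<zero>) x) = \<zero>\<^bsub>k\<^esub>" using Aut_zero[OF Ac] D01 f0 by simp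
      fix v w assume v: "v \<in> fm Z" "w \<in> Z" "\<forall>x. A v x \<in> D \<and> f (A v x) = \<zero>\<^bsub>k\<^esub>"
      have uD: "u w \<in> D" using u by (simp add: DZ_def)
      have eD': "A (?e w) x \<in> D" for x using PA(2)[OF A eDZ[OF v(2)]] by (simp add: DZ_def)
      have mD: "u w \<otimes> A (?e w) x \<in> D" for x using Dop(2)[OF uD eD'] .
      show "\<forall>x. A (\<lambda>x. v x \<oplus> u w \<otimes> ?e w x) x \<in> D \<and> f (A (\<lambda>x. v x \<oplus> u w \<otimes> ?e w x) x) = \<zero>\<^bsub>k\<^esub>"
        unfolding Aut_add_smult_basis_vec[OF Ac v(1,2) Dc[OF uD]]
      proof (intro allI conjI)
        fix x
        show "A v x \<oplus> u w \<otimes> A (?e w) x \<in> D" using Dop(3) v(3) mD by blast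
        show "f (A v x \<oplus> u w \<otimes> A (?e w) x) = \<zero>\<^bsub>k\<^esub>"
          using v(3) fm(2)[of "A v x", OF _ mD] fm(1)[OF uD eD'] u(2) fc[OF eD'] by simp
      qed
    qed
    then show ?thesis by blast
  qed
  \<comment> \<open>The action descends to reductions. Two lifts differ by a vector whose
    coefficients are killed by \<open>f\<close>, and its image is a combination, with these
    coefficients, of columns of \<open>A\<close> with entries in \<open>D\<close>, so
    \<open>f\<close> kills it as well.\<close>
  have cong: "f \<circ> A v = f \<circ> A v'" if A: "A \<in> P" and v: "v \<in> DZ" "v' \<in> DZ" "f \<circ> v = f \<circ> v'" for A v v'
  proof
    fix x
    have vD: "v x \<in> D" "v' x \<in> D" for x using v by (auto simp: DZ_def)
    have vf: "v \<in> fm Z" "v' \<in> fm Z" using v by (auto simp: DZ_def)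
    have AD: "A v x \<in> D" "A v' x \<in> D" using PA(2)[OF A v(1)] PA(2)[OF A v(2)] by (auto simp: DZ_def)
    define u where "u = (\<lambda>x. v x \<oplus> (\<ominus> \<one>) \<otimes> v' x)"
    have o: "\<ominus> \<one> \<in> D" using Dop(1)[OF D01(2)] .
    have uc: "(\<lambda>x. (\<ominus> \<one>) \<otimes> v' x) \<in> fm Z" using fm_smult[OF Dc[OF o] vf(2)] .
    have uDZ: "u \<in> DZ" unfolding u_def DZ_def using fm_add[OF vf(1) uc] Dop(3)[OF vD(1) Dop(2)[OF o vD(2)]]
      by blast
    have "f (\<ominus> \<one>) \<oplus>\<^bsub>k\<^esub> f \<one> = f \<zero>" using fm(2)[OF o D01(2)] Dc[OF D01(2)] by (simp add: l_neg)
    then have n: "f (\<ominus> \<one> \<otimes> y) = \<ominus>\<^bsub>k\<^esub> f y" if "y \<in> D" for y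
    proof -
      have "f (\<ominus> \<one> \<otimes> y) \<oplus>\<^bsub>k\<^esub> f y = \<zero>\<^bsub>k\<^esub>"
        using fm(2)[OF Dop(2)[OF o that] that] Dc[OF that] f0 by (simp add: l_minus l_neg)
      then show ?thesis using k.minus_equality fc[OF that] fc[OF Dop(2)[OF o that]] by metis
    qed
    have "f (u y) = \<zero>\<^bsub>k\<^esub>" for y
    proof -
      have "f (v y) = f (v' y)" using fun_cong[OF v(3), of y] by simp
      then show ?thesis unfolding u_def fm(2)[OF vD(1) Dop(2)[OF o vD(2)]] n[OF vD(2)] using fc[OF vD(2)]
        by (simp add: k.r_neg)
    qed
    then have "f (A u x) = \<zero>\<^bsub>k\<^esub>" by (rule ker[OF A uDZ])
    moreover have "A u = (\<lambda>x. A v x \<oplus> (\<ominus> \<one>) \<otimes> A v' x)"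
      unfolding u_def Aut_add[OF PA(1)[OF A] vf(1) uc] Aut_smult[OF PA(1)[OF A] Dc[OF o] vf(2)] ..
    ultimately have "f (A v x) \<oplus>\<^bsub>k\<^esub> \<ominus>\<^bsub>k\<^esub> f (A v' x) = \<zero>\<^bsub>k\<^esub>"
      using fm(2)[OF AD(1) Dop(2)[OF o AD(2)]] n[OF AD(2)] by simp
    then show "(f \<circ> A v) x = (f \<circ> A v') x"
      using fc[OF AD(1)] fc[OF AD(2)] k.r_right_minus_eq[of "f (A v x)" "f (A v' x)"]
        by (simp add: a_minus_def)
  qed
  define T where "T = (\<lambda>v. f \<circ> v) ` DZ"
  have "T \<subseteq> (\<lambda>g x. if x \<in> Z then g x else f \<zero>) ` (Z \<rightarrow>\<^sub>E carrier k)"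
  proof
    fix t assume "t \<in> T"
    then obtain v where v: "v \<in> DZ" "t = f \<circ> v" by (auto simp: T_def)
    have "t = (\<lambda>x. if x \<in> Z then restrict t Z x else f \<zero>)"
      using v fm_outside[of v Z] by (auto simp: fun_eq_iff DZ_def)
    moreover have "restrict t Z \<in> Z \<rightarrow>\<^sub>E carrier k" using v fc by (auto simp: DZ_def)
    ultimately show "t \<in> (\<lambda>g x. if x \<in> Z then g x else f \<zero>) ` (Z \<rightarrow>\<^sub>E carrier k)" by blast
  qed
  then have finT: "finite T" by (rule finite_subset) (use Z k(2) in \<open>simp add: finite_PiE\<close>)
  define \<Phi> where "\<Phi> (A :: (nat \<Rightarrow> 'a) \<Rightarrow> nat \<Rightarrow> 'a) = (\<lambda>t\<in>T. f \<circ> A (inv_into DZ (\<lambda>v. f \<circ> v) t))" for A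
  have \<Phi>: "\<Phi> A (f \<circ> v) = f \<circ> A v" if "A \<in> P" "v \<in> DZ" for A v
  proof -
    have t: "f \<circ> v \<in> T" using that by (simp add: T_def)
    have "inv_into DZ (\<lambda>v. f \<circ> v) (f \<circ> v) \<in> DZ" "f \<circ> inv_into DZ (\<lambda>v. f \<circ> v) (f \<circ> v) = f \<circ> v"
      using t unfolding T_def by (rule inv_into_into, rule f_inv_into_f)
    then show ?thesis unfolding \<Phi>_def restrict_apply'[OF t] using cong that by blast
  qed
  have \<Phi>T: "\<Phi> A t \<in> T" if "A \<in> P" "t \<in> T" for A t
    using that \<Phi>[OF that(1)] PA(2)[OF that(1)] by (force simp: T_def)
  have inv: "\<Phi> A (\<Phi> (inv\<^bsub>Aut Z\<^esub> A) t) = t" "\<Phi> (inv\<^bsub>Aut Z\<^esub> A) (\<Phi> A t) = t" if A: "A \<in> P" and t: "t \<in> T" for A t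
  proof -
    obtain v where v: "v \<in> DZ" "t = f \<circ> v" using t by (auto simp: T_def)
    have i: "A ((inv\<^bsub>Aut Z\<^esub> A) v) = v" "(inv\<^bsub>Aut Z\<^esub> A) (A v) = v"
      using Aut_inv_apply[OF PA(1)[OF A]] v by (auto simp: DZ_def)
    show "\<Phi> A (\<Phi> (inv\<^bsub>Aut Z\<^esub> A) t) = t" "\<Phi> (inv\<^bsub>Aut Z\<^esub> A) (\<Phi> A t) = t"
      unfolding v(2) using \<Phi>[OF PA(3)[OF A] v(1)] \<Phi>[OF A PA(2)[OF PA(3)[OF A] v(1)]] \<Phi>[OF A v(1)]
        \<Phi>[OF PA(3)[OF A] PA(2)[OF A v(1)]] i by simp_all
  qed
  have \<Phi>B: "\<Phi> A \<in> Bij T" if A: "A \<in> P" for A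
  proof -
    have "bij_betw (\<Phi> A) T T"
      by (rule bij_betw_byWitness[where f' = "\<Phi> (inv\<^bsub>Aut Z\<^esub> A)"]) (use inv[OF A] \<Phi>T A PA(3)[OF A] in auto)
    then show ?thesis by (simp add: Bij_def \<Phi>_def)
  qed
  have mult: "\<Phi> (A \<otimes>\<^bsub>Aut Z\<^esub> B) = compose T (\<Phi> A) (\<Phi> B)" if P: "A \<in> P" "B \<in> P" "A \<otimes>\<^bsub>Aut Z\<^esub> B \<in> P" for A B
  proof (rule Bij_ext[OF \<Phi>B[OF P(3)] compose_Bij[OF \<Phi>B[OF P(1)] \<Phi>B[OF P(2)]]])
    fix t assume t: "t \<in> T"
    then obtain v where v: "v \<in> DZ" "t = f \<circ> v" by (auto simp: T_def)
    have "v \<in> fm Z" using v by (simp add: DZ_def)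
    then show "\<Phi> (A \<otimes>\<^bsub>Aut Z\<^esub> B) t = compose T (\<Phi> A) (\<Phi> B) t"
      using t \<Phi>[OF P(3) v(1)] \<Phi>[OF P(2) v(1)] \<Phi>[OF P(1) PA(2)[OF P(2) v(1)]] Aut_mult_apply[OF PA(1)[OF P(1)]
        PA(1)[OF P(2)]]
      by (simp add: compose_eq v(2))
  qed
  have one: "\<one>\<^bsub>Aut Z\<^esub> \<in> P" using G.one_closed by (auto simp: P_def G.inv_one) (auto simp: Aut_one DZ_def)
  have \<Phi>1: "\<Phi> \<one>\<^bsub>Aut Z\<^esub> = (\<lambda>t\<in>T. t)"
  proof (rule Bij_ext[OF \<Phi>B[OF one] id_Bij])
    fix t assume t: "t \<in> T"
    then obtain v where v: "v \<in> DZ" "t = f \<circ> v" by (auto simp: T_def)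
    then show "\<Phi> \<one>\<^bsub>Aut Z\<^esub> t = (\<lambda>t\<in>T. t) t" using t \<Phi>[OF one v(1)] by (simp add: Aut_one DZ_def)
  qed
  have sep\<Phi>: "\<Phi> A \<noteq> (\<lambda>t\<in>T. t)" if A: "A \<in> F" "A \<noteq> \<one>\<^bsub>Aut Z\<^esub>" for A
  proof
    assume *: "\<Phi> A = (\<lambda>t\<in>T. t)"
    have AP: "A \<in> P" using A FP by blast
    have w: "?e (w A) \<in> DZ" using wz[OF A] eDZ by blast
    let ?x = "A (?e (w A)) (z A)" and ?y = "?e (w A) (z A)"
    have xD: "?x \<in> D" "?y \<in> D" using PA(2)[OF AP w] eD[of "w A" "z A"] unfolding DZ_def by blast+
    have "f \<circ> A (?e (w A)) = f \<circ> ?e (w A)" using \<Phi>[OF AP w] w * by (simp add: T_def)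
    then have e: "f ?x = f ?y" by (metis comp_apply)
    have E: "?x \<ominus> ?y \<in> E" using A by (auto simp: E_def)
    then have dD: "?x \<ominus> ?y \<in> D" using \<open>E \<subseteq> D - {\<zero>}\<close> by blast
    have "?x = (?x \<ominus> ?y) \<oplus> ?y" using Dc[OF xD(1)] Dc[OF xD(2)] by (simp add: a_minus_def a_assoc l_neg)
    then have "f ?x = f (?x \<ominus> ?y) \<oplus>\<^bsub>k\<^esub> f ?y" using fm(2)[OF dD xD(2)] by simp
    then have "f (?x \<ominus> ?y) = \<zero>\<^bsub>k\<^esub>" using e fc[OF dD] fc[OF xD(2)] k.add.r_cancel_one' by metis
    then show False using fE[OF E] by blast
  qed
  obtain Q :: "nat monoid" and h where Q: "group Q" "carrier Q = h ` carrier (BijGroup T)"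
    "h \<in> hom (BijGroup T) Q"
    "h \<one>\<^bsub>BijGroup T\<^esub> = \<one>\<^bsub>Q\<^esub>" "inj_on h (carrier (BijGroup T))"
    by (rule exists_nat_copy_of_finite_group[OF group_BijGroup]) (use finite_Bij[OF finT] in auto)
  \<comment> \<open>Outside \<open>P\<close> only the membership in \<open>Q\<close> counts: the
    remaining conditions concern \<open>1\<close> and the elements of \<open>F\<close>, all of which
    lie in \<open>P\<close>.\<close>
  define \<phi> where "\<phi> A = (if A \<in> P then h (\<Phi> A) else \<one>\<^bsub>Q\<^esub>)" for A
  have "finite (carrier Q)" using finite_Bij[OF finT] Q(2) by simp
  moreover have "\<phi> \<in> carrier (Aut Z) \<rightarrow> carrier Q"
    using Q(2) \<Phi>B monoid.one_closed[OF group.is_monoid[OF Q(1)]] by (auto simp: \<phi>_def)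
  moreover have "unital (Aut Z) Q \<phi>" using one \<Phi>1 Q(4) by (simp add: unital_def \<phi>_def)
  moreover have "\<phi> (A \<otimes>\<^bsub>Aut Z\<^esub> B) = \<phi> A \<otimes>\<^bsub>Q\<^esub> \<phi> B" if "A \<in> F" "B \<in> F" "A \<otimes>\<^bsub>Aut Z\<^esub> B \<in> F" for A B
  proof -
    have P: "A \<in> P" "B \<in> P" "A \<otimes>\<^bsub>Aut Z\<^esub> B \<in> P" using that FP by auto
    then show ?thesis using hom_mult[OF Q(3), of "\<Phi> A" "\<Phi> B"] mult[OF P] \<Phi>B by (simp add: \<phi>_def)
  qed
  moreover have "\<phi> A \<noteq> \<one>\<^bsub>Q\<^esub>" if A: "A \<in> F" "A \<noteq> \<one>\<^bsub>Aut Z\<^esub>" for A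
  proof
    assume "\<phi> A = \<one>\<^bsub>Q\<^esub>"
    moreover have "A \<in> P" using A FP by blast
    ultimately have "h (\<Phi> A) = h \<one>\<^bsub>BijGroup T\<^esub>" "\<Phi> A \<in> Bij T" using Q(4) \<Phi>B by (auto simp: \<phi>_def)
    then have "\<Phi> A = \<one>\<^bsub>BijGroup T\<^esub>" using inj_onD[OF Q(5)] id_Bij[of T] by simp
    then show False using sep\<Phi>[OF A] by simp
  qed
  ultimately show "\<exists>(Q :: nat monoid) \<phi>. group Q \<and> finite (carrier Q) \<and> \<phi> \<in> carrier (Aut Z) \<rightarrow> carrier Q \<and>
    unital (Aut Z) Q \<phi> \<and>
      (\<forall>g\<in>F. \<forall>h\<in>F. g \<otimes>\<^bsub>Aut Z\<^esub> h \<in> F \<longrightarrow> \<phi> (g \<otimes>\<^bsub>Aut Z\<^esub> h) = \<phi> g \<otimes>\<^bsub>Q\<^esub> \<phi> h) \<and> (\<forall>g\<in>F. g \<noteq> \<one>\<^bsub>Aut Z\<^esub> \<longrightarrow> \<phi> g \<noteq> \<one>\<^bsub>Q\<^esub>)"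
    using Q(1) by blast
qed

end

section \<open>The four classes of groups\<close>

text \<open>\<open>uniform\<close> is the passage from constants depending on a finite set to the
  single \<open>c\<close>, supplied by amplification for three families and by rescaling for the
  fourth. It is restricted to the type of \<open>Aut Z\<close> because a hypothesis cannot be
  polymorphic. The disjunction \<open>hyp\<close> covers both halves of the final theorem at
  once.\<close>

lemma approximable_linear_enrichment_of_family:
  fixes R :: "('r, 'b) ring_scheme" and \<G> :: "('h monoid \<times> ('h \<Rightarrow> 'h \<Rightarrow> real)) set"
  assumes \<Gamma>: "group \<Gamma>" "group_action \<Gamma> X \<alpha>" "sofic_action \<Gamma> X \<alpha>" and R: "cring R"
    and grp: "\<And>G d. (G, d) \<in> \<G> \<Longrightarrow> group G" and closed: "wreath_closed \<G>" "sum_closed \<G>" and c: "c > 0"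
    and uniform: "\<And>H :: ((nat \<Rightarrow> 'r) \<Rightarrow> nat \<Rightarrow> 'r) monoid.
      (\<And>F. finite F \<Longrightarrow> F \<subseteq> carrier H \<Longrightarrow> \<exists>c>0. approximable_on F c \<G> H) \<Longrightarrow> approximable_at c \<G> H"
    and fin: "contains_finite_groups \<G>" and G: "approximable \<G> \<Gamma>"
    and hyp: "(\<forall>Z :: nat set. finite Z \<longrightarrow> approximable \<G> (module_Aut R (free_module R Z))) \<or> domain R"
  shows "approximable \<G> (linear_enrichment \<Gamma> X \<alpha> R)"
proof -
  interpret enrichment R \<Gamma> X \<alpha> using \<Gamma> R by (intro enrichment.intro enrichment_axioms.intro)
  obtain c1 where c1: "c1 > 0" "approximable_at c1 \<G> \<Gamma>" using G unfolding approximable_iff by blast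
  have "approximable_at c \<G> (Aut Z)" if Z: "finite Z" for Z :: "nat set"
  proof (rule uniform)
    fix F assume F: "finite F" "F \<subseteq> carrier (Aut Z)"
    show "\<exists>c>0. approximable_on F c \<G> (Aut Z)"
      using hyp
    proof
      assume "\<forall>Z :: nat set. finite Z \<longrightarrow> approximable \<G> (Aut Z)"
      then show ?thesis using Z F unfolding approximable_iff approximable_at_def by meson
    next
      assume "domain R"
      then show ?thesis using approximable_on_if_locally_embeddable[OF domain.locally_embeddable_Aut[OF _ Z]
        fin F] by blast
    qed
  qed
  then show ?thesis by (intro approximable_linear_enrichment[OF grp \<Gamma>(3) closed c1(2,1) _ c])
qed

lemma approximable_linear_enrichment_indexed:
  fixes R :: "('r, 'b) ring_scheme" and G :: "nat \<Rightarrow> 'h monoid" and d :: "nat \<Rightarrow> 'h \<Rightarrow> 'h \<Rightarrow> real"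
  assumes "group \<Gamma>" "group_action \<Gamma> X \<alpha>" "sofic_action \<Gamma> X \<alpha>" "cring R"
    and G: "\<And>n. group (G n)"
    and wr: "\<And>n A. n > 0 \<Longrightarrow> finite A \<Longrightarrow> A \<noteq> {} \<Longrightarrow> \<exists>W. wreath_map (G n) (d n) (A :: nat set) (G (n * card A))
      (d (n * card A)) W"
    and am: "amplification \<kappa> (indexed_family G d)" and fin: "contains_finite_groups (indexed_family G d)"
    and "approximable (indexed_family G d) \<Gamma>"
    and "(\<forall>Z :: nat set. finite Z \<longrightarrow> approximable (indexed_family G d) (module_Aut R (free_module R Z))) \<or>
      domain R"
  shows "approximable (indexed_family G d) (linear_enrichment \<Gamma> X \<alpha> R)"
proof (rule approximable_linear_enrichment_of_family[OF assms(1-4) _ indexed_wreath_closed[OF wr]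
  indexed_sum_closed[OF G wr] _ _ fin assms(9,10), where c = "\<kappa> / 2"])
  show grp: "group G'" if "(G', d') \<in> indexed_family G d" for G' d' using that G
    by (auto simp: indexed_family_def)
  show "0 < \<kappa> / 2" using am by (simp add: amplification_def)
  show "approximable_at (\<kappa> / 2) (indexed_family G d) H"
    if "\<And>F. finite F \<Longrightarrow> F \<subseteq> carrier H \<Longrightarrow> \<exists>c>0. approximable_on F c (indexed_family G d) H"
      for H :: "((nat \<Rightarrow> 'r) \<Rightarrow> nat \<Rightarrow> 'r) monoid"
    by (rule approximable_at_amplify[OF grp am that])
qed

lemma approximable_family_iff:
  "sofic_group \<Gamma> \<longleftrightarrow> approximable (indexed_family sym_group sym_dist) \<Gamma>"
  "linear_sofic_group TYPE('k::field) \<Gamma> \<longleftrightarrow> approximable (indexed_family (gl_group TYPE('k)) rank_dist) \<Gamma>"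
  "hyperlinear_group \<Gamma> \<longleftrightarrow> approximable (indexed_family unitary_group hs_dist) \<Gamma>"
  by (simp_all add: sofic_group_def linear_sofic_group_def hyperlinear_group_def indexed_family_def)

theorem theorem6p6:
  fixes \<Gamma> :: "('g, 'a) monoid_scheme"
    and X :: "'x set"
    and \<alpha> :: "'g \<Rightarrow> 'x \<Rightarrow> 'x"
    and R :: "('r, 'b) ring_scheme"
  assumes "group \<Gamma>"
    and "group_action \<Gamma> X \<alpha>"
    and "sofic_action \<Gamma> X \<alpha>"
    and "cring R"
  shows
    "(sofic_group \<Gamma> \<and>
        (\<forall>Z :: nat set. finite Z \<longrightarrow> sofic_group (module_Aut R (free_module R Z))) \<longrightarrow>
        sofic_group (linear_enrichment \<Gamma> X \<alpha> R)) \<and>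
     (linear_sofic_group TYPE('k::field) \<Gamma> \<and>
        (\<forall>Z :: nat set. finite Z \<longrightarrow>
          linear_sofic_group TYPE('k) (module_Aut R (free_module R Z))) \<longrightarrow>
        linear_sofic_group TYPE('k) (linear_enrichment \<Gamma> X \<alpha> R)) \<and>
     (hyperlinear_group \<Gamma> \<and>
        (\<forall>Z :: nat set. finite Z \<longrightarrow> hyperlinear_group (module_Aut R (free_module R Z))) \<longrightarrow>
        hyperlinear_group (linear_enrichment \<Gamma> X \<alpha> R)) \<and>
     (weakly_sofic_group \<Gamma> \<and>
        (\<forall>Z :: nat set. finite Z \<longrightarrow> weakly_sofic_group (module_Aut R (free_module R Z))) \<longrightarrow>
        weakly_sofic_group (linear_enrichment \<Gamma> X \<alpha> R)) \<and>
     (domain R \<longrightarrow>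
        (sofic_group \<Gamma> \<longrightarrow> sofic_group (linear_enrichment \<Gamma> X \<alpha> R)) \<and>
        (linear_sofic_group TYPE('k) \<Gamma> \<longrightarrow>
          linear_sofic_group TYPE('k) (linear_enrichment \<Gamma> X \<alpha> R)) \<and>
        (hyperlinear_group \<Gamma> \<longrightarrow> hyperlinear_group (linear_enrichment \<Gamma> X \<alpha> R)) \<and>
        (weakly_sofic_group \<Gamma> \<longrightarrow> weakly_sofic_group (linear_enrichment \<Gamma> X \<alpha> R)))"
proof -
  let ?L = "linear_enrichment \<Gamma> X \<alpha> R" and ?A = "\<lambda>Z :: nat set. module_Aut R (free_module R Z)"
  note transfer = approximable_linear_enrichment_indexed[OF assms]
  have "sofic_group ?L" if "sofic_group \<Gamma>" "(\<forall>Z. finite Z \<longrightarrow> sofic_group (?A Z)) \<or> domain R"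
    using that transfer[OF group_BijGroup wreath_map_sym amplification_sym contains_finite_groups_sym]
    unfolding approximable_family_iff by blast
  moreover have "linear_sofic_group TYPE('k) ?L"
    if "linear_sofic_group TYPE('k) \<Gamma>" "(\<forall>Z. finite Z \<longrightarrow> linear_sofic_group TYPE('k) (?A Z)) \<or> domain R"
    using that transfer[OF group_gl_group wreath_map_gl amplification_gl contains_finite_groups_gl]
    unfolding approximable_family_iff by blast
  moreover have "hyperlinear_group ?L" if "hyperlinear_group \<Gamma>" "(\<forall>Z. finite Z \<longrightarrow> hyperlinear_group (?A Z)) \<or>
    domain R"
    using that transfer[OF group_unitary wreath_map_unitary amplification_unitary
      contains_finite_groups_unitary]
    unfolding approximable_family_iff by blast
  moreover have "weakly_sofic_group ?L" if "weakly_sofic_group \<Gamma>" "(\<forall>Z. finite Z \<longrightarrow> weakly_sofic_group (?A Z))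
    \<or> domain R"
  proof -
    have "group G" if "(G, d) \<in> finite_metric_groups" for G d
      using that metric_groupD(1) by (auto simp: finite_metric_groups_def)
    then show ?thesis
      using that approximable_linear_enrichment_of_family[OF assms _ wreath_closed_weak sum_closed_weak _
        approximable_at_half_weak contains_finite_groups_weak]
      unfolding weakly_sofic_group_iff by simp
  qed
  ultimately show ?thesis by blast
qed

end
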